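(* Let $V\in\mathcal S(\mathcal K,\kappa)$, and let $f_1,f_2,\dots$ be an orthonormal basis of $\mathcal K_1\cap\ker V^\dagger$. For each multi-index $\alpha=(\alpha_1,\dots,\alpha_l)$ with $\alpha_j\le\alpha_{j+1}$ (including $\alpha=0$), which has the form of $l_1$ entries $\alpha'_1$, followed by $l_2$ entries $\alpha_2'$, ..., $l_r$ entries $\alpha'_r$ with $\alpha'_1<\dots<\alpha'_r$, $l_1+\dots+l_r=l$, set $$c_\alpha=(l_1!\cdots l_r!)^{-1/2},\quad\phi_\alpha=c_\alpha a^*(f_{\alpha_1})\cdots a^*(f_{\alpha_l})\Omega_{P_1}\ (\phi_0=\Omega_{P_1}),\quad\mathcal F_\alpha=\overline{\mathfrak W(\operatorname{ran}V)\phi_\alpha},\quad\pi_\alpha=\varrho_V|_{\mathcal F_\alpha}.$$ Then, regarding $\varrho_V$ as a representation of the Weyl algebra $\mathfrak W(\mathcal K,\kappa)$ on $\mathcal F_s(\mathcal K_1)$, one has $\varrho_V=\bigoplus_\alpha\pi_\alpha$, where the sum extends over all multi-indices $\alpha=(\alpha_1,\dots,\alpha_l)$ of finite length $l$ with $\alpha_j\le\alpha_{j+1}$ whose entries are indices of the basis vectors $f_1,f_2,\dots$, including $\alpha=0$. Each $(\pi_\alpha,\mathcal F_\alpha,\phi_\alpha)$ is a GNS representation for $\omega_{P_1}\circ\varrho_V$ (regarded as a state over $\mathfrak W(\mathcal K,\kappa)$).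
   Context: Let $\mathcal K$ be an infinite-dimensional complex vector space with a nondegenerate hermitian sesquilinear form $\kappa$ (linear in the second argument) and an antilinear involution $f\mapsto f^*$ with $\kappa(f^*,g^* )=-\kappa(g,f)$. For operators $A$ put $\overline Af=(A(f^* ))^*$. A basis projection is a linear operator $P$ with $P^2=P$, $\kappa(f,Pg)=\kappa(Pf,g)$, $P+\overline P=\mathbf 1$, and $\kappa(f,Pf)>0$ whenever $Pf\ne0$. Fix a basis projection $P_1$, put $P_2=\mathbf 1-P_1$, $C=P_1-P_2$; $\mathcal K$ is assumed to be (after completion) a separable Hilbert space for the inner product $\langle f,g\rangle_{P_1}=\kappa(f,Cg)$. $\mathcal K_n=P_n(\mathcal K)$; $\operatorname{Re}\mathcal H=\{f\in\mathcal H:f^*=f\}$. For bounded $A$, $A^*$ is the Hilbert space adjoint and $A^\dagger=CA^*C$ is the adjoint relative to $\kappa$. Let $\mathcal F_s(\mathcal K_1)$ be the symmetric Fock space with vacuum $\Omega_{P_1}$, $\mathfrak D$ its dense subspace of algebraic tensors, $a^*(g),a(g)$ ($g\in\mathcal K_1$) the Bosonic creation and annihilation operators, and $\pi_{P_1}(f)=a^*(P_1f)+a(P_1f^* )$ on $\mathfrak D$. For $f\in\operatorname{Re}\mathcal K$, $w(f)$ is the exponential of the closure of $i\pi_{P_1}(f)$ (unitary Weyl operator). For a $*$-invariant subspace $\mathcal H$, $\mathfrak W(\mathcal H)$ is the $C^*$-algebra generated by all $w(f)$, $f\in\operatorname{Re}\mathcal H$; $\mathfrak W(\mathcal K,\kappa)=\mathfrak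 W(\mathcal K)$ is the Weyl algebra. $\omega_{P_1}$ is the vacuum state, $\omega_{P_1}(w(f))=e^{-\frac14\|f\|_{P_1}^2}$. Bogoliubov operators: $\mathcal S(\mathcal K,\kappa)=\{V\in\mathfrak B(\mathcal K):\overline V=V,\ V^\dagger V=\mathbf 1\}$. Each $V$ induces a $*$-endomorphism $\varrho_V$ of $\mathfrak W(\mathcal K,\kappa)$ with $\varrho_V(w(f))=w(Vf)$. *)

theory Defs
  imports
    "HOL-Analysis.Analysis"
    "HOL-Combinatorics.Permutations"
    "HOL-Library.Function_Algebras"
    "HOL-Library.Multiset"
    "HOL-Library.Extended_Nat"
begin

section \<open>Complex Hilbert spaces with a carrier set\<close>

text \<open>
  The Hilbert spaces needed here (Fock spaces over spaces given by a form and a projection, closed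
  cyclic subspaces, \<dots>) depend on terms, hence a Hilbert space is a carrier inside a complex vector
  space. Inner products are linear in the second argument.
\<close>

record 'v hspace =
  car :: "'v set"
  smul :: "complex \<Rightarrow> 'v \<Rightarrow> 'v"
  ip :: "'v \<Rightarrow> 'v \<Rightarrow> complex"

definition hnorm :: "('v, 'z) hspace_scheme \<Rightarrow> 'v \<Rightarrow> real" where
  "hnorm H v = sqrt (Re (ip H v v))"

definition hilbert_space :: "('v::ab_group_add) hspace \<Rightarrow> bool" where
  "hilbert_space H \<longleftrightarrow>
     vector_space (smul H) \<and> module.subspace (smul H) (car H) \<and>
     (\<forall>u\<in>car H. \<forall>v\<in>car H. ip H v u = cnj (ip H u v)) \<and>
     (\<forall>u\<in>car H. \<forall>v\<in>car H. \<forall>w\<in>car H. ip H u (v + w) = ip H u v + ip H u w) \<and>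
     (\<forall>c. \<forall>u\<in>car H. \<forall>v\<in>car H. ip H u (smul H c v) = c * ip H u v) \<and>
     (\<forall>u\<in>car H. u \<noteq> 0 \<longrightarrow> Re (ip H u u) > 0) \<and>
     (\<forall>s :: nat \<Rightarrow> 'v. (\<forall>n. s n \<in> car H) \<and>
          (\<forall>e>0. \<exists>N. \<forall>m\<ge>N. \<forall>n\<ge>N. hnorm H (s m - s n) < e) \<longrightarrow>
        (\<exists>l\<in>car H. (\<lambda>n. hnorm H (s n - l)) \<longlonglongrightarrow> 0))"

definition hclosure :: "('v::ab_group_add) hspace \<Rightarrow> 'v set \<Rightarrow> 'v set" where
  "hclosure H S = {v \<in> car H. \<forall>e>0. \<exists>s\<in>S. hnorm H (v - s) < e}"

definition separable_hspace :: "('v::ab_group_add) hspace \<Rightarrow> bool" where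
  "separable_hspace H \<longleftrightarrow> (\<exists>S. countable S \<and> S \<subseteq> car H \<and> hclosure H S = car H)"

definition is_onb :: "('v::ab_group_add) hspace \<Rightarrow> 'v set \<Rightarrow> bool" where
  "is_onb H B \<longleftrightarrow>
     B \<subseteq> car H \<and> (\<forall>u\<in>B. \<forall>v\<in>B. ip H u v = (if u = v then 1 else 0)) \<and>
     hclosure H (module.span (smul H) B) = car H"

definition onb :: "('v::ab_group_add) hspace \<Rightarrow> 'v set" where
  "onb H = (SOME B. is_onb H B)"

text \<open>
  Bounded operators on \<^term>\<open>car H\<close>, extended by 0 outside the carrier so that they are determined
  by their values on it; sums and compositions are then those of functions.
\<close>

definition bop :: "('v::ab_group_add) hspace \<Rightarrow> ('v \<Rightarrow> 'v) set" where
  "bop H = {A. (\<forall>v\<in>car H. A v \<in> car H) \<and> (\<forall>v. v \<notin> car H \<longrightarrow> A v = 0) \<and>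
     (\<forall>v\<in>car H. \<forall>w\<in>car H. A (v + w) = A v + A w) \<and>
     (\<forall>c. \<forall>v\<in>car H. A (smul H c v) = smul H c (A v)) \<and>
     (\<exists>M. \<forall>v\<in>car H. hnorm H (A v) \<le> M * hnorm H v)}"

definition hid :: "('v::ab_group_add) hspace \<Rightarrow> 'v \<Rightarrow> 'v" where
  "hid H v = (if v \<in> car H then v else 0)"

definition hadj :: "('v::ab_group_add) hspace \<Rightarrow> ('v \<Rightarrow> 'v) \<Rightarrow> 'v \<Rightarrow> 'v" where
  "hadj H A = (THE B. B \<in> bop H \<and> (\<forall>v\<in>car H. \<forall>w\<in>car H. ip H (B v) w = ip H v (A w)))"

section \<open>Exponentials of unbounded operators\<close>

text \<open>
  Unbounded operators are represented by their graphs. The exponential of a (skew-adjoint) operator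
  is the value at time 1 of the strongly continuous unitary group which it generates
  (Stone's theorem).
\<close>

definition graph_closure :: "('v::ab_group_add) hspace \<Rightarrow> ('v \<times> 'v) set \<Rightarrow> ('v \<times> 'v) set" where
  "graph_closure H G = {(v, w). v \<in> car H \<and> w \<in> car H \<and>
     (\<forall>e>0. \<exists>(v', w') \<in> G. hnorm H (v - v') < e \<and> hnorm H (w - w') < e)}"

definition unitary_op :: "('v::ab_group_add) hspace \<Rightarrow> ('v \<Rightarrow> 'v) \<Rightarrow> bool" where
  "unitary_op H U \<longleftrightarrow> U \<in> bop H \<and> U ` car H = car H \<and>
     (\<forall>v\<in>car H. \<forall>w\<in>car H. ip H (U v) (U w) = ip H v w)"

definition unitary_group :: "('v::ab_group_add) hspace \<Rightarrow> (real \<Rightarrow> 'v \<Rightarrow> 'v) \<Rightarrow> bool" where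
  "unitary_group H U \<longleftrightarrow>
     (\<forall>t. unitary_op H (U t)) \<and> U 0 = hid H \<and> (\<forall>s t. U (s + t) = U s \<circ> U t) \<and>
     (\<forall>v\<in>car H. ((\<lambda>t. hnorm H (U t v - v)) \<longlongrightarrow> 0) (at 0))"

definition generator :: "('v::ab_group_add) hspace \<Rightarrow> (real \<Rightarrow> 'v \<Rightarrow> 'v) \<Rightarrow> ('v \<times> 'v) set" where
  "generator H U = {(v, w). v \<in> car H \<and> w \<in> car H \<and>
     ((\<lambda>t. hnorm H (smul H (complex_of_real (1 / t)) (U t v - v) - w)) \<longlongrightarrow> 0) (at 0)}"

definition exp_op :: "('v::ab_group_add) hspace \<Rightarrow> ('v \<times> 'v) set \<Rightarrow> 'v \<Rightarrow> 'v" where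
  "exp_op H G = (THE W. \<exists>U. unitary_group H U \<and> generator H U = G \<and> W = U 1)"

section \<open>Operator algebras, states and representations\<close>

definition cstar_algebra_on :: "('v::ab_group_add) hspace \<Rightarrow> ('v \<Rightarrow> 'v) set \<Rightarrow> bool" where
  "cstar_algebra_on H \<A> \<longleftrightarrow>
     \<A> \<subseteq> bop H \<and> (\<lambda>_. 0) \<in> \<A> \<and>
     (\<forall>A\<in>\<A>. \<forall>B\<in>\<A>. (\<lambda>v. A v + B v) \<in> \<A> \<and> A \<circ> B \<in> \<A>) \<and>
     (\<forall>c. \<forall>A\<in>\<A>. (\<lambda>v. smul H c (A v)) \<in> \<A>) \<and>
     (\<forall>A\<in>\<A>. hadj H A \<in> \<A>) \<and>
     (\<forall>A\<in>bop H. (\<forall>e>0. \<exists>B\<in>\<A>. \<forall>v\<in>car H. hnorm H (A v - B v) \<le> e * hnorm H v) \<longrightarrow> A \<in> \<A>)"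

definition cstar_generated :: "('v::ab_group_add) hspace \<Rightarrow> ('v \<Rightarrow> 'v) set \<Rightarrow> ('v \<Rightarrow> 'v) set" where
  "cstar_generated H S = \<Inter>{\<A>. cstar_algebra_on H \<A> \<and> S \<subseteq> \<A>}"

definition star_hom ::
  "('v::ab_group_add) hspace \<Rightarrow> ('v \<Rightarrow> 'v) set \<Rightarrow> ('w::ab_group_add) hspace \<Rightarrow>
     (('v \<Rightarrow> 'v) \<Rightarrow> 'w \<Rightarrow> 'w) \<Rightarrow> bool" where
  "star_hom L \<A> H \<rho> \<longleftrightarrow>
     (\<forall>A\<in>\<A>. \<rho> A \<in> bop H) \<and>
     (\<forall>A\<in>\<A>. \<forall>B\<in>\<A>. \<rho> (\<lambda>v. A v + B v) = (\<lambda>v. \<rho> A v + \<rho> B v) \<and> \<rho> (A \<circ> B) = \<rho> A \<circ> \<rho> B) \<and>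
     (\<forall>c. \<forall>A\<in>\<A>. \<rho> (\<lambda>v. smul L c (A v)) = (\<lambda>v. smul H c (\<rho> A v))) \<and>
     (\<forall>A\<in>\<A>. \<rho> (hadj L A) = hadj H (\<rho> A))"

definition star_endomorphism ::
  "('v::ab_group_add) hspace \<Rightarrow> ('v \<Rightarrow> 'v) set \<Rightarrow> (('v \<Rightarrow> 'v) \<Rightarrow> 'v \<Rightarrow> 'v) \<Rightarrow> bool" where
  "star_endomorphism L \<A> \<rho> \<longleftrightarrow> star_hom L \<A> L \<rho> \<and> \<rho> ` \<A> \<subseteq> \<A>"

text \<open>
  A representation on a Hilbert space \<^term>\<open>H\<close> of a unital algebra \<^term>\<open>\<A>\<close> of operators on
  \<^term>\<open>L\<close>.
\<close>

definition representation ::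
  "('v::ab_group_add) hspace \<Rightarrow> ('v \<Rightarrow> 'v) set \<Rightarrow> ('w::ab_group_add) hspace \<Rightarrow>
     (('v \<Rightarrow> 'v) \<Rightarrow> 'w \<Rightarrow> 'w) \<Rightarrow> bool" where
  "representation L \<A> H \<rho> \<longleftrightarrow> hilbert_space H \<and> star_hom L \<A> H \<rho> \<and> \<rho> (hid L) = hid H"

definition state_on ::
  "('v::ab_group_add) hspace \<Rightarrow> ('v \<Rightarrow> 'v) set \<Rightarrow> (('v \<Rightarrow> 'v) \<Rightarrow> complex) \<Rightarrow> bool" where
  "state_on L \<A> \<omega> \<longleftrightarrow>
     (\<forall>A\<in>\<A>. \<forall>B\<in>\<A>. \<omega> (\<lambda>v. A v + B v) = \<omega> A + \<omega> B) \<and>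
     (\<forall>c. \<forall>A\<in>\<A>. \<omega> (\<lambda>v. smul L c (A v)) = c * \<omega> A) \<and>
     (\<forall>A\<in>\<A>. \<exists>r\<ge>0. \<omega> (hadj L A \<circ> A) = complex_of_real r) \<and>
     \<omega> (hid L) = 1"

definition gns_representation ::
  "('v::ab_group_add) hspace \<Rightarrow> ('v \<Rightarrow> 'v) set \<Rightarrow> (('v \<Rightarrow> 'v) \<Rightarrow> complex) \<Rightarrow>
     (('v \<Rightarrow> 'v) \<Rightarrow> 'w \<Rightarrow> 'w) \<Rightarrow> ('w::ab_group_add) hspace \<Rightarrow> 'w \<Rightarrow> bool" where
  "gns_representation L \<A> \<omega> \<rho> H \<phi> \<longleftrightarrow>
     state_on L \<A> \<omega> \<and> representation L \<A> H \<rho> \<and> \<phi> \<in> car H \<and>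
     hclosure H {\<rho> A \<phi> |A. A \<in> \<A>} = car H \<and>
     (\<forall>A\<in>\<A>. ip H \<phi> (\<rho> A \<phi>) = \<omega> A)"

text \<open>
  The representation \<open>(\<rho>, H)\<close> is the internal orthogonal direct sum of the representations
  \<open>(\<rho>\<^sub>i, H\<^sub>i)\<close>, \<open>i \<in> I\<close>, on closed subspaces \<open>H\<^sub>i\<close> of \<open>H\<close>. The subspaces are closed because they are
  complete.
\<close>

definition rep_direct_sum ::
  "('v::ab_group_add) hspace \<Rightarrow> ('v \<Rightarrow> 'v) set \<Rightarrow>
     ('w::ab_group_add) hspace \<Rightarrow> (('v \<Rightarrow> 'v) \<Rightarrow> 'w \<Rightarrow> 'w) \<Rightarrow>
     'i set \<Rightarrow> ('i \<Rightarrow> 'w hspace) \<Rightarrow> ('i \<Rightarrow> ('v \<Rightarrow> 'v) \<Rightarrow> 'w \<Rightarrow> 'w) \<Rightarrow> bool" where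
  "rep_direct_sum L \<A> H \<rho> I Hs \<rho>s \<longleftrightarrow>
     representation L \<A> H \<rho> \<and>
     (\<forall>i\<in>I. representation L \<A> (Hs i) (\<rho>s i) \<and> car (Hs i) \<subseteq> car H \<and>
        smul (Hs i) = smul H \<and> (\<forall>u\<in>car (Hs i). \<forall>v\<in>car (Hs i). ip (Hs i) u v = ip H u v)) \<and>
     (\<forall>i\<in>I. \<forall>j\<in>I. i \<noteq> j \<longrightarrow> (\<forall>u\<in>car (Hs i). \<forall>v\<in>car (Hs j). ip H u v = 0)) \<and>
     hclosure H (module.span (smul H) (\<Union>i\<in>I. car (Hs i))) = car H \<and>
     (\<forall>i\<in>I. \<forall>A\<in>\<A>. \<forall>v\<in>car (Hs i). \<rho> A v = \<rho>s i A v)"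

section \<open>Symmetric Fock space\<close>

text \<open>
  The \<open>n\<close>-fold symmetric Hilbert space tensor power of \<open>H\<close> is realised as the space of symmetric
  bounded antilinear Hilbert--Schmidt functionals of \<open>n\<close> arguments, where \<open>\<psi>\<close> is identified with
  \<open>(g\<^sub>1, \<dots>, g\<^sub>n) \<mapsto> \<langle>g\<^sub>1 \<otimes> \<dots> \<otimes> g\<^sub>n, \<psi>\<rangle>\<close>. An element of the Fock space is a function on lists, its
  restriction to lists of length \<open>n\<close> being its \<open>n\<close>-particle component; it is 0 on lists which are not
  lists over \<open>car H\<close>. By symmetry, antilinearity has to be required in the first argument only. The
  inner product does not depend on the orthonormal basis: \<open>lists B\<close> indexes the product bases of all
  tensor powers.
\<close>

definition fock_carrier :: "('k::ab_group_add) hspace \<Rightarrow> ('k list \<Rightarrow> complex) set" where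
  "fock_carrier H = {\<psi>.
     (\<forall>xs. xs \<notin> lists (car H) \<longrightarrow> \<psi> xs = 0) \<and>
     (\<forall>xs ys. mset xs = mset ys \<longrightarrow> \<psi> xs = \<psi> ys) \<and>
     (\<forall>x\<in>car H. \<forall>y\<in>car H. \<forall>xs\<in>lists (car H). \<psi> ((x + y) # xs) = \<psi> (x # xs) + \<psi> (y # xs)) \<and>
     (\<forall>c. \<forall>x\<in>car H. \<forall>xs\<in>lists (car H). \<psi> (smul H c x # xs) = cnj c * \<psi> (x # xs)) \<and>
     (\<forall>n. \<exists>M. \<forall>xs\<in>lists (car H). length xs = n \<longrightarrow>
        cmod (\<psi> xs) \<le> M * prod_list (map (hnorm H) xs)) \<and>
     (\<lambda>xs. (cmod (\<psi> xs))\<^sup>2) summable_on lists (onb H)}"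

definition sym_fock :: "('k::ab_group_add) hspace \<Rightarrow> ('k list \<Rightarrow> complex) hspace" where
  "sym_fock H = \<lparr>car = fock_carrier H, smul = (\<lambda>c \<psi> xs. c * \<psi> xs),
     ip = (\<lambda>\<psi> \<phi>. \<Sum>\<^sub>\<infinity>xs\<in>lists (onb H). cnj (\<psi> xs) * \<phi> xs)\<rparr>"

definition vacuum :: "'k list \<Rightarrow> complex" where
  "vacuum xs = (if xs = [] then 1 else 0)"

text \<open>The symmetrised elementary tensor \<open>S(g\<^sub>1 \<otimes> \<dots> \<otimes> g\<^sub>n)\<close>, with \<open>S\<close> the projection
  \<open>(1/n!) \<Sum>\<^sub>\<sigma> \<sigma>\<close>.\<close>

definition sym_tensor :: "('k::ab_group_add) hspace \<Rightarrow> 'k list \<Rightarrow> 'k list \<Rightarrow> complex" where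
  "sym_tensor H gs xs =
     (if xs \<in> lists (car H) \<and> length xs = length gs
      then (\<Sum>p | p permutes {..<length gs}. \<Prod>i<length gs. ip H (xs ! i) (gs ! p i))
             / fact (length gs)
      else 0)"

definition algebraic_tensors :: "('k::ab_group_add) hspace \<Rightarrow> ('k list \<Rightarrow> complex) set" where
  "algebraic_tensors H = module.span (smul (sym_fock H)) (sym_tensor H ` lists (car H))"

text \<open>
  In terms of tensors, \<open>a\<^sup>*(g)\<psi> = \<surd>n S(g \<otimes> \<psi>)\<close> for \<open>\<psi>\<close> of degree \<open>n - 1\<close>, and
  \<open>a(g) (g\<^sub>1 \<otimes> \<dots> \<otimes> g\<^sub>n) = \<surd>n \<langle>g, g\<^sub>1\<rangle> g\<^sub>2 \<otimes> \<dots> \<otimes> g\<^sub>n\<close> on symmetric tensors, so that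
  \<open>[a(g), a\<^sup>*(h)] = \<langle>g, h\<rangle>\<close>.
\<close>

definition creation ::
  "('k::ab_group_add) hspace \<Rightarrow> 'k \<Rightarrow> ('k list \<Rightarrow> complex) \<Rightarrow> 'k list \<Rightarrow> complex" where
  "creation H g \<psi> xs =
     (if xs \<noteq> [] \<and> xs \<in> lists (car H)
      then (\<Sum>j<length xs. ip H (xs ! j) g * \<psi> (take j xs @ drop (Suc j) xs)) / complex_of_real (sqrt (real (length xs)))
      else 0)"

definition annihilation :: "'k \<Rightarrow> ('k list \<Rightarrow> complex) \<Rightarrow> 'k list \<Rightarrow> complex" where
  "annihilation g \<psi> xs = complex_of_real (sqrt (real (length xs + 1))) * \<psi> (g # xs)"

section \<open>The selfdual CCR setting\<close>

record 'k ccr_space =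
  scal :: "complex \<Rightarrow> 'k \<Rightarrow> 'k"
  kap :: "'k \<Rightarrow> 'k \<Rightarrow> complex"
  star :: "'k \<Rightarrow> 'k"

definition is_ccr_space :: "('k::ab_group_add) ccr_space \<Rightarrow> bool" where
  "is_ccr_space X \<longleftrightarrow>
     vector_space (scal X) \<and> (\<nexists>B. finite B \<and> module.span (scal X) B = UNIV) \<and>
     (\<forall>f g h. kap X f (g + h) = kap X f g + kap X f h) \<and>
     (\<forall>c f g. kap X f (scal X c g) = c * kap X f g) \<and>
     (\<forall>f g. kap X g f = cnj (kap X f g)) \<and>
     (\<forall>f. (\<forall>g. kap X f g = 0) \<longrightarrow> f = 0) \<and>
     (\<forall>f g. star X (f + g) = star X f + star X g) \<and>
     (\<forall>c f. star X (scal X c f) = scal X (cnj c) (star X f)) \<and>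
     (\<forall>f. star X (star X f) = f) \<and>
     (\<forall>f g. kap X (star X f) (star X g) = - kap X g f)"

definition bar :: "('k::ab_group_add) ccr_space \<Rightarrow> ('k \<Rightarrow> 'k) \<Rightarrow> 'k \<Rightarrow> 'k" where
  "bar X A f = star X (A (star X f))"

definition basis_projection :: "('k::ab_group_add) ccr_space \<Rightarrow> ('k \<Rightarrow> 'k) \<Rightarrow> bool" where
  "basis_projection X P \<longleftrightarrow>
     Vector_Spaces.linear (scal X) (scal X) P \<and> P \<circ> P = P \<and>
     (\<forall>f g. kap X f (P g) = kap X (P f) g) \<and>
     (\<forall>f. P f + bar X P f = f) \<and>
     (\<forall>f. P f \<noteq> 0 \<longrightarrow> (\<exists>r>0. kap X f (P f) = complex_of_real r))"

text \<open>\<open>C = P\<^sub>1 - P\<^sub>2\<close> with \<open>P\<^sub>2 = 1 - P\<^sub>1\<close>.\<close>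

definition Cop :: "('k \<Rightarrow> 'k::ab_group_add) \<Rightarrow> 'k \<Rightarrow> 'k" where
  "Cop P f = P f - (f - P f)"

definition Khilb :: "('k::ab_group_add) ccr_space \<Rightarrow> ('k \<Rightarrow> 'k) \<Rightarrow> 'k hspace" where
  "Khilb X P = \<lparr>car = UNIV, smul = scal X, ip = (\<lambda>f g. kap X f (Cop P g))\<rparr>"

definition K1hilb :: "('k::ab_group_add) ccr_space \<Rightarrow> ('k \<Rightarrow> 'k) \<Rightarrow> 'k hspace" where
  "K1hilb X P = (Khilb X P)\<lparr>car := range P\<rparr>"

definition kdagger :: "('k::ab_group_add) ccr_space \<Rightarrow> ('k \<Rightarrow> 'k) \<Rightarrow> ('k \<Rightarrow> 'k) \<Rightarrow> 'k \<Rightarrow> 'k" where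
  "kdagger X P A = Cop P \<circ> hadj (Khilb X P) A \<circ> Cop P"

definition bogoliubov :: "('k::ab_group_add) ccr_space \<Rightarrow> ('k \<Rightarrow> 'k) \<Rightarrow> ('k \<Rightarrow> 'k) set" where
  "bogoliubov X P = {V \<in> bop (Khilb X P). bar X V = V \<and> kdagger X P V \<circ> V = id}"

abbreviation Fock :: "('k::ab_group_add) ccr_space \<Rightarrow> ('k \<Rightarrow> 'k) \<Rightarrow> ('k list \<Rightarrow> complex) hspace" where
  "Fock X P \<equiv> sym_fock (K1hilb X P)"

definition field_op ::
  "('k::ab_group_add) ccr_space \<Rightarrow> ('k \<Rightarrow> 'k) \<Rightarrow> 'k \<Rightarrow> ('k list \<Rightarrow> complex) \<Rightarrow> 'k list \<Rightarrow> complex" where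
  "field_op X P f \<psi> = creation (K1hilb X P) (P f) \<psi> + annihilation (P (star X f)) \<psi>"

definition weyl ::
  "('k::ab_group_add) ccr_space \<Rightarrow> ('k \<Rightarrow> 'k) \<Rightarrow> 'k \<Rightarrow> ('k list \<Rightarrow> complex) \<Rightarrow> 'k list \<Rightarrow> complex" where
  "weyl X P f = exp_op (Fock X P) (graph_closure (Fock X P)
     {(\<psi>, smul (Fock X P) \<i> (field_op X P f \<psi>)) |\<psi>. \<psi> \<in> algebraic_tensors (K1hilb X P)})"

definition weyl_algebra ::
  "('k::ab_group_add) ccr_space \<Rightarrow> ('k \<Rightarrow> 'k) \<Rightarrow> 'k set \<Rightarrow>
     (('k list \<Rightarrow> complex) \<Rightarrow> 'k list \<Rightarrow> complex) set" where
  "weyl_algebra X P M = cstar_generated (Fock X P) {weyl X P f |f. f \<in> M \<and> star X f = f}"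

definition vacuum_state ::
  "('k::ab_group_add) ccr_space \<Rightarrow> ('k \<Rightarrow> 'k) \<Rightarrow> (('k list \<Rightarrow> complex) \<Rightarrow> 'k list \<Rightarrow> complex) \<Rightarrow> complex" where
  "vacuum_state X P A = ip (Fock X P) vacuum (A vacuum)"

text \<open>A \<open>*\<close>-endomorphism of the Weyl algebra with this property is unique, since it is norm
  continuous.\<close>

definition induced_endomorphism ::
  "('k::ab_group_add) ccr_space \<Rightarrow> ('k \<Rightarrow> 'k) \<Rightarrow> ('k \<Rightarrow> 'k) \<Rightarrow>
     ((('k list \<Rightarrow> complex) \<Rightarrow> 'k list \<Rightarrow> complex) \<Rightarrow> ('k list \<Rightarrow> complex) \<Rightarrow> 'k list \<Rightarrow> complex) \<Rightarrow> bool" where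
  "induced_endomorphism X P V \<rho> \<longleftrightarrow>
     star_endomorphism (Fock X P) (weyl_algebra X P UNIV) \<rho> \<and>
     (\<forall>f. star X f = f \<longrightarrow> \<rho> (weyl X P f) = weyl X P (V f))"

section \<open>The vectors and subspaces attached to multi-indices\<close>

definition K1kernel :: "('k::ab_group_add) ccr_space \<Rightarrow> ('k \<Rightarrow> 'k) \<Rightarrow> ('k \<Rightarrow> 'k) \<Rightarrow> 'k hspace" where
  "K1kernel X P V = (Khilb X P)\<lparr>car := range P \<inter> {f. kdagger X P V f = 0}\<rparr>"

text \<open>Indices of a sequence \<open>f\<^sub>1, f\<^sub>2, \<dots>\<close> with \<open>d \<in> {0, 1, \<dots>, \<infinity>}\<close> members.\<close>

definition indices :: "enat \<Rightarrow> nat set" where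
  "indices d = {j. 1 \<le> j \<and> enat j \<le> d}"

text \<open>Multi-indices are increasing lists; the multi-index \<open>0\<close> is the empty list.\<close>

definition multi_indices :: "enat \<Rightarrow> nat list set" where
  "multi_indices d = {\<alpha> \<in> lists (indices d). sorted \<alpha>}"

definition c_coeff :: "nat list \<Rightarrow> real" where
  "c_coeff \<alpha> = 1 / sqrt (\<Prod>j\<in>set \<alpha>. fact (count_list \<alpha> j))"

definition phi ::
  "('k::ab_group_add) ccr_space \<Rightarrow> ('k \<Rightarrow> 'k) \<Rightarrow> (nat \<Rightarrow> 'k) \<Rightarrow> nat list \<Rightarrow> 'k list \<Rightarrow> complex" where
  "phi X P f \<alpha> = smul (Fock X P) (complex_of_real (c_coeff \<alpha>))
     (foldr (\<lambda>j. creation (K1hilb X P) (f j)) \<alpha> vacuum)"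

definition F_sub ::
  "('k::ab_group_add) ccr_space \<Rightarrow> ('k \<Rightarrow> 'k) \<Rightarrow> ('k \<Rightarrow> 'k) \<Rightarrow> (nat \<Rightarrow> 'k) \<Rightarrow> nat list \<Rightarrow>
     ('k list \<Rightarrow> complex) hspace" where
  "F_sub X P V f \<alpha> = (Fock X P)\<lparr>car :=
     hclosure (Fock X P) {A (phi X P f \<alpha>) |A. A \<in> weyl_algebra X P (range V)}\<rparr>"

definition pi_sub ::
  "('k::ab_group_add) ccr_space \<Rightarrow> ('k \<Rightarrow> 'k) \<Rightarrow> ('k \<Rightarrow> 'k) \<Rightarrow>
     ((('k list \<Rightarrow> complex) \<Rightarrow> 'k list \<Rightarrow> complex) \<Rightarrow> ('k list \<Rightarrow> complex) \<Rightarrow> 'k list \<Rightarrow> complex) \<Rightarrow>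
     (nat \<Rightarrow> 'k) \<Rightarrow> nat list \<Rightarrow>
     (('k list \<Rightarrow> complex) \<Rightarrow> 'k list \<Rightarrow> complex) \<Rightarrow> ('k list \<Rightarrow> complex) \<Rightarrow> 'k list \<Rightarrow> complex" where
  "pi_sub X P V \<rho> f \<alpha> A = (\<lambda>\<psi>. if \<psi> \<in> car (F_sub X P V f \<alpha>) then \<rho> A \<psi> else 0)"

end

theory Submission
  imports Defs "HOL-Combinatorics.Permutations"
begin

text \<open>
  Weyl operators displace exponential vectors. In the symmetric Fock space over \<open>\<K>\<^sub>1\<close> the vectors
  \<open>e(h) = \<Sum>\<^sub>n h\<^sup>\<otimes>\<^sup>n / \<surd>n!\<close> are total and satisfy \<open>\<langle>e(h), e(k)\<rangle> = exp \<langle>h, k\<rangle>\<close>, so that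
  \<open>W(z) e(h) = exp (- \<parallel>z\<parallel>\<^sup>2/2 - \<langle>z, h\<rangle>) e(h + z)\<close> defines unitary operators. For \<open>f = f\<^sup>*\<close> the
  exponential \<open>w(f)\<close> of the closure of \<open>i \<pi>(f)\<close> is \<open>W(i P\<^sub>1 f)\<close>: the generator of the unitary group
  \<open>t \<mapsto> W(t i P\<^sub>1 f)\<close> extends \<open>i \<pi>(f)\<close>, and it is no larger than the closure because the domain of
  the closure contains the exponential vectors, which the group permutes up to factors
  (\<open>graph_closure_eq_generator\<close>, \<open>exp_field\<close>).

  Let \<open>N = \<K>\<^sub>1 \<inter> ker V\<^sup>\<dagger>\<close>. A vector of \<open>\<K>\<^sub>1\<close> lies in \<open>N\<close> iff it is orthogonal to \<open>P\<^sub>1 V g\<close> for all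
  \<open>g\<close>. Hence, for \<open>u \<in> N\<close> and \<open>g = g\<^sup>*\<close>, \<open>w(V g) e(u)\<close> is \<open>e(u + i P\<^sub>1 V g)\<close> times a number which
  does not depend on \<open>u\<close>, and \<open>\<langle>\<psi>, w(V g) \<phi>\<rangle> = \<omega>(w(V g)) \<langle>\<psi>, \<phi>\<rangle>\<close> for all \<open>\<psi>, \<phi>\<close> in the closed span
  of \<open>{e(u) | u \<in> N}\<close> (\<open>weyl_T\<close>). The \<open>\<phi>\<^sub>\<alpha>\<close> are orthonormal vectors in this span, so
  \<open>\<langle>\<phi>\<^sub>\<alpha>, A \<phi>\<^sub>\<beta>\<rangle> = \<delta>\<^sub>\<alpha>\<^sub>\<beta> \<omega>(A)\<close> for all \<open>A\<close> in the Weyl algebra of \<open>ran V\<close> (\<open>matrix_element\<close>). For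
  \<open>\<alpha> \<noteq> \<beta>\<close> this is the orthogonality of the cyclic subspaces, and for \<open>\<alpha> = \<beta>\<close> it says that all \<open>\<phi>\<^sub>\<alpha>\<close>
  induce the state \<open>\<omega> \<circ> \<rho>\<close>.

  The cyclic subspaces are total (\<open>M_total\<close>): if \<open>v\<close> is orthogonal to all of them, then it is
  orthogonal to \<open>w(V g) e(u)\<close>, hence to \<open>e(h)\<close> for all \<open>h\<close> in the real subspace
  \<open>R = N + i P\<^sub>1 V(Re \<K>)\<close>. The complex span of \<open>R\<close> is dense, since a vector of \<open>\<K>\<^sub>1\<close> orthogonal to
  \<open>P\<^sub>1 V(Re \<K>)\<close> lies in \<open>N\<close>; by polarization, the homogeneous components of \<open>v\<close> vanish
  (\<open>orth_ev_imp_zero\<close>).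

  The endomorphism \<open>\<rho>\<close> enters through two facts. The Weyl relation makes the linear span of the
  Weyl operators a \<open>*\<close>-algebra, so Weyl algebras are the norm closures of these spans
  (\<open>cstar_generated_eq\<close>). A \<open>*\<close>-homomorphism is automatically a contraction
  (\<open>star_hom_contractive\<close>). Hence \<open>\<rho>\<close> maps the Weyl algebra of \<open>\<K>\<close> into that of \<open>ran V\<close>, with
  dense range, and the cyclic subspaces of \<open>\<rho>\<close> and of the Weyl algebra of \<open>ran V\<close> agree.
\<close>

section \<open>Hilbert spaces inside a vector space\<close>

text \<open>The carrier may be a proper subset of the underlying type, so every rule is relative to it.\<close>

locale prehilbert =
  fixes H :: "('v::ab_group_add) hspace"
  assumes vector_space_smul: "vector_space (smul H)"
    and subspace_car: "module.subspace (smul H) (car H)"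
    and ip_cnj: "\<And>u v. u \<in> car H \<Longrightarrow> v \<in> car H \<Longrightarrow> ip H v u = cnj (ip H u v)"
    and ip_add: "\<And>u v w. u \<in> car H \<Longrightarrow> v \<in> car H \<Longrightarrow> w \<in> car H \<Longrightarrow> ip H u (v + w) = ip H u v + ip H u w"
    and ip_scale: "\<And>c u v. u \<in> car H \<Longrightarrow> v \<in> car H \<Longrightarrow> ip H u (smul H c v) = c * ip H u v"
    and ip_pos: "\<And>u. u \<in> car H \<Longrightarrow> u \<noteq> 0 \<Longrightarrow> Re (ip H u u) > 0"
begin

sublocale vs: vector_space "smul H" by (rule vector_space_smul)

lemma zero_car [simp, intro]: "0 \<in> car H"
  using subspace_car vs.subspace_0 by blast
lemma add_car [simp, intro]: "u \<in> car H \<Longrightarrow> v \<in> car H \<Longrightarrow> u + v \<in> car H"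
  using subspace_car vs.subspace_add by blast
lemma scale_car [simp, intro]: "u \<in> car H \<Longrightarrow> smul H c u \<in> car H"
  using subspace_car vs.subspace_scale by blast
lemma diff_car [simp, intro]: "u \<in> car H \<Longrightarrow> v \<in> car H \<Longrightarrow> u - v \<in> car H"
  using subspace_car vs.subspace_diff by blast
lemma uminus_car [simp, intro]: "u \<in> car H \<Longrightarrow> - u \<in> car H"
  using subspace_car vs.subspace_neg by blast
lemma sum_car [intro]: "(\<And>i. i \<in> F \<Longrightarrow> x i \<in> car H) \<Longrightarrow> sum x F \<in> car H"
  using subspace_car vs.subspace_sum by blast
lemma span_car: "S \<subseteq> car H \<Longrightarrow> vs.span S \<subseteq> car H"
  using vs.span_minimal[OF _ subspace_car] .

lemma ip_add_left: "u \<in> car H \<Longrightarrow> v \<in> car H \<Longrightarrow> w \<in> car H \<Longrightarrow> ip H (u + v) w = ip H u w + ip H v w"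
  by (metis add_car complex_cnj_add ip_add ip_cnj)
lemma ip_scale_left: "u \<in> car H \<Longrightarrow> v \<in> car H \<Longrightarrow> ip H (smul H c u) v = cnj c * ip H u v"
  by (metis complex_cnj_mult ip_cnj ip_scale scale_car)
lemma ip_zero [simp]: "u \<in> car H \<Longrightarrow> ip H u 0 = 0"
  using ip_scale[of u 0 0] by simp
lemma ip_zero_left [simp]: "u \<in> car H \<Longrightarrow> ip H 0 u = 0"
  using ip_scale_left[of 0 u 0] by simp
lemma ip_minus: "u \<in> car H \<Longrightarrow> v \<in> car H \<Longrightarrow> ip H u (- v) = - ip H u v"
  using ip_scale[of u v "-1"] by simp
lemma ip_minus_left: "u \<in> car H \<Longrightarrow> v \<in> car H \<Longrightarrow> ip H (- u) v = - ip H u v"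
  using ip_scale_left[of u v "-1"] by simp
lemma ip_diff: "u \<in> car H \<Longrightarrow> v \<in> car H \<Longrightarrow> w \<in> car H \<Longrightarrow> ip H u (v - w) = ip H u v - ip H u w"
  using ip_add[of u v "-w"] by (simp add: ip_minus)
lemma ip_diff_left: "u \<in> car H \<Longrightarrow> v \<in> car H \<Longrightarrow> w \<in> car H \<Longrightarrow> ip H (u - v) w = ip H u w - ip H v w"
  using ip_add_left[of u "-v" w] by (simp add: ip_minus_left)
lemma ip_sum: "u \<in> car H \<Longrightarrow> (\<And>i. i \<in> F \<Longrightarrow> x i \<in> car H) \<Longrightarrow> ip H u (sum x F) = (\<Sum>i\<in>F. ip H u (x i))"
  by (induction F rule: infinite_finite_induct) (auto simp: ip_add sum_car)
lemma ip_sum_left: "u \<in> car H \<Longrightarrow> (\<And>i. i \<in> F \<Longrightarrow> x i \<in> car H) \<Longrightarrow> ip H (sum x F) u = (\<Sum>i\<in>F. ip H (x i) u)"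
  by (induction F rule: infinite_finite_induct) (auto simp: ip_add_left sum_car)

lemmas ip_simps = ip_add ip_add_left ip_scale ip_scale_left ip_minus ip_minus_left ip_diff ip_diff_left

lemma Im_ip_self: "u \<in> car H \<Longrightarrow> Im (ip H u u) = 0"
  using ip_cnj[of u u] by (simp add: complex_eq_iff)
lemma Re_ip_self: "u \<in> car H \<Longrightarrow> Re (ip H u u) \<ge> 0"
  by (cases "u = 0") (auto dest: ip_pos)
lemma hnorm_sq: "u \<in> car H \<Longrightarrow> (hnorm H u)\<^sup>2 = Re (ip H u u)"
  by (simp add: hnorm_def Re_ip_self)
lemma ip_self: "u \<in> car H \<Longrightarrow> ip H u u = complex_of_real ((hnorm H u)\<^sup>2)"
  by (simp add: hnorm_sq complex_eq_iff Im_ip_self)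
lemma hnorm_nonneg [simp]: "u \<in> car H \<Longrightarrow> hnorm H u \<ge> 0"
  by (simp add: hnorm_def Re_ip_self)
lemma hnorm_zero [simp]: "hnorm H 0 = 0"
  by (simp add: hnorm_def)
lemma hnorm_eq_zero: "u \<in> car H \<Longrightarrow> hnorm H u = 0 \<longleftrightarrow> u = 0"
  using ip_pos[of u] by (fastforce simp: hnorm_def)
lemma hnorm_scale: "u \<in> car H \<Longrightarrow> hnorm H (smul H c u) = cmod c * hnorm H u"
proof -
  assume u: "u \<in> car H"
  have "ip H (smul H c u) (smul H c u) = (c * cnj c) * ip H u u"
    using u by (simp add: ip_scale ip_scale_left)
  also have "\<dots> = (c * cnj c) * complex_of_real ((hnorm H u)\<^sup>2)"
    using u by (simp only: ip_self)
  also have "\<dots> = complex_of_real ((cmod c * hnorm H u)\<^sup>2)"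
    by (simp only: complex_norm_square[symmetric]) (simp add: power_mult_distrib)
  finally have "ip H (smul H c u) (smul H c u) = complex_of_real ((cmod c * hnorm H u)\<^sup>2)" .
  then show ?thesis using u by (simp add: hnorm_def[of H "smul H c u"])
qed
lemma hnorm_uminus: "u \<in> car H \<Longrightarrow> hnorm H (- u) = hnorm H u"
  using hnorm_scale[of u "-1"] by simp
lemma hnorm_minus_commute: "u \<in> car H \<Longrightarrow> v \<in> car H \<Longrightarrow> hnorm H (u - v) = hnorm H (v - u)"
  using hnorm_uminus[of "u - v"] by simp

lemma hnorm_sq_add: "u \<in> car H \<Longrightarrow> v \<in> car H \<Longrightarrow>
    (hnorm H (u + v))\<^sup>2 = (hnorm H u)\<^sup>2 + (hnorm H v)\<^sup>2 + 2 * Re (ip H u v)"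
  using ip_cnj[of u v] by (simp add: hnorm_sq ip_simps)
lemma hnorm_sq_diff: "u \<in> car H \<Longrightarrow> v \<in> car H \<Longrightarrow>
    (hnorm H (u - v))\<^sup>2 = (hnorm H u)\<^sup>2 + (hnorm H v)\<^sup>2 - 2 * Re (ip H u v)"
  using hnorm_sq_add[of u "-v"] by (simp add: hnorm_uminus ip_minus)

text \<open>
  Subtracting from \<open>v\<close> its orthogonal projection onto the line of \<open>u\<close>. Positivity of the left hand
  side is the Cauchy--Schwarz inequality; in the projection theorem the formula shows that a
  nearest point leaves an orthogonal remainder.
\<close>

lemma hnorm_sq_orth_component:
  assumes u: "u \<in> car H" and v: "v \<in> car H" and u0: "u \<noteq> 0"
  shows "(hnorm H (v - smul H (ip H u v / complex_of_real ((hnorm H u)\<^sup>2)) u))\<^sup>2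
    = (hnorm H v)\<^sup>2 - (cmod (ip H u v))\<^sup>2 / (hnorm H u)\<^sup>2"
proof -
  define n where "n = (hnorm H u)\<^sup>2"
  have n: "n > 0" using u u0 hnorm_eq_zero[of u] by (auto simp: n_def)
  have s: "ip H u v * cnj (ip H u v) = complex_of_real ((cmod (ip H u v))\<^sup>2)"
    by (rule complex_norm_square[symmetric])
  have 1: "ip H v (smul H (ip H u v / complex_of_real n) u) = complex_of_real ((cmod (ip H u v))\<^sup>2 / n)"
    using u v n s by (simp add: ip_scale ip_cnj[of u v])
  have 2: "hnorm H (smul H (ip H u v / complex_of_real n) u) = cmod (ip H u v) / n * hnorm H u"
    using u n by (simp add: hnorm_scale norm_divide)
  have 3: "(cmod (ip H u v) / n * hnorm H u)\<^sup>2 = (cmod (ip H u v))\<^sup>2 / n"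
    using n by (simp add: power_mult_distrib power_divide flip: n_def) (simp add: power2_eq_square)
  show ?thesis
    using u v by (simp add: hnorm_sq_diff flip: n_def) (simp only: 1 2 3, simp)
qed

lemma cauchy_schwarz: 
  assumes u: "u \<in> car H" and v: "v \<in> car H"
  shows "cmod (ip H u v) \<le> hnorm H u * hnorm H v"
proof (cases "u = 0")
  case False
  then have n: "hnorm H u > 0" using u hnorm_eq_zero[of u] hnorm_nonneg[of u] by linarith
  have "0 \<le> (hnorm H v)\<^sup>2 - (cmod (ip H u v))\<^sup>2 / (hnorm H u)\<^sup>2"
    by (metis hnorm_sq_orth_component[OF u v False] zero_le_power2)
  then have "(cmod (ip H u v))\<^sup>2 \<le> (hnorm H u * hnorm H v)\<^sup>2"
    using n by (simp add: field_simps power_mult_distrib)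
  moreover have "0 \<le> hnorm H u * hnorm H v" using n hnorm_nonneg[OF v] by simp
  ultimately show ?thesis by (rule power2_le_imp_le)
qed (use v in auto)

lemma hnorm_triangle: "u \<in> car H \<Longrightarrow> v \<in> car H \<Longrightarrow> hnorm H (u + v) \<le> hnorm H u + hnorm H v"
proof -
  assume a: "u \<in> car H" "v \<in> car H"
  have "Re (ip H u v) \<le> hnorm H u * hnorm H v"
    using cauchy_schwarz[OF a] complex_Re_le_cmod order_trans by blast
  then have "(hnorm H (u + v))\<^sup>2 \<le> (hnorm H u + hnorm H v)\<^sup>2"
    using a by (simp add: hnorm_sq_add power2_sum)
  then show ?thesis using a by (meson add_nonneg_nonneg hnorm_nonneg power2_le_imp_le)
qed
lemma hnorm_triangle_diff: "u \<in> car H \<Longrightarrow> v \<in> car H \<Longrightarrow> w \<in> car H \<Longrightarrow>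
    hnorm H (u - w) \<le> hnorm H (u - v) + hnorm H (v - w)"
  using hnorm_triangle[of "u - v" "v - w"] by simp
lemma hnorm_diff_ineq: "u \<in> car H \<Longrightarrow> v \<in> car H \<Longrightarrow> \<bar>hnorm H u - hnorm H v\<bar> \<le> hnorm H (u - v)"
  using hnorm_triangle[of "u - v" v] hnorm_triangle[of "v - u" u] hnorm_minus_commute[of u v] by simp
lemma hnorm_sum: "(\<And>i. i \<in> F \<Longrightarrow> x i \<in> car H) \<Longrightarrow> hnorm H (sum x F) \<le> (\<Sum>i\<in>F. hnorm H (x i))"
proof (induction F rule: infinite_finite_induct)
  case (insert i F)
  then show ?case using hnorm_triangle[of "x i" "sum x F"] by (force simp: sum_car)
qed auto

text \<open>
  Norm convergence within the carrier; a type class topology is not at hand, because the norm is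
  given by a record.
\<close>

definition lim_to :: "(nat \<Rightarrow> 'v) \<Rightarrow> 'v \<Rightarrow> bool" where
  "lim_to s l \<longleftrightarrow> (\<forall>n. s n \<in> car H) \<and> l \<in> car H \<and> (\<lambda>n. hnorm H (s n - l)) \<longlonglongrightarrow> 0"

lemma lim_to_const: "v \<in> car H \<Longrightarrow> lim_to (\<lambda>_. v) v"
  by (simp add: lim_to_def)
lemma lim_to_bound:
  assumes "\<And>n. s n \<in> car H" "l \<in> car H" "\<And>n. hnorm H (s n - l) \<le> b n" "b \<longlonglongrightarrow> 0"
  shows "lim_to s l"
  unfolding lim_to_def using assms by (auto intro!: tendsto_sandwich[OF _ _ tendsto_const assms(4)] always_eventually)
lemma lim_to_add: "lim_to s l \<Longrightarrow> lim_to t m \<Longrightarrow> lim_to (\<lambda>n. s n + t n) (l + m)"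
proof -
  assume a: "lim_to s l" "lim_to t m"
  show ?thesis
  proof (rule lim_to_bound[where b = "\<lambda>n. hnorm H (s n - l) + hnorm H (t n - m)"])
    fix n show "hnorm H (s n + t n - (l + m)) \<le> hnorm H (s n - l) + hnorm H (t n - m)"
      using hnorm_triangle[of "s n - l" "t n - m"] a by (simp add: lim_to_def add_diff_add)
  qed (use a tendsto_add_zero in \<open>auto simp: lim_to_def\<close>)
qed
lemma lim_to_scale: "lim_to s l \<Longrightarrow> lim_to (\<lambda>n. smul H c (s n)) (smul H c l)"
proof -
  assume a: "lim_to s l"
  show ?thesis
    by (rule lim_to_bound[where b = "\<lambda>n. cmod c * hnorm H (s n - l)"])
      (use a in \<open>auto simp: lim_to_def hnorm_scale simp flip: vs.scale_right_diff_distrib intro: tendsto_mult_right_zero\<close>)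
qed
lemma lim_to_diff: "lim_to s l \<Longrightarrow> lim_to t m \<Longrightarrow> lim_to (\<lambda>n. s n - t n) (l - m)"
  using lim_to_add[of s l "\<lambda>n. smul H (-1) (t n)" "smul H (-1) m"] lim_to_scale[of t m "-1"] by simp
lemma tendsto_ip:
  assumes c: "\<And>n. s n \<in> car H" "\<And>n. t n \<in> car H" "l \<in> car H" "m \<in> car H"
    and lim: "((\<lambda>n. hnorm H (s n - l)) \<longlongrightarrow> 0) F" "((\<lambda>n. hnorm H (t n - m)) \<longlongrightarrow> 0) F"
  shows "((\<lambda>n. ip H (s n) (t n)) \<longlongrightarrow> ip H l m) F"
proof -
  have b: "cmod (ip H (s n) (t n) - ip H l m) \<le>
      hnorm H (s n - l) * hnorm H (t n - m) + hnorm H (s n - l) * hnorm H m + hnorm H l * hnorm H (t n - m)" for n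
  proof -
    have "ip H (s n) (t n) - ip H l m = ip H (s n - l) (t n - m) + ip H (s n - l) m + ip H l (t n - m)"
      using c by (simp add: ip_simps)
    also have "cmod \<dots> \<le> cmod (ip H (s n - l) (t n - m)) + cmod (ip H (s n - l) m) + cmod (ip H l (t n - m))"
      by (meson add_right_mono norm_triangle_ineq order_trans)
    also have "\<dots> \<le> hnorm H (s n - l) * hnorm H (t n - m) + hnorm H (s n - l) * hnorm H m + hnorm H l * hnorm H (t n - m)"
      using c by (intro add_mono cauchy_schwarz diff_car)
    finally show ?thesis .
  qed
  have "((\<lambda>n. hnorm H (s n - l) * hnorm H (t n - m) + hnorm H (s n - l) * hnorm H m + hnorm H l * hnorm H (t n - m))
      \<longlongrightarrow> 0 * 0 + 0 * hnorm H m + hnorm H l * 0) F"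
    using lim by (intro tendsto_add tendsto_mult tendsto_const) auto
  then have z: "((\<lambda>n. hnorm H (s n - l) * hnorm H (t n - m) + hnorm H (s n - l) * hnorm H m + hnorm H l * hnorm H (t n - m))
      \<longlongrightarrow> 0) F" by simp
  have "((\<lambda>n. ip H (s n) (t n) - ip H l m) \<longlongrightarrow> 0) F"
    by (rule Lim_null_comparison[OF always_eventually z]) (simp add: b)
  then show ?thesis using LIM_zero_iff by blast
qed
lemma lim_to_ip: "lim_to s l \<Longrightarrow> lim_to t m \<Longrightarrow> (\<lambda>n. ip H (s n) (t n)) \<longlonglongrightarrow> ip H l m"
  by (rule tendsto_ip) (auto simp: lim_to_def)
lemma lim_to_norm: "lim_to s l \<Longrightarrow> (\<lambda>n. hnorm H (s n)) \<longlonglongrightarrow> hnorm H l"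
  unfolding hnorm_def by (intro tendsto_real_sqrt tendsto_Re lim_to_ip)
lemma lim_to_unique: assumes "lim_to s l" "lim_to s m" shows "l = m"
proof -
  have "lim_to (\<lambda>n. s n - s n) (l - m)" using assms by (rule lim_to_diff)
  then have "(\<lambda>n. 0) \<longlonglongrightarrow> hnorm H (l - m)" using lim_to_norm by fastforce
  then have "hnorm H (l - m) = 0" using LIMSEQ_unique tendsto_const by blast
  then show ?thesis using assms hnorm_eq_zero[of "l - m"] by (auto simp: lim_to_def)
qed

lemma hclosure_iff: assumes "S \<subseteq> car H"
  shows "v \<in> hclosure H S \<longleftrightarrow> (\<exists>s. (\<forall>n. s n \<in> S) \<and> lim_to s v)"
proof
  assume v: "v \<in> hclosure H S"
  have "\<exists>s\<in>S. hnorm H (v - s) < inverse (Suc n)" for n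
    using v by (auto simp: hclosure_def)
  then obtain s where s: "\<And>n. s n \<in> S" "\<And>n. hnorm H (v - s n) < inverse (Suc n)" by metis
  have "lim_to s v"
  proof (rule lim_to_bound[OF _ _ _ LIMSEQ_inverse_real_of_nat])
    fix n show "s n \<in> car H" using s assms by auto
    show "v \<in> car H" using v by (auto simp: hclosure_def)
    then show "hnorm H (s n - v) \<le> inverse (Suc n)"
      using s(2)[of n] hnorm_minus_commute[of v "s n"] \<open>s n \<in> car H\<close> by simp
  qed
  then show "\<exists>s. (\<forall>n. s n \<in> S) \<and> lim_to s v" using s by auto
next
  assume "\<exists>s. (\<forall>n. s n \<in> S) \<and> lim_to s v"
  then obtain s where s: "\<And>n. s n \<in> S" "lim_to s v" by auto
  have v: "v \<in> car H" using s by (auto simp: lim_to_def)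
  have "\<exists>s\<in>S. hnorm H (v - s) < e" if "e > 0" for e
  proof -
    have "\<forall>\<^sub>F n in sequentially. hnorm H (s n - v) < e"
      using s(2) that by (auto simp: lim_to_def intro: order_tendstoD)
    then obtain n where "hnorm H (s n - v) < e" using eventually_happens' by fastforce
    moreover have "s n \<in> car H" using s(1) assms by blast
    ultimately show ?thesis using s(1) v hnorm_minus_commute[of v "s n"] by metis
  qed
  then show "v \<in> hclosure H S" using v by (auto simp: hclosure_def)
qed
lemma hclosureI: "S \<subseteq> car H \<Longrightarrow> (\<And>n. s n \<in> S) \<Longrightarrow> lim_to s v \<Longrightarrow> v \<in> hclosure H S"
  using hclosure_iff by blast
lemma hclosureE: 
  assumes "S \<subseteq> car H" "v \<in> hclosure H S" obtains s where "\<And>n. s n \<in> S" "lim_to s v"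
  using assms hclosure_iff by blast
lemma hclosure_car: "hclosure H S \<subseteq> car H"
  by (auto simp: hclosure_def)
lemma hclosure_superset: "S \<subseteq> car H \<Longrightarrow> S \<subseteq> hclosure H S"
  using hclosureI[of S "\<lambda>_. _"] lim_to_const by (meson subsetD subsetI)
lemma hclosure_idem: assumes "S \<subseteq> car H" shows "hclosure H (hclosure H S) = hclosure H S"
proof
  show "hclosure H (hclosure H S) \<subseteq> hclosure H S"
  proof
    fix v assume v: "v \<in> hclosure H (hclosure H S)"
    then have vc: "v \<in> car H" by (simp add: hclosure_def)
    have "\<exists>s\<in>S. hnorm H (v - s) < e" if "e > 0" for e
    proof -
      obtain u where u: "u \<in> hclosure H S" "hnorm H (v - u) < e / 2"
        using v \<open>e > 0\<close> unfolding hclosure_def[of H "hclosure H S"] by (auto dest!: spec[of _ "e/2"])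
      then obtain s where s: "s \<in> S" "hnorm H (u - s) < e / 2"
        using \<open>e > 0\<close> unfolding hclosure_def[of H S] by (auto dest!: spec[of _ "e/2"])
      have "hnorm H (v - s) < e"
        using hnorm_triangle_diff[of v u s] vc u s assms hclosure_car by fastforce
      then show ?thesis using s by auto
    qed
    then show "v \<in> hclosure H S" using vc by (auto simp: hclosure_def)
  qed
qed (rule hclosure_superset[OF hclosure_car])
lemma subspace_hclosure: assumes "vs.subspace S" "S \<subseteq> car H" shows "vs.subspace (hclosure H S)"
proof (rule vs.subspaceI)
  show "0 \<in> hclosure H S" using assms hclosure_superset vs.subspace_0 by blast
next
  fix x y assume "x \<in> hclosure H S" "y \<in> hclosure H S"
  then show "x + y \<in> hclosure H S"
    using assms by (elim hclosureE[OF assms(2)]) (rule hclosureI[OF assms(2) _ lim_to_add], auto intro: vs.subspace_add)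
next
  fix c x assume "x \<in> hclosure H S"
  then show "smul H c x \<in> hclosure H S"
    using assms by (elim hclosureE[OF assms(2)]) (rule hclosureI[OF assms(2) _ lim_to_scale], auto intro: vs.subspace_scale)
qed

lemma orth_span: 
  assumes "S \<subseteq> car H" "v \<in> car H" "\<And>s. s \<in> S \<Longrightarrow> ip H s v = 0" "x \<in> vs.span S"
  shows "ip H x v = 0"
proof -
  have "x \<in> car H \<and> ip H x v = 0"
    using assms(4)
  proof (induction rule: vs.span_induct_alt)
    case base then show ?case using assms by simp
  next
    case (step c x y) then show ?case using assms by (auto simp: ip_simps)
  qed
  then show ?thesis by simp
qed
lemma orth_hclosure:
  assumes "S \<subseteq> car H" "v \<in> car H" "\<And>s. s \<in> S \<Longrightarrow> ip H s v = 0" "x \<in> hclosure H S"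
  shows "ip H x v = 0"
proof -
  obtain s where s: "\<And>n. s n \<in> S" "lim_to s x" using assms hclosureE by blast
  have "(\<lambda>n. ip H (s n) v) \<longlonglongrightarrow> ip H x v"
    using s assms by (intro lim_to_ip lim_to_const) auto
  moreover have "(\<lambda>n. ip H (s n) v) = (\<lambda>n. 0)" using s assms(3) by auto
  ultimately show ?thesis by (simp add: LIMSEQ_const_iff)
qed

definition closed_sub :: "'v set \<Rightarrow> bool" where
  "closed_sub M \<longleftrightarrow> vs.subspace M \<and> M \<subseteq> car H \<and> hclosure H M \<subseteq> M"

lemma closed_sub_hclosure: "vs.subspace S \<Longrightarrow> S \<subseteq> car H \<Longrightarrow> closed_sub (hclosure H S)"
  by (simp add: closed_sub_def subspace_hclosure hclosure_car hclosure_idem)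
lemma closed_subD: "closed_sub M \<Longrightarrow> (\<And>n. s n \<in> M) \<Longrightarrow> lim_to s v \<Longrightarrow> v \<in> M"
  unfolding closed_sub_def using hclosureI by blast

lemma bop_car: "A \<in> bop H \<Longrightarrow> v \<in> car H \<Longrightarrow> A v \<in> car H"
  and bop_outside: "A \<in> bop H \<Longrightarrow> v \<notin> car H \<Longrightarrow> A v = 0"
  and bop_add: "A \<in> bop H \<Longrightarrow> v \<in> car H \<Longrightarrow> w \<in> car H \<Longrightarrow> A (v + w) = A v + A w"
  and bop_scale: "A \<in> bop H \<Longrightarrow> v \<in> car H \<Longrightarrow> A (smul H c v) = smul H c (A v)"
  by (auto simp: bop_def)
lemma bop_car': "A \<in> bop H \<Longrightarrow> A v \<in> car H"
  using bop_car bop_outside by (metis zero_car)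
lemma bop_zero: "A \<in> bop H \<Longrightarrow> A 0 = 0"
  using bop_scale[of A 0 0] by simp
lemma bop_diff: "A \<in> bop H \<Longrightarrow> v \<in> car H \<Longrightarrow> w \<in> car H \<Longrightarrow> A (v - w) = A v - A w"
  by (metis bop_add bop_car diff_add_cancel diff_car eq_diff_eq)
lemma bop_bound: assumes "A \<in> bop H" obtains M where "M \<ge> 0" "\<And>v. v \<in> car H \<Longrightarrow> hnorm H (A v) \<le> M * hnorm H v"
proof -
  obtain M where M: "\<forall>v\<in>car H. hnorm H (A v) \<le> M * hnorm H v" using assms by (auto simp: bop_def)
  have "hnorm H (A v) \<le> \<bar>M\<bar> * hnorm H v" if "v \<in> car H" for v
    using M that by (smt (verit, best) mult_right_mono hnorm_nonneg)
  then show ?thesis using that[of "\<bar>M\<bar>"] by auto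
qed
lemma lim_to_bop: assumes A: "A \<in> bop H" and s: "lim_to s l" shows "lim_to (\<lambda>n. A (s n)) (A l)"
proof -
  obtain M where M: "M \<ge> 0" "\<And>v. v \<in> car H \<Longrightarrow> hnorm H (A v) \<le> M * hnorm H v"
    using bop_bound[OF A] by blast
  show ?thesis
  proof (rule lim_to_bound[where b = "\<lambda>n. M * hnorm H (s n - l)"])
    fix n show "hnorm H (A (s n) - A l) \<le> M * hnorm H (s n - l)"
      using s A M(2)[of "s n - l"] by (simp add: lim_to_def bop_diff)
  qed (use A s bop_car in \<open>auto simp: lim_to_def intro: tendsto_mult_right_zero\<close>)
qed

text \<open>
  Bounded operators vanish outside the carrier, so equality on a total set is equality of
  functions.
\<close>

lemma bop_eqI:
  assumes A: "A \<in> bop H" and B: "B \<in> bop H" and S: "S \<subseteq> car H" "hclosure H (vs.span S) = car H"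
    and eq: "\<And>s. s \<in> S \<Longrightarrow> A s = B s"
  shows "A = B"
proof
  fix v
  have sp: "x \<in> car H \<and> A x = B x" if "x \<in> vs.span S" for x
    using that by (induction rule: vs.span_induct_alt)
      (use A B S eq bop_zero[OF A] bop_zero[OF B] in \<open>auto simp: bop_add bop_scale subset_iff\<close>)
  show "A v = B v"
  proof (cases "v \<in> car H")
    case True
    then obtain s where s: "\<And>n. s n \<in> vs.span S" "lim_to s v"
      using S hclosureE[OF span_car[OF S(1)]] by metis
    have "lim_to (\<lambda>n. A (s n)) (A v)" "lim_to (\<lambda>n. B (s n)) (B v)" using A B s lim_to_bop by auto
    moreover have "(\<lambda>n. A (s n)) = (\<lambda>n. B (s n))" using s sp by auto
    ultimately show ?thesis using lim_to_unique by metis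
  next
    case False then show ?thesis using bop_outside[OF A] bop_outside[OF B] by simp
  qed
qed
lemma bop_comp: assumes A: "A \<in> bop H" and B: "B \<in> bop H" shows "A \<circ> B \<in> bop H"
proof -
  obtain M N where "M \<ge> 0" "\<And>v. v \<in> car H \<Longrightarrow> hnorm H (A v) \<le> M * hnorm H v"
    "\<And>v. v \<in> car H \<Longrightarrow> hnorm H (B v) \<le> N * hnorm H v" using A B bop_bound by metis
  then have "\<forall>v\<in>car H. hnorm H (A (B v)) \<le> (M * N) * hnorm H v"
    by (metis (no_types, opaque_lifting) B bop_car mult.assoc mult_left_mono order_trans)
  then show ?thesis using A B unfolding bop_def by (auto simp: bop_zero[OF A])
qed
lemma bop_plus: assumes A: "A \<in> bop H" and B: "B \<in> bop H" shows "(\<lambda>v. A v + B v) \<in> bop H"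
proof -
  obtain M N where "\<And>v. v \<in> car H \<Longrightarrow> hnorm H (A v) \<le> M * hnorm H v"
    "\<And>v. v \<in> car H \<Longrightarrow> hnorm H (B v) \<le> N * hnorm H v" using A B bop_bound by metis
  then have "\<forall>v\<in>car H. hnorm H (A v + B v) \<le> (M + N) * hnorm H v"
    by (smt (verit, best) A B bop_car distrib_right hnorm_triangle)
  then show ?thesis using A B unfolding bop_def by (auto simp: vs.scale_right_distrib)
qed
lemma bop_smul: assumes A: "A \<in> bop H" shows "(\<lambda>v. smul H c (A v)) \<in> bop H"
proof -
  obtain M where "\<And>v. v \<in> car H \<Longrightarrow> hnorm H (A v) \<le> M * hnorm H v" using A bop_bound by metis
  then have "\<forall>v\<in>car H. hnorm H (smul H c (A v)) \<le> (cmod c * M) * hnorm H v"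
    using A by (auto simp: hnorm_scale bop_car mult.assoc mult_left_mono)
  then have "\<exists>M. \<forall>v\<in>car H. hnorm H (smul H c (A v)) \<le> M * hnorm H v" by blast
  then show ?thesis using A unfolding bop_def
    by (simp add: vs.scale_right_distrib mult.commute)
qed
lemma bop_0: "(\<lambda>_. 0) \<in> bop H"
  unfolding bop_def by (auto intro: exI[of _ 0])
lemma bop_hid: "hid H \<in> bop H"
  unfolding bop_def by (auto simp: hid_def intro: exI[of _ 1])
lemma hid_simp [simp]: "v \<in> car H \<Longrightarrow> hid H v = v"
  by (simp add: hid_def)

lemma hadj_eqI:
  assumes B: "B \<in> bop H" "\<And>v w. v \<in> car H \<Longrightarrow> w \<in> car H \<Longrightarrow> ip H (B v) w = ip H v (A w)"
  shows "hadj H A = B"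
  unfolding hadj_def
proof (rule the_equality)
  show "B \<in> bop H \<and> (\<forall>v\<in>car H. \<forall>w\<in>car H. ip H (B v) w = ip H v (A w))" using B by auto
next
  fix B' assume B': "B' \<in> bop H \<and> (\<forall>v\<in>car H. \<forall>w\<in>car H. ip H (B' v) w = ip H v (A w))"
  show "B' = B"
  proof
    fix v show "B' v = B v"
    proof (cases "v \<in> car H")
      case True
      then have c: "B' v \<in> car H" "B v \<in> car H" using B B' bop_car by auto
      then have "ip H (B' v - B v) (B' v - B v) = 0"
        using B B' True by (simp add: ip_diff_left)
      then show ?thesis using c ip_pos[of "B' v - B v"] by (metis diff_car eq_iff_diff_eq_0 order_less_irrefl zero_complex.simps(1))
    next
      case False then show ?thesis using bop_outside[OF B(1)] bop_outside[of B'] B' by simp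
    qed
  qed
qed

end

locale hilbert = prehilbert +
  assumes complete: "\<And>s. (\<And>n. s n \<in> car H) \<Longrightarrow> (\<And>e. e > 0 \<Longrightarrow> \<exists>N. \<forall>m\<ge>N. \<forall>n\<ge>N. hnorm H (s m - s n) < e)
      \<Longrightarrow> \<exists>l\<in>car H. (\<lambda>n. hnorm H (s n - l)) \<longlonglongrightarrow> 0"

lemma hilbert_space_iff: "hilbert_space H \<longleftrightarrow> hilbert H"
proof
  assume h: "hilbert_space H"
  note h = h[unfolded hilbert_space_def]
  note h1 = h[THEN conjunct1] and h2 = h[THEN conjunct2]
  note h3 = h2[THEN conjunct1] and h4 = h2[THEN conjunct2]
  note h5 = h4[THEN conjunct1] and h6 = h4[THEN conjunct2]
  note h7 = h6[THEN conjunct1] and h8 = h6[THEN conjunct2]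
  note h9 = h8[THEN conjunct1] and h10 = h8[THEN conjunct2]
  note h11 = h10[THEN conjunct1] and h12 = h10[THEN conjunct2]
  show "hilbert H"
  proof (intro hilbert.intro prehilbert.intro hilbert_axioms.intro)
    show "vector_space (smul H)" "module.subspace (smul H) (car H)" by (fact h1) (fact h3)
  qed (use h5 h7 h9 h11 in \<open>blast+\<close>, rule h12[rule_format], blast)
next
  assume "hilbert H" then interpret hilbert H .
  show "hilbert_space H" unfolding hilbert_space_def
    by (intro conjI allI ballI impI vector_space_smul subspace_car ip_cnj ip_add ip_scale ip_pos)
      (auto intro: complete)
qed

context hilbert begin

lemma Cauchy_lim_to:
  assumes "\<And>n. s n \<in> car H" "\<And>e. e > 0 \<Longrightarrow> \<exists>N. \<forall>m\<ge>N. \<forall>n\<ge>N. hnorm H (s m - s n) < e"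
  shows "\<exists>l. lim_to s l"
  using complete[of s] assms by (auto simp: lim_to_def)

text \<open>
  The form in which the parallelogram law delivers the Cauchy property of a minimizing sequence.
\<close>

lemma Cauchy_lim_to_sq:
  assumes "\<And>n. s n \<in> car H" "\<And>m n. (hnorm H (s m - s n))\<^sup>2 \<le> b m + b n" "b \<longlonglongrightarrow> (0::real)"
  shows "\<exists>l. lim_to s l"
proof (rule Cauchy_lim_to)
  fix e :: real assume e: "e > 0"
  have "\<forall>\<^sub>F n in sequentially. b n < e\<^sup>2 / 2"
    using assms(3) e by (intro order_tendstoD(2)[where y=0]) auto
  then obtain N where N: "\<And>n. n \<ge> N \<Longrightarrow> b n < e\<^sup>2 / 2" by (auto simp: eventually_sequentially)
  have "hnorm H (s m - s n) < e" if "m \<ge> N" "n \<ge> N" for m n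
  proof -
    have "(hnorm H (s m - s n))\<^sup>2 < e\<^sup>2" using assms(2)[of m n] N[OF that(1)] N[OF that(2)] by linarith
    then show ?thesis using e by (simp add: power_less_imp_less_base)
  qed
  then show "\<exists>N. \<forall>m\<ge>N. \<forall>n\<ge>N. hnorm H (s m - s n) < e" by blast
qed (use assms in auto)

lemma hilbert_closed_sub: assumes "closed_sub M" shows "hilbert (H\<lparr>car := M\<rparr>)"
proof -
  have M: "vs.subspace M" "M \<subseteq> car H" using assms by (auto simp: closed_sub_def)
  have nm: "hnorm (H\<lparr>car := M\<rparr>) = hnorm H" by (simp add: hnorm_def fun_eq_iff)
  show ?thesis
  proof unfold_locales
    fix s :: "nat \<Rightarrow> 'a"
    assume s: "\<And>n. s n \<in> car (H\<lparr>car := M\<rparr>)"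
      "\<And>e. e > 0 \<Longrightarrow> \<exists>N. \<forall>m\<ge>N. \<forall>n\<ge>N. hnorm (H\<lparr>car := M\<rparr>) (s m - s n) < e"
    have "\<exists>l. lim_to s l" by (rule Cauchy_lim_to) (use s M nm in auto)
    then obtain l where l: "lim_to s l" ..
    then have "l \<in> M" using closed_subD[OF assms] s by auto
    then show "\<exists>l\<in>car (H\<lparr>car := M\<rparr>). (\<lambda>n. hnorm (H\<lparr>car := M\<rparr>) (s n - l)) \<longlonglongrightarrow> 0"
      using l by (auto simp: lim_to_def nm)
  qed (use M vector_space_smul in \<open>auto simp: ip_add ip_scale ip_pos ip_cnj[symmetric] vector_space_def subset_iff intro: ip_cnj\<close>)
qed

theorem projection:
  assumes M: "closed_sub M" and v: "v \<in> car H"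
  obtains m where "m \<in> M" "\<And>u. u \<in> M \<Longrightarrow> ip H u (v - m) = 0"
proof -
  have sub: "vs.subspace M" "M \<subseteq> car H" using M by (auto simp: closed_sub_def)
  have M0: "0 \<in> M" using sub vs.subspace_0 by auto
  define d where "d = Inf ((\<lambda>m. (hnorm H (v - m))\<^sup>2) ` M)"
  have bdd: "bdd_below ((\<lambda>m. (hnorm H (v - m))\<^sup>2) ` M)" by (rule bdd_belowI[of _ 0]) auto
  have d: "d \<le> (hnorm H (v - m))\<^sup>2" if "m \<in> M" for m
    unfolding d_def using bdd that by (auto intro: cInf_lower)
  have "\<exists>m\<in>M. (hnorm H (v - m))\<^sup>2 < d + inverse (Suc n)" for n
  proof -
    have "d < d + inverse (Suc n)" by simp
    then show ?thesis unfolding d_def using cInf_lessD[of "(\<lambda>m. (hnorm H (v - m))\<^sup>2) ` M"] M0 by blast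
  qed
  then obtain s where s: "\<And>n. s n \<in> M" "\<And>n. (hnorm H (v - s n))\<^sup>2 < d + inverse (Suc n)" by metis
  have sc: "\<And>n. s n \<in> car H" using s sub by auto
  have "\<exists>m. lim_to s m"
  proof (rule Cauchy_lim_to_sq[where b = "\<lambda>n. 2 * inverse (Suc n)"])
    fix i j
    let ?x = "v - s i" and ?y = "v - s j"
    \<comment> \<open>The midpoint of two points of \<open>M\<close> is at distance at least \<open>\<surd>d\<close>, so by the
      parallelogram law two almost nearest points are close to each other.\<close>
    have mid: "smul H (1/2) (s i + s j) \<in> M" using s sub by (auto intro: vs.subspace_scale vs.subspace_add)
    have "?x + ?y = smul H 2 (v - smul H (1/2) (s i + s j))"
    proof -
      have "smul H 2 v = v + v" using vs.scale_left_distrib[of 1 1 v] by simp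
      then show ?thesis by (simp add: vs.scale_right_diff_distrib)
    qed
    then have "(hnorm H (?x + ?y))\<^sup>2 = 4 * (hnorm H (v - smul H (1/2) (s i + s j)))\<^sup>2"
      using v sc by (simp add: hnorm_scale power_mult_distrib)
    then have 1: "(hnorm H (?x + ?y))\<^sup>2 \<ge> 4 * d" using d[OF mid] by simp
    have e: "s j - s i = ?x - ?y" by simp
    have "(hnorm H (s j - s i))\<^sup>2 + (hnorm H (?x + ?y))\<^sup>2 = 2 * (hnorm H ?x)\<^sup>2 + 2 * (hnorm H ?y)\<^sup>2"
      unfolding e using v sc hnorm_sq_add[of ?x ?y] hnorm_sq_diff[of ?x ?y] by simp
    then show "(hnorm H (s i - s j))\<^sup>2 \<le> 2 * inverse (Suc i) + 2 * inverse (Suc j)"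
      using 1 s(2)[of i] s(2)[of j] sc hnorm_minus_commute[of "s i" "s j"] by simp
  next
    show "(\<lambda>n. 2 * inverse (real (Suc n))) \<longlonglongrightarrow> 0"
      using tendsto_mult_left[OF LIMSEQ_inverse_real_of_nat, of 2] by simp
  qed (use sc in auto)
  then obtain m where m: "lim_to s m" ..
  have mM: "m \<in> M" using m s M closed_subD by blast
  have mc: "m \<in> car H" using mM sub by auto
  have "lim_to (\<lambda>n. v - s n) (v - m)" using m v lim_to_const lim_to_diff by blast
  then have "(\<lambda>n. (hnorm H (v - s n))\<^sup>2) \<longlonglongrightarrow> (hnorm H (v - m))\<^sup>2"
    using lim_to_norm tendsto_power by blast
  moreover have "(\<lambda>n. d + inverse (real (Suc n))) \<longlonglongrightarrow> d"
    using tendsto_add[OF tendsto_const LIMSEQ_inverse_real_of_nat, of d] by simp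
  ultimately have le: "(hnorm H (v - m))\<^sup>2 \<le> d"
    by (rule LIMSEQ_le) (use s(2) less_imp_le in blast)
  show thesis
  proof (rule that[OF mM])
    fix u assume u: "u \<in> M"
    show "ip H u (v - m) = 0"
    proof (cases "u = 0")
      case True then show ?thesis using v mc by simp
    next
      case False
      have uc: "u \<in> car H" using u sub by auto
      let ?c = "ip H u (v - m) / complex_of_real ((hnorm H u)\<^sup>2)"
      have n: "(hnorm H u)\<^sup>2 > 0" using hnorm_eq_zero[OF uc] False by simp
      have "m + smul H ?c u \<in> M" using u mM sub by (auto intro: vs.subspace_add vs.subspace_scale)
      then have "d \<le> (hnorm H (v - m - smul H ?c u))\<^sup>2" using d by (metis diff_diff_add)
      also have "\<dots> = (hnorm H (v - m))\<^sup>2 - (cmod (ip H u (v - m)))\<^sup>2 / (hnorm H u)\<^sup>2"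
        using v mc uc False by (intro hnorm_sq_orth_component) auto
      finally have "(cmod (ip H u (v - m)))\<^sup>2 / (hnorm H u)\<^sup>2 \<le> 0" using le by linarith
      then show ?thesis using n by (simp add: divide_le_0_iff)
    qed
  qed
qed

lemma closed_sub_eq_car:
  assumes M: "closed_sub M" and orth: "\<And>v. v \<in> car H \<Longrightarrow> (\<And>u. u \<in> M \<Longrightarrow> ip H u v = 0) \<Longrightarrow> v = 0"
  shows "M = car H"
proof
  show "M \<subseteq> car H" using M by (simp add: closed_sub_def)
  show "car H \<subseteq> M"
  proof
    fix v assume v: "v \<in> car H"
    obtain m where m: "m \<in> M" "\<And>u. u \<in> M \<Longrightarrow> ip H u (v - m) = 0" using projection[OF M v] by blast
    have "v - m = 0" using m v M orth[of "v - m"] by (auto simp: closed_sub_def)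
    then show "v \<in> M" using m by simp
  qed
qed

text \<open>
  The usual way to prove totality in what follows: the projection theorem reduces it to the
  triviality of the orthogonal complement.
\<close>

lemma total_if_orth:
  assumes S: "S \<subseteq> car H" and orth: "\<And>v. v \<in> car H \<Longrightarrow> (\<And>u. u \<in> S \<Longrightarrow> ip H u v = 0) \<Longrightarrow> v = 0"
  shows "hclosure H (vs.span S) = car H"
proof (rule closed_sub_eq_car)
  show "closed_sub (hclosure H (vs.span S))"
    by (rule closed_sub_hclosure[OF vs.subspace_span span_car[OF S]])
  fix v assume v: "v \<in> car H" "\<And>u. u \<in> hclosure H (vs.span S) \<Longrightarrow> ip H u v = 0"
  have "S \<subseteq> hclosure H (vs.span S)"
    using hclosure_superset[OF span_car[OF S]] vs.span_superset by blast
  then show "v = 0" using orth v by blast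
qed

lemma total_orth: 
  assumes S: "S \<subseteq> car H" "hclosure H (vs.span S) = car H" and v: "v \<in> car H" "\<And>u. u \<in> S \<Longrightarrow> ip H u v = 0"
  shows "v = 0"
proof -
  have "ip H v v = 0"
    using orth_hclosure[OF span_car[OF S(1)] v(1), of v] orth_span[OF S(1) v] S v by blast
  then show ?thesis using ip_pos[OF v(1)] by fastforce
qed

theorem riesz:
  assumes add: "\<And>v w. v \<in> car H \<Longrightarrow> w \<in> car H \<Longrightarrow> L (v + w) = L v + L w"
    and scale: "\<And>c v. v \<in> car H \<Longrightarrow> L (smul H c v) = c * L v"
    and bdd: "\<And>v. v \<in> car H \<Longrightarrow> cmod (L v) \<le> B * hnorm H v"
  obtains w where "w \<in> car H" "\<And>v. v \<in> car H \<Longrightarrow> L v = ip H w v"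
proof (cases "\<forall>v\<in>car H. L v = 0")
  case True then show ?thesis using that[of 0] by auto
next
  case False
  then obtain v0 where v0: "v0 \<in> car H" "L v0 \<noteq> 0" by auto
  have diff: "L (v - w) = L v - L w" if "v \<in> car H" "w \<in> car H" for v w
    using add[of "v - w" w] that by simp
  let ?M = "{v \<in> car H. L v = 0}"
  have M: "closed_sub ?M"
    unfolding closed_sub_def
  proof (intro conjI)
    show "vs.subspace ?M" using scale[of 0 0] by (intro vs.subspaceI) (auto simp: add scale)
    show "hclosure H ?M \<subseteq> ?M"
    proof
      fix v assume "v \<in> hclosure H ?M"
      then obtain s where s: "\<And>n. s n \<in> ?M" "lim_to s v" by (rule hclosureE[rotated]) auto
      have vc: "v \<in> car H" using s by (simp add: lim_to_def)
      have "(\<lambda>n. B * hnorm H (s n - v)) \<longlonglongrightarrow> 0"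
        using s by (auto simp: lim_to_def intro: tendsto_mult_right_zero)
      moreover have "cmod (L v) \<le> B * hnorm H (s n - v)" for n
        using bdd[of "s n - v"] s(1)[of n] vc diff[of "s n" v] by simp
      ultimately have "cmod (L v) \<le> 0" by (intro LIMSEQ_le_const) auto
      then show "v \<in> ?M" using vc by simp
    qed
  qed auto
  obtain m where m: "m \<in> ?M" "\<And>u. u \<in> ?M \<Longrightarrow> ip H u (v0 - m) = 0" using projection[OF M v0(1)] by blast
  define u where "u = v0 - m"
  have u: "u \<in> car H" "L u = L v0" using m v0 diff by (auto simp: u_def)
  have u0: "u \<noteq> 0" using u v0 scale[of 0 0] by auto
  have n: "complex_of_real ((hnorm H u)\<^sup>2) \<noteq> 0" using u0 hnorm_eq_zero[OF u(1)] by simp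
  \<comment> \<open>The kernel of \<open>L\<close> has codimension one, and \<open>u\<close> is orthogonal to it.\<close>
  define w where "w = smul H (cnj (L u) / complex_of_real ((hnorm H u)\<^sup>2)) u"
  show ?thesis
  proof (rule that[of w])
    fix v assume v: "v \<in> car H"
    have "v - smul H (L v / L u) u \<in> ?M" using v u v0 by (simp add: diff scale)
    then have "ip H (v - smul H (L v / L u) u) u = 0" using m(2) by (simp add: u_def)
    then have "ip H u (v - smul H (L v / L u) u) = 0" using u v by (subst ip_cnj) auto
    then have "ip H u v = (L v / L u) * complex_of_real ((hnorm H u)\<^sup>2)"
      using u v by (simp add: ip_simps ip_self)
    then show "L v = ip H w v"
      using u v n v0 by (simp add: w_def ip_simps)
  qed (use u in \<open>auto simp: w_def\<close>)
qed

lemma adjoint_exists: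
  assumes A: "A \<in> bop H"
  shows "\<exists>B\<in>bop H. \<forall>v\<in>car H. \<forall>w\<in>car H. ip H (B v) w = ip H v (A w)"
proof -
  obtain M where M: "M \<ge> 0" "\<And>v. v \<in> car H \<Longrightarrow> hnorm H (A v) \<le> M * hnorm H v"
    using bop_bound[OF A] by blast
  have "\<exists>b\<in>car H. \<forall>w\<in>car H. ip H v (A w) = ip H b w" if v: "v \<in> car H" for v
  proof -
    have "cmod (ip H v (A w)) \<le> (hnorm H v * M) * hnorm H w" if w: "w \<in> car H" for w
      using cauchy_schwarz[OF v bop_car[OF A w]] mult_left_mono[OF M(2)[OF w] hnorm_nonneg[OF v]]
      by (simp add: mult.assoc)
    then obtain b where "b \<in> car H" "\<And>w. w \<in> car H \<Longrightarrow> ip H v (A w) = ip H b w"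
      by (rule riesz[of "\<lambda>w. ip H v (A w)" "hnorm H v * M", rotated 2])
        (use v A in \<open>auto simp: bop_add bop_scale bop_car ip_add ip_scale\<close>)
    then show ?thesis by blast
  qed
  then obtain B0 where B0: "\<And>v. v \<in> car H \<Longrightarrow> B0 v \<in> car H" 
    "\<And>v w. v \<in> car H \<Longrightarrow> w \<in> car H \<Longrightarrow> ip H v (A w) = ip H (B0 v) w" by metis
  have uniq: "x = y" if xy: "x \<in> car H" "y \<in> car H" and e: "\<And>w. w \<in> car H \<Longrightarrow> ip H x w = ip H y w" for x y
  proof -
    have "ip H (x - y) (x - y) = 0" using e[of "x - y"] xy by (simp add: ip_diff_left)
    then show ?thesis using ip_pos[of "x - y"] xy by force
  qed
  have "hnorm H (B0 v) \<le> M * hnorm H v" if v: "v \<in> car H" for v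
  proof (cases "hnorm H (B0 v) = 0")
    case False
    then have p: "hnorm H (B0 v) > 0" using B0(1)[OF v] hnorm_nonneg by (metis less_eq_real_def)
    have "(hnorm H (B0 v))\<^sup>2 = cmod (ip H v (A (B0 v)))"
      using B0 v by (simp add: ip_self norm_power)
    also have "\<dots> \<le> hnorm H v * (M * hnorm H (B0 v))"
      using cauchy_schwarz[OF v bop_car[OF A B0(1)[OF v]]] mult_left_mono[OF M(2)[OF B0(1)[OF v]] hnorm_nonneg[OF v]]
      by linarith
    finally show ?thesis using p by (simp add: power2_eq_square mult.commute mult.left_commute)
  qed (use M v in simp)
  moreover have "B0 (v + w) = B0 v + B0 w" if "v \<in> car H" "w \<in> car H" for v w
    using that B0 A by (intro uniq) (auto simp: ip_add_left bop_car simp flip: B0(2))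
  moreover have "B0 (smul H c v) = smul H c (B0 v)" if "v \<in> car H" for c v
    using that B0 A by (intro uniq) (auto simp: ip_scale_left bop_car simp flip: B0(2))
  ultimately have "(\<lambda>v. if v \<in> car H then B0 v else 0) \<in> bop H"
    unfolding bop_def using B0(1) by auto
  then show ?thesis using B0 by (intro bexI[of _ "\<lambda>v. if v \<in> car H then B0 v else 0"]) auto
qed

lemma hadj_bop: "A \<in> bop H \<Longrightarrow> hadj H A \<in> bop H"
  and ip_hadj: "A \<in> bop H \<Longrightarrow> v \<in> car H \<Longrightarrow> w \<in> car H \<Longrightarrow> ip H (hadj H A v) w = ip H v (A w)"
  using adjoint_exists[of A] hadj_eqI[of _ A] by metis+

end

section \<open>One-parameter unitary groups\<close>

lemma has_vector_derivative_quotientI: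
  fixes f :: "real \<Rightarrow> complex"
  assumes "((\<lambda>h. complex_of_real (1 / h) * (f (x + h) - f x)) \<longlongrightarrow> D) (at 0)"
  shows "(f has_vector_derivative D) (at x)"
  unfolding has_vector_derivative_def has_derivative_at
proof
  have "((\<lambda>h. norm (complex_of_real (1 / h) * (f (x + h) - f x) - D)) \<longlongrightarrow> 0) (at 0)"
    using assms LIM_zero tendsto_norm_zero by blast
  moreover have "\<forall>\<^sub>F h in at 0. norm (complex_of_real (1 / h) * (f (x + h) - f x) - D)
      = norm (f (x + h) - f x - h *\<^sub>R D) / norm h"
    unfolding eventually_at_filter
  proof (intro always_eventually allI impI)
    fix h :: real assume h: "h \<noteq> 0"
    have "f (x + h) - f x - h *\<^sub>R D = complex_of_real h * (complex_of_real (1 / h) * (f (x + h) - f x) - D)"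
      using h by (simp add: scaleR_conv_of_real field_simps)
    then have "norm (f (x + h) - f x - h *\<^sub>R D) = \<bar>h\<bar> * norm (complex_of_real (1 / h) * (f (x + h) - f x) - D)"
      by (simp only: norm_mult norm_of_real)
    then show "norm (complex_of_real (1 / h) * (f (x + h) - f x) - D) = norm (f (x + h) - f x - h *\<^sub>R D) / norm h"
      using h by simp
  qed
  ultimately show "((\<lambda>h. norm (f (x + h) - f x - h *\<^sub>R D) / norm h) \<longlongrightarrow> 0) (at 0)"
    by (rule Lim_transform_eventually)
qed (rule bounded_linear_scaleR_left)

context hilbert begin

lemma graph_closure_iff:
  assumes G: "G \<subseteq> car H \<times> car H"
  shows "(v, w) \<in> graph_closure H G \<longleftrightarrow> (\<exists>s t. (\<forall>n. (s n, t n) \<in> G) \<and> lim_to s v \<and> lim_to t w)"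
proof
  assume vw: "(v, w) \<in> graph_closure H G"
  then have c: "v \<in> car H" "w \<in> car H" by (auto simp: graph_closure_def)
  have "\<exists>p\<in>G. hnorm H (v - fst p) < inverse (Suc n) \<and> hnorm H (w - snd p) < inverse (Suc n)" for n
  proof -
    have "inverse (real (Suc n)) > 0" by simp
    then have "\<exists>(v', w')\<in>G. hnorm H (v - v') < inverse (Suc n) \<and> hnorm H (w - w') < inverse (Suc n)"
      using vw unfolding graph_closure_def by blast
    then obtain v' w' where "(v', w') \<in> G" "hnorm H (v - v') < inverse (Suc n)" "hnorm H (w - w') < inverse (Suc n)"
      by blast
    then show ?thesis by (intro bexI[of _ "(v', w')"]) simp_all
  qed
  then obtain p where p: "\<And>n. p n \<in> G" "\<And>n. hnorm H (v - fst (p n)) < inverse (Suc n)"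
    "\<And>n. hnorm H (w - snd (p n)) < inverse (Suc n)" by metis
  have pc: "fst (p n) \<in> car H" "snd (p n) \<in> car H" for n using p(1)[of n] G by auto
  have "lim_to (\<lambda>n. fst (p n)) v" "lim_to (\<lambda>n. snd (p n)) w"
    by (rule lim_to_bound[OF _ _ _ LIMSEQ_inverse_real_of_nat];
        use c pc p in \<open>simp add: hnorm_minus_commute less_imp_le\<close>)+
  then show "\<exists>s t. (\<forall>n. (s n, t n) \<in> G) \<and> lim_to s v \<and> lim_to t w"
    using p(1) by (metis prod.collapse)
next
  assume "\<exists>s t. (\<forall>n. (s n, t n) \<in> G) \<and> lim_to s v \<and> lim_to t w"
  then obtain s t where st: "\<And>n. (s n, t n) \<in> G" "lim_to s v" "lim_to t w" by auto
  have c: "v \<in> car H" "w \<in> car H" "\<And>n. s n \<in> car H" "\<And>n. t n \<in> car H" using st by (auto simp: lim_to_def)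
  have "\<exists>(v', w')\<in>G. hnorm H (v - v') < e \<and> hnorm H (w - w') < e" if e: "e > 0" for e
  proof -
    have "\<forall>\<^sub>F n in sequentially. hnorm H (s n - v) < e \<and> hnorm H (t n - w) < e"
      using st(2,3) e by (intro eventually_conj order_tendstoD(2)[of _ 0]) (auto simp: lim_to_def)
    then obtain n where "hnorm H (s n - v) < e" "hnorm H (t n - w) < e" by (auto simp: eventually_sequentially)
    then show ?thesis using st(1)[of n] c hnorm_minus_commute by (intro bexI[of _ "(s n, t n)"]) auto
  qed
  then show "(v, w) \<in> graph_closure H G" using c by (auto simp: graph_closure_def)
qed

lemma graph_closure_superset: "G \<subseteq> car H \<times> car H \<Longrightarrow> G \<subseteq> graph_closure H G"
  by (auto simp: graph_closure_def subset_iff intro!: bexI[rotated])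

lemma graph_closure_mono: "G \<subseteq> G' \<Longrightarrow> graph_closure H G \<subseteq> graph_closure H G'"
proof clarify
  fix a b assume "G \<subseteq> G'" "(a, b) \<in> graph_closure H G"
  then show "(a, b) \<in> graph_closure H G'" by (simp add: graph_closure_def) blast
qed

text \<open>
  Linearity of an unbounded operator given by its graph, without single-valuedness: that is a
  consequence of uniqueness of derivatives for generators, and of isometry in
  \<open>isometry_extension\<close>.
\<close>

definition linear_graph :: "('a \<times> 'a) set \<Rightarrow> bool" where
  "linear_graph G \<longleftrightarrow> (0, 0) \<in> G \<and> (\<forall>a b c d. (a, b) \<in> G \<longrightarrow> (c, d) \<in> G \<longrightarrow> (a + c, b + d) \<in> G) \<and>
     (\<forall>z a b. (a, b) \<in> G \<longrightarrow> (smul H z a, smul H z b) \<in> G)"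

lemma linear_graph_closure:
  assumes "linear_graph G" "G \<subseteq> car H \<times> car H" shows "linear_graph (graph_closure H G)"
  unfolding linear_graph_def
proof (intro conjI allI impI)
  show "(0, 0) \<in> graph_closure H G"
    using assms graph_closure_superset by (auto simp: linear_graph_def)
next
  fix a b c d assume "(a, b) \<in> graph_closure H G" "(c, d) \<in> graph_closure H G"
  then obtain s t s' t' where "\<forall>n. (s n, t n) \<in> G" "lim_to s a" "lim_to t b"
    "\<forall>n. (s' n, t' n) \<in> G" "lim_to s' c" "lim_to t' d"
    unfolding graph_closure_iff[OF assms(2)] by blast
  then show "(a + c, b + d) \<in> graph_closure H G"
    using assms(1) lim_to_add unfolding graph_closure_iff[OF assms(2)] linear_graph_def
    by (intro exI[of _ "\<lambda>n. s n + s' n"] exI[of _ "\<lambda>n. t n + t' n"]) auto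
next
  fix z a b assume "(a, b) \<in> graph_closure H G"
  then obtain s t where "\<forall>n. (s n, t n) \<in> G" "lim_to s a" "lim_to t b"
    unfolding graph_closure_iff[OF assms(2)] by blast
  then show "(smul H z a, smul H z b) \<in> graph_closure H G"
    using assms(1) lim_to_scale unfolding graph_closure_iff[OF assms(2)] linear_graph_def
    by (intro exI[of _ "\<lambda>n. smul H z (s n)"] exI[of _ "\<lambda>n. smul H z (t n)"]) auto
qed

end

locale unitary_flow = hilbert +
  fixes U assumes unitary_group: "unitary_group H U"
begin

lemma U_bop: "U t \<in> bop H"
  and U_ip: "v \<in> car H \<Longrightarrow> w \<in> car H \<Longrightarrow> ip H (U t v) (U t w) = ip H v w"
  and U_zero: "U 0 = hid H"
  and U_comp: "U (s + t) = U s \<circ> U t"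
  and U_cont: "v \<in> car H \<Longrightarrow> ((\<lambda>t. hnorm H (U t v - v)) \<longlongrightarrow> 0) (at 0)"
  using unitary_group by (auto simp: unitary_group_def unitary_op_def)

lemma U_car [simp, intro]: "U t v \<in> car H"
  using U_bop bop_car' by blast
lemma U_plus: "U s (U t v) = U (s + t) v"
  by (simp add: U_comp)
lemma U_norm: "v \<in> car H \<Longrightarrow> hnorm H (U t v) = hnorm H v"
  by (simp add: hnorm_def U_ip)
lemma U_ip_shift: "v \<in> car H \<Longrightarrow> w \<in> car H \<Longrightarrow> ip H (U t v) w = ip H v (U (- t) w)"
  using U_ip[of v "U (-t) w" t] by (simp add: U_plus U_zero)
lemma U_diff: "v \<in> car H \<Longrightarrow> w \<in> car H \<Longrightarrow> U t (v - w) = U t v - U t w"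
  using bop_diff U_bop by blast

lemma generator_car: "(a, b) \<in> generator H U \<Longrightarrow> a \<in> car H \<and> b \<in> car H"
  by (auto simp: generator_def)
lemma generator_lim: "(a, b) \<in> generator H U \<Longrightarrow>
    ((\<lambda>t. hnorm H (smul H (complex_of_real (1 / t)) (U t a - a) - b)) \<longlongrightarrow> 0) (at 0)"
  by (auto simp: generator_def)

lemma generator_invariant:
  assumes "(a, b) \<in> generator H U" shows "(U s a, U s b) \<in> generator H U"
proof -
  note c = generator_car[OF assms]
  have "smul H (complex_of_real (1 / t)) (U t (U s a) - U s a) - U s b
      = U s (smul H (complex_of_real (1 / t)) (U t a - a) - b)" for t
    using c by (simp add: U_plus U_diff bop_scale[OF U_bop] add.commute)
  then show ?thesis using assms c by (simp add: generator_def U_norm)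
qed

lemma generator_weak_derivative:
  assumes ab: "(a, b) \<in> generator H U" and x: "x \<in> car H"
  shows "((\<lambda>t. ip H x (U t a)) has_vector_derivative ip H x (U t b)) (at t)"
proof (rule has_vector_derivative_quotientI)
  note c = generator_car[OF ab]
  have "((\<lambda>h. ip H x (smul H (complex_of_real (1 / h)) (U h (U t a) - U t a))) \<longlongrightarrow> ip H x (U t b)) (at 0)"
    using generator_lim[OF generator_invariant[OF ab]] x by (intro tendsto_ip) auto
  then show "((\<lambda>h. complex_of_real (1 / h) * (ip H x (U (t + h) a) - ip H x (U t a))) \<longlongrightarrow> ip H x (U t b)) (at 0)"
    using x by (simp add: U_plus ip_scale ip_diff add.commute)
qed

text \<open>
  It is enough to have the derivative of \<open>t \<mapsto> U(t) a\<close> weakly, against a total set of vectors: the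
  mean value inequality applies to the scalar functions \<open>t \<mapsto> \<langle>x, U(t) a\<rangle>\<close>, and its bound is
  uniform in \<open>x\<close>, hence a bound in norm.
\<close>

lemma linearization_bound:
  assumes X: "X \<subseteq> car H" "hclosure H (vs.span X) = car H" and a: "a \<in> car H" and b: "b \<in> car H"
    and der: "\<And>x t. x \<in> X \<Longrightarrow> ((\<lambda>t. ip H x (U t a)) has_vector_derivative ip H x (U t b)) (at t)"
    and M: "\<And>s. \<bar>s\<bar> \<le> \<bar>t\<bar> \<Longrightarrow> hnorm H (U s b - b) \<le> M"
  shows "hnorm H (U t a - a - smul H (complex_of_real t) b) \<le> \<bar>t\<bar> * M"
proof -
  have der': "x \<in> car H \<and> (\<forall>t. ((\<lambda>t. ip H x (U t a)) has_vector_derivative ip H x (U t b)) (at t))"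
    if "x \<in> vs.span X" for x
    using that
  proof (induction rule: vs.span_induct_alt)
    case base then show ?case by (simp add: a b)
  next
    case (step c x y)
    then have "x \<in> car H" using X by auto
    then show ?case using step der[of x]
      by (auto simp: ip_add_left ip_scale_left intro!: has_vector_derivative_add has_vector_derivative_mult_right)
  qed
  define y where "y = U t a - a - smul H (complex_of_real t) b"
  have y: "y \<in> car H" using a b by (auto simp: y_def)
  have M0: "M \<ge> 0" using M[of 0] b by (simp add: U_zero)
  have le: "cmod (ip H x y) \<le> \<bar>t\<bar> * M * hnorm H x" if "x \<in> vs.span X" for x
  proof -
    have x: "x \<in> car H" and d: "\<And>t. ((\<lambda>t. ip H x (U t a)) has_vector_derivative ip H x (U t b)) (at t)"
      using der'[OF that] by auto
    have "norm (ip H x (U t a) - ip H x (U 0 a) - (t - 0) *\<^sub>R ip H x (U 0 b)) \<le> norm (t - 0) * (hnorm H x * M)"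
    proof (rule vector_differentiable_bound_linearization[where S = "closed_segment 0 t"])
      fix s assume s: "s \<in> closed_segment 0 t"
      show "((\<lambda>t. ip H x (U t a)) has_vector_derivative ip H x (U s b)) (at s within closed_segment 0 t)"
        using d has_vector_derivative_at_within by blast
      have "\<bar>s\<bar> \<le> \<bar>t\<bar>" using s by (auto simp: closed_segment_eq_real_ivl split: if_splits)
      then have "hnorm H x * hnorm H (U s b - b) \<le> hnorm H x * M"
        using M x by (intro mult_left_mono) auto
      then show "norm (ip H x (U s b) - ip H x (U 0 b)) \<le> hnorm H x * M"
        using cauchy_schwarz[of x "U s b - b"] x b by (simp add: ip_diff U_zero)
    qed auto
    then show ?thesis
      using x a b by (simp add: y_def ip_diff ip_scale U_zero scaleR_conv_of_real mult_ac)
  qed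
  obtain s where s: "\<And>n. s n \<in> vs.span X" "lim_to s y"
    using hclosureE[OF span_car[OF X(1)]] y X(2) by metis
  have "(\<lambda>n. cmod (ip H (s n) y)) \<longlonglongrightarrow> cmod (ip H y y)"
    by (intro tendsto_norm lim_to_ip s lim_to_const y)
  moreover have "(\<lambda>n. \<bar>t\<bar> * M * hnorm H (s n)) \<longlonglongrightarrow> \<bar>t\<bar> * M * hnorm H y"
    by (intro tendsto_mult tendsto_const lim_to_norm s)
  ultimately have "cmod (ip H y y) \<le> \<bar>t\<bar> * M * hnorm H y"
    by (rule LIMSEQ_le) (use le s in auto)
  then have "(hnorm H y)\<^sup>2 \<le> \<bar>t\<bar> * M * hnorm H y" using y by (simp add: ip_self norm_power)
  then have "hnorm H y \<le> \<bar>t\<bar> * M"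
    using y M0 hnorm_nonneg[OF y] by (cases "hnorm H y = 0") (auto simp: power2_eq_square)
  then show ?thesis by (simp add: y_def)
qed

lemma generatorI_bound:
  assumes a: "a \<in> car H" and b: "b \<in> car H"
    and bd: "\<And>t M. (\<And>s. \<bar>s\<bar> \<le> \<bar>t\<bar> \<Longrightarrow> hnorm H (U s b - b) \<le> M) \<Longrightarrow>
      hnorm H (U t a - a - smul H (complex_of_real t) b) \<le> \<bar>t\<bar> * M"
  shows "(a, b) \<in> generator H U"
proof -
  have "((\<lambda>t. hnorm H (smul H (complex_of_real (1 / t)) (U t a - a) - b)) \<longlongrightarrow> 0) (at 0)"
  proof (rule tendstoI)
    fix e :: real assume e: "e > 0"
    have "\<forall>\<^sub>F t in at 0. hnorm H (U t b - b) < e / 2"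
      using U_cont[OF b] e by (intro order_tendstoD) auto
    then obtain d where d: "d > 0" "\<And>t. t \<noteq> 0 \<Longrightarrow> \<bar>t\<bar> < d \<Longrightarrow> hnorm H (U t b - b) < e / 2"
      unfolding eventually_at by (auto simp: dist_real_def)
    have "hnorm H (smul H (complex_of_real (1 / t)) (U t a - a) - b) < e" if t: "t \<noteq> 0" "\<bar>t\<bar> < d" for t
    proof -
      have "hnorm H (U s b - b) \<le> e / 2" if "\<bar>s\<bar> \<le> \<bar>t\<bar>" for s
        using d(2)[of s] that t e b by (cases "s = 0") (auto simp: U_zero)
      then have "hnorm H (U t a - a - smul H (complex_of_real t) b) \<le> \<bar>t\<bar> * (e / 2)" by (rule bd)
      then have "1 / \<bar>t\<bar> * hnorm H (U t a - a - smul H (complex_of_real t) b) \<le> 1 / \<bar>t\<bar> * (\<bar>t\<bar> * (e / 2))"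
        by (rule mult_left_mono) simp
      moreover have "smul H (complex_of_real (1 / t)) (U t a - a) - b
          = smul H (complex_of_real (1 / t)) (U t a - a - smul H (complex_of_real t) b)"
        using t by (simp add: vs.scale_right_diff_distrib)
      moreover have "hnorm H (smul H (complex_of_real (1 / t)) (U t a - a - smul H (complex_of_real t) b))
          = 1 / \<bar>t\<bar> * hnorm H (U t a - a - smul H (complex_of_real t) b)"
        using a b by (subst hnorm_scale) (auto simp: norm_divide)
      moreover have "1 / \<bar>t\<bar> * (\<bar>t\<bar> * (e / 2)) = e / 2" using t by simp
      ultimately have "hnorm H (smul H (complex_of_real (1 / t)) (U t a - a) - b) \<le> e / 2" by metis
      then show ?thesis using e by simp
    qed
    then show "\<forall>\<^sub>F t in at 0. dist (hnorm H (smul H (complex_of_real (1 / t)) (U t a - a) - b)) 0 < e"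
      unfolding eventually_at using d(1) a b by (intro exI[of _ d]) (auto simp: dist_real_def)
  qed
  then show ?thesis using a b by (simp add: generator_def)
qed

text \<open>
  The strong continuity of \<open>U\<close> makes the error in \<open>linearization_bound\<close> small, so that a weak
  derivative is a strong one. This is how the generators of Weyl operators are computed.
\<close>

lemma generatorI_weak:
  assumes "X \<subseteq> car H" "hclosure H (vs.span X) = car H" "a \<in> car H" "b \<in> car H"
    and "\<And>x t. x \<in> X \<Longrightarrow> ((\<lambda>t. ip H x (U t a)) has_vector_derivative ip H x (U t b)) (at t)"
  shows "(a, b) \<in> generator H U"
proof (rule generatorI_bound[OF assms(3,4)])
  fix t M assume M: "\<And>s. \<bar>s\<bar> \<le> \<bar>t\<bar> \<Longrightarrow> hnorm H (U s b - b) \<le> M"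
  show "hnorm H (U t a - a - smul H (complex_of_real t) b) \<le> \<bar>t\<bar> * M"
    by (rule linearization_bound[OF assms M])
qed

lemma hclosure_span_car: "hclosure H (vs.span (car H)) = car H"
  by (metis hclosure_car hclosure_superset order_refl span_car subset_antisym vs.span_superset)

text \<open>
  The linearization bound contains no derivative of \<open>U(t) a\<close>, so it survives limits of graph
  points.
\<close>

lemma generator_closed: "graph_closure H (generator H U) \<subseteq> generator H U"
proof clarify
  fix a b assume ab: "(a, b) \<in> graph_closure H (generator H U)"
  have sub: "generator H U \<subseteq> car H \<times> car H" using generator_car by auto
  obtain s r where st: "\<And>n. (s n, r n) \<in> generator H U" "lim_to s a" "lim_to r b"
    using ab unfolding graph_closure_iff[OF sub] by blast
  have c: "a \<in> car H" "b \<in> car H" "\<And>n. s n \<in> car H" "\<And>n. r n \<in> car H"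
    using st(2,3) by (auto simp: lim_to_def)
  show "(a, b) \<in> generator H U"
  proof (rule generatorI_bound[OF c(1,2)])
    fix t M assume M: "\<And>s. \<bar>s\<bar> \<le> \<bar>t\<bar> \<Longrightarrow> hnorm H (U s b - b) \<le> M"
    have le: "hnorm H (U t (s n) - s n - smul H (complex_of_real t) (r n)) \<le> \<bar>t\<bar> * (M + 2 * hnorm H (r n - b))" for n
    proof (rule linearization_bound[OF order_refl hclosure_span_car c(3) c(4)])
      fix q assume q: "\<bar>q\<bar> \<le> \<bar>t\<bar>"
      have "U q (r n) - r n = U q (r n - b) + (U q b - b) + (b - r n)" using c by (simp add: U_diff)
      also have "hnorm H \<dots> \<le> hnorm H (U q (r n - b)) + hnorm H (U q b - b) + hnorm H (b - r n)"
        using c by (intro order_trans[OF hnorm_triangle] add_right_mono hnorm_triangle) auto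
      finally show "hnorm H (U q (r n) - r n) \<le> M + 2 * hnorm H (r n - b)"
        using M[OF q] c by (simp add: U_norm hnorm_minus_commute[of b])
    qed (use generator_weak_derivative[OF st(1)] in auto)
    have "(\<lambda>n. hnorm H (U t (s n) - s n - smul H (complex_of_real t) (r n)))
        \<longlonglongrightarrow> hnorm H (U t a - a - smul H (complex_of_real t) b)"
      by (rule lim_to_norm[OF lim_to_diff[OF lim_to_diff[OF lim_to_bop[OF U_bop st(2)] st(2)] lim_to_scale[OF st(3)]]])
    moreover have "(\<lambda>n. \<bar>t\<bar> * (M + 2 * hnorm H (r n - b))) \<longlonglongrightarrow> \<bar>t\<bar> * (M + 2 * 0)"
      using st(3) by (intro tendsto_mult tendsto_add tendsto_const) (auto simp: lim_to_def)
    ultimately show "hnorm H (U t a - a - smul H (complex_of_real t) b) \<le> \<bar>t\<bar> * M"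
      using LIMSEQ_le[OF _ _ exI[of _ 0]] le by fastforce
  qed
qed

lemma generator_closedI: "G \<subseteq> generator H U \<Longrightarrow> graph_closure H G \<subseteq> generator H U"
  using generator_closed graph_closure_mono by blast

lemma generator_unique: assumes "(a, b) \<in> generator H U" "(a, c) \<in> generator H U" shows "b = c"
proof -
  have car: "a \<in> car H" "b \<in> car H" "c \<in> car H" using assms generator_car by auto
  have "ip H x (U 0 b) = ip H x (U 0 c)" if "x \<in> car H" for x
    using generator_weak_derivative[OF assms(1) that] generator_weak_derivative[OF assms(2) that]
      vector_derivative_unique_at by blast
  then have "ip H (b - c) (b - c) = 0" using car by (simp add: U_zero ip_diff)
  then show ?thesis using ip_pos[of "b - c"] car by (metis diff_car eq_iff_diff_eq_0 order_less_irrefl zero_complex.simps(1))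
qed

lemma generator_skew:
  assumes "(a, b) \<in> generator H U" "(c, d) \<in> generator H U" shows "ip H b c + ip H a d = 0"
proof -
  have car: "a \<in> car H" "b \<in> car H" "c \<in> car H" "d \<in> car H" using assms generator_car by auto
  let ?q = "\<lambda>t a. smul H (complex_of_real (1 / t)) (U t a - a)"
  have "((\<lambda>t. ip H (?q t a) (U t c) + ip H a (?q t c)) \<longlongrightarrow> ip H b c + ip H a d) (at 0)"
    using generator_lim[OF assms(1)] generator_lim[OF assms(2)] U_cont[of c] car
    by (intro tendsto_add tendsto_ip) auto
  moreover have "(\<lambda>t. ip H (?q t a) (U t c) + ip H a (?q t c)) = (\<lambda>t. 0)"
  proof
    fix t
    have "ip H (?q t a) (U t c) + ip H a (?q t c)
        = complex_of_real (1 / t) * (ip H (U t a) (U t c) - ip H a c)"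
      using car by (simp add: ip_simps algebra_simps)
    then show "ip H (?q t a) (U t c) + ip H a (?q t c) = 0" using car by (simp add: U_ip)
  qed
  ultimately show ?thesis by (simp add: tendsto_const_iff)
qed

lemma linear_graph_generator: "linear_graph (generator H U)"
  unfolding linear_graph_def
proof (intro conjI allI impI)
  show "(0, 0) \<in> generator H U" by (simp add: generator_def bop_zero[OF U_bop])
next
  fix a b c d assume ab: "(a, b) \<in> generator H U" "(c, d) \<in> generator H U"
  then have car: "a \<in> car H" "b \<in> car H" "c \<in> car H" "d \<in> car H" using generator_car by auto
  show "(a + c, b + d) \<in> generator H U"
    by (rule generatorI_weak[OF order_refl hclosure_span_car])
      (use car generator_weak_derivative[OF ab(1)] generator_weak_derivative[OF ab(2)] in
        \<open>auto simp: bop_add[OF U_bop] ip_add intro: has_vector_derivative_add\<close>)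
next
  fix z a b assume ab: "(a, b) \<in> generator H U"
  then have car: "a \<in> car H" "b \<in> car H" using generator_car by auto
  show "(smul H z a, smul H z b) \<in> generator H U"
    by (rule generatorI_weak[OF order_refl hclosure_span_car])
      (use car generator_weak_derivative[OF ab] in
        \<open>auto simp: bop_scale[OF U_bop] ip_scale intro: has_vector_derivative_mult_right\<close>)
qed

text \<open>
  A core criterion: a restriction of the generator is essentially skew-adjoint if the domain of
  its closure contains a total set which the group preserves up to scalars. For the closure \<open>G\<close>
  one shows that \<open>b - a\<close>, \<open>(a, b) \<in> G\<close>, exhausts the space; as \<open>b - a\<close> determines the point
  \<open>(a, b)\<close> of the generator, \<open>G\<close> then is the whole generator. The range is closed because
  \<open>\<parallel>b - a\<parallel>\<^sup>2 = \<parallel>a\<parallel>\<^sup>2 + \<parallel>b\<parallel>\<^sup>2\<close>. A vector \<open>v\<close> orthogonal to it satisfies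
  \<open>d/dt \<langle>v, U(t) e\<rangle> = \<langle>v, U(t) e\<rangle>\<close> for \<open>e\<close> in the total set, and as a solution of this equation is
  bounded only if it is 0, \<open>v\<close> is orthogonal to the total set.
\<close>

theorem graph_closure_eq_generator:
  assumes G0: "linear_graph G0" "G0 \<subseteq> generator H U"
    and E: "E \<subseteq> car H" "hclosure H (vs.span E) = car H"
    and inv: "\<And>e t. e \<in> E \<Longrightarrow> \<exists>c. \<exists>e'\<in>E. U t e = smul H c e'"
    and dom: "\<And>e. e \<in> E \<Longrightarrow> \<exists>b. (e, b) \<in> graph_closure H G0"
  shows "graph_closure H G0 = generator H U"
proof
  define G where "G = graph_closure H G0"
  have sub: "G0 \<subseteq> car H \<times> car H" using G0(2) generator_car by auto
  have Ggen: "G \<subseteq> generator H U" unfolding G_def by (rule generator_closedI[OF G0(2)])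
  then show "graph_closure H G0 \<subseteq> generator H U" by (simp add: G_def)
  have Glin: "linear_graph G" unfolding G_def by (rule linear_graph_closure[OF G0(1) sub])
  have subG: "G \<subseteq> car H \<times> car H" using Ggen generator_car by auto
  have skew: "(hnorm H (b - a))\<^sup>2 = (hnorm H a)\<^sup>2 + (hnorm H b)\<^sup>2" if "(a, b) \<in> generator H U" for a b
  proof -
    have c: "a \<in> car H" "b \<in> car H" using that generator_car by auto
    have "ip H b a + ip H a b = 0" using generator_skew[OF that that] .
    then have "Re (ip H b a) = 0" using ip_cnj[OF c] by (simp add: complex_eq_iff)
    then show ?thesis using c by (simp add: hnorm_sq_diff)
  qed
  define R where "R = (\<lambda>(a, b). b - a) ` G"
  have Rsub: "R \<subseteq> car H" using subG by (auto simp: R_def)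
  have Rlin: "vs.subspace R"
  proof (rule vs.subspaceI)
    show "0 \<in> R" unfolding R_def using Glin by (force simp: linear_graph_def)
  next
    fix x y assume "x \<in> R" "y \<in> R"
    then obtain a b c d where "(a, b) \<in> G" "(c, d) \<in> G" "x = b - a" "y = d - c" by (auto simp: R_def)
    then have "(a + c, b + d) \<in> G" "x + y = (b + d) - (a + c)" using Glin by (auto simp: linear_graph_def)
    then show "x + y \<in> R" unfolding R_def by force
  next
    fix z x assume "x \<in> R"
    then obtain a b where "(a, b) \<in> G" "x = b - a" by (auto simp: R_def)
    then have "(smul H z a, smul H z b) \<in> G" "smul H z x = smul H z b - smul H z a"
      using Glin by (auto simp: linear_graph_def vs.scale_right_diff_distrib)
    then show "smul H z x \<in> R" unfolding R_def by force
  qed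
  have "closed_sub R"
    unfolding closed_sub_def
  proof (intro conjI subsetI Rlin)
    fix y assume "y \<in> hclosure H R"
    then obtain r where r: "\<And>n. r n \<in> R" "lim_to r y" using hclosureE[OF Rsub] by metis
    have "\<forall>n. \<exists>p\<in>G. r n = snd p - fst p" using r(1) by (force simp: R_def)
    then obtain p where p: "\<And>n. p n \<in> G" "\<And>n. r n = snd (p n) - fst (p n)" by metis
    have pc: "fst (p n) \<in> car H" "snd (p n) \<in> car H" for n using p(1)[of n] subG by auto
    have dist: "(hnorm H (fst (p m) - fst (p n)))\<^sup>2 + (hnorm H (snd (p m) - snd (p n)))\<^sup>2 = (hnorm H (r m - r n))\<^sup>2" for m n
    proof -
      have "(fst (p m), snd (p m)) \<in> G" "(fst (p n), snd (p n)) \<in> G" using p by auto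
      then have "(fst (p m) + smul H (-1) (fst (p n)), snd (p m) + smul H (-1) (snd (p n))) \<in> G"
        using Glin unfolding linear_graph_def by blast
      then have g: "(fst (p m) - fst (p n), snd (p m) - snd (p n)) \<in> generator H U" using Ggen by auto
      have "r m - r n = (snd (p m) - snd (p n)) - (fst (p m) - fst (p n))" by (simp add: p(2))
      then show ?thesis using skew[OF g] by simp
    qed
    have bd: "hnorm H (fst (p m) - fst (p n)) \<le> hnorm H (r m - y) + hnorm H (r n - y)"
      "hnorm H (snd (p m) - snd (p n)) \<le> hnorm H (r m - y) + hnorm H (r n - y)" for m n
    proof -
      have rc: "r m \<in> car H" "r n \<in> car H" "y \<in> car H" using r by (auto simp: lim_to_def)
      have t: "hnorm H (r m - r n) \<le> hnorm H (r m - y) + hnorm H (r n - y)"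
        using hnorm_triangle_diff[of "r m" y "r n"] rc by (simp add: hnorm_minus_commute[of y])
      have "(hnorm H (fst (p m) - fst (p n)))\<^sup>2 \<le> (hnorm H (r m - r n))\<^sup>2"
        "(hnorm H (snd (p m) - snd (p n)))\<^sup>2 \<le> (hnorm H (r m - r n))\<^sup>2"
        using dist[of m n] zero_le_power2[of "hnorm H (fst (p m) - fst (p n))"]
          zero_le_power2[of "hnorm H (snd (p m) - snd (p n))"] by linarith+
      then have "hnorm H (fst (p m) - fst (p n)) \<le> hnorm H (r m - r n)"
        "hnorm H (snd (p m) - snd (p n)) \<le> hnorm H (r m - r n)"
        using rc by (auto intro: power2_le_imp_le)
      with t show "hnorm H (fst (p m) - fst (p n)) \<le> hnorm H (r m - y) + hnorm H (r n - y)"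
        "hnorm H (snd (p m) - snd (p n)) \<le> hnorm H (r m - y) + hnorm H (r n - y)" by linarith+
    qed
    have cau: "\<exists>N. \<forall>m\<ge>N. \<forall>n\<ge>N. hnorm H (r m - y) + hnorm H (r n - y) < e" if e: "e > 0" for e
    proof -
      have "\<forall>\<^sub>F n in sequentially. hnorm H (r n - y) < e / 2"
        using r(2) e by (intro order_tendstoD(2)[of _ 0]) (auto simp: lim_to_def)
      then obtain N where N: "\<And>n. n \<ge> N \<Longrightarrow> hnorm H (r n - y) < e / 2" by (auto simp: eventually_sequentially)
      show ?thesis using N by (intro exI[of _ N]) (metis add_strict_mono field_sum_of_halves)
    qed
    have "\<exists>l. lim_to (\<lambda>n. fst (p n)) l"
      by (rule Cauchy_lim_to[OF pc(1)]) (use cau bd(1) in \<open>meson le_less_trans\<close>)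
    moreover have "\<exists>l. lim_to (\<lambda>n. snd (p n)) l"
      by (rule Cauchy_lim_to[OF pc(2)]) (use cau bd(2) in \<open>meson le_less_trans\<close>)
    ultimately obtain a b where ab: "lim_to (\<lambda>n. fst (p n)) a" "lim_to (\<lambda>n. snd (p n)) b" by auto
    then have "(a, b) \<in> graph_closure H G"
      unfolding graph_closure_iff[OF subG] using p(1)
      by (intro exI[of _ "\<lambda>n. fst (p n)"] exI[of _ "\<lambda>n. snd (p n)"]) auto
    moreover have "graph_closure H G \<subseteq> G"
    proof clarify
      fix a b assume ab: "(a, b) \<in> graph_closure H G"
      then have c: "a \<in> car H" "b \<in> car H" by (auto simp: graph_closure_def)
      have "\<exists>(v', w')\<in>G0. hnorm H (a - v') < e \<and> hnorm H (b - w') < e" if e: "e > 0" for e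
      proof -
        obtain a' b' where 1: "(a', b') \<in> G" "hnorm H (a - a') < e / 2" "hnorm H (b - b') < e / 2"
          using ab e unfolding graph_closure_def by (auto dest!: spec[of _ "e / 2"])
        then obtain a'' b'' where 2: "(a'', b'') \<in> G0" "hnorm H (a' - a'') < e / 2" "hnorm H (b' - b'') < e / 2"
          using e unfolding G_def graph_closure_def by (auto dest!: spec[of _ "e / 2"])
        have cc: "a' \<in> car H" "b' \<in> car H" "a'' \<in> car H" "b'' \<in> car H" using 1 2 subG sub by auto
        have "hnorm H (a - a'') < e" "hnorm H (b - b'') < e"
          using hnorm_triangle_diff[of a a' a''] hnorm_triangle_diff[of b b' b''] c cc 1 2 by simp_all
        then show ?thesis using 2 by auto
      qed
      then show "(a, b) \<in> G" using c unfolding G_def graph_closure_def by auto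
    qed
    ultimately have "(a, b) \<in> G" by auto
    moreover have "y = b - a"
    proof (rule lim_to_unique[OF r(2)])
      have "r = (\<lambda>n. snd (p n) - fst (p n))" using p by auto
      then show "lim_to r (b - a)" using lim_to_diff[OF ab(2,1)] by simp
    qed
    ultimately show "y \<in> R" unfolding R_def by force
  qed (use Rsub in auto)
  moreover have "v = 0" if v: "v \<in> car H" "\<And>u. u \<in> R \<Longrightarrow> ip H u v = 0" for v
  proof (rule total_orth[OF E v(1)])
    fix e assume e: "e \<in> E"
    have ec: "e \<in> car H" using e E by auto
    obtain b where b: "(e, b) \<in> G" using dom[OF e] by (auto simp: G_def)
    \<comment> \<open>The invariance of \<open>E\<close> puts the point \<open>(U t e, U t b)\<close> of the generator into \<open>G\<close>.\<close>
    have d: "ip H v (U t b) = ip H v (U t e)" for t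
    proof -
      obtain c e' where ce: "e' \<in> E" "U t e = smul H c e'" using inv[OF e] by blast
      obtain b' where "(e', b') \<in> G" using dom[OF ce(1)] by (auto simp: G_def)
      then have g: "(smul H c e', smul H c b') \<in> G" using Glin by (auto simp: linear_graph_def)
      have "(U t e, U t b) \<in> generator H U" using generator_invariant b Ggen by blast
      then have "U t b = smul H c b'" using g Ggen ce generator_unique by auto
      then have "U t b - U t e \<in> R" using g ce(2) unfolding R_def by force
      then have "ip H (U t b - U t e) v = 0" using v by auto
      then have "ip H v (U t b - U t e) = 0" using v by (subst ip_cnj) auto
      then show ?thesis using v by (simp add: ip_diff)
    qed
    have "ip H v (U t e) = complex_of_real (exp t) * ip H v e" for t
    proof -
      have "((\<lambda>t. complex_of_real (exp (- t)) * ip H v (U t e)) has_vector_derivative 0) (at t)" for t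
      proof -
        have 1: "((\<lambda>t. ip H v (U t e)) has_vector_derivative ip H v (U t e)) (at t)"
          using generator_weak_derivative[of e b v t] b Ggen v d by auto
        have "((\<lambda>t. complex_of_real (exp (- t))) has_vector_derivative complex_of_real (- exp (- t))) (at t)"
          by (rule has_vector_derivative_of_real) (auto intro!: derivative_eq_intros)
        from has_vector_derivative_mult[OF this 1] show ?thesis by simp
      qed
      then have "complex_of_real (exp (- t)) * ip H v (U t e) = complex_of_real (exp (- 0)) * ip H v (U 0 e)"
        using has_derivative_zero_unique[of UNIV "\<lambda>t. complex_of_real (exp (- t)) * ip H v (U t e)" t 0]
        by (simp add: has_vector_derivative_def)
      then show ?thesis using ec by (simp add: U_zero exp_minus field_simps)
    qed
    then have bd: "exp t * cmod (ip H v e) \<le> hnorm H v * hnorm H e" for t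
      using cauchy_schwarz[of v "U t e"] v ec by (simp add: U_norm norm_mult)
    have "cmod (ip H v e) = 0"
    proof (rule ccontr)
      assume "cmod (ip H v e) \<noteq> 0"
      then have p: "cmod (ip H v e) > 0" by simp
      define K where "K = hnorm H v * hnorm H e / cmod (ip H v e)"
      \<comment> \<open>Exponential growth contradicts the bound at this time.\<close>
      have "exp (K + 1) \<le> K" using bd[of "K + 1"] p by (simp add: K_def field_simps)
      then show False using exp_ge_add_one_self[of "K + 1"] by linarith
    qed
    then show "ip H e v = 0" using ip_cnj[OF v(1) ec] by simp
  qed
  ultimately have R: "R = car H" by (rule closed_sub_eq_car)
  show "generator H U \<subseteq> graph_closure H G0"
  proof clarify
    fix x y assume xy: "(x, y) \<in> generator H U"
    then have "y - x \<in> R" using R generator_car by auto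
    then obtain a b where ab: "(a, b) \<in> G" "y - x = b - a" by (auto simp: R_def)
    then have "(x + smul H (-1) a, y + smul H (-1) b) \<in> generator H U"
      using xy Ggen linear_graph_generator unfolding linear_graph_def by blast
    then have g: "(x - a, y - b) \<in> generator H U" by simp
    then have c: "x - a \<in> car H" "y - b \<in> car H" using generator_car by auto
    have "y - b - (x - a) = 0" using ab by (simp add: algebra_simps)
    then have "(hnorm H (x - a))\<^sup>2 + (hnorm H (y - b))\<^sup>2 = 0" using skew[OF g] by simp
    then have "x - a = 0" "y - b = 0" using hnorm_eq_zero[OF c(1)] hnorm_eq_zero[OF c(2)]
      by (auto simp: sum_power2_eq_zero_iff)
    then show "(x, y) \<in> graph_closure H G0" using ab by (simp add: G_def)
  qed
qed

end

context hilbert begin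

text \<open>
  \<open>\<langle>U(t) a, U'(t) c\<rangle>\<close> has derivative 0, by skewness of the common generator, so \<open>U(-t) U'(t)\<close> is
  the identity.
\<close>

theorem unitary_group_eqI:
  assumes U: "unitary_group H U" and U': "unitary_group H U'" and gen: "generator H U' = generator H U"
    and E: "E \<subseteq> car H" "hclosure H (vs.span E) = car H" "\<And>e. e \<in> E \<Longrightarrow> \<exists>b. (e, b) \<in> generator H U"
  shows "U' = U"
proof
  fix t
  interpret u: unitary_flow H U using U by unfold_locales
  interpret u': unitary_flow H U' using U' by unfold_locales
  have const: "ip H (U t a) (U' t c) = ip H a c" if ab: "(a, b) \<in> generator H U" and cd: "(c, d) \<in> generator H U" for a b c d t
  proof -
    have car: "a \<in> car H" "b \<in> car H" "c \<in> car H" "d \<in> car H" using ab cd u.generator_car by auto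
    have "((\<lambda>t. ip H (U t a) (U' t c)) has_vector_derivative 0) (at t)" for t
    proof (rule has_vector_derivative_quotientI)
      let ?q = "\<lambda>h a. smul H (complex_of_real (1 / h)) (U h a - a)" and ?q' = "\<lambda>h a. smul H (complex_of_real (1 / h)) (U' h a - a)"
      have g: "(U t a, U t b) \<in> generator H U" using u.generator_invariant ab .
      have g': "(U' t c, U' t d) \<in> generator H U'" using u'.generator_invariant cd gen by auto
      have "((\<lambda>h. ip H (?q h (U t a)) (U' h (U' t c)) + ip H (U t a) (?q' h (U' t c)))
          \<longlongrightarrow> ip H (U t b) (U' t c) + ip H (U t a) (U' t d)) (at 0)"
        using u.generator_lim[OF g] u'.generator_lim[OF g'] u'.U_cont[of "U' t c"] car
        by (intro tendsto_add tendsto_ip) auto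
      moreover have "ip H (U t b) (U' t c) + ip H (U t a) (U' t d) = 0"
        using u.generator_skew[OF g] g' gen by auto
      moreover have "ip H (?q h (U t a)) (U' h (U' t c)) + ip H (U t a) (?q' h (U' t c))
          = complex_of_real (1 / h) * (ip H (U (t + h) a) (U' (t + h) c) - ip H (U t a) (U' t c))" for h
        using car by (simp add: ip_simps algebra_simps u.U_plus u'.U_plus)
      ultimately show "((\<lambda>h. complex_of_real (1 / h) * (ip H (U (t + h) a) (U' (t + h) c) - ip H (U t a) (U' t c))) \<longlongrightarrow> 0) (at 0)"
        by simp
    qed
    then have "ip H (U t a) (U' t c) = ip H (U 0 a) (U' 0 c)"
      using has_derivative_zero_unique[of UNIV "\<lambda>t. ip H (U t a) (U' t c)" t 0]
      by (simp add: has_vector_derivative_def)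
    then show ?thesis using car by (simp add: u.U_zero u'.U_zero)
  qed
  show "U' t = U t"
  proof (rule bop_eqI[OF u'.U_bop u.U_bop E(1,2)])
    fix c assume c: "c \<in> E"
    then have cc: "c \<in> car H" using E by auto
    have "U (- t) (U' t c) - c = 0"
    proof (rule total_orth[OF E(1,2)])
      fix a assume a: "a \<in> E"
      then have ac: "a \<in> car H" using E by auto
      have "ip H (U t a) (U' t c) = ip H a c" using const E(3)[OF a] E(3)[OF c] by blast
      then show "ip H a (U (- t) (U' t c) - c) = 0"
        using u.U_ip_shift[of a "U' t c" t] ac cc by (simp add: ip_diff)
    qed (use cc in auto)
    then have "U t (U (- t) (U' t c)) = U t c" by simp
    then show "U' t c = U t c" by (simp add: u.U_plus u.U_zero)
  qed
qed

text \<open>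
  A group with generator \<open>G\<close> is unique as soon as the domain of \<open>G\<close> is total. Thus the definite
  description in the exponential denotes \<open>U 1\<close>.
\<close>

theorem exp_op_eqI:
  assumes U: "unitary_group H U" and gen: "generator H U = G"
    and E: "E \<subseteq> car H" "hclosure H (vs.span E) = car H" "\<And>e. e \<in> E \<Longrightarrow> \<exists>b. (e, b) \<in> G"
  shows "exp_op H G = U 1"
  unfolding exp_op_def
proof (rule the_equality)
  show "\<exists>U'. unitary_group H U' \<and> generator H U' = G \<and> U 1 = U' 1" using U gen by blast
next
  fix W assume "\<exists>U'. unitary_group H U' \<and> generator H U' = G \<and> W = U' 1"
  then show "W = U 1" using unitary_group_eqI[OF U] gen E by metis
qed

end

section \<open>Operator algebras and automatic continuity\<close>

text \<open>
  The linear span of \<open>S\<close> for the pointwise operations given by \<open>H\<close>, generated by adding one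
  multiple of an operator at a time, so that its closure properties are plain inductions.
\<close>

inductive_set op_span :: "('v::ab_group_add) hspace \<Rightarrow> ('v \<Rightarrow> 'v) set \<Rightarrow> ('v \<Rightarrow> 'v) set"
  for H :: "('v::ab_group_add) hspace" and S :: "('v \<Rightarrow> 'v) set" where
  zero: "(\<lambda>_. 0) \<in> op_span H S"
| step: "A \<in> S \<Longrightarrow> B \<in> op_span H S \<Longrightarrow> (\<lambda>v. smul H c (A v) + B v) \<in> op_span H S"

definition op_closure :: "('v::ab_group_add) hspace \<Rightarrow> ('v \<Rightarrow> 'v) set \<Rightarrow> ('v \<Rightarrow> 'v) set" where
  "op_closure H \<S> = {A \<in> bop H. \<forall>e>0. \<exists>B\<in>\<S>. \<forall>v\<in>car H. hnorm H (A v - B v) \<le> e * hnorm H v}"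

lemma cstar_algebra_add:
  assumes "cstar_algebra_on H \<A>" "A \<in> \<A>" "B \<in> \<A>" shows "(\<lambda>v. A v + B v) \<in> \<A>"
proof -
  have *: "\<forall>A\<in>\<A>. \<forall>B\<in>\<A>. (\<lambda>v. A v + B v) \<in> \<A>" using assms(1) unfolding cstar_algebra_on_def by blast
  show ?thesis by (rule *[rule_format, OF assms(2,3)])
qed

lemma star_hom_add:
  assumes "star_hom L \<A> H \<rho>" "A \<in> \<A>" "B \<in> \<A>" shows "\<rho> (\<lambda>v. A v + B v) = (\<lambda>v. \<rho> A v + \<rho> B v)"
proof -
  have *: "\<forall>A\<in>\<A>. \<forall>B\<in>\<A>. \<rho> (\<lambda>v. A v + B v) = (\<lambda>v. \<rho> A v + \<rho> B v)" using assms(1) unfolding star_hom_def by blast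
  show ?thesis by (rule *[rule_format, OF assms(2,3)])
qed

context hilbert begin

text \<open>By this estimate, norm closures of \<open>*\<close>-algebras inherit adjoints.\<close>

lemma hadj_dist_bound:
  assumes A: "A \<in> bop H" and B: "B \<in> bop H" and e: "e \<ge> 0"
    and bd: "\<And>v. v \<in> car H \<Longrightarrow> hnorm H (A v - B v) \<le> e * hnorm H v" and v: "v \<in> car H"
  shows "hnorm H (hadj H A v - hadj H B v) \<le> e * hnorm H v"
proof -
  define u where "u = hadj H A v - hadj H B v"
  have c: "hadj H A v \<in> car H" "hadj H B v \<in> car H" using A B hadj_bop bop_car v by auto
  then have u: "u \<in> car H" by (simp add: u_def)
  have AB: "A u \<in> car H" "B u \<in> car H" using A B u bop_car by auto
  have "ip H u u = ip H (hadj H A v - hadj H B v) u" by (simp only: u_def)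
  also have "\<dots> = ip H v (A u - B u)"
    using c u v AB ip_hadj[OF A v u] ip_hadj[OF B v u] by (simp add: ip_diff ip_diff_left)
  finally have uu: "ip H u u = ip H v (A u - B u)" .
  have "(hnorm H u)\<^sup>2 = cmod (ip H u u)" using u by (simp add: ip_self norm_power)
  also have "\<dots> = cmod (ip H v (A u - B u))" by (simp only: uu)
  also have "\<dots> \<le> hnorm H v * hnorm H (A u - B u)" using v AB by (intro cauchy_schwarz) auto
  also have "\<dots> \<le> hnorm H v * (e * hnorm H u)" using v bd[OF u] by (intro mult_left_mono) auto
  finally have "hnorm H u * hnorm H u \<le> (e * hnorm H v) * hnorm H u" by (simp add: power2_eq_square mult_ac)
  then show ?thesis using u v e hnorm_nonneg[OF u] hnorm_nonneg[OF v]
    unfolding u_def[symmetric] by (cases "hnorm H u = 0") (auto simp: mult_le_cancel_right)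
qed

lemma hadj_zero: "hadj H (\<lambda>_. 0) = (\<lambda>_. 0)"
  by (rule hadj_eqI[OF bop_0]) simp

lemma hadj_bound:
  assumes A: "A \<in> bop H" and M: "M \<ge> 0" "\<And>v. v \<in> car H \<Longrightarrow> hnorm H (A v) \<le> M * hnorm H v" and v: "v \<in> car H"
  shows "hnorm H (hadj H A v) \<le> M * hnorm H v"
  using hadj_dist_bound[OF A bop_0 M(1) _ v] M by (simp add: hadj_zero)

lemma op_span_bop: assumes "S \<subseteq> bop H" "A \<in> op_span H S" shows "A \<in> bop H"
  using assms(2)
proof (induction rule: op_span.induct)
  case (step A B c) then show ?case using bop_plus[OF bop_smul, of A B c] assms(1) by auto
qed (rule bop_0)

lemma op_span_add: "A \<in> op_span H S \<Longrightarrow> B \<in> op_span H S \<Longrightarrow> (\<lambda>v. A v + B v) \<in> op_span H S"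
proof (induction rule: op_span.induct)
  case (step A C c)
  then show ?case using op_span.step[of A S "\<lambda>v. C v + B v" H c] by (simp add: add.assoc)
qed simp

lemma op_span_scale: "A \<in> op_span H S \<Longrightarrow> (\<lambda>v. smul H c (A v)) \<in> op_span H S"
proof (induction rule: op_span.induct)
  case (step A B d)
  then show ?case using op_span.step[of A S "\<lambda>v. smul H c (B v)" H "c * d"] by (simp add: vs.scale_right_distrib)
qed (simp add: op_span.zero)

lemma op_span_base: "A \<in> S \<Longrightarrow> A \<in> op_span H S"
  using op_span.step[OF _ op_span.zero, of A S H 1] by simp

lemma op_span_comp:
  assumes S: "S \<subseteq> bop H" and comp: "\<And>A B. A \<in> S \<Longrightarrow> B \<in> S \<Longrightarrow> A \<circ> B \<in> op_span H S"
    and A: "A \<in> op_span H S" and B: "B \<in> op_span H S"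
  shows "A \<circ> B \<in> op_span H S"
proof -
  have left: "A \<circ> B \<in> op_span H S" if A: "A \<in> S" and B: "B \<in> op_span H S" for A B
    using B
  proof (induction rule: op_span.induct)
    case zero
    have "A 0 = 0" using A S bop_zero by blast
    then show ?case by (simp add: comp_def op_span.zero)
  next
    case (step C D c)
    have "A (smul H c (C v) + D v) = smul H c (A (C v)) + A (D v)" for v
      using A S step op_span_bop[OF S, of D] bop_car'[of C v] bop_car'[of D v]
      by (subst bop_add) (auto simp: bop_scale subset_iff)
    then have "A \<circ> (\<lambda>v. smul H c (C v) + D v) = (\<lambda>v. smul H c ((A \<circ> C) v) + (A \<circ> D) v)" by auto
    then show ?case
      using op_span_add[OF op_span_scale[OF comp[OF A step(1)]] step.IH] by simp
  qed
  show ?thesis using A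
  proof (induction rule: op_span.induct)
    case zero then show ?case by (simp add: op_span.zero comp_def)
  next
    case (step C D c)
    have "(\<lambda>v. smul H c (C v) + D v) \<circ> B = (\<lambda>v. smul H c ((C \<circ> B) v) + (D \<circ> B) v)" by auto
    then show ?case using op_span_add[OF op_span_scale[OF left[OF step(1) B]] step.IH] by simp
  qed
qed

lemma op_span_hadj:
  assumes S: "S \<subseteq> bop H" and adj: "\<And>A. A \<in> S \<Longrightarrow> hadj H A \<in> op_span H S" and A: "A \<in> op_span H S"
  shows "hadj H A \<in> op_span H S"
  using A
proof (induction rule: op_span.induct)
  case zero then show ?case by (simp add: hadj_zero op_span.zero)
next
  case (step A B c)
  have b: "A \<in> bop H" "B \<in> bop H" using S step op_span_bop[OF S] by auto
  have "hadj H (\<lambda>v. smul H c (A v) + B v) = (\<lambda>v. smul H (cnj c) (hadj H A v) + hadj H B v)"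
    by (rule hadj_eqI[OF bop_plus[OF bop_smul[OF hadj_bop] hadj_bop]])
      (use b in \<open>auto simp: ip_simps ip_hadj bop_car hadj_bop\<close>)
  then show ?case using op_span_add[OF op_span_scale[OF adj[OF step(1)]] step.IH] by simp
qed

lemma op_closureE:
  assumes "A \<in> op_closure H \<S>" "e > 0"
  obtains B where "B \<in> \<S>" "\<And>v. v \<in> car H \<Longrightarrow> hnorm H (A v - B v) \<le> e * hnorm H v"
  using assms by (auto simp: op_closure_def)

lemma cstar_op_closure:
  assumes S: "S \<subseteq> bop H" and comp: "\<And>A B. A \<in> S \<Longrightarrow> B \<in> S \<Longrightarrow> A \<circ> B \<in> op_span H S"
    and adj: "\<And>A. A \<in> S \<Longrightarrow> hadj H A \<in> op_span H S"
  shows "cstar_algebra_on H (op_closure H (op_span H S))"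
proof -
  let ?N = "op_closure H (op_span H S)"
  have bop: "A \<in> bop H" if "A \<in> op_span H S" for A using op_span_bop[OF S that] .
  have Nb: "A \<in> bop H" if "A \<in> ?N" for A using that by (simp add: op_closure_def)
  have zero: "(\<lambda>_. 0) \<in> ?N"
    unfolding op_closure_def using op_span.zero[of H S] bop_0 by (auto intro!: bexI[of _ "\<lambda>_. 0"])
  have add: "(\<lambda>v. A v + B v) \<in> ?N" if A: "A \<in> ?N" and B: "B \<in> ?N" for A B
    unfolding op_closure_def
  proof (intro CollectI conjI allI impI)
    fix e :: real assume "e > 0"
    then have e: "e / 2 > 0" by simp
    obtain A' where A': "A' \<in> op_span H S" "\<And>v. v \<in> car H \<Longrightarrow> hnorm H (A v - A' v) \<le> e / 2 * hnorm H v"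
      using op_closureE[OF A e] by metis
    obtain B' where B': "B' \<in> op_span H S" "\<And>v. v \<in> car H \<Longrightarrow> hnorm H (B v - B' v) \<le> e / 2 * hnorm H v"
      using op_closureE[OF B e] by metis
    have "hnorm H (A v + B v - (A' v + B' v)) \<le> e * hnorm H v" if v: "v \<in> car H" for v
    proof -
      have c: "A v \<in> car H" "B v \<in> car H" "A' v \<in> car H" "B' v \<in> car H"
        using v Nb[OF A] Nb[OF B] bop[OF A'(1)] bop[OF B'(1)] bop_car by auto
      have "hnorm H ((A v - A' v) + (B v - B' v)) \<le> hnorm H (A v - A' v) + hnorm H (B v - B' v)"
        using c by (intro hnorm_triangle) auto
      then show ?thesis using A'(2)[OF v] B'(2)[OF v] by (simp add: algebra_simps)
    qed
    then show "\<exists>C\<in>op_span H S. \<forall>v\<in>car H. hnorm H (A v + B v - C v) \<le> e * hnorm H v"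
      using op_span_add[OF A'(1) B'(1)] by (intro bexI[of _ "\<lambda>v. A' v + B' v"]) auto
  qed (rule bop_plus[OF Nb[OF A] Nb[OF B]])
  have scale: "(\<lambda>v. smul H c (A v)) \<in> ?N" if A: "A \<in> ?N" for A c
    unfolding op_closure_def
  proof (intro CollectI conjI allI impI)
    fix e :: real assume e: "e > 0"
    then have e': "e / (cmod c + 1) > 0" by (simp add: add_nonneg_pos)
    obtain A' where A': "A' \<in> op_span H S" "\<And>v. v \<in> car H \<Longrightarrow> hnorm H (A v - A' v) \<le> e / (cmod c + 1) * hnorm H v"
      using op_closureE[OF A e'] by metis
    have "hnorm H (smul H c (A v) - smul H c (A' v)) \<le> e * hnorm H v" if v: "v \<in> car H" for v
    proof -
      have c: "A v \<in> car H" "A' v \<in> car H" using v Nb[OF A] bop[OF A'(1)] bop_car by auto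
      then have "hnorm H (smul H c (A v) - smul H c (A' v)) = cmod c * hnorm H (A v - A' v)"
        by (simp add: hnorm_scale flip: vs.scale_right_diff_distrib)
      also have "\<dots> \<le> (cmod c + 1) * (e / (cmod c + 1) * hnorm H v)"
        using A'(2)[OF v] c by (intro mult_mono) auto
      also have "\<dots> = e * hnorm H v" using add_nonneg_pos[OF norm_ge_zero[of c] zero_less_one] by simp
      finally show ?thesis .
    qed
    then show "\<exists>C\<in>op_span H S. \<forall>v\<in>car H. hnorm H (smul H c (A v) - C v) \<le> e * hnorm H v"
      using op_span_scale[OF A'(1)] by (intro bexI[of _ "\<lambda>v. smul H c (A' v)"]) auto
  qed (rule bop_smul[OF Nb[OF A]])
  have mult: "A \<circ> B \<in> ?N" if A: "A \<in> ?N" and B: "B \<in> ?N" for A B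
    unfolding op_closure_def
  proof (intro CollectI conjI allI impI)
    fix e :: real assume e: "e > 0"
    obtain M where M: "M \<ge> 0" "\<And>v. v \<in> car H \<Longrightarrow> hnorm H (B v) \<le> M * hnorm H v" using bop_bound[OF Nb[OF B]] by metis
    \<comment> \<open>First \<open>A\<close> is approximated relative to a bound of \<open>B\<close>, then \<open>B\<close> relative to a bound of
      the approximation of \<open>A\<close>.\<close>
    have eA: "e / (2 * (M + 1)) > 0" using e M by (simp add: add_nonneg_pos)
    obtain A' where A': "A' \<in> op_span H S" "\<And>v. v \<in> car H \<Longrightarrow> hnorm H (A v - A' v) \<le> e / (2 * (M + 1)) * hnorm H v"
      using op_closureE[OF A eA] by metis
    obtain M' where M': "M' \<ge> 0" "\<And>v. v \<in> car H \<Longrightarrow> hnorm H (A' v) \<le> M' * hnorm H v" using bop_bound[OF bop[OF A'(1)]] by metis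
    have eB: "e / (2 * (M' + 1)) > 0" using e M' by (simp add: add_nonneg_pos)
    obtain B' where B': "B' \<in> op_span H S" "\<And>v. v \<in> car H \<Longrightarrow> hnorm H (B v - B' v) \<le> e / (2 * (M' + 1)) * hnorm H v"
      using op_closureE[OF B eB] by metis
    have "hnorm H ((A \<circ> B) v - (A' \<circ> B') v) \<le> e * hnorm H v" if v: "v \<in> car H" for v
    proof -
      have c: "B v \<in> car H" "B' v \<in> car H" using v Nb[OF B] bop[OF B'(1)] bop_car by auto
      have c': "A (B v) \<in> car H" "A' (B v) \<in> car H" "A' (B' v) \<in> car H"
        using c Nb[OF A] bop[OF A'(1)] bop_car by auto
      have "hnorm H (A (B v) - A' (B' v)) \<le> hnorm H (A (B v) - A' (B v)) + hnorm H (A' (B v) - A' (B' v))"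
        using c' by (intro hnorm_triangle_diff) auto
      also have "A' (B v) - A' (B' v) = A' (B v - B' v)" using c bop_diff[OF bop[OF A'(1)]] by simp
      also have "hnorm H (A (B v) - A' (B v)) \<le> e / (2 * (M + 1)) * (M * hnorm H v)"
        using A'(2)[OF c(1)] M(2)[OF v] eA by (smt (verit) mult_left_mono)
      also have "hnorm H (A' (B v - B' v)) \<le> M' * (e / (2 * (M' + 1)) * hnorm H v)"
        using M'(2)[of "B v - B' v"] B'(2)[OF v] M'(1) c by (smt (verit) diff_car mult_left_mono)
      also have "e / (2 * (M + 1)) * (M * hnorm H v) \<le> e / 2 * hnorm H v"
      proof -
        have "e / (2 * (M + 1)) * M \<le> e / 2" using e M by (simp add: field_simps)
        from mult_right_mono[OF this hnorm_nonneg[OF v]] show ?thesis by (simp only: mult.assoc)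
      qed
      also have "M' * (e / (2 * (M' + 1)) * hnorm H v) \<le> e / 2 * hnorm H v"
      proof -
        have "M' * (e / (2 * (M' + 1))) \<le> e / 2" using e M' by (simp add: field_simps)
        from mult_right_mono[OF this hnorm_nonneg[OF v]] show ?thesis by (simp only: mult.assoc)
      qed
      finally show ?thesis by simp
    qed
    then show "\<exists>C\<in>op_span H S. \<forall>v\<in>car H. hnorm H ((A \<circ> B) v - C v) \<le> e * hnorm H v"
      using op_span_comp[OF S comp A'(1) B'(1)] by (intro bexI[of _ "A' \<circ> B'"]) auto
  qed (rule bop_comp[OF Nb[OF A] Nb[OF B]])
  have hadj: "hadj H A \<in> ?N" if A: "A \<in> ?N" for A
    unfolding op_closure_def
  proof (intro CollectI conjI allI impI)
    fix e :: real assume e: "e > 0"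
    obtain A' where A': "A' \<in> op_span H S" "\<And>v. v \<in> car H \<Longrightarrow> hnorm H (A v - A' v) \<le> e * hnorm H v"
      using op_closureE[OF A e] by metis
    then have "\<forall>v\<in>car H. hnorm H (hadj H A v - hadj H A' v) \<le> e * hnorm H v"
      using hadj_dist_bound[OF Nb[OF A] bop[OF A'(1)]] e by auto
    then show "\<exists>C\<in>op_span H S. \<forall>v\<in>car H. hnorm H (hadj H A v - C v) \<le> e * hnorm H v"
      using op_span_hadj[OF S adj A'(1)] by blast
  qed (rule hadj_bop[OF Nb[OF A]])
  have closed: "A \<in> ?N" if A: "A \<in> bop H" "\<forall>e>0. \<exists>B\<in>?N. \<forall>v\<in>car H. hnorm H (A v - B v) \<le> e * hnorm H v" for A
    unfolding op_closure_def
  proof (intro CollectI conjI allI impI A(1))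
    fix e :: real assume "e > 0"
    then have e: "e / 2 > 0" by simp
    obtain B where B: "B \<in> ?N" "\<And>v. v \<in> car H \<Longrightarrow> hnorm H (A v - B v) \<le> e / 2 * hnorm H v" using A(2) e by blast
    obtain B' where B': "B' \<in> op_span H S" "\<And>v. v \<in> car H \<Longrightarrow> hnorm H (B v - B' v) \<le> e / 2 * hnorm H v"
      using op_closureE[OF B(1) e] by metis
    have "hnorm H (A v - B' v) \<le> e * hnorm H v" if v: "v \<in> car H" for v
    proof -
      have "hnorm H (A v - B' v) \<le> hnorm H (A v - B v) + hnorm H (B v - B' v)"
        using v A(1) Nb[OF B(1)] bop[OF B'(1)] bop_car by (intro hnorm_triangle_diff) auto
      then show ?thesis using B(2)[OF v] B'(2)[OF v] by linarith
    qed
    then show "\<exists>C\<in>op_span H S. \<forall>v\<in>car H. hnorm H (A v - C v) \<le> e * hnorm H v" using B' by blast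
  qed
  show ?thesis
    unfolding cstar_algebra_on_def
    by (intro conjI subsetI ballI allI impI; (rule zero | (rule Nb add scale mult hadj closed; assumption)))
qed

text \<open>
  If products and adjoints of generators are linear combinations of generators, as for Weyl
  operators, the generated C*-algebra is the norm closure of their linear span.
\<close>

theorem cstar_generated_eq:
  assumes S: "S \<subseteq> bop H" and comp: "\<And>A B. A \<in> S \<Longrightarrow> B \<in> S \<Longrightarrow> A \<circ> B \<in> op_span H S"
    and adj: "\<And>A. A \<in> S \<Longrightarrow> hadj H A \<in> op_span H S"
  shows "cstar_generated H S = op_closure H (op_span H S)"
proof
  have "S \<subseteq> op_closure H (op_span H S)"
  proof
    fix A assume A: "A \<in> S"
    then have "A \<in> op_span H S" "A \<in> bop H" using op_span_base S by auto
    then show "A \<in> op_closure H (op_span H S)"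
      unfolding op_closure_def by (auto intro!: bexI[of _ A])
  qed
  then show "cstar_generated H S \<subseteq> op_closure H (op_span H S)"
    unfolding cstar_generated_def using cstar_op_closure[OF assms] by blast
  show "op_closure H (op_span H S) \<subseteq> cstar_generated H S"
    unfolding cstar_generated_def
  proof (intro Inter_greatest, clarify)
    fix \<A> A assume \<A>: "cstar_algebra_on H \<A>" "S \<subseteq> \<A>" and A: "A \<in> op_closure H (op_span H S)"
    have "B \<in> \<A>" if "B \<in> op_span H S" for B
      using that
    proof (induction rule: op_span.induct)
      case zero then show ?case using \<A> by (simp add: cstar_algebra_on_def)
    next
      case (step A B c)
      have "(\<lambda>v. smul H c (A v)) \<in> \<A>" using \<A> step unfolding cstar_algebra_on_def by blast
      then show ?case by (rule cstar_algebra_add[OF \<A>(1) _ step.IH])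
    qed
    then have "\<forall>e>0. \<exists>B\<in>\<A>. \<forall>v\<in>car H. hnorm H (A v - B v) \<le> e * hnorm H v" "A \<in> bop H"
      using A unfolding op_closure_def by blast+
    then show "A \<in> \<A>" using \<A>(1) unfolding cstar_algebra_on_def by blast
  qed
qed

text \<open>The inverse of \<open>1 - S\<close> is a norm limit of polynomials in \<open>S\<close>, so it stays in the algebra.\<close>

lemma neumann_series:
  assumes \<A>: "cstar_algebra_on H \<A>" "hid H \<in> \<A>" and S: "S \<in> \<A>"
    and q: "0 \<le> q" "q < 1" "\<And>v. v \<in> car H \<Longrightarrow> hnorm H (S v) \<le> q * hnorm H v"
  obtains R where "R \<in> \<A>" "\<And>v. v \<in> car H \<Longrightarrow> R (v - S v) = v"
proof -
  have Sb: "S \<in> bop H" using \<A> S by (auto simp: cstar_algebra_on_def)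
  have pc: "(S ^^ k) v \<in> car H" and pn: "hnorm H ((S ^^ k) v) \<le> q ^ k * hnorm H v" if "v \<in> car H" for k v
  proof -
    have "(S ^^ k) v \<in> car H \<and> hnorm H ((S ^^ k) v) \<le> q ^ k * hnorm H v"
    proof (induction k)
      case (Suc k)
      have "hnorm H (S ((S ^^ k) v)) \<le> q * (q ^ k * hnorm H v)"
        using q(3)[of "(S ^^ k) v"] Suc q(1) by (smt (verit) mult_left_mono)
      then show ?case using Suc Sb bop_car by (auto simp: mult.assoc)
    qed (use that in simp)
    then show "(S ^^ k) v \<in> car H" "hnorm H ((S ^^ k) v) \<le> q ^ k * hnorm H v" by auto
  qed
  define Rn where "Rn n v = (if v \<in> car H then \<Sum>k<n. (S ^^ k) v else 0)" for n :: nat and v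
  have RnA: "Rn n \<in> \<A>" for n
  proof (induction n)
    case 0
    have "Rn 0 = (\<lambda>_. 0)" by (auto simp: Rn_def)
    then show ?case using \<A>(1) by (simp add: cstar_algebra_on_def)
  next
    case (Suc n)
    have "Rn (Suc n) v = hid H v + (Rn n \<circ> S) v" for v
    proof (cases "v \<in> car H")
      case True
      then show ?thesis using Sb bop_car by (simp add: Rn_def sum.lessThan_Suc_shift funpow_swap1 del: sum.lessThan_Suc)
    next
      case False
      have "(S ^^ k) 0 = 0" for k by (induction k) (auto simp: bop_zero[OF Sb])
      then show ?thesis using False bop_outside[OF Sb] by (simp add: Rn_def hid_def)
    qed
    then have "Rn (Suc n) = (\<lambda>v. hid H v + (Rn n \<circ> S) v)" by auto
    moreover have "Rn n \<circ> S \<in> \<A>" using \<A>(1) Suc S unfolding cstar_algebra_on_def by blast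
    ultimately show ?case using cstar_algebra_add[OF \<A>] by presburger
  qed
  have Rnb: "Rn n \<in> bop H" for n using RnA \<A>(1) by (auto simp: cstar_algebra_on_def)
  have diff: "hnorm H (Rn n v - Rn m v) \<le> q ^ m / (1 - q) * hnorm H v" if v: "v \<in> car H" and mn: "m \<le> n" for v m n
  proof -
    have "Rn n v - Rn m v = (\<Sum>k=m..<n. (S ^^ k) v)"
      using v mn by (simp add: Rn_def sum_diff_nat_ivl[of 0 m n, simplified] lessThan_atLeast0)
    then have "hnorm H (Rn n v - Rn m v) \<le> (\<Sum>k=m..<n. hnorm H ((S ^^ k) v))"
      using hnorm_sum[of "{m..<n}" "\<lambda>k. (S ^^ k) v"] pc[OF v] by simp
    also have "\<dots> \<le> (\<Sum>k=m..<n. q ^ k * hnorm H v)" by (intro sum_mono pn v)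
    also have "\<dots> = (\<Sum>k=m..<n. q ^ k) * hnorm H v" by (simp add: sum_distrib_right)
    also have "\<dots> \<le> q ^ m / (1 - q) * hnorm H v"
    proof (rule mult_right_mono)
      have "(1 - q) * (\<Sum>k=m..<n. q ^ k) = q ^ m - q ^ n"
        using mn
      proof (induction n rule: dec_induct)
        case (step k)
        then have *: "(\<Sum>k=m..<Suc k. q ^ k) = (\<Sum>k=m..<k. q ^ k) + q ^ k" by simp
        show ?case unfolding * distrib_left step.IH by (simp add: left_diff_distrib)
      qed simp
      then show "(\<Sum>k=m..<n. q ^ k) \<le> q ^ m / (1 - q)"
        using q zero_le_power[OF q(1), of n] by (simp add: pos_le_divide_eq mult.commute)
    qed (use v in simp)
    finally show ?thesis .
  qed
  have qlim: "(\<lambda>m. q ^ m / (1 - q) * c) \<longlonglongrightarrow> 0" for c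
    using LIMSEQ_realpow_zero[OF q(1,2)] by (intro tendsto_mult_left_zero tendsto_divide_zero)
  have ex: "\<exists>l. lim_to (\<lambda>n. Rn n v) l" if v: "v \<in> car H" for v
  proof (rule Cauchy_lim_to)
    fix e :: real assume "e > 0"
    then have "\<forall>\<^sub>F m in sequentially. q ^ m / (1 - q) * hnorm H v < e"
      using qlim[of "hnorm H v"] by (auto intro: order_tendstoD)
    then obtain N where N: "\<And>m. m \<ge> N \<Longrightarrow> q ^ m / (1 - q) * hnorm H v < e" by (auto simp: eventually_sequentially)
    have "hnorm H (Rn m v - Rn n v) < e" if "m \<ge> N" "n \<ge> N" for m n
    proof (cases "m \<le> n")
      case True
      then show ?thesis using diff[OF v True] N[OF that(1)] hnorm_minus_commute[of "Rn m v" "Rn n v"] Rnb bop_car v by force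
    next
      case False
      then show ?thesis using diff[OF v, of n m] N[OF that(2)] by simp
    qed
    then show "\<exists>N. \<forall>m\<ge>N. \<forall>n\<ge>N. hnorm H (Rn m v - Rn n v) < e" by blast
  qed (use Rnb bop_car v in auto)
  then obtain R0 where R0: "\<And>v. v \<in> car H \<Longrightarrow> lim_to (\<lambda>n. Rn n v) (R0 v)" by metis
  define R where "R v = (if v \<in> car H then R0 v else 0)" for v
  have R: "lim_to (\<lambda>n. Rn n v) (R v)" if "v \<in> car H" for v using R0 that by (simp add: R_def)
  have Rc: "R v \<in> car H" if "v \<in> car H" for v using R[OF that] by (simp add: lim_to_def)
  have Rd: "hnorm H (R v - Rn m v) \<le> q ^ m / (1 - q) * hnorm H v" if v: "v \<in> car H" for v m
  proof (rule LIMSEQ_le_const2)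
    show "(\<lambda>n. hnorm H (Rn n v - Rn m v)) \<longlonglongrightarrow> hnorm H (R v - Rn m v)"
      using lim_to_norm[OF lim_to_diff[OF R[OF v] lim_to_const]] v Rnb bop_car by auto
    show "\<exists>N. \<forall>n\<ge>N. hnorm H (Rn n v - Rn m v) \<le> q ^ m / (1 - q) * hnorm H v" using diff[OF v] by blast
  qed
  have "R \<in> bop H"
    unfolding bop_def
  proof (intro CollectI conjI ballI allI impI)
    fix v w assume vw: "v \<in> car H" "w \<in> car H"
    have "lim_to (\<lambda>n. Rn n v + Rn n w) (R v + R w)" using R vw lim_to_add by blast
    moreover have "(\<lambda>n. Rn n v + Rn n w) = (\<lambda>n. Rn n (v + w))" using bop_add[OF Rnb] vw by simp
    ultimately show "R (v + w) = R v + R w" using lim_to_unique R vw by (metis add_car)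
  next
    fix c v assume v: "v \<in> car H"
    have "lim_to (\<lambda>n. smul H c (Rn n v)) (smul H c (R v))" using R v lim_to_scale by blast
    moreover have "(\<lambda>n. smul H c (Rn n v)) = (\<lambda>n. Rn n (smul H c v))" using bop_scale[OF Rnb] v by simp
    ultimately show "R (smul H c v) = smul H c (R v)" using lim_to_unique R v by (metis scale_car)
  next
    have "hnorm H (R v) \<le> 1 / (1 - q) * hnorm H v" if "v \<in> car H" for v
      using Rd[OF that, of 0] that by (simp add: Rn_def)
    then show "\<exists>M. \<forall>v\<in>car H. hnorm H (R v) \<le> M * hnorm H v" by blast
  qed (use Rc in \<open>auto simp: R_def\<close>)
  moreover have "\<exists>B\<in>\<A>. \<forall>v\<in>car H. hnorm H (R v - B v) \<le> e * hnorm H v" if e: "e > 0" for e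
  proof -
    have "\<forall>\<^sub>F m in sequentially. q ^ m / (1 - q) * 1 < e"
      using qlim[of 1] e by (auto intro: order_tendstoD)
    then obtain m where m: "q ^ m / (1 - q) < e" by (auto simp: eventually_sequentially)
    have "hnorm H (R v - Rn m v) \<le> e * hnorm H v" if v: "v \<in> car H" for v
      using Rd[OF v, of m] mult_right_mono[OF less_imp_le[OF m] hnorm_nonneg[OF v]] by linarith
    then show ?thesis using RnA by blast
  qed
  ultimately have RA: "R \<in> \<A>" using \<A>(1) unfolding cstar_algebra_on_def by blast
  show thesis
  proof (rule that[OF RA])
    fix v assume v: "v \<in> car H"
    have Sv: "S v \<in> car H" using Sb v bop_car by auto
    have tele: "Rn n (v - S v) = v - (S ^^ n) v" for n
    proof -
      have "Rn n (v - S v) = Rn n v - Rn n (S v)" using bop_diff[OF Rnb v Sv] .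
      also have "\<dots> = (\<Sum>k<n. (S ^^ k) v - (S ^^ Suc k) v)"
        using v Sv by (simp add: Rn_def sum_subtractf funpow_swap1)
      also have "\<dots> = v - (S ^^ n) v" by (induction n) auto
      finally show ?thesis .
    qed
    have "lim_to (\<lambda>n. v - (S ^^ n) v) v"
    proof (rule lim_to_bound[where b = "\<lambda>n. q ^ n * hnorm H v"])
      show "(\<lambda>n. q ^ n * hnorm H v) \<longlonglongrightarrow> 0"
        using LIMSEQ_realpow_zero[OF q(1,2)] by (intro tendsto_mult_left_zero)
    qed (use v pc pn in \<open>auto simp: hnorm_uminus\<close>)
    moreover have "lim_to (\<lambda>n. v - (S ^^ n) v) (R (v - S v))"
      using R[of "v - S v"] v Sv by (simp add: tele)
    ultimately show "R (v - S v) = v" using lim_to_unique by blast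
  qed
qed

end

text \<open>
  A \<open>*\<close>-homomorphism does not enlarge spectra, which for \<open>A\<^sup>* A\<close> bounds the norm. Spectral theory
  is avoided as follows. Let \<open>B = \<rho> A\<close> and let \<open>l = \<parallel>B\<parallel>\<^sup>2\<close> exceed \<open>M\<^sup>2 \<ge> \<parallel>A\<parallel>\<^sup>2\<close>. Then \<open>S = A\<^sup>* A / l\<close>
  has norm less than 1, so \<open>1 - S\<close> has an inverse in the algebra, and \<open>1 - T\<close>,
  \<open>T = \<rho> S = B\<^sup>* B / l\<close>, has a bounded left inverse. But unit vectors \<open>u\<close> for which \<open>\<parallel>B u\<parallel>\<^sup>2\<close> is
  almost \<open>l\<close> are almost fixed by \<open>T\<close>.
\<close>

theorem star_hom_contractive:
  assumes L: "hilbert L" and H: "hilbert H" and \<A>: "cstar_algebra_on L \<A>" "hid L \<in> \<A>"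
    and hom: "star_hom L \<A> H \<rho>" "\<rho> (hid L) = hid H" and A: "A \<in> \<A>"
    and M: "M \<ge> 0" "\<And>v. v \<in> car L \<Longrightarrow> hnorm L (A v) \<le> M * hnorm L v" and w: "w \<in> car H"
  shows "hnorm H (\<rho> A w) \<le> M * hnorm H w"
proof (rule ccontr)
  interpret L: hilbert L by fact
  interpret H: hilbert H by fact
  assume "\<not> hnorm H (\<rho> A w) \<le> M * hnorm H w"
  then have gt: "hnorm H (\<rho> A w) > M * hnorm H w" by simp
  define B where "B = \<rho> A"
  have Bb: "B \<in> bop H" using hom(1) A by (simp add: star_hom_def B_def)
  have Ab: "A \<in> bop L" using \<A>(1) A by (auto simp: cstar_algebra_on_def)
  have wn: "hnorm H w > 0"
    using gt H.hnorm_nonneg[OF w] H.hnorm_eq_zero[OF w] H.bop_zero[OF Bb] by (cases "w = 0") (auto simp: B_def less_le)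
  define Q where "Q = {(hnorm H (B u))\<^sup>2 |u. u \<in> car H \<and> hnorm H u = 1}"
  obtain K where K: "K \<ge> 0" "\<And>u. u \<in> car H \<Longrightarrow> hnorm H (B u) \<le> K * hnorm H u" using H.bop_bound[OF Bb] by metis
  have Bc: "B u \<in> car H" if "u \<in> car H" for u using H.bop_car[OF Bb that] .
  have bdd: "bdd_above Q"
  proof (rule bdd_aboveI[of _ "K\<^sup>2"])
    fix x assume "x \<in> Q"
    then obtain u where u: "u \<in> car H" "hnorm H u = 1" "x = (hnorm H (B u))\<^sup>2" by (auto simp: Q_def)
    show "x \<le> K\<^sup>2" unfolding u(3) using K(2)[OF u(1)] u(2) Bc[OF u(1)] by (intro power_mono) auto
  qed
  define l where "l = Sup Q"
  have le: "(hnorm H (B u))\<^sup>2 \<le> l * (hnorm H u)\<^sup>2" if u: "u \<in> car H" for u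
  proof (cases "u = 0")
    case False
    then have n: "hnorm H u > 0" using H.hnorm_eq_zero[OF u] H.hnorm_nonneg[OF u] by linarith
    let ?u = "smul H (complex_of_real (1 / hnorm H u)) u"
    have 1: "?u \<in> car H" "hnorm H ?u = 1" using u n by (auto simp: H.hnorm_scale norm_divide)
    then have "(hnorm H (B ?u))\<^sup>2 \<le> l" unfolding l_def by (intro cSup_upper bdd) (auto simp: Q_def)
    from mult_right_mono[OF this zero_le_power2[of "hnorm H u"]]
    have "(hnorm H (B ?u) * hnorm H u)\<^sup>2 \<le> l * (hnorm H u)\<^sup>2" by (simp only: power_mult_distrib)
    moreover have "hnorm H (B ?u) * hnorm H u = hnorm H (B u)"
      using n u Bc by (simp add: H.bop_scale[OF Bb] H.hnorm_scale norm_divide)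
    ultimately show ?thesis by simp
  qed (simp add: H.bop_zero[OF Bb])
  have "(M * hnorm H w)\<^sup>2 < (hnorm H (B w))\<^sup>2"
    using gt M(1) wn by (intro power_strict_mono) (auto simp: B_def)
  also have "\<dots> \<le> l * (hnorm H w)\<^sup>2" by (rule le[OF w])
  finally have lM: "M\<^sup>2 < l" using wn by (simp add: power_mult_distrib)
  then have l0: "l > 0" using zero_le_power2[of M] by linarith
  have adjA: "hadj L A \<in> \<A>" using \<A>(1) A by (auto simp: cstar_algebra_on_def)
  have comp: "hadj L A \<circ> A \<in> \<A>" using \<A>(1) adjA A unfolding cstar_algebra_on_def by blast
  define S where "S = (\<lambda>v. smul L (complex_of_real (1 / l)) ((hadj L A \<circ> A) v))"
  have SA: "S \<in> \<A>" using \<A>(1) comp unfolding cstar_algebra_on_def S_def by blast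
  have Sb: "S \<in> bop L" using SA \<A>(1) by (auto simp: cstar_algebra_on_def)
  have Sq: "hnorm L (S v) \<le> M\<^sup>2 / l * hnorm L v" if v: "v \<in> car L" for v
  proof -
    have c: "A v \<in> car L" "hadj L A (A v) \<in> car L" using v Ab L.hadj_bop L.bop_car by auto
    have "hnorm L (hadj L A (A v)) \<le> M * hnorm L (A v)" by (rule L.hadj_bound[OF Ab M c(1)])
    also have "\<dots> \<le> M * (M * hnorm L v)" using M v by (intro mult_left_mono) auto
    finally show ?thesis using l0 c by (simp add: S_def L.hnorm_scale norm_divide power2_eq_square divide_right_mono)
  qed
  obtain R where R: "R \<in> \<A>" "\<And>v. v \<in> car L \<Longrightarrow> R (v - S v) = v"
    by (rule L.neumann_series[OF \<A> SA _ _ Sq]) (use l0 lM in auto)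
  have Rb: "R \<in> bop L" using R(1) \<A>(1) by (auto simp: cstar_algebra_on_def)
  define T where "T = (\<lambda>v. smul H (complex_of_real (1 / l)) (hadj H B (B v)))"
  have rS: "\<rho> S = T"
  proof -
    have "\<rho> (hadj L A \<circ> A) = hadj H B \<circ> B"
      using hom(1) adjA A unfolding star_hom_def B_def by metis
    moreover have "\<rho> S = (\<lambda>v. smul H (complex_of_real (1 / l)) (\<rho> (hadj L A \<circ> A) v))"
      using hom(1) comp unfolding star_hom_def S_def by blast
    ultimately show ?thesis by (simp add: T_def)
  qed
  have nS: "(\<lambda>v. smul L (-1) (S v)) \<in> \<A>" using \<A>(1) SA unfolding cstar_algebra_on_def by blast
  have dS: "(\<lambda>v. hid L v + smul L (-1) (S v)) \<in> \<A>" by (rule cstar_algebra_add[OF \<A> nS])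
  have "R \<circ> (\<lambda>v. hid L v + smul L (-1) (S v)) = hid L"
  proof
    fix v show "(R \<circ> (\<lambda>v. hid L v + smul L (-1) (S v))) v = hid L v"
      using R(2)[of v] L.bop_outside[OF Sb] L.bop_zero[OF Rb] by (cases "v \<in> car L") (auto simp: hid_def)
  qed
  moreover have "\<rho> (R \<circ> (\<lambda>v. hid L v + smul L (-1) (S v))) = \<rho> R \<circ> \<rho> (\<lambda>v. hid L v + smul L (-1) (S v))"
    using hom(1) R(1) dS unfolding star_hom_def by blast
  moreover have "\<rho> (\<lambda>v. hid L v + smul L (-1) (S v)) = (\<lambda>v. \<rho> (hid L) v + \<rho> (\<lambda>v. smul L (-1) (S v)) v)"
    by (rule star_hom_add[OF hom(1) \<A>(2) nS])
  moreover have "\<rho> (\<lambda>v. smul L (-1) (S v)) = (\<lambda>v. smul H (-1) (\<rho> S v))"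
    using hom(1) SA unfolding star_hom_def by blast
  ultimately have "\<rho> R \<circ> (\<lambda>v. hid H v + smul H (-1) (T v)) = hid H" using hom(2) rS by simp
  then have inv: "\<rho> R (u - T u) = u" if "u \<in> car H" for u
    using that by (auto dest!: fun_cong[of _ _ u] simp: hid_def)
  have "\<rho> R \<in> bop H" using hom(1) R(1) by (simp add: star_hom_def)
  then obtain J where J: "J \<ge> 0" "\<And>u. u \<in> car H \<Longrightarrow> hnorm H (\<rho> R u) \<le> J * hnorm H u" using H.bop_bound by metis
  \<comment> \<open>If \<open>\<parallel>B u\<parallel>\<^sup>2 > d\<close> for a unit vector \<open>u\<close>, then \<open>\<parallel>u - T u\<parallel>\<^sup>2 \<le> 1 / (J\<^sup>2 + 1)\<close>, which is too
    small for a left inverse of norm at most \<open>J\<close>.\<close>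
  define d where "d = l * (1 - 1 / (2 * (J\<^sup>2 + 1)))"
  have J1: "J\<^sup>2 + 1 > 0" by (simp add: add_nonneg_pos)
  have "d < l" using l0 J1 by (simp add: d_def field_simps)
  moreover have "Q \<noteq> {}"
  proof -
    let ?u = "smul H (complex_of_real (1 / hnorm H w)) w"
    have "?u \<in> car H" "hnorm H ?u = 1" using w wn by (auto simp: H.hnorm_scale norm_divide)
    then show ?thesis unfolding Q_def by blast
  qed
  ultimately obtain x where x: "x \<in> Q" "d < x" unfolding l_def using less_cSupD by blast
  then obtain u where u: "u \<in> car H" "hnorm H u = 1" "d < (hnorm H (B u))\<^sup>2" by (auto simp: Q_def)
  have hc: "hadj H B (B u) \<in> car H" using H.hadj_bop[OF Bb] H.bop_car Bc u by auto
  have Tc: "T u \<in> car H" using hc by (simp add: T_def)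
  have "hnorm H (hadj H B (B u)) \<le> sqrt l * hnorm H (B u)"
  proof (rule H.hadj_bound[OF Bb])
    fix v assume v: "v \<in> car H"
    show "hnorm H (B v) \<le> sqrt l * hnorm H v"
    proof (rule power2_le_imp_le)
      have "(sqrt l)\<^sup>2 = l" using l0 by simp
      then show "(hnorm H (B v))\<^sup>2 \<le> (sqrt l * hnorm H v)\<^sup>2"
        using le[OF v] by (simp only: power_mult_distrib)
      show "0 \<le> sqrt l * hnorm H v" using l0 v by simp
    qed
  next
    show "0 \<le> sqrt l" using l0 by simp
    show "B u \<in> car H" using Bc u by simp
  qed
  also have "\<dots> \<le> sqrt l * sqrt l"
    using le[OF u(1)] u(2) l0 by (intro mult_left_mono) (auto intro: real_le_rsqrt)
  finally have "hnorm H (T u) \<le> 1" using hc l0 by (simp add: T_def H.hnorm_scale norm_divide)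
  then have T1: "(hnorm H (T u))\<^sup>2 \<le> 1" using Tc by (simp add: power_le_one)
  have "ip H u (hadj H B (B u)) = cnj (ip H (hadj H B (B u)) u)" using H.ip_cnj hc u by blast
  also have "\<dots> = complex_of_real ((hnorm H (B u))\<^sup>2)" using u Bc by (simp add: H.ip_hadj[OF Bb] H.ip_self)
  finally have "Re (ip H u (T u)) = (hnorm H (B u))\<^sup>2 / l" using u hc by (simp add: T_def H.ip_scale)
  then have "(hnorm H (u - T u))\<^sup>2 = 1 + (hnorm H (T u))\<^sup>2 - 2 * ((hnorm H (B u))\<^sup>2 / l)"
    using u Tc by (simp add: H.hnorm_sq_diff)
  also have "\<dots> \<le> 2 - 2 * (d / l)" using T1 u(3) l0 by (smt (verit) divide_strict_right_mono)
  also have "\<dots> = 1 / (J\<^sup>2 + 1)"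
  proof -
    have "d / l = 1 - 1 / (2 * (J\<^sup>2 + 1))" using l0 by (simp add: d_def)
    moreover have "2 - 2 * (1 - 1 / (2 * k)) = 1 / k" for k :: real by (simp add: right_diff_distrib)
    ultimately show ?thesis by (simp only:)
  qed
  finally have s: "(hnorm H (u - T u))\<^sup>2 \<le> 1 / (J\<^sup>2 + 1)" .
  have "1 \<le> J * hnorm H (u - T u)" using J(2)[of "u - T u"] inv[OF u(1)] u Tc by simp
  then have "1 \<le> (J * hnorm H (u - T u))\<^sup>2" by (simp add: one_le_power)
  also have "\<dots> \<le> J\<^sup>2 * (1 / (J\<^sup>2 + 1))" unfolding power_mult_distrib by (intro mult_left_mono s) simp
  also have "\<dots> < 1" using J1 by (simp add: field_simps)
  finally show False by simp
qed

section \<open>Orthonormal bases and multilinear functionals\<close>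

definition l2 :: "'i set \<Rightarrow> ('i \<Rightarrow> complex) \<Rightarrow> bool" where
  "l2 A f \<longleftrightarrow> (\<lambda>i. (cmod (f i))\<^sup>2) summable_on A"

lemma two_mult_le_sum_squares: "2 * x * y \<le> x\<^sup>2 + (y::real)\<^sup>2"
  using zero_le_power2[of "x - y"] by (simp add: power2_diff)

lemma l2_add: assumes "l2 A f" "l2 A g" shows "l2 A (\<lambda>i. f i + g i)"
  unfolding l2_def
proof (rule summable_on_comparison_test)
  show "(\<lambda>i. 2 * (cmod (f i))\<^sup>2 + 2 * (cmod (g i))\<^sup>2) summable_on A"
    using assms unfolding l2_def by (intro summable_on_add summable_on_cmult_right)
  fix i
  have "(cmod (f i + g i))\<^sup>2 \<le> (cmod (f i) + cmod (g i))\<^sup>2"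
    by (intro power_mono norm_triangle_ineq norm_ge_zero)
  also have "\<dots> \<le> 2 * (cmod (f i))\<^sup>2 + 2 * (cmod (g i))\<^sup>2"
    using two_mult_le_sum_squares[of "cmod (f i)" "cmod (g i)"] by (simp add: power2_sum)
  finally show "(cmod (f i + g i))\<^sup>2 \<le> 2 * (cmod (f i))\<^sup>2 + 2 * (cmod (g i))\<^sup>2" .
qed auto

lemma l2_scale: "l2 A f \<Longrightarrow> l2 A (\<lambda>i. c * f i)"
  unfolding l2_def by (simp add: norm_mult power_mult_distrib summable_on_cmult_right)

lemma l2_sum: "(\<And>p. p \<in> P \<Longrightarrow> l2 A (f p)) \<Longrightarrow> l2 A (\<lambda>i. \<Sum>p\<in>P. f p i)"
proof (induction P rule: infinite_finite_induct)
  case (insert p P)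
  then show ?case by (simp add: l2_add)
qed (auto simp: l2_def)

lemma l2_cnj [simp]: "l2 A (\<lambda>i. cnj (f i)) = l2 A f"
  by (simp add: l2_def)

lemma l2_mult_summable: assumes "l2 A f" "l2 A g" shows "(\<lambda>i. f i * g i) summable_on A"
proof (rule abs_summable_summable, rule summable_on_comparison_test)
  show "(\<lambda>i. (cmod (f i))\<^sup>2 + (cmod (g i))\<^sup>2) summable_on A"
    using assms unfolding l2_def by (rule summable_on_add)
  fix i
  have "2 * (cmod (f i) * cmod (g i)) \<le> (cmod (f i))\<^sup>2 + (cmod (g i))\<^sup>2"
    using two_mult_le_sum_squares[of "cmod (f i)" "cmod (g i)"] by simp
  moreover have "0 \<le> cmod (f i) * cmod (g i)" by simp
  ultimately have "cmod (f i) * cmod (g i) \<le> (cmod (f i))\<^sup>2 + (cmod (g i))\<^sup>2" by linarith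
  then show "norm (f i * g i) \<le> (cmod (f i))\<^sup>2 + (cmod (g i))\<^sup>2" by (simp add: norm_mult)
qed auto

lemma l2_cauchy_schwarz:
  assumes f: "l2 A f" and g: "l2 A g" and s: "((\<lambda>i. f i * g i) has_sum s) A"
  shows "(cmod s)\<^sup>2 \<le> (\<Sum>\<^sub>\<infinity>i\<in>A. (cmod (f i))\<^sup>2) * (\<Sum>\<^sub>\<infinity>i\<in>A. (cmod (g i))\<^sup>2)"
proof (rule tendsto_upperbound)
  show "((\<lambda>F. (cmod (\<Sum>i\<in>F. f i * g i))\<^sup>2) \<longlongrightarrow> (cmod s)\<^sup>2) (finite_subsets_at_top A)"
    using s unfolding has_sum_def by (intro tendsto_power tendsto_norm)
  show "\<forall>\<^sub>F F in finite_subsets_at_top A. (cmod (\<Sum>i\<in>F. f i * g i))\<^sup>2 \<le>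
      (\<Sum>\<^sub>\<infinity>i\<in>A. (cmod (f i))\<^sup>2) * (\<Sum>\<^sub>\<infinity>i\<in>A. (cmod (g i))\<^sup>2)"
  proof (rule eventually_finite_subsets_at_top_weakI)
    fix F assume F: "finite F" "F \<subseteq> A"
    have "(cmod (\<Sum>i\<in>F. f i * g i))\<^sup>2 \<le> (\<Sum>i\<in>F. cmod (f i) * cmod (g i))\<^sup>2"
      by (intro power_mono norm_ge_zero order_trans[OF norm_sum]) (simp add: norm_mult)
    also have "\<dots> \<le> (\<Sum>i\<in>F. (cmod (f i))\<^sup>2) * (\<Sum>i\<in>F. (cmod (g i))\<^sup>2)"
      by (rule Cauchy_Schwarz_ineq_sum)
    also have "\<dots> \<le> (\<Sum>\<^sub>\<infinity>i\<in>A. (cmod (f i))\<^sup>2) * (\<Sum>\<^sub>\<infinity>i\<in>A. (cmod (g i))\<^sup>2)"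
      using f g F unfolding l2_def
      by (intro mult_mono finite_sum_le_infsum sum_nonneg infsum_nonneg) auto
    finally show "(cmod (\<Sum>i\<in>F. f i * g i))\<^sup>2 \<le> (\<Sum>\<^sub>\<infinity>i\<in>A. (cmod (f i))\<^sup>2) * (\<Sum>\<^sub>\<infinity>i\<in>A. (cmod (g i))\<^sup>2)" .
  qed
qed simp

text \<open>
  The inner product of the elementary tensors \<open>x\<^sub>1 \<otimes> \<dots> \<otimes> x\<^sub>n\<close> and \<open>y\<^sub>1 \<otimes> \<dots> \<otimes> y\<^sub>n\<close>; tensors of
  different degree are orthogonal.
\<close>

fun iplist :: "('v, 'z) hspace_scheme \<Rightarrow> 'v list \<Rightarrow> 'v list \<Rightarrow> complex" where
  "iplist H [] [] = 1"
| "iplist H (x # xs) (y # ys) = ip H x y * iplist H xs ys"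
| "iplist H _ _ = 0"

lemma iplist_eq_prod: "length xs = length ys \<Longrightarrow> iplist H xs ys = (\<Prod>i<length xs. ip H (xs ! i) (ys ! i))"
  by (induction xs ys rule: list_induct2) (auto simp: prod.lessThan_Suc_shift simp del: prod.lessThan_Suc)

definition lists_of :: "'v set \<Rightarrow> nat \<Rightarrow> 'v list set" where
  "lists_of B n = {xs \<in> lists B. length xs = n}"

lemma lists_of_0: "lists_of B 0 = {[]}"
  by (auto simp: lists_of_def)
lemma bij_Cons_lists_of: "bij_betw (\<lambda>(x, xs). x # xs) (B \<times> lists_of B n) (lists_of B (Suc n))"
  unfolding bij_betw_def inj_on_def lists_of_def by (auto simp: image_iff length_Suc_conv)

text \<open>
  The elements of the Fock space are such functionals which in addition are square summable over
  the lists of basis vectors. The algebraic part is separated, because binomial theorem and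
  polarization need nothing else.
\<close>

definition form :: "('v::ab_group_add) hspace \<Rightarrow> ('v list \<Rightarrow> complex) \<Rightarrow> bool" where
  "form H \<psi> \<longleftrightarrow>
     (\<forall>xs ys. mset xs = mset ys \<longrightarrow> \<psi> xs = \<psi> ys) \<and>
     (\<forall>x\<in>car H. \<forall>y\<in>car H. \<forall>xs\<in>lists (car H). \<psi> ((x + y) # xs) = \<psi> (x # xs) + \<psi> (y # xs)) \<and>
     (\<forall>c. \<forall>x\<in>car H. \<forall>xs\<in>lists (car H). \<psi> (smul H c x # xs) = cnj c * \<psi> (x # xs)) \<and>
     (\<forall>n. \<exists>M. \<forall>xs\<in>lists (car H). length xs = n \<longrightarrow> cmod (\<psi> xs) \<le> M * prod_list (map (hnorm H) xs))"

lemma form_sym: "form H \<psi> \<Longrightarrow> mset xs = mset ys \<Longrightarrow> \<psi> xs = \<psi> ys"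
  and form_add: "form H \<psi> \<Longrightarrow> x \<in> car H \<Longrightarrow> y \<in> car H \<Longrightarrow> xs \<in> lists (car H) \<Longrightarrow> \<psi> ((x + y) # xs) = \<psi> (x # xs) + \<psi> (y # xs)"
  and form_scale: "form H \<psi> \<Longrightarrow> x \<in> car H \<Longrightarrow> xs \<in> lists (car H) \<Longrightarrow> \<psi> (smul H c x # xs) = cnj c * \<psi> (x # xs)"
  unfolding form_def by blast+

lemma fock_carrier_iff:
  "\<psi> \<in> fock_carrier H \<longleftrightarrow> form H \<psi> \<and> (\<forall>xs. xs \<notin> lists (car H) \<longrightarrow> \<psi> xs = 0) \<and> l2 (lists (onb H)) \<psi>"
  unfolding fock_carrier_def form_def l2_def mem_Collect_eq by (simp only: conj_ac)

context hilbert begin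

lemma prod_hnorm_nonneg: "xs \<in> lists (car H) \<Longrightarrow> prod_list (map (hnorm H) xs) \<ge> 0"
  by (induction xs) auto

lemma form_bound:
  assumes "form H \<psi>"
  obtains M where "M \<ge> 0" "\<And>xs. xs \<in> lists (car H) \<Longrightarrow> length xs = n \<Longrightarrow> cmod (\<psi> xs) \<le> M * prod_list (map (hnorm H) xs)"
proof -
  obtain M where M: "\<forall>xs\<in>lists (car H). length xs = n \<longrightarrow> cmod (\<psi> xs) \<le> M * prod_list (map (hnorm H) xs)"
    using assms unfolding form_def by blast
  have "cmod (\<psi> xs) \<le> \<bar>M\<bar> * prod_list (map (hnorm H) xs)" if "xs \<in> lists (car H)" "length xs = n" for xs
    using M that mult_right_mono[OF abs_ge_self[of M] prod_hnorm_nonneg[OF that(1)]] by fastforce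
  then show thesis using that[of "\<bar>M\<bar>"] by auto
qed

lemma form_Cons:
  assumes \<psi>: "form H \<psi>" and x: "x \<in> car H" shows "form H (\<lambda>xs. \<psi> (x # xs))"
proof -
  have sw: "\<psi> (a # b # xs) = \<psi> (b # a # xs)" for a b xs by (rule form_sym[OF \<psi>]) simp
  have bd: "\<exists>M. \<forall>xs\<in>lists (car H). length xs = n \<longrightarrow> cmod (\<psi> (x # xs)) \<le> M * prod_list (map (hnorm H) xs)" for n
  proof -
    obtain M where M: "\<And>xs. xs \<in> lists (car H) \<Longrightarrow> length xs = Suc n \<Longrightarrow> cmod (\<psi> xs) \<le> M * prod_list (map (hnorm H) xs)"
      using form_bound[OF \<psi>, of "Suc n"] by metis
    have "cmod (\<psi> (x # xs)) \<le> M * prod_list (map (hnorm H) (x # xs))" if "xs \<in> lists (car H)" "length xs = n" for xs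
      using that x by (intro M) auto
    then show ?thesis by (intro exI[of _ "M * hnorm H x"]) (auto simp: mult.assoc)
  qed
  show ?thesis
    unfolding form_def
  proof (intro conjI allI ballI impI bd)
    show "\<psi> (x # xs) = \<psi> (x # ys)" if "mset xs = mset ys" for xs ys using that by (intro form_sym[OF \<psi>]) simp
  qed (use x in \<open>auto simp: sw[of x] form_add[OF \<psi>] form_scale[OF \<psi>]\<close>)
qed

text \<open>
  A maximal orthonormal set is total, since otherwise a normalized vector of its orthogonal
  complement could be added.
\<close>

lemma ex_onb: "\<exists>B. is_onb H B"
proof -
  let ?O = "{B. B \<subseteq> car H \<and> (\<forall>u\<in>B. \<forall>v\<in>B. ip H u v = (if u = v then 1 else 0))}"
  have "\<exists>M\<in>?O. \<forall>X\<in>?O. M \<subseteq> X \<longrightarrow> X = M"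
  proof (rule subset_Zorn_nonempty)
    fix C assume C: "C \<noteq> {}" "subset.chain ?O C"
    show "\<Union> C \<in> ?O"
    proof (intro CollectI conjI ballI)
      show "\<Union> C \<subseteq> car H" using C by (auto simp: subset.chain_def)
      fix u v assume "u \<in> \<Union> C" "v \<in> \<Union> C"
      then obtain X Y where XY: "X \<in> C" "Y \<in> C" "u \<in> X" "v \<in> Y" by auto
      then have "X \<subseteq> Y \<or> Y \<subseteq> X" using C unfolding subset_chain_def by blast
      then obtain Z where Z: "Z \<in> C" "u \<in> Z" "v \<in> Z" using XY by blast
      then have "Z \<in> ?O" using C by (auto simp: subset.chain_def)
      then show "ip H u v = (if u = v then 1 else 0)" using Z by blast
    qed
  next
    have "{} \<in> ?O" by simp
    then show "?O \<noteq> {}" by blast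
  qed
  then obtain B where B: "B \<in> ?O" and max: "\<forall>X\<in>?O. B \<subseteq> X \<longrightarrow> X = B" by (elim bexE)
  have "hclosure H (vs.span B) = car H"
  proof (rule total_if_orth)
    fix v assume v: "v \<in> car H" "\<And>u. u \<in> B \<Longrightarrow> ip H u v = 0"
    show "v = 0"
    proof (rule ccontr)
      assume "v \<noteq> 0"
      then have n: "hnorm H v > 0" using hnorm_eq_zero[OF v(1)] hnorm_nonneg[OF v(1)] by linarith
      define w where "w = smul H (complex_of_real (1 / hnorm H v)) v"
      have w: "w \<in> car H" "hnorm H w = 1" using v n by (auto simp: w_def hnorm_scale norm_divide)
      have 1: "ip H w w = 1" using w by (simp add: ip_self)
      have 2: "ip H u w = 0" if "u \<in> B" for u using v that B by (auto simp: w_def ip_scale)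
      have 3: "ip H w u = 0" if "u \<in> B" for u using 2[OF that] w B that by (subst ip_cnj) auto
      have i: "insert w B \<in> ?O" using B w 1 2 3 by force
      then have "insert w B = B" using bspec[OF max i] by blast
      then have "w \<in> B" by blast
      then show False using 1 2 by force
    qed
  qed (use B in auto)
  then have "is_onb H B" using B by (auto simp: is_onb_def)
  then show ?thesis ..
qed

lemma onb: "is_onb H (onb H)"
  unfolding onb_def using ex_onb by (rule someI_ex)
lemma onb_car: "onb H \<subseteq> car H"
  using onb by (simp add: is_onb_def)
lemma onb_ip: "b \<in> onb H \<Longrightarrow> c \<in> onb H \<Longrightarrow> ip H b c = (if b = c then 1 else 0)"
  using onb by (simp add: is_onb_def)
lemma onb_total: "hclosure H (vs.span (onb H)) = car H"
  using onb by (simp add: is_onb_def)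
lemma lists_onb_car: "bs \<in> lists (onb H) \<Longrightarrow> bs \<in> lists (car H)"
  using lists_mono[OF onb_car] by (rule subsetD)

definition onb_part :: "'a set \<Rightarrow> 'a \<Rightarrow> 'a" where
  "onb_part F x = (\<Sum>b\<in>F. smul H (ip H b x) b)"

lemma onb_part_car: "F \<subseteq> onb H \<Longrightarrow> onb_part F x \<in> car H"
  unfolding onb_part_def using onb_car by (intro sum_car scale_car) auto

lemma ip_onb_part: "finite F \<Longrightarrow> F \<subseteq> onb H \<Longrightarrow> x \<in> car H \<Longrightarrow> b \<in> F \<Longrightarrow> ip H b (onb_part F x) = ip H b x"
proof -
  assume a: "finite F" "F \<subseteq> onb H" "x \<in> car H" "b \<in> F"
  have "ip H b (onb_part F x) = (\<Sum>c\<in>F. ip H b (smul H (ip H c x) c))"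
    unfolding onb_part_def by (rule ip_sum) (use a onb_car in auto)
  also have "\<dots> = (\<Sum>c\<in>F. if b = c then ip H c x else 0)"
    using a onb_car onb_ip by (intro sum.cong) (auto simp: ip_scale subset_iff)
  finally show ?thesis using a by simp
qed

lemma ip_onb_part_eq: "finite F \<Longrightarrow> F \<subseteq> onb H \<Longrightarrow> x \<in> car H \<Longrightarrow> y \<in> car H \<Longrightarrow>
    ip H y (onb_part F x) = (\<Sum>b\<in>F. ip H y b * ip H b x)"
proof -
  assume a: "finite F" "F \<subseteq> onb H" "x \<in> car H" "y \<in> car H"
  have "ip H y (onb_part F x) = (\<Sum>c\<in>F. ip H y (smul H (ip H c x) c))"
    unfolding onb_part_def by (rule ip_sum) (use a onb_car in auto)
  then show ?thesis using a onb_car by (simp add: ip_scale subset_iff mult.commute)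
qed

lemma span_finite_support: "y \<in> vs.span B \<Longrightarrow> \<exists>F. finite F \<and> F \<subseteq> B \<and> y \<in> vs.span F"
proof (induction rule: vs.span_induct_alt)
  case base then show ?case by (intro exI[of _ "{}"]) auto
next
  case (step c b y)
  then obtain F where F: "finite F" "F \<subseteq> B" "y \<in> vs.span F" by auto
  have "smul H c b + y \<in> vs.span (insert b F)"
    by (intro vs.span_add vs.span_scale vs.span_base subsetD[OF vs.span_mono F(3)]) auto
  then show ?case using F step by (intro exI[of _ "insert b F"]) auto
qed

text \<open>
  The partial sum of the Fourier series is the nearest point in the span of finitely many basis
  vectors. With totality of the basis this gives convergence of the series.
\<close>

lemma onb_part_best:
  assumes F: "finite F" "F \<subseteq> onb H" and x: "x \<in> car H" and y: "y \<in> vs.span F"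
  shows "hnorm H (x - onb_part F x) \<le> hnorm H (x - y)"
proof -
  have p: "onb_part F x \<in> car H" using onb_part_car F by auto
  have Fc: "F \<subseteq> car H" using F onb_car by auto
  have yc: "y \<in> car H" using y span_car[OF Fc] by auto
  have "onb_part F x \<in> vs.span F"
    unfolding onb_part_def by (intro vs.span_sum vs.span_scale vs.span_base)
  then have d: "onb_part F x - y \<in> vs.span F" using y vs.span_diff by auto
  have "ip H (onb_part F x - y) (x - onb_part F x) = 0"
    by (rule orth_span[OF Fc _ _ d]) (use p x F Fc in \<open>auto simp: ip_diff ip_onb_part\<close>)
  then have z: "ip H (x - onb_part F x) (onb_part F x - y) = 0"
    using p x yc by (subst ip_cnj) auto
  have "x - y = (x - onb_part F x) + (onb_part F x - y)" by simp
  then have "(hnorm H (x - y))\<^sup>2 = (hnorm H (x - onb_part F x))\<^sup>2 + (hnorm H (onb_part F x - y))\<^sup>2"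
    using hnorm_sq_add[of "x - onb_part F x" "onb_part F x - y"] z p x yc by simp
  then have "(hnorm H (x - onb_part F x))\<^sup>2 \<le> (hnorm H (x - y))\<^sup>2" by simp
  then show ?thesis by (rule power2_le_imp_le) (use x yc in simp)
qed

lemma parseval:
  assumes x: "x \<in> car H" and y: "y \<in> car H"
  shows "((\<lambda>b. ip H x b * ip H b y) has_sum ip H x y) (onb H)"
  unfolding has_sum_def
proof (rule tendstoI)
  fix e :: real assume e: "e > 0"
  define e' where "e' = e / (hnorm H x + 1)"
  have e': "e' > 0" using e x by (simp add: e'_def add_nonneg_pos)
  have "y \<in> hclosure H (vs.span (onb H))" using onb_total y by simp
  then obtain z where z: "z \<in> vs.span (onb H)" "hnorm H (y - z) < e'" using e' by (auto simp: hclosure_def)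
  obtain F0 where F0: "finite F0" "F0 \<subseteq> onb H" "z \<in> vs.span F0" using span_finite_support[OF z(1)] by auto
  show "\<forall>\<^sub>F F in finite_subsets_at_top (onb H). dist (\<Sum>b\<in>F. ip H x b * ip H b y) (ip H x y) < e"
    unfolding eventually_finite_subsets_at_top
  proof (intro exI[of _ F0] conjI allI impI F0(1,2))
    fix F assume F: "finite F \<and> F0 \<subseteq> F \<and> F \<subseteq> onb H"
    have p: "onb_part F y \<in> car H" using onb_part_car F by auto
    have "hnorm H (y - onb_part F y) \<le> hnorm H (y - z)"
      using F F0(3) vs.span_mono[of F0 F] by (intro onb_part_best y) auto
    then have lt: "hnorm H (y - onb_part F y) < e'" using z by simp
    have "dist (\<Sum>b\<in>F. ip H x b * ip H b y) (ip H x y) = cmod (ip H x (y - onb_part F y))"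
      using F x y p by (simp add: ip_diff ip_onb_part_eq dist_norm norm_minus_commute)
    also have "\<dots> \<le> hnorm H x * hnorm H (y - onb_part F y)" using x y p by (intro cauchy_schwarz) auto
    also have "\<dots> \<le> hnorm H x * e'" using lt x by (intro mult_left_mono) auto
    also have "\<dots> < (hnorm H x + 1) * e'" using e' by (simp add: distrib_right)
    also have "\<dots> = e" using add_nonneg_pos[OF hnorm_nonneg[OF x] zero_less_one] by (simp add: e'_def)
    finally show "dist (\<Sum>b\<in>F. ip H x b * ip H b y) (ip H x y) < e" .
  qed
qed

lemma parseval_norm:
  assumes x: "x \<in> car H" shows "((\<lambda>b. (cmod (ip H x b))\<^sup>2) has_sum (hnorm H x)\<^sup>2) (onb H)"
proof -
  have "((\<lambda>b. complex_of_real ((cmod (ip H x b))\<^sup>2)) has_sum complex_of_real ((hnorm H x)\<^sup>2)) (onb H)"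
    using parseval[OF x x]
  proof (subst ip_self[OF x, symmetric], elim has_sum_cong[THEN iffD1, rotated])
    fix b assume "b \<in> onb H"
    then have "ip H b x = cnj (ip H x b)" using x onb_car by (intro ip_cnj) auto
    then show "ip H x b * ip H b x = complex_of_real ((cmod (ip H x b))\<^sup>2)"
      using complex_norm_square[of "ip H x b"] by simp
  qed
  from has_sum_Re[OF this] show ?thesis by simp
qed

text \<open>
  A bounded antilinear functional is \<open>\<langle>\<cdot>, w\<rangle>\<close> for a vector \<open>w\<close>, so this is Parseval's identity.
\<close>

lemma antilinear_expansion:
  assumes L: "\<And>x y. x \<in> car H \<Longrightarrow> y \<in> car H \<Longrightarrow> L (x + y) = L x + L y"
    "\<And>c x. x \<in> car H \<Longrightarrow> L (smul H c x) = cnj c * L x" "\<And>x. x \<in> car H \<Longrightarrow> cmod (L x) \<le> M * hnorm H x"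
    and x: "x \<in> car H"
  shows "((\<lambda>b. ip H x b * L b) has_sum L x) (onb H)"
proof -
  obtain w where w: "w \<in> car H" "\<And>v. v \<in> car H \<Longrightarrow> cnj (L v) = ip H w v"
    by (rule riesz[of "\<lambda>v. cnj (L v)" M]) (use L in auto)
  have e: "L v = ip H v w" if "v \<in> car H" for v
    using w(2)[OF that] ip_cnj[OF w(1) that] by (metis complex_cnj_cnj)
  have "((\<lambda>b. ip H x b * ip H b w) has_sum ip H x w) (onb H)" by (rule parseval[OF x w(1)])
  then show ?thesis
    unfolding e[OF x] by (elim has_sum_cong[THEN iffD1, rotated]) (use e onb_car in auto)
qed

lemma has_sum_lists_of_Suc:
  "(f has_sum s) (lists_of B (Suc n)) \<longleftrightarrow> ((\<lambda>(x, xs). f (x # xs)) has_sum s) (B \<times> lists_of B n)"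
  using has_sum_reindex_bij_betw[OF bij_Cons_lists_of, where f = f and S = s] by (simp add: case_prod_unfold)
lemma summable_lists_of_Suc:
  "f summable_on (lists_of B (Suc n)) \<longleftrightarrow> (\<lambda>(x, xs). f (x # xs)) summable_on (B \<times> lists_of B n)"
  using summable_on_reindex_bij_betw[OF bij_Cons_lists_of, where f = f] by (simp add: case_prod_unfold)

lemma iplist_norm_has_sum:
  "xs \<in> lists (car H) \<Longrightarrow> ((\<lambda>bs. (cmod (iplist H xs bs))\<^sup>2) has_sum (prod_list (map (hnorm H) xs))\<^sup>2) (lists_of (onb H) (length xs))"
proof (induction xs)
  case Nil
  then show ?case using has_sum_finite[of "{[]}" "\<lambda>bs. (cmod (iplist H [] bs))\<^sup>2"] by (simp add: lists_of_0)
next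
  case (Cons x xs)
  let ?n = "length xs" and ?f = "\<lambda>(b, bs). (cmod (ip H x b * iplist H xs bs))\<^sup>2"
  have x: "x \<in> car H" using Cons by auto
  have 1: "((\<lambda>bs. ?f (b, bs)) has_sum (cmod (ip H x b))\<^sup>2 * (prod_list (map (hnorm H) xs))\<^sup>2) (lists_of (onb H) ?n)" for b
    using has_sum_cmult_right[OF Cons.IH, of "(cmod (ip H x b))\<^sup>2"] Cons.prems by (simp add: norm_mult power_mult_distrib)
  have 2: "((\<lambda>b. (cmod (ip H x b))\<^sup>2 * (prod_list (map (hnorm H) xs))\<^sup>2) has_sum
      (hnorm H x)\<^sup>2 * (prod_list (map (hnorm H) xs))\<^sup>2) (onb H)"
    by (rule has_sum_cmult_left[OF parseval_norm[OF x]])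
  have "?f summable_on (onb H \<times> lists_of (onb H) ?n)"
    by (rule summable_on_SigmaI[OF 1]) (use 2 has_sum_imp_summable in auto)
  from has_sum_SigmaI[OF 1 2 this] show ?case
    by (simp add: has_sum_lists_of_Suc power_mult_distrib case_prod_unfold)
qed

text \<open>
  A square summable functional is determined by its values on basis vectors. The induction expands
  the first argument; summation over a product set is allowed because both factors of the summand
  are square summable.
\<close>

lemma form_expansion:
  assumes "form H \<psi>" "l2 (lists_of (onb H) n) \<psi>" "xs \<in> lists (car H)" "length xs = n"
  shows "((\<lambda>bs. iplist H xs bs * \<psi> bs) has_sum \<psi> xs) (lists_of (onb H) n)"
  using assms
proof (induction n arbitrary: \<psi> xs)
  case 0
  then show ?case using has_sum_finite[of "{[]}" "\<lambda>bs. iplist H xs bs * \<psi> bs"] by (simp add: lists_of_0)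
next
  case (Suc n)
  obtain x xs' where xs: "xs = x # xs'" "x \<in> car H" "xs' \<in> lists (car H)" "length xs' = n"
    using Suc.prems(3,4) by (cases xs) auto
  have s2: "(\<lambda>(b, bs). (cmod (\<psi> (b # bs)))\<^sup>2) summable_on (onb H \<times> lists_of (onb H) n)"
    using Suc.prems(2) unfolding l2_def by (simp add: summable_lists_of_Suc)
  have l2b: "l2 (lists_of (onb H) n) (\<lambda>bs. \<psi> (b # bs))" if b: "b \<in> onb H" for b
  proof -
    have "(\<lambda>(b, bs). (cmod (\<psi> (b # bs)))\<^sup>2) summable_on ((\<lambda>bs. (b, bs)) ` lists_of (onb H) n)"
      by (rule summable_on_subset_banach[OF s2]) (use b in auto)
    then show ?thesis unfolding l2_def by (subst (asm) summable_on_reindex) (auto simp: inj_on_def comp_def)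
  qed
  have 1: "((\<lambda>bs. (\<lambda>(b, bs). iplist H xs (b # bs) * \<psi> (b # bs)) (b, bs)) has_sum ip H x b * \<psi> (b # xs')) (lists_of (onb H) n)"
    if b: "b \<in> onb H" for b
    using has_sum_cmult_right[OF Suc.IH[OF form_Cons[OF Suc.prems(1)] l2b[OF b] xs(3,4)], of "ip H x b"] b onb_car
    by (auto simp: xs(1) mult.assoc)
  obtain M where M: "\<And>ys. ys \<in> lists (car H) \<Longrightarrow> length ys = Suc n \<Longrightarrow> cmod (\<psi> ys) \<le> M * prod_list (map (hnorm H) ys)"
    using form_bound[OF Suc.prems(1), of "Suc n"] by metis
  have 2: "((\<lambda>b. ip H x b * \<psi> (b # xs')) has_sum \<psi> (x # xs')) (onb H)"
  proof (rule antilinear_expansion[where M = "M * prod_list (map (hnorm H) xs')"])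
    fix y assume "y \<in> car H"
    then show "cmod (\<psi> (y # xs')) \<le> M * prod_list (map (hnorm H) xs') * hnorm H y"
      using M[of "y # xs'"] xs by (simp add: mult_ac)
  qed (use xs form_add[OF Suc.prems(1)] form_scale[OF Suc.prems(1)] in auto)
  have "l2 (lists_of (onb H) (Suc n)) (iplist H xs)"
    using iplist_norm_has_sum[OF Suc.prems(3)] has_sum_imp_summable unfolding l2_def Suc.prems(4) by blast
  then have "(\<lambda>bs. iplist H xs bs * \<psi> bs) summable_on (lists_of (onb H) (Suc n))"
    using Suc.prems(2) by (rule l2_mult_summable)
  then have "(\<lambda>(b, bs). iplist H xs (b # bs) * \<psi> (b # bs)) summable_on (onb H \<times> lists_of (onb H) n)"
    by (simp add: summable_lists_of_Suc)
  from has_sum_SigmaI[OF 1 2 this] show ?case by (simp add: has_sum_lists_of_Suc xs(1))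
qed

lemma l2_subset: "l2 A f \<Longrightarrow> B \<subseteq> A \<Longrightarrow> l2 B f"
  unfolding l2_def by (rule summable_on_subset_banach)

text \<open>
  Evaluation at a list of vectors is continuous in the Fock norm. Thus norm limits are pointwise
  limits, from which completeness of the Fock space is obtained.
\<close>

lemma form_le_l2:
  assumes \<psi>: "form H \<psi>" "l2 (lists (onb H)) \<psi>" and xs: "xs \<in> lists (car H)"
  shows "cmod (\<psi> xs) \<le> sqrt (\<Sum>\<^sub>\<infinity>bs\<in>lists (onb H). (cmod (\<psi> bs))\<^sup>2) * prod_list (map (hnorm H) xs)"
proof -
  let ?L = "lists_of (onb H) (length xs)"
  have sub: "?L \<subseteq> lists (onb H)" by (auto simp: lists_of_def)
  have l2: "l2 ?L \<psi>" using \<psi>(2) sub l2_subset by blast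
  have w: "l2 ?L (iplist H xs)"
    using iplist_norm_has_sum[OF xs] has_sum_imp_summable unfolding l2_def by blast
  have "(cmod (\<psi> xs))\<^sup>2 \<le> (\<Sum>\<^sub>\<infinity>bs\<in>?L. (cmod (iplist H xs bs))\<^sup>2) * (\<Sum>\<^sub>\<infinity>bs\<in>?L. (cmod (\<psi> bs))\<^sup>2)"
    by (rule l2_cauchy_schwarz[OF w l2 form_expansion[OF \<psi>(1) l2 xs refl]])
  also have "\<dots> = (prod_list (map (hnorm H) xs))\<^sup>2 * (\<Sum>\<^sub>\<infinity>bs\<in>?L. (cmod (\<psi> bs))\<^sup>2)"
    using infsumI[OF iplist_norm_has_sum[OF xs]] by simp
  also have "\<dots> \<le> (prod_list (map (hnorm H) xs))\<^sup>2 * (\<Sum>\<^sub>\<infinity>bs\<in>lists (onb H). (cmod (\<psi> bs))\<^sup>2)"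
    using l2 \<psi>(2) sub unfolding l2_def by (intro mult_left_mono infsum_mono_neutral) auto
  also have "\<dots> = (sqrt (\<Sum>\<^sub>\<infinity>bs\<in>lists (onb H). (cmod (\<psi> bs))\<^sup>2) * prod_list (map (hnorm H) xs))\<^sup>2"
    by (simp add: power_mult_distrib infsum_nonneg mult.commute)
  finally show ?thesis
    by (rule power2_le_imp_le) (use prod_hnorm_nonneg[OF xs] in \<open>simp add: infsum_nonneg\<close>)
qed

end

lemma form_plus: assumes "form H \<psi>" "form H \<phi>" shows "form H (\<psi> + \<phi>)"
proof -
  have bd: "\<exists>M. \<forall>xs\<in>lists (car H). length xs = n \<longrightarrow> cmod ((\<psi> + \<phi>) xs) \<le> M * prod_list (map (hnorm H) xs)" for n
  proof -
    obtain M where M: "\<forall>xs\<in>lists (car H). length xs = n \<longrightarrow> cmod (\<psi> xs) \<le> M * prod_list (map (hnorm H) xs)"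
      using assms(1) unfolding form_def by meson
    obtain N where N: "\<forall>xs\<in>lists (car H). length xs = n \<longrightarrow> cmod (\<phi> xs) \<le> N * prod_list (map (hnorm H) xs)"
      using assms(2) unfolding form_def by meson
    have "cmod ((\<psi> + \<phi>) xs) \<le> (M + N) * prod_list (map (hnorm H) xs)" if xs: "xs \<in> lists (car H)" "length xs = n" for xs
      using norm_triangle_ineq[of "\<psi> xs" "\<phi> xs"] M[rule_format, OF xs] N[rule_format, OF xs]
      by (simp add: distrib_right)
    then show ?thesis by blast
  qed
  have sy: "(\<psi> + \<phi>) xs = (\<psi> + \<phi>) ys" if "mset xs = mset ys" for xs ys
    using form_sym[OF assms(1) that] form_sym[OF assms(2) that] by simp
  have ad: "(\<psi> + \<phi>) ((x + y) # xs) = (\<psi> + \<phi>) (x # xs) + (\<psi> + \<phi>) (y # xs)"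
    if "x \<in> car H" "y \<in> car H" "xs \<in> lists (car H)" for x y xs
    using form_add[OF assms(1) that] form_add[OF assms(2) that] by simp
  have sc: "(\<psi> + \<phi>) (smul H c x # xs) = cnj c * (\<psi> + \<phi>) (x # xs)"
    if "x \<in> car H" "xs \<in> lists (car H)" for x xs c
    using form_scale[OF assms(1) that, of c] form_scale[OF assms(2) that, of c] by (simp add: distrib_left)
  show ?thesis
    unfolding form_def by (intro conjI allI ballI impI bd sy ad sc)
qed

lemma form_smul: assumes "form H \<psi>" shows "form H (\<lambda>xs. c * \<psi> xs)"
proof -
  have bd: "\<exists>M. \<forall>xs\<in>lists (car H). length xs = n \<longrightarrow> cmod (c * \<psi> xs) \<le> M * prod_list (map (hnorm H) xs)" for n
  proof -
    obtain M where M: "\<forall>xs\<in>lists (car H). length xs = n \<longrightarrow> cmod (\<psi> xs) \<le> M * prod_list (map (hnorm H) xs)"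
      using assms unfolding form_def by meson
    have "cmod (c * \<psi> xs) \<le> (cmod c * M) * prod_list (map (hnorm H) xs)" if "xs \<in> lists (car H)" "length xs = n" for xs
      unfolding norm_mult mult.assoc using M that by (intro mult_left_mono) auto
    then show ?thesis by blast
  qed
  have ad: "c * \<psi> ((x + y) # xs) = c * \<psi> (x # xs) + c * \<psi> (y # xs)"
    if "x \<in> car H" "y \<in> car H" "xs \<in> lists (car H)" for x y xs
    using form_add[OF assms that] by (simp add: distrib_left)
  have sc: "c * \<psi> (smul H d x # xs) = cnj d * (c * \<psi> (x # xs))"
    if "x \<in> car H" "xs \<in> lists (car H)" for x xs d
    using form_scale[OF assms that, of d] by simp
  show ?thesis
    unfolding form_def by (intro conjI allI ballI impI bd ad sc arg_cong[of _ _ "(*) c"] form_sym[OF assms])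
qed

lemma form_zero: "form H (\<lambda>_. 0)"
  unfolding form_def by (auto intro: exI[of _ 0])

lemma sym_fock_sel [simp]:
  "car (sym_fock H) = fock_carrier H" "smul (sym_fock H) = (\<lambda>c \<psi> xs. c * \<psi> xs)"
  "ip (sym_fock H) = (\<lambda>\<psi> \<phi>. \<Sum>\<^sub>\<infinity>xs\<in>lists (onb H). cnj (\<psi> xs) * \<phi> xs)"
  by (simp_all add: sym_fock_def)

context hilbert begin

lemma fock_l2: "\<psi> \<in> fock_carrier H \<Longrightarrow> l2 (lists (onb H)) \<psi>"
  and fock_form: "\<psi> \<in> fock_carrier H \<Longrightarrow> form H \<psi>"
  and fock_outside: "\<psi> \<in> fock_carrier H \<Longrightarrow> xs \<notin> lists (car H) \<Longrightarrow> \<psi> xs = 0"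
  by (simp_all add: fock_carrier_iff)

lemma fock_ip_summable: "\<psi> \<in> fock_carrier H \<Longrightarrow> \<phi> \<in> fock_carrier H \<Longrightarrow>
    (\<lambda>xs. cnj (\<psi> xs) * \<phi> xs) summable_on lists (onb H)"
  by (rule l2_mult_summable) (simp_all add: fock_l2)

lemma fock_ip_self:
  assumes "\<psi> \<in> fock_carrier H"
  shows "ip (sym_fock H) \<psi> \<psi> = complex_of_real (\<Sum>\<^sub>\<infinity>bs\<in>lists (onb H). (cmod (\<psi> bs))\<^sup>2)"
proof -
  have "((\<lambda>bs. (cmod (\<psi> bs))\<^sup>2) has_sum (\<Sum>\<^sub>\<infinity>bs\<in>lists (onb H). (cmod (\<psi> bs))\<^sup>2)) (lists (onb H))"
    using fock_l2[OF assms] unfolding l2_def by simp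
  then have "((\<lambda>bs. complex_of_real ((cmod (\<psi> bs))\<^sup>2)) has_sum complex_of_real (\<Sum>\<^sub>\<infinity>bs\<in>lists (onb H). (cmod (\<psi> bs))\<^sup>2)) (lists (onb H))"
    by (rule has_sum_of_real)
  moreover have "complex_of_real ((cmod z)\<^sup>2) = cnj z * z" for z
    using complex_norm_square[of z] by (simp add: mult.commute)
  ultimately show ?thesis by (simp only: sym_fock_sel infsumI)
qed

lemma fock_norm: "\<psi> \<in> fock_carrier H \<Longrightarrow> hnorm (sym_fock H) \<psi> = sqrt (\<Sum>\<^sub>\<infinity>bs\<in>lists (onb H). (cmod (\<psi> bs))\<^sup>2)"
  by (simp add: hnorm_def fock_ip_self del: sym_fock_sel)

lemma fock_eval_bound:
  "\<psi> \<in> fock_carrier H \<Longrightarrow> xs \<in> lists (car H) \<Longrightarrow> cmod (\<psi> xs) \<le> hnorm (sym_fock H) \<psi> * prod_list (map (hnorm H) xs)"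
  using form_le_l2[OF fock_form fock_l2] by (simp add: fock_norm)

lemma prehilbert_fock: "prehilbert (sym_fock H)"
proof -
  have v: "vector_space (smul (sym_fock H))"
    by unfold_locales (auto simp: fun_eq_iff algebra_simps)
  interpret vf: vector_space "smul (sym_fock H)" by (rule v)
  have add: "\<psi> + \<phi> \<in> fock_carrier H" if "\<psi> \<in> fock_carrier H" "\<phi> \<in> fock_carrier H" for \<psi> \<phi>
    using that l2_add[of _ \<psi> \<phi>] form_plus[of H \<psi> \<phi>] unfolding fock_carrier_iff by (auto simp: plus_fun_def)
  have scale: "(\<lambda>xs. c * \<psi> xs) \<in> fock_carrier H" if "\<psi> \<in> fock_carrier H" for c \<psi>
    using that unfolding fock_carrier_iff by (auto simp: form_smul l2_scale)
  have zero: "0 \<in> fock_carrier H"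
    unfolding fock_carrier_iff using form_zero[of H] by (auto simp: l2_def zero_fun_def)
  have sub: "vf.subspace (car (sym_fock H))"
    by (rule vf.subspaceI) (use add scale zero in auto)
  show ?thesis
  proof (intro prehilbert.intro v sub)
    fix u v assume uv: "u \<in> car (sym_fock H)" "v \<in> car (sym_fock H)"
    show "ip (sym_fock H) v u = cnj (ip (sym_fock H) u v)"
      by (simp flip: infsum_cnj add: mult.commute)
    fix w assume w: "w \<in> car (sym_fock H)"
    show "ip (sym_fock H) u (v + w) = ip (sym_fock H) u v + ip (sym_fock H) u w"
      using infsum_add[OF fock_ip_summable[of u v] fock_ip_summable[of u w]] uv w
      by (simp add: distrib_left)
  next
    fix c u v assume "u \<in> car (sym_fock H)" "v \<in> car (sym_fock H)"
    show "ip (sym_fock H) u (smul (sym_fock H) c v) = c * ip (sym_fock H) u v"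
      by (simp flip: infsum_cmult_right' add: mult.left_commute)
  next
    fix u assume u: "u \<in> car (sym_fock H)" "u \<noteq> 0"
    let ?N = "\<Sum>\<^sub>\<infinity>bs\<in>lists (onb H). (cmod (u bs))\<^sup>2"
    have "?N \<noteq> 0"
    proof
      assume "?N = 0"
      then have "u xs = 0" for xs
        using form_le_l2[OF fock_form fock_l2, of u xs] u(1) fock_outside[of u xs]
        by (cases "xs \<in> lists (car H)") auto
      then show False using u(2) by auto
    qed
    moreover have "?N \<ge> 0" by (simp add: infsum_nonneg)
    moreover have "ip (sym_fock H) u u = complex_of_real ?N" using u(1) by (intro fock_ip_self) simp
    ultimately show "0 < Re (ip (sym_fock H) u u)" by (simp del: sym_fock_sel)
  qed
qed

text \<open>
  Completeness. A Cauchy sequence converges pointwise by \<open>fock_eval_bound\<close>. The pointwise limit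
  inherits the defining identities, and Fatou's argument on finite sets of basis lists shows that
  it is square summable and a limit in norm.
\<close>

lemma hilbert_fock: "hilbert (sym_fock H)"
proof -
  interpret F: prehilbert "sym_fock H" by (rule prehilbert_fock)
  note [simp del] = sym_fock_sel(2,3)
  show ?thesis
  proof unfold_locales
    fix s :: "nat \<Rightarrow> 'a list \<Rightarrow> complex"
    assume sc: "\<And>n. s n \<in> car (sym_fock H)"
      and cau: "\<And>e. e > 0 \<Longrightarrow> \<exists>N. \<forall>m\<ge>N. \<forall>n\<ge>N. hnorm (sym_fock H) (s m - s n) < e"
    have sf: "s n \<in> fock_carrier H" for n using sc by simp
    have sd: "s m - s n \<in> fock_carrier H" for m n using F.diff_car[OF sc sc] by simp
    have conv: "convergent (\<lambda>n. s n xs)" for xs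
    proof (cases "xs \<in> lists (car H)")
      case True
      have "Cauchy (\<lambda>n. s n xs)"
        unfolding Cauchy_def
      proof (intro allI impI)
        fix e :: real assume e: "e > 0"
        let ?p = "prod_list (map (hnorm H) xs)"
        have p: "?p + 1 > 0" using prod_hnorm_nonneg[OF True] by simp
        obtain N where N: "\<forall>m\<ge>N. \<forall>n\<ge>N. hnorm (sym_fock H) (s m - s n) < e / (?p + 1)"
          using cau[of "e / (?p + 1)"] e p by auto
        have "dist (s m xs) (s n xs) < e" if "m \<ge> N" "n \<ge> N" for m n
        proof -
          have "dist (s m xs) (s n xs) = cmod ((s m - s n) xs)" by (simp add: dist_norm)
          also have "\<dots> \<le> hnorm (sym_fock H) (s m - s n) * ?p" by (rule fock_eval_bound[OF sd True])
          also have "\<dots> \<le> e / (?p + 1) * ?p"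
            using N that prod_hnorm_nonneg[OF True] by (intro mult_right_mono) (auto simp: less_imp_le)
          also have "\<dots> < e" using e p by (simp add: field_simps)
          finally show ?thesis .
        qed
        then show "\<exists>N. \<forall>m\<ge>N. \<forall>n\<ge>N. dist (s m xs) (s n xs) < e" by blast
      qed
      then show ?thesis by (rule Cauchy_convergent)
    next
      case False
      then show ?thesis using fock_outside[OF sf False] by (simp add: convergent_const)
    qed
    define \<psi> where "\<psi> xs = lim (\<lambda>n. s n xs)" for xs
    have lim: "(\<lambda>n. s n xs) \<longlonglongrightarrow> \<psi> xs" for xs
      using conv[of xs] by (simp add: \<psi>_def convergent_LIMSEQ_iff)
    have outside: "\<psi> xs = 0" if "xs \<notin> lists (car H)" for xs
      using lim[of xs] fock_outside[OF sf that] by (simp add: LIMSEQ_const_iff)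
    have tail: "l2 (lists (onb H)) (\<lambda>xs. s n xs - \<psi> xs) \<and> (\<Sum>\<^sub>\<infinity>bs\<in>lists (onb H). (cmod (s n bs - \<psi> bs))\<^sup>2) \<le> e\<^sup>2"
      if N: "\<forall>m\<ge>N. \<forall>n\<ge>N. hnorm (sym_fock H) (s m - s n) < e" and n: "n \<ge> N" for N n e
    proof -
      have bd: "(\<Sum>bs\<in>F. (cmod (s n bs - \<psi> bs))\<^sup>2) \<le> e\<^sup>2" if F: "finite F" "F \<subseteq> lists (onb H)" for F
      proof (rule LIMSEQ_le_const2)
        show "(\<lambda>m. \<Sum>bs\<in>F. (cmod (s n bs - s m bs))\<^sup>2) \<longlonglongrightarrow> (\<Sum>bs\<in>F. (cmod (s n bs - \<psi> bs))\<^sup>2)"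
          by (intro tendsto_sum tendsto_power tendsto_norm tendsto_diff tendsto_const lim)
        have "(\<Sum>bs\<in>F. (cmod (s n bs - s m bs))\<^sup>2) \<le> e\<^sup>2" if m: "m \<ge> N" for m
        proof -
          have "(\<Sum>bs\<in>F. (cmod ((s n - s m) bs))\<^sup>2) \<le> (\<Sum>\<^sub>\<infinity>bs\<in>lists (onb H). (cmod ((s n - s m) bs))\<^sup>2)"
            using F fock_l2[OF sd] unfolding l2_def by (intro finite_sum_le_infsum) auto
          also have "\<dots> = (hnorm (sym_fock H) (s n - s m))\<^sup>2"
            by (simp add: fock_norm[OF sd] infsum_nonneg)
          also have "\<dots> \<le> e\<^sup>2" using N n m F.hnorm_nonneg[OF F.diff_car[OF sc sc]] by (intro power_mono) (auto intro: less_imp_le)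
          finally show ?thesis by simp
        qed
        then show "\<exists>N. \<forall>m\<ge>N. (\<Sum>bs\<in>F. (cmod (s n bs - s m bs))\<^sup>2) \<le> e\<^sup>2" by blast
      qed
      have "(\<lambda>bs. (cmod (s n bs - \<psi> bs))\<^sup>2) summable_on lists (onb H)"
      proof (rule nonneg_bdd_above_summable_on)
        show "bdd_above (sum (\<lambda>bs. (cmod (s n bs - \<psi> bs))\<^sup>2) ` {F. F \<subseteq> lists (onb H) \<and> finite F})"
          using bd by (intro bdd_aboveI2[of _ _ "e\<^sup>2"]) blast
      qed simp
      then show ?thesis unfolding l2_def by (intro conjI infsum_le_finite_sums bd)
    qed
    obtain N1 where N1: "\<forall>m\<ge>N1. \<forall>n\<ge>N1. hnorm (sym_fock H) (s m - s n) < 1" using cau[of 1] by auto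
    have "l2 (lists (onb H)) (\<lambda>xs. s N1 xs + (-1) * (s N1 xs - \<psi> xs))"
      using tail[OF N1 order_refl] fock_l2[OF sf] by (intro l2_add l2_scale) auto
    then have l2: "l2 (lists (onb H)) \<psi>" by simp
    have "form H \<psi>"
      unfolding form_def
    proof (intro conjI allI ballI impI)
      fix xs ys :: "'a list" assume "mset xs = mset ys"
      then have "s n xs = s n ys" for n by (rule form_sym[OF fock_form[OF sf]])
      then show "\<psi> xs = \<psi> ys" by (simp add: \<psi>_def)
    next
      fix x y xs assume a: "x \<in> car H" "y \<in> car H" "xs \<in> lists (car H)"
      have "(\<lambda>n. s n (x # xs) + s n (y # xs)) \<longlonglongrightarrow> \<psi> (x # xs) + \<psi> (y # xs)" by (intro tendsto_add lim)
      then have "(\<lambda>n. s n ((x + y) # xs)) \<longlonglongrightarrow> \<psi> (x # xs) + \<psi> (y # xs)"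
        using form_add[OF fock_form[OF sf] a] by simp
      then show "\<psi> ((x + y) # xs) = \<psi> (x # xs) + \<psi> (y # xs)" using lim LIMSEQ_unique by blast
    next
      fix c x xs assume a: "x \<in> car H" "xs \<in> lists (car H)"
      have "(\<lambda>n. cnj c * s n (x # xs)) \<longlonglongrightarrow> cnj c * \<psi> (x # xs)" by (intro tendsto_mult tendsto_const lim)
      then have "(\<lambda>n. s n (smul H c x # xs)) \<longlonglongrightarrow> cnj c * \<psi> (x # xs)"
        using form_scale[OF fock_form[OF sf] a] by simp
      then show "\<psi> (smul H c x # xs) = cnj c * \<psi> (x # xs)" using lim LIMSEQ_unique by blast
    next
      fix n
      let ?C = "hnorm (sym_fock H) (s N1) + 1"
      have "cmod (\<psi> xs) \<le> ?C * prod_list (map (hnorm H) xs)" if xs: "xs \<in> lists (car H)" for xs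
      proof (rule LIMSEQ_le_const2)
        show "(\<lambda>n. cmod (s n xs)) \<longlonglongrightarrow> cmod (\<psi> xs)" by (intro tendsto_norm lim)
        have "cmod (s m xs) \<le> ?C * prod_list (map (hnorm H) xs)" if m: "m \<ge> N1" for m
        proof -
          have "hnorm (sym_fock H) (s m) \<le> ?C"
            using F.hnorm_diff_ineq[OF sc sc, of m N1] N1 m by (smt (verit) order_refl)
          then show ?thesis
            using fock_eval_bound[OF sf xs, of m] mult_right_mono[OF _ prod_hnorm_nonneg[OF xs]] by fastforce
        qed
        then show "\<exists>N. \<forall>n\<ge>N. cmod (s n xs) \<le> ?C * prod_list (map (hnorm H) xs)" by blast
      qed
      then show "\<exists>M. \<forall>xs\<in>lists (car H). length xs = n \<longrightarrow> cmod (\<psi> xs) \<le> M * prod_list (map (hnorm H) xs)" by blast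
    qed
    then have \<psi>: "\<psi> \<in> fock_carrier H" unfolding fock_carrier_iff using outside l2 by auto
    have sp: "s n - \<psi> \<in> fock_carrier H" for n using F.diff_car[OF sc, of \<psi> n] \<psi> by simp
    have "(\<lambda>n. hnorm (sym_fock H) (s n - \<psi>)) \<longlonglongrightarrow> 0"
    proof (rule LIMSEQ_I)
      fix r :: real assume "r > 0"
      then have r: "r / 2 > 0" by simp
      obtain N where N: "\<forall>m\<ge>N. \<forall>n\<ge>N. hnorm (sym_fock H) (s m - s n) < r / 2" using cau[OF r] by auto
      have "norm (hnorm (sym_fock H) (s n - \<psi>) - 0) < r" if n: "n \<ge> N" for n
      proof -
        have "hnorm (sym_fock H) (s n - \<psi>) \<le> sqrt ((r / 2)\<^sup>2)"
          unfolding fock_norm[OF sp] by (rule real_sqrt_le_mono) (use tail[OF N n] in simp)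
        then have "hnorm (sym_fock H) (s n - \<psi>) \<le> r / 2" using r by simp
        then show ?thesis using r F.hnorm_nonneg[of "s n - \<psi>"] sp by simp
      qed
      then show "\<exists>no. \<forall>n\<ge>no. norm (hnorm (sym_fock H) (s n - \<psi>) - 0) < r" by blast
    qed
    then show "\<exists>l\<in>car (sym_fock H). (\<lambda>n. hnorm (sym_fock H) (s n - l)) \<longlonglongrightarrow> 0" using \<psi> by auto
  qed
qed

end

section \<open>Permanents and symmetrised tensors\<close>

text \<open>
  The permanent of the matrix of inner products \<open>\<langle>x\<^sub>i, g\<^sub>j\<rangle>\<close>. Up to the factor \<open>n!\<close> it is the value
  of the symmetrised tensor of the \<open>g\<^sub>j\<close>.
\<close>

definition per :: "('v, 'z) hspace_scheme \<Rightarrow> 'v list \<Rightarrow> 'v list \<Rightarrow> complex" where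
  "per H gs xs = (\<Sum>p | p permutes {..<length gs}. iplist H xs (permute_list p gs))"

lemma iplist_length: "length xs \<noteq> length ys \<Longrightarrow> iplist H xs ys = 0"
  by (induction H xs ys rule: iplist.induct) auto
lemma per_length: "length xs \<noteq> length gs \<Longrightarrow> per H gs xs = 0"
  by (simp add: per_def iplist_length)

lemma iplist_permute:
  assumes "length xs = length ys" "p permutes {..<length ys}"
  shows "iplist H (permute_list p xs) (permute_list p ys) = iplist H xs ys"
proof -
  have "iplist H xs ys = (\<Prod>i<length ys. ip H (xs ! i) (ys ! i))"
    using assms by (simp add: iplist_eq_prod)
  also have "\<dots> = (\<Prod>i<length ys. ip H (xs ! p i) (ys ! p i))"
    using prod.permute[OF assms(2)] by (simp add: comp_def)
  also have "\<dots> = (\<Prod>i<length ys. ip H (permute_list p xs ! i) (permute_list p ys ! i))"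
    using assms by (intro prod.cong) (auto simp: permute_list_nth)
  finally show ?thesis using assms by (simp add: iplist_eq_prod)
qed

lemma per_sym_right: assumes "mset xs = mset ys" shows "per H gs xs = per H gs ys"
proof (cases "length xs = length gs")
  case True
  have l: "length ys = length gs" using True mset_eq_length[OF assms] by simp
  obtain q where q: "q permutes {..<length gs}" "permute_list q ys = xs"
    using mset_eq_permutation[OF assms] l by metis
  have "per H gs xs = (\<Sum>p | p permutes {..<length gs}. iplist H xs (permute_list (p \<circ> q) gs))"
    unfolding per_def by (rule sum_permutations_compose_right[OF q(1)])
  also have "\<dots> = (\<Sum>p | p permutes {..<length gs}. iplist H ys (permute_list p gs))"
  proof (rule sum.cong[OF refl])
    fix p assume "p \<in> {p. p permutes {..<length gs}}"
    then have "permute_list (p \<circ> q) gs = permute_list q (permute_list p gs)" by (intro permute_list_compose q)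
    then show "iplist H xs (permute_list (p \<circ> q) gs) = iplist H ys (permute_list p gs)"
      using iplist_permute[of ys "permute_list p gs" q H] q l by simp
  qed
  finally show ?thesis by (simp add: per_def)
next
  case False
  then show ?thesis using mset_eq_length[OF assms] by (simp add: per_length)
qed

lemma per_eq_permute_right: "length xs = length gs \<Longrightarrow>
    per H gs xs = (\<Sum>p | p permutes {..<length gs}. iplist H (permute_list p xs) gs)"
proof -
  assume l: "length xs = length gs"
  have "per H gs xs = (\<Sum>p | p permutes {..<length gs}. iplist H xs (permute_list (inv p) gs))"
    unfolding per_def by (rule sum_permutations_inverse)
  also have "\<dots> = (\<Sum>p | p permutes {..<length gs}. iplist H (permute_list p xs) gs)"
  proof (rule sum.cong[OF refl])
    fix p assume "p \<in> {p. p permutes {..<length gs}}"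
    then have p: "p permutes {..<length gs}" by simp
    have "permute_list p (permute_list (inv p) gs) = gs"
      using permute_list_compose[OF p, of "inv p"] permutes_inv_o(2)[OF p] by simp
    then show "iplist H xs (permute_list (inv p) gs) = iplist H (permute_list p xs) gs"
      using iplist_permute[of xs "permute_list (inv p) gs" p H] l p by simp
  qed
  finally show ?thesis .
qed

lemma per_sym_left: assumes "mset gs = mset hs" shows "per H gs xs = per H hs xs"
proof (cases "length xs = length hs")
  case True
  have l: "length gs = length hs" using mset_eq_length[OF assms] .
  obtain q where q: "q permutes {..<length hs}" "permute_list q hs = gs"
    using mset_eq_permutation[OF assms] by metis
  have "per H gs xs = (\<Sum>p | p permutes {..<length hs}. iplist H (permute_list p xs) gs)"
    using True l by (simp add: per_eq_permute_right)
  also have "\<dots> = (\<Sum>p | p permutes {..<length hs}. iplist H (permute_list (p \<circ> q) xs) gs)"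
    by (rule sum_permutations_compose_right[OF q(1)])
  also have "\<dots> = (\<Sum>p | p permutes {..<length hs}. iplist H (permute_list p xs) hs)"
  proof (rule sum.cong[OF refl])
    fix p
    have "permute_list (p \<circ> q) xs = permute_list q (permute_list p xs)"
      using q(1) True by (intro permute_list_compose) simp
    then show "iplist H (permute_list (p \<circ> q) xs) gs = iplist H (permute_list p xs) hs"
      using iplist_permute[of "permute_list p xs" hs q H] q True by simp
  qed
  finally show ?thesis using True by (simp add: per_eq_permute_right)
next
  case False
  then show ?thesis using mset_eq_length[OF assms] by (simp add: per_length)
qed

lemma iplist_snoc: "length xs = length ys \<Longrightarrow> iplist H (xs @ [x]) (ys @ [y]) = iplist H xs ys * ip H x y"
  by (induction xs ys rule: list_induct2) auto

text \<open>
  Expansion of the permanent along the column of \<open>g\<close>. This is the combinatorial identity behind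
  the action of creation operators on symmetrised tensors.
\<close>

lemma per_Cons:
  assumes l: "length xs = Suc (length gs)"
  shows "per H (g # gs) xs = (\<Sum>j<length xs. ip H (xs ! j) g * per H gs (take j xs @ drop (Suc j) xs))"
proof -
  let ?n = "length gs"
  have ins: "{..<Suc ?n} = insert ?n {..<?n}" by auto
  \<comment> \<open>Permutations of \<open>{..n}\<close> are products of a transposition \<open>(n b)\<close> and a permutation fixing
    \<open>n\<close>. To match, the vector \<open>g\<close> is moved to the last place.\<close>
  have "per H (g # gs) xs = per H (gs @ [g]) xs" by (rule per_sym_left) simp
  also have "\<dots> = (\<Sum>p | p permutes insert ?n {..<?n}. iplist H (permute_list p xs) (gs @ [g]))"
    using l by (subst per_eq_permute_right) (simp_all flip: ins)
  also have "\<dots> = (\<Sum>b\<in>insert ?n {..<?n}. \<Sum>q | q permutes {..<?n}. iplist H (permute_list (Transposition.transpose ?n b \<circ> q) xs) (gs @ [g]))"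
    by (rule sum_over_permutations_insert) auto
  also have "\<dots> = (\<Sum>b\<in>insert ?n {..<?n}. ip H (xs ! b) g * per H gs (take b xs @ drop (Suc b) xs))"
  proof (rule sum.cong[OF refl])
    fix b assume "b \<in> insert ?n {..<?n}"
    then have b: "b < length xs" using l by auto
    have t: "Transposition.transpose ?n b permutes {..<length xs}" using b l by (intro permutes_swap_id) auto
    define ys where "ys = permute_list (Transposition.transpose ?n b) xs"
    have ys: "length ys = Suc ?n" "ys ! ?n = xs ! b" "mset ys = mset xs"
      using l t by (auto simp: ys_def permute_list_nth)
    define zs where "zs = take ?n ys"
    have zs: "ys = zs @ [xs ! b]" "length zs = ?n"
      using ys take_Suc_conv_app_nth[of ?n ys] by (auto simp: zs_def)
    have "xs = take b xs @ xs ! b # drop (Suc b) xs" using b by (simp add: id_take_nth_drop)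
    then have "mset xs = add_mset (xs ! b) (mset (take b xs @ drop (Suc b) xs))"
      by (metis mset.simps(2) mset_append union_mset_add_mset_right)
    then have mz: "mset zs = mset (take b xs @ drop (Suc b) xs)"
      using ys(3) by (simp add: zs(1))
    have "(\<Sum>q | q permutes {..<?n}. iplist H (permute_list (Transposition.transpose ?n b \<circ> q) xs) (gs @ [g]))
        = (\<Sum>q | q permutes {..<?n}. iplist H (permute_list q zs) gs * ip H (xs ! b) g)"
    proof (rule sum.cong[OF refl])
      fix q assume "q \<in> {q. q permutes {..<?n}}"
      then have q: "q permutes {..<?n}" by simp
      then have q': "q permutes {..<length xs}" by (rule permutes_subset) (use l in auto)
      have "permute_list (Transposition.transpose ?n b \<circ> q) xs = permute_list q ys"
        unfolding ys_def by (rule permute_list_compose[OF q'])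
      also have "\<dots> = permute_list q zs @ [xs ! b]"
      proof -
        have "q ?n = ?n" using q by (simp add: permutes_not_in)
        moreover have "(zs @ [xs ! b]) ! q i = zs ! q i" if "i < ?n" for i
          using permutes_in_image[OF q, of i] that zs(2) by (simp add: nth_append)
        moreover have "(zs @ [xs ! b]) ! ?n = xs ! b" using nth_append_length[of zs] zs(2) by metis
        ultimately show ?thesis using zs by (simp add: permute_list_def)
      qed
      finally show "iplist H (permute_list (Transposition.transpose ?n b \<circ> q) xs) (gs @ [g]) = iplist H (permute_list q zs) gs * ip H (xs ! b) g"
        using zs by (simp add: iplist_snoc)
    qed
    also have "\<dots> = ip H (xs ! b) g * per H gs zs"
      using zs(2) by (simp add: per_eq_permute_right sum_distrib_left mult.commute)
    also have "per H gs zs = per H gs (take b xs @ drop (Suc b) xs)" by (rule per_sym_right[OF mz])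
    finally show "(\<Sum>q | q permutes {..<?n}. iplist H (permute_list (Transposition.transpose ?n b \<circ> q) xs) (gs @ [g]))
      = ip H (xs ! b) g * per H gs (take b xs @ drop (Suc b) xs)" .
  qed
  finally show ?thesis using l by (simp flip: ins)
qed

lemma sym_tensor_eq_per: "sym_tensor H gs xs = (if xs \<in> lists (car H) then per H gs xs / fact (length gs) else 0)"
proof (cases "length xs = length gs")
  case True
  have "(\<Prod>i<length gs. ip H (xs ! i) (gs ! p i)) = iplist H xs (permute_list p gs)" if "p permutes {..<length gs}" for p
    using True that by (simp add: iplist_eq_prod permute_list_nth)
  then show ?thesis using True by (simp add: sym_tensor_def per_def)
next
  case False
  then show ?thesis by (simp add: sym_tensor_def per_length)
qed

lemma lists_append_drop: "xs \<in> lists A \<Longrightarrow> take j xs @ drop k xs \<in> lists A"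
  by (auto dest: in_set_takeD in_set_dropD)

lemma creation_sym_tensor:
  "creation H g (sym_tensor H gs) = (\<lambda>xs. complex_of_real (sqrt (real (Suc (length gs)))) * sym_tensor H (g # gs) xs)"
proof
  fix xs :: "'a list"
  let ?n = "length gs"
  show "creation H g (sym_tensor H gs) xs = complex_of_real (sqrt (real (Suc ?n))) * sym_tensor H (g # gs) xs"
  proof (cases "xs \<in> lists (car H) \<and> length xs = Suc ?n")
    case True
    have s: "complex_of_real (sqrt (real (Suc ?n))) * complex_of_real (sqrt (real (Suc ?n))) = complex_of_real (real (Suc ?n))"
      unfolding of_real_mult[symmetric] by simp
    have "creation H g (sym_tensor H gs) xs
        = (\<Sum>j<length xs. ip H (xs ! j) g * (per H gs (take j xs @ drop (Suc j) xs) / fact ?n)) / complex_of_real (sqrt (real (Suc ?n)))"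
      using True lists_append_drop[of xs "car H"] by (auto simp: creation_def sym_tensor_eq_per intro!: sum.cong)
    also have "\<dots> = per H (g # gs) xs / fact ?n / complex_of_real (sqrt (real (Suc ?n)))"
      by (simp only: per_Cons[OF conjunct2[OF True]] times_divide_eq_right sum_divide_distrib)
    also have "\<dots> = complex_of_real (sqrt (real (Suc ?n))) * (per H (g # gs) xs / fact (Suc ?n))"
    proof -
      define a where "a = complex_of_real (sqrt (real (Suc ?n)))"
      have "fact (Suc ?n) = (a * a) * fact ?n" unfolding a_def s by simp
      moreover have "a \<noteq> 0" by (simp add: a_def)
      ultimately show ?thesis unfolding a_def[symmetric] by (simp only: fact_Suc) simp
    qed
    finally show ?thesis using True by (simp add: sym_tensor_eq_per)
  next
    case False
    then show ?thesis by (auto simp: creation_def sym_tensor_eq_per per_length intro!: sum.neutral)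
  qed
qed

lemma sum_fun_apply: "(\<Sum>i\<in>I. f i) x = (\<Sum>i\<in>I. f i x)"
  for f :: "'i \<Rightarrow> 'b \<Rightarrow> complex"
  by (induction I rule: infinite_finite_induct) auto

context hilbert begin

lemma summable_lim_to:
  assumes v: "\<And>n. v n \<in> car H" and b: "\<And>n. hnorm H (v n) \<le> b n" "summable b"
  shows "\<exists>l. lim_to (\<lambda>N. \<Sum>n<N. v n) l"
proof (rule Cauchy_lim_to)
  show "(\<Sum>n<N. v n) \<in> car H" for N using v by (intro sum_car)
  fix e :: real assume e: "e > 0"
  obtain N where N: "\<And>m n. m \<ge> N \<Longrightarrow> norm (sum b {m..<n}) < e" using b(2) e unfolding summable_Cauchy by blast
  have lt: "hnorm H ((\<Sum>k<n. v k) - (\<Sum>k<m. v k)) < e" if "m \<ge> N" "m \<le> n" for m n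
  proof -
    have "(\<Sum>k<n. v k) - (\<Sum>k<m. v k) = (\<Sum>k=m..<n. v k)"
      using that(2) by (simp add: sum_diff_nat_ivl[of 0 m n, simplified] lessThan_atLeast0)
    then have "hnorm H ((\<Sum>k<n. v k) - (\<Sum>k<m. v k)) \<le> (\<Sum>k=m..<n. hnorm H (v k))"
      using hnorm_sum[of "{m..<n}" v] v by simp
    also have "\<dots> \<le> sum b {m..<n}" by (intro sum_mono b)
    finally show ?thesis using N[OF that(1), of n] by simp
  qed
  have "hnorm H ((\<Sum>k<m. v k) - (\<Sum>k<n. v k)) < e" if "m \<ge> N" "n \<ge> N" for m n
  proof (cases "m \<le> n")
    case True
    have c: "(\<Sum>k<m. v k) \<in> car H" "(\<Sum>k<n. v k) \<in> car H" using v by (auto intro: sum_car)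
    show ?thesis using lt[OF that(1) True] hnorm_minus_commute[OF c] by simp
  next
    case False then show ?thesis using lt[OF that(2)] by simp
  qed
  then show "\<exists>N. \<forall>m\<ge>N. \<forall>n\<ge>N. hnorm H ((\<Sum>k<m. v k) - (\<Sum>k<n. v k)) < e" by blast
qed

end

locale fock_space = hilbert
begin

sublocale F: hilbert "sym_fock H"
  by (rule hilbert_fock)

declare sym_fock_sel(2,3) [simp del]

lemma fock_smul: "smul (sym_fock H) c \<psi> xs = c * \<psi> xs"
  by (simp add: sym_fock_sel)

lemma fock_add: "\<psi> \<in> fock_carrier H \<Longrightarrow> \<phi> \<in> fock_carrier H \<Longrightarrow> \<psi> + \<phi> \<in> fock_carrier H"
  and fock_diff: "\<psi> \<in> fock_carrier H \<Longrightarrow> \<phi> \<in> fock_carrier H \<Longrightarrow> \<psi> - \<phi> \<in> fock_carrier H"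
  and fock_scale: "\<psi> \<in> fock_carrier H \<Longrightarrow> smul (sym_fock H) c \<psi> \<in> fock_carrier H"
  and fock_0: "0 \<in> fock_carrier H"
  using F.add_car[of \<psi> \<phi>] F.diff_car[of \<psi> \<phi>] F.scale_car[of \<psi> c] F.zero_car by simp_all

lemma fock_eqI:
  assumes "\<psi> \<in> fock_carrier H" "\<phi> \<in> fock_carrier H" "\<And>xs. xs \<in> lists (car H) \<Longrightarrow> \<psi> xs = \<phi> xs"
  shows "\<psi> = \<phi>"
proof
  fix xs show "\<psi> xs = \<phi> xs"
  proof (cases "xs \<in> lists (car H)")
    case False
    then show ?thesis using fock_outside[OF assms(1) False] fock_outside[OF assms(2) False] by simp
  qed (rule assms(3))
qed

lemma fock_lim_eval:
  assumes "F.lim_to s l" shows "(\<lambda>n. s n xs) \<longlonglongrightarrow> l xs"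
proof (cases "xs \<in> lists (car H)")
  case True
  have c: "s n \<in> fock_carrier H" "l \<in> fock_carrier H" for n using assms by (auto simp: F.lim_to_def)
  have z: "(\<lambda>n. hnorm (sym_fock H) (s n - l) * prod_list (map (hnorm H) xs)) \<longlonglongrightarrow> 0"
    using assms by (intro tendsto_mult_left_zero) (simp add: F.lim_to_def)
  have b: "norm (s n xs - l xs) \<le> hnorm (sym_fock H) (s n - l) * prod_list (map (hnorm H) xs)" for n
    using fock_eval_bound[OF fock_diff[OF c] True] by simp
  have "(\<lambda>n. s n xs - l xs) \<longlonglongrightarrow> 0"
    by (rule Lim_null_comparison[OF always_eventually z]) (simp add: b)
  then show ?thesis using LIM_zero_iff by blast
next
  case False
  have "s n xs = 0" "l xs = 0" for n
    by (rule fock_outside[OF _ False], use assms in \<open>simp add: F.lim_to_def\<close>)+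
  then show ?thesis by simp
qed

lemma iplist_bound: "xs \<in> lists (car H) \<Longrightarrow> ys \<in> lists (car H) \<Longrightarrow>
    cmod (iplist H xs ys) \<le> prod_list (map (hnorm H) ys) * prod_list (map (hnorm H) xs)"
proof (induction xs arbitrary: ys)
  case Nil
  then show ?case using prod_hnorm_nonneg[of ys] by (cases ys) auto
next
  case (Cons x xs)
  show ?case
  proof (cases ys)
    case Nil then show ?thesis using Cons prod_hnorm_nonneg[of "x # xs"] by simp
  next
    case (Cons y ys')
    have c: "x \<in> car H" "y \<in> car H" "xs \<in> lists (car H)" "ys' \<in> lists (car H)" using Cons Cons.prems by auto
    have "cmod (ip H x y) * cmod (iplist H xs ys') \<le>
        (hnorm H x * hnorm H y) * (prod_list (map (hnorm H) ys') * prod_list (map (hnorm H) xs))"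
      using c by (intro mult_mono cauchy_schwarz Cons.IH) auto
    then show ?thesis using Cons by (simp add: norm_mult mult_ac)
  qed
qed

lemma iplist_cnj: "xs \<in> lists (car H) \<Longrightarrow> ys \<in> lists (car H) \<Longrightarrow> cnj (iplist H xs ys) = iplist H ys xs"
proof (induction xs arbitrary: ys)
  case Nil then show ?case by (cases ys) auto
next
  case (Cons x xs)
  then show ?case
  proof (cases ys)
    case (Cons y ys')
    then show ?thesis using Cons.IH[of ys'] Cons.prems ip_cnj[of x y] by simp
  qed simp
qed

lemma permute_list_lists: "p permutes {..<length gs} \<Longrightarrow> gs \<in> lists A \<Longrightarrow> permute_list p gs \<in> lists A"
  by auto

lemma per_cnj: "gs \<in> lists (car H) \<Longrightarrow> xs \<in> lists (car H) \<Longrightarrow> cnj (per H gs xs) = per H xs gs"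
proof (cases "length xs = length gs")
  case True
  assume a: "gs \<in> lists (car H)" "xs \<in> lists (car H)"
  have "cnj (per H gs xs) = (\<Sum>p | p permutes {..<length gs}. iplist H (permute_list p gs) xs)"
    unfolding per_def cnj_sum using a permute_list_lists by (intro sum.cong refl iplist_cnj) auto
  then show ?thesis using True by (simp add: per_eq_permute_right)
qed (simp add: per_length)

lemma form_sym_tensor:
  assumes gs: "gs \<in> lists (car H)" shows "form H (sym_tensor H gs)"
  unfolding form_def
proof (intro conjI allI ballI impI)
  fix xs ys :: "'a list" assume m: "mset xs = mset ys"
  then have "xs \<in> lists (car H) \<longleftrightarrow> ys \<in> lists (car H)" using mset_eq_setD by blast
  then show "sym_tensor H gs xs = sym_tensor H gs ys" using per_sym_right[OF m, of H gs] by (simp add: sym_tensor_eq_per)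
next
  fix x y xs assume a: "x \<in> car H" "y \<in> car H" "xs \<in> lists (car H)"
  have lin: "iplist H ((x + y) # xs) zs = iplist H (x # xs) zs + iplist H (y # xs) zs" if "zs \<in> lists (car H)" for zs
    using that a by (cases zs) (auto simp: ip_add_left distrib_right)
  have "per H gs ((x + y) # xs) = per H gs (x # xs) + per H gs (y # xs)"
    unfolding per_def sum.distrib[symmetric] by (intro sum.cong refl lin permute_list_lists gs) simp
  then show "sym_tensor H gs ((x + y) # xs) = sym_tensor H gs (x # xs) + sym_tensor H gs (y # xs)"
    using a by (simp add: sym_tensor_eq_per add_divide_distrib)
next
  fix c x xs assume a: "x \<in> car H" "xs \<in> lists (car H)"
  have lin: "iplist H (smul H c x # xs) zs = cnj c * iplist H (x # xs) zs" if "zs \<in> lists (car H)" for zs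
    using that a by (cases zs) (auto simp: ip_scale_left)
  have "per H gs (smul H c x # xs) = cnj c * per H gs (x # xs)"
    unfolding per_def sum_distrib_left by (intro sum.cong refl lin permute_list_lists gs) simp
  then show "sym_tensor H gs (smul H c x # xs) = cnj c * sym_tensor H gs (x # xs)"
    using a by (simp add: sym_tensor_eq_per)
next
  fix n
  let ?P = "{p. p permutes {..<length gs}}"
  have "cmod (sym_tensor H gs xs) \<le> ((\<Sum>p\<in>?P. prod_list (map (hnorm H) (permute_list p gs))) / fact (length gs)) * prod_list (map (hnorm H) xs)"
    if xs: "xs \<in> lists (car H)" for xs
  proof -
    have "cmod (per H gs xs) \<le> (\<Sum>p\<in>?P. cmod (iplist H xs (permute_list p gs)))"
      unfolding per_def by (rule norm_sum)
    also have "\<dots> \<le> (\<Sum>p\<in>?P. prod_list (map (hnorm H) (permute_list p gs)) * prod_list (map (hnorm H) xs))"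
      using gs permute_list_lists xs by (intro sum_mono iplist_bound) auto
    finally show ?thesis
      using xs by (simp add: sym_tensor_eq_per norm_divide divide_right_mono sum_distrib_right)
  qed
  then show "\<exists>M. \<forall>xs\<in>lists (car H). length xs = n \<longrightarrow> cmod (sym_tensor H gs xs) \<le> M * prod_list (map (hnorm H) xs)"
    by blast
qed

lemma has_sum_finite_sum:
  "(\<And>p. p \<in> P \<Longrightarrow> ((f p) has_sum (s p :: complex)) A) \<Longrightarrow> ((\<lambda>x. \<Sum>p\<in>P. f p x) has_sum (\<Sum>p\<in>P. s p)) A"
  by (induction P rule: infinite_finite_induct) (auto intro: has_sum_add)

lemma l2_extend:
  assumes "l2 A f" "A \<subseteq> B" "\<And>x. x \<in> B - A \<Longrightarrow> f x = 0" shows "l2 B f"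
  using assms(1) unfolding l2_def by (rule summable_on_cong_neutral[THEN iffD1, rotated 3]) (use assms in auto)

lemma lists_of_sub: "lists_of B n \<subseteq> lists B"
  by (auto simp: lists_of_def)

lemma sym_tensor_fock:
  assumes gs: "gs \<in> lists (car H)" shows "sym_tensor H gs \<in> fock_carrier H"
proof -
  let ?P = "{p. p permutes {..<length gs}}" and ?L = "lists_of (onb H) (length gs)"
  have "l2 ?L (\<lambda>xs. iplist H xs (permute_list p gs))" if p: "p \<in> ?P" for p
  proof -
    have pl: "permute_list p gs \<in> lists (car H)" "length (permute_list p gs) = length gs"
      using p gs permute_list_lists by auto
    have "(\<lambda>bs. (cmod (iplist H (permute_list p gs) bs))\<^sup>2) summable_on ?L"
      using iplist_norm_has_sum[OF pl(1)] pl(2) has_sum_imp_summable by metis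
    then show ?thesis
      unfolding l2_def
    proof (rule summable_on_cong[THEN iffD1, rotated])
      fix bs assume "bs \<in> ?L"
      then have "bs \<in> lists (car H)" using lists_of_sub lists_onb_car by blast
      then have "iplist H bs (permute_list p gs) = cnj (iplist H (permute_list p gs) bs)" using pl iplist_cnj by metis
      then show "(cmod (iplist H (permute_list p gs) bs))\<^sup>2 = (cmod (iplist H bs (permute_list p gs)))\<^sup>2" by simp
    qed
  qed
  then have "l2 ?L (per H gs)" unfolding per_def by (rule l2_sum)
  then have "l2 ?L (\<lambda>xs. 1 / fact (length gs) * per H gs xs)" by (rule l2_scale)
  then have "l2 ?L (sym_tensor H gs)"
    unfolding l2_def
  proof (rule summable_on_cong[THEN iffD1, rotated])
    fix bs assume "bs \<in> ?L"
    then have "bs \<in> lists (car H)" using lists_of_sub lists_onb_car by blast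
    then show "(cmod (1 / fact (length gs) * per H gs bs))\<^sup>2 = (cmod (sym_tensor H gs bs))\<^sup>2"
      by (simp add: sym_tensor_eq_per)
  qed
  then have "l2 (lists (onb H)) (sym_tensor H gs)"
    by (rule l2_extend[OF _ lists_of_sub]) (auto simp: lists_of_def sym_tensor_def)
  then show ?thesis
    unfolding fock_carrier_iff using form_sym_tensor[OF gs] by (auto simp: sym_tensor_def)
qed

text \<open>
  In the realisation of tensors as functionals, \<open>\<psi>(g\<^sub>1, \<dots>, g\<^sub>n)\<close> stands for \<open>\<langle>g\<^sub>1 \<otimes> \<dots> \<otimes> g\<^sub>n, \<psi>\<rangle>\<close>.
  Together with \<open>form_expansion\<close> this holds literally for the inner product, which is defined by a
  sum over a basis. All inner products with tensors below are computed by evaluation.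
\<close>

theorem sym_tensor_reproducing:
  assumes gs: "gs \<in> lists (car H)" and \<psi>: "\<psi> \<in> fock_carrier H"
  shows "ip (sym_fock H) (sym_tensor H gs) \<psi> = \<psi> gs"
proof -
  let ?P = "{p. p permutes {..<length gs}}" and ?L = "lists_of (onb H) (length gs)"
  have l2: "l2 ?L \<psi>" using fock_l2[OF \<psi>] l2_subset lists_of_sub by blast
  have "((\<lambda>bs. \<Sum>p\<in>?P. iplist H (permute_list p gs) bs * \<psi> bs) has_sum (\<Sum>p\<in>?P. \<psi> gs)) ?L"
  proof (rule has_sum_finite_sum)
    fix p assume p: "p \<in> ?P"
    have pl: "permute_list p gs \<in> lists (car H)" "length (permute_list p gs) = length gs"
      using p gs permute_list_lists by auto
    have "\<psi> (permute_list p gs) = \<psi> gs" using p by (intro form_sym[OF fock_form[OF \<psi>]]) simp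
    then show "((\<lambda>bs. iplist H (permute_list p gs) bs * \<psi> bs) has_sum \<psi> gs) ?L"
      using form_expansion[OF fock_form[OF \<psi>] l2 pl] by simp
  qed
  then have "((\<lambda>bs. 1 / fact (length gs) * (\<Sum>p\<in>?P. iplist H (permute_list p gs) bs * \<psi> bs))
      has_sum 1 / fact (length gs) * (\<Sum>p\<in>?P. \<psi> gs)) ?L"
    by (rule has_sum_cmult_right)
  also have "1 / fact (length gs) * (\<Sum>p\<in>?P. \<psi> gs) = \<psi> gs"
    using card_permutations[of "{..<length gs}" "length gs"] by simp
  finally have "((\<lambda>bs. cnj (sym_tensor H gs bs) * \<psi> bs) has_sum \<psi> gs) ?L"
  proof (rule has_sum_cong[THEN iffD1, rotated])
    fix bs assume "bs \<in> ?L"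
    then have bs: "bs \<in> lists (car H)" using lists_of_sub lists_onb_car by blast
    have "cnj (per H gs bs) = (\<Sum>p\<in>?P. iplist H (permute_list p gs) bs)"
      unfolding per_def cnj_sum using bs gs permute_list_lists by (intro sum.cong refl iplist_cnj) auto
    then show "1 / fact (length gs) * (\<Sum>p\<in>?P. iplist H (permute_list p gs) bs * \<psi> bs) = cnj (sym_tensor H gs bs) * \<psi> bs"
      using bs by (simp add: sym_tensor_eq_per sum_distrib_right)
  qed
  then have "((\<lambda>bs. cnj (sym_tensor H gs bs) * \<psi> bs) has_sum \<psi> gs) (lists (onb H))"
    by (rule has_sum_cong_neutral[THEN iffD1, rotated 3]) (auto simp: lists_of_def sym_tensor_def)
  then show ?thesis by (simp add: sym_fock_sel infsumI)
qed

lemma norm_sym_tensor: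
  assumes gs: "gs \<in> lists (car H)"
  shows "hnorm (sym_fock H) (sym_tensor H gs) \<le> prod_list (map (hnorm H) gs)"
proof -
  let ?T = "sym_tensor H gs" and ?N = "hnorm (sym_fock H) (sym_tensor H gs)"
  have T: "?T \<in> car (sym_fock H)" using sym_tensor_fock[OF gs] by simp
  have "?N\<^sup>2 = cmod (ip (sym_fock H) ?T ?T)" using T by (simp add: F.ip_self norm_power)
  also have "\<dots> = cmod (?T gs)" using sym_tensor_reproducing[OF gs] T by simp
  also have "\<dots> \<le> ?N * prod_list (map (hnorm H) gs)" using fock_eval_bound[OF _ gs] T by simp
  finally show ?thesis
    using F.hnorm_nonneg[OF T] prod_hnorm_nonneg[OF gs] by (cases "?N = 0") (auto simp: power2_eq_square)
qed

lemma annihilation_sym_tensor_Nil: "annihilation g (sym_tensor H []) = 0"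
  by (auto simp: annihilation_def sym_tensor_def)

text \<open>
  Evaluation at \<open>g # xs\<close>, expanded along the row of \<open>g\<close>. As the permanent expansion removes
  columns, complex conjugation is used to exchange rows and columns.
\<close>

lemma annihilation_sym_tensor:
  assumes gs: "gs \<in> lists (car H)" and g: "g \<in> car H"
  shows "annihilation g (sym_tensor H gs) =
    (\<Sum>j<length gs. smul (sym_fock H) (ip H g (gs ! j) / complex_of_real (sqrt (real (length gs))))
       (sym_tensor H (take j gs @ drop (Suc j) gs)))"
proof
  fix xs
  let ?n = "length gs"
  have rhs: "(\<Sum>j<?n. smul (sym_fock H) (ip H g (gs ! j) / complex_of_real (sqrt (real ?n)))
       (sym_tensor H (take j gs @ drop (Suc j) gs))) xs
     = (\<Sum>j<?n. ip H g (gs ! j) / complex_of_real (sqrt (real ?n)) * sym_tensor H (take j gs @ drop (Suc j) gs) xs)"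
    by (induction "{..<?n}" rule: infinite_finite_induct) (simp_all add: sum_fun_apply fock_smul)
  show "annihilation g (sym_tensor H gs) xs = (\<Sum>j<?n. smul (sym_fock H) (ip H g (gs ! j) / complex_of_real (sqrt (real ?n)))
       (sym_tensor H (take j gs @ drop (Suc j) gs))) xs"
  proof (cases "xs \<in> lists (car H) \<and> Suc (length xs) = ?n")
    case True
    then have xs: "xs \<in> lists (car H)" and l: "?n = Suc (length xs)" by auto
    have c: "take j gs @ drop (Suc j) gs \<in> lists (car H)" for j by (rule lists_append_drop[OF gs])
    have "per H gs (g # xs) = cnj (per H (g # xs) gs)" using per_cnj[of "g # xs" gs] xs g gs by simp
    also have "\<dots> = (\<Sum>j<?n. cnj (ip H (gs ! j) g) * cnj (per H xs (take j gs @ drop (Suc j) gs)))"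
      using per_Cons[OF l, of H g] by simp
    also have "\<dots> = (\<Sum>j<?n. ip H g (gs ! j) * per H (take j gs @ drop (Suc j) gs) xs)"
    proof (rule sum.cong[OF refl])
      fix j assume "j \<in> {..<?n}"
      then have "gs ! j \<in> car H" using gs by (auto simp: in_lists_conv_set)
      then show "cnj (ip H (gs ! j) g) * cnj (per H xs (take j gs @ drop (Suc j) gs)) = ip H g (gs ! j) * per H (take j gs @ drop (Suc j) gs) xs"
        using g per_cnj[OF xs c] ip_cnj[of "gs ! j" g] by simp
    qed
    finally have 1: "per H gs (g # xs) = (\<Sum>j<?n. ip H g (gs ! j) * per H (take j gs @ drop (Suc j) gs) xs)" .
    define a where "a = complex_of_real (sqrt (real ?n))"
    have a: "a \<noteq> 0" "a * a = complex_of_real (real ?n)" using l unfolding a_def of_real_mult[symmetric] by simp_all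
    have f: "fact ?n = (a * a) * fact (length xs)" unfolding a(2) using l by simp
    have "annihilation g (sym_tensor H gs) xs = a * (per H gs (g # xs) / fact ?n)"
      using xs g l by (simp add: annihilation_def sym_tensor_eq_per a_def)
    also have "\<dots> = (\<Sum>j<?n. ip H g (gs ! j) * per H (take j gs @ drop (Suc j) gs) xs) / (a * fact (length xs))"
      unfolding 1 f using a(1) by simp
    also have "\<dots> = (\<Sum>j<?n. ip H g (gs ! j) / a * sym_tensor H (take j gs @ drop (Suc j) gs) xs)"
      unfolding sum_divide_distrib
    proof (rule sum.cong[OF refl])
      fix j assume j: "j \<in> {..<?n}"
      then have "length (take j gs @ drop (Suc j) gs) = length xs" using l by auto
      then show "ip H g (gs ! j) * per H (take j gs @ drop (Suc j) gs) xs / (a * fact (length xs)) =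
          ip H g (gs ! j) / a * sym_tensor H (take j gs @ drop (Suc j) gs) xs"
        using xs by (simp add: sym_tensor_eq_per del: length_append)
    qed
    finally show ?thesis unfolding rhs a_def .
  next
    case False
    have "annihilation g (sym_tensor H gs) xs = 0"
      using False by (auto simp: annihilation_def sym_tensor_def)
    moreover have "sym_tensor H (take j gs @ drop (Suc j) gs) xs = 0" if "j < ?n" for j
      using False that by (auto simp: sym_tensor_def)
    ultimately show ?thesis unfolding rhs by simp
  qed
qed

section \<open>Exponential vectors\<close>

text \<open>The vector \<open>e(h) = \<Sum>\<^sub>n h\<^sup>\<otimes>\<^sup>n / \<surd>n!\<close>.\<close>

definition ev :: "'a \<Rightarrow> 'a list \<Rightarrow> complex" where
  "ev h xs = (if xs \<in> lists (car H) then iplist H xs (replicate (length xs) h) / complex_of_real (sqrt (fact (length xs))) else 0)"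

lemma permute_replicate: "permute_list p (replicate n h) = replicate n h" if "p permutes {..<n}"
  by (rule nth_equalityI) (use that permutes_in_image[OF that] in \<open>auto simp: permute_list_nth\<close>)

lemma sym_tensor_replicate:
  "xs \<in> lists (car H) \<Longrightarrow> sym_tensor H (replicate n h) xs = iplist H xs (replicate n h)"
  using card_permutations[of "{..<n}" n] by (simp add: sym_tensor_eq_per per_def permute_replicate)

definition ev_term :: "'a \<Rightarrow> nat \<Rightarrow> 'a list \<Rightarrow> complex" where
  "ev_term h n = smul (sym_fock H) (complex_of_real (1 / sqrt (fact n))) (sym_tensor H (replicate n h))"

end

text \<open>
  The series \<open>\<Sum>\<^sub>n \<parallel>h\<^sup>\<otimes>\<^sup>n\<parallel> / \<surd>n!\<close>. The terms are products \<open>A B\<close> with \<open>B = 2\<^sup>-\<^sup>n\<close>, where \<open>A\<^sup>2\<close> is the term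
  of an exponential series, so \<open>A B \<le> A\<^sup>2 + B\<^sup>2\<close> gives a majorant.
\<close>

lemma summable_power_root_fact: "summable (\<lambda>n. x ^ n / sqrt (fact n))" if "x \<ge> (0::real)"
proof (rule summable_comparison_test')
  have "summable (\<lambda>n. (1 / 4 :: real) ^ n + inverse (fact n) * (4 * x\<^sup>2) ^ n)"
    by (intro summable_add summable_geometric summable_exp) simp
  then show "summable (\<lambda>n. 1 / 2 * ((1 / 4 :: real) ^ n + inverse (fact n) * (4 * x\<^sup>2) ^ n))"
    by (rule summable_mult)
  fix n :: nat
  define A B where "A = (2 * x) ^ n / sqrt (fact n)" and "B = (1 / 2 :: real) ^ n"
  have "((2 * x) ^ n)\<^sup>2 = ((2 * x)\<^sup>2) ^ n" by (simp only: power_mult[symmetric] mult.commute)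
  also have "(2 * x)\<^sup>2 = 4 * x\<^sup>2" by (simp add: power2_eq_square)
  finally have c: "((2 * x) ^ n)\<^sup>2 = (4 * x\<^sup>2) ^ n" .
  have A: "A\<^sup>2 = inverse (fact n) * (4 * x\<^sup>2) ^ n"
    unfolding A_def power_divide c by (simp add: divide_inverse mult.commute)
  have "B\<^sup>2 = ((1 / 2)\<^sup>2) ^ n" unfolding B_def by (simp only: power_mult[symmetric] mult.commute)
  then have B: "B\<^sup>2 = (1 / 4) ^ n" by (simp add: power2_eq_square)
  have "norm (x ^ n / sqrt (fact n)) = A * B"
    using that by (simp add: A_def B_def power_mult_distrib power_divide)
  then have "norm (x ^ n / sqrt (fact n)) \<le> 1 / 2 * (B\<^sup>2 + A\<^sup>2)"
    using two_mult_le_sum_squares[of A B] by simp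
  then show "norm (x ^ n / sqrt (fact n)) \<le> 1 / 2 * ((1 / 4) ^ n + inverse (fact n) * (4 * x\<^sup>2) ^ n)"
    unfolding A B .
qed

lemma Suc_le_four_power: "Suc n \<le> 4 ^ n"
  by (induction n) auto

lemma summable_Suc_power_root_fact: "summable (\<lambda>n. sqrt (real (Suc n)) * x ^ n / sqrt (fact n))" if "x \<ge> (0::real)"
proof (rule summable_comparison_test')
  show "summable (\<lambda>n. (2 * x) ^ n / sqrt (fact n))" using that by (intro summable_power_root_fact) simp
  fix n :: nat
  have "real (Suc n) \<le> real (4 ^ n)" using Suc_le_four_power[of n] by (simp only: of_nat_le_iff)
  also have "\<dots> = (2 ^ n)\<^sup>2" by (simp add: power_mult[symmetric] mult.commute[of n]) (simp add: power_mult power2_eq_square)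
  finally have "sqrt (real (Suc n)) \<le> 2 ^ n" by (rule real_le_lsqrt[rotated]) simp
  then have "sqrt (real (Suc n)) * x ^ n \<le> (2 * x) ^ n"
    using that by (simp add: power_mult_distrib mult_right_mono)
  then show "norm (sqrt (real (Suc n)) * x ^ n / sqrt (fact n)) \<le> (2 * x) ^ n / sqrt (fact n)"
    using that by (simp add: divide_right_mono)
qed

lemma real_powser_unique_zero:
  fixes c :: "nat \<Rightarrow> real"
  assumes "\<And>t. (\<lambda>n. c n * t ^ n) sums 0" shows "c n = 0"
proof (induction n rule: less_induct)
  case (less m)
  have "((\<lambda>_. 0) \<longlongrightarrow> c (0 + m)) (at (0::real))"
  proof (rule powser_limit_0_strong[where s = 1 and a = "\<lambda>n. c (n + m)" and f = "\<lambda>_. 0"])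
    fix t :: real assume "t \<noteq> 0"
    have "(\<lambda>n. c (n + m) * t ^ (n + m)) sums (0 - (\<Sum>i<m. c i * t ^ i))"
      using assms by (rule sums_split_initial_segment)
    then have "(\<lambda>n. t ^ m * (c (n + m) * t ^ n)) sums (t ^ m * 0)"
      using less by (simp add: power_add mult_ac)
    then show "(\<lambda>n. c (n + m) * t ^ n) sums 0"
      using sums_mult_iff[of "t ^ m" "\<lambda>n. c (n + m) * t ^ n" 0] \<open>t \<noteq> 0\<close> by simp
  qed simp
  then show ?case by (simp add: tendsto_const_iff)
qed

lemma powser_unique_zero:
  fixes c :: "nat \<Rightarrow> complex"
  assumes "\<And>t. (\<lambda>n. c n * complex_of_real t ^ n) sums 0" shows "c n = 0"
proof (rule complex_eqI)
  have "(\<lambda>n. Re (c n) * t ^ n) sums 0" for t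
    using sums_Re[OF assms[of t]] by (simp flip: of_real_power)
  then show "Re (c n) = Re 0" using real_powser_unique_zero[of "\<lambda>n. Re (c n)"] by simp
  have "(\<lambda>n. Im (c n) * t ^ n) sums 0" for t
    using sums_Im[OF assms[of t]] by (simp flip: of_real_power)
  then show "Im (c n) = Im 0" using real_powser_unique_zero[of "\<lambda>n. Im (c n)"] by simp
qed

lemma polynomial_unique_zero:
  fixes c :: "nat \<Rightarrow> complex"
  assumes "\<And>t. (\<Sum>j\<le>m. c j * complex_of_real t ^ j) = 0" "n \<le> m" shows "c n = 0"
proof -
  have "(\<lambda>j. (if j \<le> m then c j else 0) * complex_of_real t ^ j) sums 0" for t
    using sums_finite[of "{..m}" "\<lambda>j. (if j \<le> m then c j else 0) * complex_of_real t ^ j"] assms(1)[of t] by simp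
  from powser_unique_zero[OF this, of n] show ?thesis using assms(2) by simp
qed

lemma sum_choose_Suc:
  fixes x :: "nat \<Rightarrow> complex"
  shows "(\<Sum>j\<le>m. of_nat (m choose j) * x j) + (\<Sum>j\<le>m. of_nat (m choose j) * x (Suc j))
    = (\<Sum>j\<le>Suc m. of_nat (Suc m choose j) * x j)"
proof -
  have "(\<Sum>j\<le>Suc m. of_nat (Suc m choose j) * x j) = x 0 + (\<Sum>j\<le>m. of_nat (Suc m choose Suc j) * x (Suc j))"
    by (simp add: sum.atMost_Suc_shift del: sum.atMost_Suc binomial_Suc_Suc)
  also have "\<dots> = x 0 + (\<Sum>j\<le>m. of_nat (m choose Suc j) * x (Suc j)) + (\<Sum>j\<le>m. of_nat (m choose j) * x (Suc j))"
    by (simp add: distrib_right sum.distrib add_ac)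
  also have "x 0 + (\<Sum>j\<le>m. of_nat (m choose Suc j) * x (Suc j)) = (\<Sum>j\<le>Suc m. of_nat (m choose j) * x j)"
    by (simp add: sum.atMost_Suc_shift del: sum.atMost_Suc)
  also have "\<dots> = (\<Sum>j\<le>m. of_nat (m choose j) * x j)" by (simp add: binomial_eq_0)
  finally show ?thesis by simp
qed

context fock_space begin

lemma replicate_car: "h \<in> car H \<Longrightarrow> replicate n h \<in> lists (car H)"
  by (auto simp: in_lists_conv_set)

lemma norm_replicate: "prod_list (map (hnorm H) (replicate n h)) = hnorm H h ^ n"
  by (induction n) auto

lemma ev_term_fock: "h \<in> car H \<Longrightarrow> ev_term h n \<in> fock_carrier H"
  unfolding ev_term_def by (intro fock_scale sym_tensor_fock replicate_car)

lemma ev_term_eval: "xs \<in> lists (car H) \<Longrightarrow> ev_term h n xs = (if n = length xs then ev h xs else 0)"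
  by (auto simp: ev_term_def fock_smul sym_tensor_replicate ev_def iplist_length)

lemma norm_ev_term: assumes "h \<in> car H"
  shows "hnorm (sym_fock H) (ev_term h n) \<le> hnorm H h ^ n / sqrt (fact n)"
proof -
  have "hnorm (sym_fock H) (ev_term h n) = 1 / sqrt (fact n) * hnorm (sym_fock H) (sym_tensor H (replicate n h))"
    unfolding ev_term_def using sym_tensor_fock[OF replicate_car[OF assms]]
    by (subst F.hnorm_scale) (auto simp: norm_divide)
  also have "\<dots> \<le> 1 / sqrt (fact n) * hnorm H h ^ n"
    using norm_sym_tensor[OF replicate_car[OF assms]] norm_replicate by (intro mult_left_mono) auto
  finally show ?thesis by simp
qed

lemma ev_lim:
  assumes h: "h \<in> car H" shows "F.lim_to (\<lambda>N. \<Sum>n<N. ev_term h n) (ev h)"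
proof -
  obtain l where l: "F.lim_to (\<lambda>N. \<Sum>n<N. ev_term h n) l"
    using F.summable_lim_to[of "ev_term h" "\<lambda>n. hnorm H h ^ n / sqrt (fact n)"] norm_ev_term[OF h]
      ev_term_fock[OF h] summable_power_root_fact[OF hnorm_nonneg[OF h]] by auto
  have "l = ev h"
  proof
    fix xs
    show "l xs = ev h xs"
    proof (cases "xs \<in> lists (car H)")
      case True
      have "\<forall>\<^sub>F N in sequentially. (\<Sum>n<N. ev_term h n) xs = ev h xs"
        using eventually_gt_at_top[of "length xs"]
        by eventually_elim (simp add: sum_fun_apply ev_term_eval[OF True])
      moreover have "(\<lambda>N. (\<Sum>n<N. ev_term h n) xs) \<longlonglongrightarrow> l xs" by (rule fock_lim_eval[OF l])
      ultimately have "(\<lambda>N. ev h xs) \<longlonglongrightarrow> l xs" by (rule Lim_transform_eventually[rotated])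
      then show ?thesis by (simp add: LIMSEQ_const_iff)
    next
      case False
      then show ?thesis using l fock_outside by (auto simp: F.lim_to_def ev_def)
    qed
  qed
  then show ?thesis using l by simp
qed

lemma ev_fock: "h \<in> car H \<Longrightarrow> ev h \<in> fock_carrier H"
  using ev_lim by (simp add: F.lim_to_def)

text \<open>
  Inner products with \<open>e(h)\<close> only see \<open>\<psi>\<close> on the diagonal; that \<open>t \<mapsto> \<langle>e(t h), \<psi>\<rangle>\<close> is a power
  series separates the degrees.
\<close>

lemma ip_ev_sums:
  assumes h: "h \<in> car H" and \<psi>: "\<psi> \<in> fock_carrier H"
  shows "(\<lambda>n. \<psi> (replicate n h) / complex_of_real (sqrt (fact n))) sums ip (sym_fock H) (ev h) \<psi>"
proof -
  have "(\<lambda>N. ip (sym_fock H) (\<Sum>n<N. ev_term h n) \<psi>) \<longlonglongrightarrow> ip (sym_fock H) (ev h) \<psi>"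
    using \<psi> by (intro F.lim_to_ip ev_lim h F.lim_to_const) simp
  moreover have "ip (sym_fock H) (\<Sum>n<N. ev_term h n) \<psi> = (\<Sum>n<N. \<psi> (replicate n h) / complex_of_real (sqrt (fact n)))" for N
  proof -
    have "ip (sym_fock H) (\<Sum>n<N. ev_term h n) \<psi> = (\<Sum>n<N. ip (sym_fock H) (ev_term h n) \<psi>)"
      using \<psi> ev_term_fock[OF h] by (intro F.ip_sum_left) auto
    also have "\<dots> = (\<Sum>n<N. \<psi> (replicate n h) / complex_of_real (sqrt (fact n)))"
      using \<psi> sym_tensor_fock[OF replicate_car[OF h]]
      by (intro sum.cong refl) (simp add: ev_term_def F.ip_scale_left sym_tensor_reproducing[OF replicate_car[OF h]])
    finally show ?thesis .
  qed
  ultimately show ?thesis by (simp add: sums_def)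
qed

lemma iplist_replicate: "iplist H (replicate n h) (replicate n k) = ip H h k ^ n"
  by (induction n) auto

lemma ip_ev_ev:
  assumes h: "h \<in> car H" and k: "k \<in> car H"
  shows "ip (sym_fock H) (ev h) (ev k) = exp (ip H h k)"
proof -
  have "ev k (replicate n h) / complex_of_real (sqrt (fact n)) = ip H h k ^ n /\<^sub>R fact n" for n
  proof -
    have "complex_of_real (sqrt (fact n)) * complex_of_real (sqrt (fact n)) = complex_of_real (fact n)"
      unfolding of_real_mult[symmetric] by simp
    moreover have "ev k (replicate n h) / complex_of_real (sqrt (fact n))
        = ip H h k ^ n / (complex_of_real (sqrt (fact n)) * complex_of_real (sqrt (fact n)))"
      using replicate_car[OF h] by (simp add: ev_def iplist_replicate)
    ultimately have "ev k (replicate n h) / complex_of_real (sqrt (fact n)) = ip H h k ^ n / complex_of_real (fact n)"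
      by (simp only:)
    then show ?thesis by (simp add: scaleR_conv_of_real divide_inverse mult.commute)
  qed
  then have "(\<lambda>n. ip H h k ^ n /\<^sub>R fact n) sums ip (sym_fock H) (ev h) (ev k)"
    using ip_ev_sums[OF h ev_fock[OF k]] by simp
  then show ?thesis using exp_converges[of "ip H h k"] sums_unique2 by blast
qed

lemma form_Cons_append:
  assumes "form H \<psi>" shows "\<psi> (xs @ x # ys) = \<psi> (x # xs @ ys)"
  by (rule form_sym[OF assms]) simp

text \<open>
  The binomial theorem for symmetric multi-antilinear functionals; the list \<open>ys\<close> makes the
  induction work and is needed for polarization.
\<close>

lemma form_binomial:
  assumes \<psi>: "form H \<psi>" and h: "h \<in> car H" and s: "s \<in> car H"
  shows "ys \<in> lists (car H) \<Longrightarrow> \<psi> (replicate m (h + smul H c s) @ ys)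
    = (\<Sum>j\<le>m. of_nat (m choose j) * (cnj c ^ j * \<psi> (replicate j s @ replicate (m - j) h @ ys)))"
proof (induction m arbitrary: ys)
  case (Suc m)
  let ?k = "h + smul H c s"
  define x where "x j = cnj c ^ j * \<psi> (replicate j s @ replicate (Suc m - j) h @ ys)" for j
  have k: "?k \<in> car H" using h s by auto
  have l: "replicate m ?k @ ys \<in> lists (car H)" using Suc.prems replicate_car[OF k] by auto
  have "\<psi> (replicate (Suc m) ?k @ ys) = \<psi> (h # replicate m ?k @ ys) + cnj c * \<psi> (s # replicate m ?k @ ys)"
    using form_add[OF \<psi> h scale_car[OF s] l, of c] form_scale[OF \<psi> s l, of c] by simp
  also have "\<psi> (h # replicate m ?k @ ys) = \<psi> (replicate m ?k @ h # ys)" by (rule form_sym[OF \<psi>]) simp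
  also have "\<dots> = (\<Sum>j\<le>m. of_nat (m choose j) * x j)"
  proof -
    have mv: "\<psi> (replicate j s @ replicate (m - j) h @ h # ys) = \<psi> (replicate j s @ replicate (Suc m - j) h @ ys)" if "j \<le> m" for j
      using that by (intro form_sym[OF \<psi>]) (simp add: Suc_diff_le)
    moreover have "\<psi> (replicate m ?k @ h # ys) =
        (\<Sum>j\<le>m. of_nat (m choose j) * (cnj c ^ j * \<psi> (replicate j s @ replicate (m - j) h @ h # ys)))"
      using Suc.prems h by (intro Suc.IH) auto
    moreover have "\<dots> = (\<Sum>j\<le>m. of_nat (m choose j) * x j)"
      by (rule sum.cong[OF refl]) (simp only: x_def atMost_iff mv)
    ultimately show ?thesis by simp
  qed
  also have "\<psi> (s # replicate m ?k @ ys) = \<psi> (replicate m ?k @ s # ys)" by (rule form_sym[OF \<psi>]) simp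
  also have "cnj c * \<dots> = (\<Sum>j\<le>m. of_nat (m choose j) * x (Suc j))"
  proof -
    have "\<psi> (replicate j s @ replicate (m - j) h @ s # ys) = \<psi> (replicate (Suc j) s @ replicate (m - j) h @ ys)" for j
      by (intro form_sym[OF \<psi>]) simp
    moreover have "\<psi> (replicate m ?k @ s # ys) =
        (\<Sum>j\<le>m. of_nat (m choose j) * (cnj c ^ j * \<psi> (replicate j s @ replicate (m - j) h @ s # ys)))"
      using Suc.prems s by (intro Suc.IH) auto
    ultimately show ?thesis unfolding x_def by (simp only: sum_distrib_left diff_Suc_Suc power_Suc mult_ac)
  qed
  finally show ?case unfolding sum_choose_Suc by (simp add: x_def)
qed simp

text \<open>
  On a real subspace \<open>R\<close>, the values on \<open>(h + t s, \<dots>, h + t s, x\<^sub>1, \<dots>)\<close> form a polynomial in the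
  real variable \<open>t\<close>. It vanishes by hypothesis, and so does its linear coefficient, which has one
  argument \<open>s\<close> in place of \<open>h\<close>. Repeating this makes all arguments independent.
\<close>

lemma form_polarization:
  assumes \<psi>: "form H \<psi>" and R: "R \<subseteq> car H" "0 \<in> R"
    and add: "\<And>h s t. h \<in> R \<Longrightarrow> s \<in> R \<Longrightarrow> h + smul H (complex_of_real t) s \<in> R"
    and diag: "\<And>h n. h \<in> R \<Longrightarrow> \<psi> (replicate n h) = 0" and xs: "xs \<in> lists R"
  shows "\<psi> xs = 0"
proof -
  have "\<forall>h\<in>R. \<forall>m. \<psi> (replicate m h @ xs) = 0"
    using xs
  proof (induction xs rule: list.induct)
    case Nil then show ?case using diag by simp
  next
    case (Cons s xs)
    show ?case
    proof (intro ballI allI)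
      fix h m assume h: "h \<in> R"
      have s: "s \<in> R" "xs \<in> lists R" using Cons.prems by auto
      have c: "h \<in> car H" "s \<in> car H" "xs \<in> lists (car H)"
        using h s R subsetD[OF lists_mono[OF R(1)] s(2)] by auto
      let ?c = "\<lambda>j. of_nat (Suc m choose j) * \<psi> (replicate j s @ replicate (Suc m - j) h @ xs)"
      have "(\<Sum>j\<le>Suc m. ?c j * complex_of_real t ^ j) = 0" for t
      proof -
        have "\<psi> (replicate (Suc m) (h + smul H (complex_of_real t) s) @ xs) = 0"
          using Cons.IH s add[OF h s(1)] by blast
        then show ?thesis
          unfolding form_binomial[OF \<psi> c] by (simp add: mult_ac del: sum.atMost_Suc)
      qed
      from polynomial_unique_zero[OF this, of 1] have "\<psi> (replicate 1 s @ replicate m h @ xs) = 0"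
        using of_nat_neq_0[where 'a = complex, of m] by simp
      then show "\<psi> (replicate m h @ s # xs) = 0" using form_Cons_append[OF \<psi>] by simp
    qed
  qed
  then have "\<psi> (replicate 0 0 @ xs) = 0" using R(2) by blast
  then show ?thesis by simp
qed

text \<open>
  Here complex scalars and limits come in: a functional vanishing on a real subspace vanishes on
  the closed complex subspace which it generates, one argument at a time.
\<close>

lemma form_zero_closed_span:
  assumes \<psi>: "form H \<psi>" and S: "S \<subseteq> car H" and zero: "\<And>xs. xs \<in> lists S \<Longrightarrow> \<psi> xs = 0"
    and xs: "xs \<in> lists (hclosure H (vs.span S))"
  shows "\<psi> xs = 0"
proof -
  let ?T = "hclosure H (vs.span S)"
  have T: "?T \<subseteq> car H" by (rule hclosure_car)
  have "\<forall>zs\<in>lists S. \<psi> (xs @ zs) = 0"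
    using xs
  proof (induction xs rule: list.induct)
    case Nil then show ?case using zero by simp
  next
    case (Cons y ys)
    show ?case
    proof
      fix zs assume zs: "zs \<in> lists S"
      have l: "ys @ zs \<in> lists (car H)" using Cons.prems zs S T by (auto simp: in_lists_conv_set)
      have base: "\<psi> (x # ys @ zs) = 0" if "x \<in> S" for x
      proof -
        have "\<psi> (ys @ x # zs) = 0" using Cons that zs by auto
        then show ?thesis using form_Cons_append[OF \<psi>] by simp
      qed
      have sp: "x \<in> car H \<and> \<psi> (x # ys @ zs) = 0" if "x \<in> vs.span S" for x
        using that
      proof (induction rule: vs.span_induct_alt)
        case base
        then show ?case using form_scale[OF \<psi> zero_car l, of 0] by simp
      next
        case (step c x y)
        then have x: "x \<in> car H" using S by auto
        then show ?case
          using step base[OF step(1)] form_add[OF \<psi> scale_car[OF x, of c] _ l, of y] form_scale[OF \<psi> x l, of c] by auto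
      qed
      have y: "y \<in> ?T" using Cons.prems by auto
      obtain s where s: "\<And>n. s n \<in> vs.span S" "lim_to s y" using hclosureE[OF span_car[OF S] y] by metis
      have yc: "y \<in> car H" and sc: "\<And>n. s n \<in> car H" using s by (auto simp: lim_to_def)
      obtain M where M: "\<And>xs. xs \<in> lists (car H) \<Longrightarrow> length xs = Suc (length (ys @ zs)) \<Longrightarrow> cmod (\<psi> xs) \<le> M * prod_list (map (hnorm H) xs)"
        using form_bound[OF \<psi>, of "Suc (length (ys @ zs))"] by metis
      let ?p = "prod_list (map (hnorm H) (ys @ zs))"
      have "cmod (\<psi> (y # ys @ zs)) \<le> M * (hnorm H (s n - y) * ?p)" for n
      proof -
        have "\<psi> (s n # ys @ zs) = \<psi> ((s n - y) # ys @ zs) + \<psi> (y # ys @ zs)"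
          using form_add[OF \<psi> diff_car[OF sc yc] yc l, of n] by simp
        then have "\<psi> (y # ys @ zs) = - \<psi> ((s n - y) # ys @ zs)" using sp[OF s(1)[of n]] by (simp add: eq_neg_iff_add_eq_0 add.commute)
        then show ?thesis using M[of "(s n - y) # ys @ zs"] l sc[of n] yc by simp
      qed
      moreover have "(\<lambda>n. M * (hnorm H (s n - y) * ?p)) \<longlonglongrightarrow> 0"
        using s(2) by (intro tendsto_mult_right_zero tendsto_mult_left_zero) (simp add: lim_to_def)
      ultimately have "cmod (\<psi> (y # ys @ zs)) \<le> 0" by (intro LIMSEQ_le_const) auto
      then show "\<psi> ((y # ys) @ zs) = 0" by simp
    qed
  qed
  then have "\<psi> (xs @ []) = 0" by blast
  then show ?thesis by simp
qed

text \<open>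
  The exponential vectors of a real subspace \<open>R\<close> already determine a functional on the closed
  complex span of \<open>R\<close>. This is why the real vectors \<open>P\<^sub>1 V g\<close>, \<open>g = g\<^sup>*\<close>, suffice for totality.
\<close>

theorem orth_ev_imp_zero:
  assumes \<psi>: "\<psi> \<in> fock_carrier H" and R: "R \<subseteq> car H" "0 \<in> R"
    and add: "\<And>h s t. h \<in> R \<Longrightarrow> s \<in> R \<Longrightarrow> h + smul H (complex_of_real t) s \<in> R"
    and orth: "\<And>h. h \<in> R \<Longrightarrow> ip (sym_fock H) (ev h) \<psi> = 0"
    and xs: "xs \<in> lists (hclosure H (vs.span R))"
  shows "\<psi> xs = 0"
proof (rule form_zero_closed_span[OF fock_form[OF \<psi>] R(1) _ xs])
  fix xs assume xs: "xs \<in> lists R"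
  show "\<psi> xs = 0"
  proof (rule form_polarization[OF fock_form[OF \<psi>] R add _ xs])
    fix h n assume h: "h \<in> R"
    then have hc: "h \<in> car H" using R by auto
    have "(\<lambda>n. \<psi> (replicate n h) / complex_of_real (sqrt (fact n)) * complex_of_real t ^ n) sums 0" for t
    proof -
      have th: "smul H (complex_of_real t) h \<in> R" using add[OF R(2) h, of t] by simp
      have "\<psi> (replicate n (smul H (complex_of_real t) h)) = complex_of_real t ^ n * \<psi> (replicate n h)" for n
      proof -
        have "\<psi> (replicate n (smul H (complex_of_real t) h) @ ys) = complex_of_real t ^ n * \<psi> (replicate n h @ ys)"
          if "ys \<in> lists (car H)" for ys
          using that
        proof (induction n arbitrary: ys)
          case (Suc n)
          let ?k = "smul H (complex_of_real t) h"
          have "replicate n ?k @ ys \<in> lists (car H)" using Suc.prems replicate_car[OF scale_car[OF hc]] by auto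
          then have "\<psi> (replicate (Suc n) ?k @ ys) = complex_of_real t * \<psi> (h # replicate n ?k @ ys)"
            using form_scale[OF fock_form[OF \<psi>] hc] by simp
          also have "\<psi> (h # replicate n ?k @ ys) = \<psi> (replicate n ?k @ h # ys)" by (rule form_sym[OF fock_form[OF \<psi>]]) simp
          also have "\<dots> = complex_of_real t ^ n * \<psi> (replicate n h @ h # ys)" using Suc.prems hc by (intro Suc.IH) auto
          also have "\<psi> (replicate n h @ h # ys) = \<psi> (replicate (Suc n) h @ ys)" by (rule form_sym[OF fock_form[OF \<psi>]]) simp
          finally show ?case by simp
        qed simp
        from this[of "[]"] show ?thesis by simp
      qed
      then show ?thesis
        using ip_ev_sums[OF scale_car[OF hc, of "complex_of_real t"] \<psi>] orth[OF th] by (simp add: mult_ac)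
    qed
    from powser_unique_zero[OF this] show "\<psi> (replicate n h) = 0" by simp
  qed
qed

lemma ev_total: "hclosure (sym_fock H) (F.vs.span (ev ` car H)) = fock_carrier H"
proof -
  have "hclosure (sym_fock H) (F.vs.span (ev ` car H)) = car (sym_fock H)"
  proof (rule F.total_if_orth)
    fix \<psi> assume \<psi>: "\<psi> \<in> car (sym_fock H)" "\<And>u. u \<in> ev ` car H \<Longrightarrow> ip (sym_fock H) u \<psi> = 0"
    have "\<psi> xs = 0 xs" if "xs \<in> lists (car H)" for xs
    proof -
      have "xs \<in> lists (hclosure H (vs.span (car H)))"
        using that lists_mono[OF hclosure_superset[OF span_car[OF order_refl]]] lists_mono[OF vs.span_superset, of "car H"] by blast
      then show ?thesis using \<psi> by (auto intro!: orth_ev_imp_zero[of \<psi> "car H"])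
    qed
    then show "\<psi> = 0" using \<psi> fock_0 by (intro fock_eqI) auto
  qed (use ev_fock in auto)
  then show ?thesis by simp
qed

end

section \<open>Weyl operators as displacement operators\<close>

text \<open>
  The linear relation generated by the assignments \<open>x i \<mapsto> y i\<close>. Defining the extension as a
  relation postpones the question whether it is well defined.
\<close>

inductive_set pair_span :: "('v::ab_group_add) hspace \<Rightarrow> ('i \<Rightarrow> 'v) \<Rightarrow> ('i \<Rightarrow> 'v) \<Rightarrow> 'i set \<Rightarrow> ('v \<times> 'v) set"
  for H :: "('v::ab_group_add) hspace" and x y :: "'i \<Rightarrow> 'v" and I :: "'i set" where
  zero: "(0, 0) \<in> pair_span H x y I"
| step: "i \<in> I \<Longrightarrow> (a, b) \<in> pair_span H x y I \<Longrightarrow> (smul H c (x i) + a, smul H c (y i) + b) \<in> pair_span H x y I"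

context hilbert begin

lemma pair_span_linear: "linear_graph (pair_span H x y I)"
proof -
  have add: "(a + c, b + d) \<in> pair_span H x y I" if "(a, b) \<in> pair_span H x y I" "(c, d) \<in> pair_span H x y I" for a b c d
    using that
  proof (induction rule: pair_span.induct)
    case (step i a b z)
    then show ?case using pair_span.step[of i I "a + c" "b + d" H x y z] by (simp add: add.assoc)
  qed simp
  have scale: "(smul H z a, smul H z b) \<in> pair_span H x y I" if "(a, b) \<in> pair_span H x y I" for a b z
    using that
  proof (induction rule: pair_span.induct)
    case (step i a b w)
    then show ?case using pair_span.step[of i I "smul H z a" "smul H z b" H x y "z * w"] by (simp add: vs.scale_right_distrib)
  qed (simp add: pair_span.zero)
  show ?thesis unfolding linear_graph_def using pair_span.zero add scale by blast
qed

text \<open>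
  Preservation of inner products of a total family passes to the linear relation generated by
  \<open>x i \<mapsto> y i\<close> and to its closure; an isometric relation is single valued, and completeness makes
  its domain closed.
\<close>

theorem isometry_extension:
  assumes x: "\<And>i. i \<in> I \<Longrightarrow> x i \<in> car H" and y: "\<And>i. i \<in> I \<Longrightarrow> y i \<in> car H"
    and iso: "\<And>i j. i \<in> I \<Longrightarrow> j \<in> I \<Longrightarrow> ip H (y i) (y j) = ip H (x i) (x j)"
    and total: "hclosure H (vs.span (x ` I)) = car H"
  shows "\<exists>U\<in>bop H. (\<forall>i\<in>I. U (x i) = y i) \<and> (\<forall>v\<in>car H. \<forall>w\<in>car H. ip H (U v) (U w) = ip H v w)"
proof -
  define G where "G = pair_span H x y I"
  have sub: "G \<subseteq> car H \<times> car H"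
  proof clarify
    fix a b assume "(a, b) \<in> G"
    then show "a \<in> car H \<and> b \<in> car H"
      unfolding G_def by (induction rule: pair_span.induct) (use x y in auto)
  qed
  have lin: "linear_graph G" unfolding G_def by (rule pair_span_linear)
  have isoI: "ip H (y i) b = ip H (x i) a" if "i \<in> I" "(a, b) \<in> G" for i a b
  proof -
    have "a \<in> car H \<and> b \<in> car H \<and> ip H (y i) b = ip H (x i) a"
      using that(2) unfolding G_def
      by (induction rule: pair_span.induct) (use x y iso that(1) in \<open>auto simp: ip_simps\<close>)
    then show ?thesis by simp
  qed
  have isoG: "ip H b d = ip H a c" if "(a, b) \<in> G" "(c, d) \<in> G" for a b c d
  proof -
    have cd: "c \<in> car H" "d \<in> car H" using that(2) sub by auto
    have "a \<in> car H \<and> b \<in> car H \<and> ip H b d = ip H a c"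
      using that(1) unfolding G_def
      by (induction rule: pair_span.induct) (use x y cd isoI[OF _ that(2)] in \<open>auto simp: ip_simps\<close>)
    then show ?thesis by simp
  qed
  define Gc where "Gc = graph_closure H G"
  have linc: "linear_graph Gc" unfolding Gc_def by (rule linear_graph_closure[OF lin sub])
  have subc: "Gc \<subseteq> car H \<times> car H" by (auto simp: Gc_def graph_closure_def)
  have isoc: "ip H b d = ip H a c" if ab: "(a, b) \<in> Gc" and cd: "(c, d) \<in> Gc" for a b c d
  proof -
    obtain s t where st: "\<And>n. (s n, t n) \<in> G" "lim_to s a" "lim_to t b"
      using ab unfolding Gc_def graph_closure_iff[OF sub] by blast
    obtain s' t' where st': "\<And>n. (s' n, t' n) \<in> G" "lim_to s' c" "lim_to t' d"
      using cd unfolding Gc_def graph_closure_iff[OF sub] by blast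
    have "(\<lambda>n. ip H (t n) (t' n)) \<longlonglongrightarrow> ip H b d" by (intro lim_to_ip st st')
    moreover have "(\<lambda>n. ip H (s n) (s' n)) \<longlonglongrightarrow> ip H a c" by (intro lim_to_ip st st')
    moreover have "(\<lambda>n. ip H (t n) (t' n)) = (\<lambda>n. ip H (s n) (s' n))" using isoG st(1) st'(1) by blast
    ultimately show ?thesis using LIMSEQ_unique by metis
  qed
  have norm: "hnorm H b = hnorm H a" if "(a, b) \<in> Gc" for a b
    using isoc[OF that that] by (simp add: hnorm_def)
  have diff: "(a - c, b - d) \<in> Gc" if "(a, b) \<in> Gc" "(c, d) \<in> Gc" for a b c d
  proof -
    have "(a + smul H (-1) c, b + smul H (-1) d) \<in> Gc" using linc that unfolding linear_graph_def by blast
    then show ?thesis by simp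
  qed
  have GGc: "G \<subseteq> Gc" unfolding Gc_def by (rule graph_closure_superset[OF sub])
  have uniq: "b = d" if "(a, b) \<in> Gc" "(a, d) \<in> Gc" for a b d
  proof -
    have "(a - a, b - d) \<in> Gc" using diff that by blast
    then have "hnorm H (b - d) = 0" "b - d \<in> car H" using norm[of 0 "b - d"] subc by auto
    then show ?thesis using hnorm_eq_zero by simp
  qed
  have total: "\<exists>w. (v, w) \<in> Gc" if v: "v \<in> car H" for v
  proof -
    have xI: "x ` I \<subseteq> car H" using x by auto
    obtain s where s: "\<And>n. s n \<in> vs.span (x ` I)" "lim_to s v"
      using hclosureE[OF span_car[OF xI]] total v by metis
    have "\<exists>w. (u, w) \<in> G" if "u \<in> vs.span (x ` I)" for u
      using that
    proof (induction rule: vs.span_induct_alt)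
      case base then show ?case using pair_span.zero G_def by blast
    next
      case (step c u a)
      then obtain i w where "u = x i" "i \<in> I" "(a, w) \<in> G" by blast
      then show ?case using pair_span.step[of i I a w H x y c] unfolding G_def by blast
    qed
    then have "\<forall>n. \<exists>w. (s n, w) \<in> G" using s(1) by blast
    then obtain t where t: "\<And>n. (s n, t n) \<in> G" by metis
    have tc: "t n \<in> car H" for n using t[of n] sub by auto
    have dist: "hnorm H (t m - t n) = hnorm H (s m - s n)" for m n
      using norm[OF diff] t GGc by blast
    have sc: "s n \<in> car H" for n using s(2) by (auto simp: lim_to_def)
    have "\<exists>w. lim_to t w"
    proof (rule Cauchy_lim_to[OF tc])
      fix e :: real assume e: "e > 0"
      have "\<forall>\<^sub>F n in sequentially. hnorm H (s n - v) < e / 2"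
        using s(2) e by (intro order_tendstoD(2)[of _ 0]) (auto simp: lim_to_def)
      then obtain N where N: "\<And>n. n \<ge> N \<Longrightarrow> hnorm H (s n - v) < e / 2" by (auto simp: eventually_sequentially)
      have "hnorm H (t m - t n) < e" if "m \<ge> N" "n \<ge> N" for m n
        using hnorm_triangle_diff[OF sc[of m] v sc[of n]] N[OF that(1)] N[OF that(2)]
          hnorm_minus_commute[OF v sc[of n]] dist[of m n] by linarith
      then show "\<exists>N. \<forall>m\<ge>N. \<forall>n\<ge>N. hnorm H (t m - t n) < e" by blast
    qed
    then show ?thesis unfolding Gc_def graph_closure_iff[OF sub] using t s(2) by blast
  qed
  define U where "U v = (if v \<in> car H then (THE w. (v, w) \<in> Gc) else 0)" for v
  have UG: "(v, U v) \<in> Gc" if "v \<in> car H" for v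
  proof -
    obtain w where w: "(v, w) \<in> Gc" using total \<open>v \<in> car H\<close> by blast
    then have "(THE w. (v, w) \<in> Gc) = w" using uniq by blast
    then show ?thesis using w that by (simp add: U_def)
  qed
  have UI: "U v = w" if "(v, w) \<in> Gc" for v w
  proof -
    have "v \<in> car H" using subsetD[OF subc that] by simp
    then show ?thesis by (rule uniq[OF UG that])
  qed
  have addc: "(v + w, v' + w') \<in> Gc" if "(v, v') \<in> Gc" "(w, w') \<in> Gc" for v v' w w'
    using linc that unfolding linear_graph_def by blast
  have scalec: "(smul H c v, smul H c v') \<in> Gc" if "(v, v') \<in> Gc" for c v v'
    using linc that unfolding linear_graph_def by blast
  have "U \<in> bop H"
    unfolding bop_def
  proof (intro CollectI conjI ballI allI impI)
    fix v w assume "v \<in> car H" "w \<in> car H"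
    then show "U (v + w) = U v + U w" by (intro UI addc UG)
  next
    fix c v assume "v \<in> car H"
    then show "U (smul H c v) = smul H c (U v)" by (intro UI scalec UG)
  next
    show "\<exists>M. \<forall>v\<in>car H. hnorm H (U v) \<le> M * hnorm H v"
      using norm[OF UG] by (intro exI[of _ 1]) auto
  next
    show "U v \<in> car H" if "v \<in> car H" for v using UG[OF that] subc by auto
  qed (simp add: U_def)
  moreover have "U (x i) = y i" if "i \<in> I" for i
  proof -
    have "(smul H 1 (x i) + 0, smul H 1 (y i) + 0) \<in> G"
      unfolding G_def using that by (intro pair_span.intros)
    then show ?thesis using GGc by (intro UI) auto
  qed
  moreover have "ip H (U v) (U w) = ip H v w" if "v \<in> car H" "w \<in> car H" for v w
    by (rule isoc[OF UG[OF that(1)] UG[OF that(2)]])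
  ultimately show ?thesis by blast
qed

text \<open>By isometry, strong continuity on a total set is enough.\<close>

lemma strongly_continuous_at_0I:
  assumes U: "\<And>t. U t \<in> bop H" "\<And>t v. v \<in> car H \<Longrightarrow> hnorm H (U t v) = hnorm H v"
    and S: "S \<subseteq> car H" "hclosure H (vs.span S) = car H"
    and cont: "\<And>s. s \<in> S \<Longrightarrow> ((\<lambda>t. hnorm H (U t s - s)) \<longlongrightarrow> 0) (at (0::real))"
    and v: "v \<in> car H"
  shows "((\<lambda>t. hnorm H (U t v - v)) \<longlongrightarrow> 0) (at 0)"
proof -
  have sp: "u \<in> car H \<and> ((\<lambda>t. hnorm H (U t u - u)) \<longlongrightarrow> 0) (at 0)" if "u \<in> vs.span S" for u
    using that
  proof (induction rule: vs.span_induct_alt)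
    case base then show ?case using bop_zero[OF U(1)] by simp
  next
    case (step c x y)
    then have c: "x \<in> car H" "y \<in> car H" using S by auto
    have "((\<lambda>t. cmod c * hnorm H (U t x - x) + hnorm H (U t y - y)) \<longlongrightarrow> cmod c * 0 + 0) (at 0)"
      using step cont by (intro tendsto_intros) auto
    then have z: "((\<lambda>t. cmod c * hnorm H (U t x - x) + hnorm H (U t y - y)) \<longlongrightarrow> 0) (at 0)" by simp
    have b: "norm (hnorm H (U t (smul H c x + y) - (smul H c x + y))) \<le> cmod c * hnorm H (U t x - x) + hnorm H (U t y - y)" for t
    proof -
      have cc: "U t x \<in> car H" "U t y \<in> car H" using c U bop_car by auto
      have "U t (smul H c x + y) - (smul H c x + y) = smul H c (U t x - x) + (U t y - y)"
        using c by (simp add: bop_add[OF U(1)] bop_scale[OF U(1)] vs.scale_right_diff_distrib)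
      then have "hnorm H (U t (smul H c x + y) - (smul H c x + y)) = hnorm H (smul H c (U t x - x) + (U t y - y))"
        by (simp only:)
      also have "\<dots> \<le> cmod c * hnorm H (U t x - x) + hnorm H (U t y - y)"
        using hnorm_triangle[of "smul H c (U t x - x)" "U t y - y"] c cc by (simp add: hnorm_scale)
      finally show ?thesis using bop_car'[OF U(1)] c by simp
    qed
    have "((\<lambda>t. hnorm H (U t (smul H c x + y) - (smul H c x + y))) \<longlongrightarrow> 0) (at 0)"
      by (rule Lim_null_comparison[OF always_eventually z]) (use b in blast)
    then show ?case using c by auto
  qed
  show ?thesis
  proof (rule tendstoI)
    fix e :: real assume e: "e > 0"
    obtain u where u: "u \<in> vs.span S" "hnorm H (v - u) < e / 3"
      using v S(2) e unfolding hclosure_def by (auto dest!: equalityD2 subsetD[of _ _ v] spec[of _ "e / 3"])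
    have uc: "u \<in> car H" using sp u by blast
    have "\<forall>\<^sub>F t in at 0. hnorm H (U t u - u) < e / 3"
      using sp[OF u(1)] e by (intro order_tendstoD(2)[of _ 0]) auto
    then show "\<forall>\<^sub>F t in at 0. dist (hnorm H (U t v - v)) 0 < e"
    proof eventually_elim
      case (elim t)
      have c: "U t v \<in> car H" "U t u \<in> car H" using v uc U bop_car by auto
      have 1: "hnorm H (U t v - U t u) = hnorm H (v - u)" using v uc U(2)[of "v - u"] bop_diff[OF U(1)] by simp
      have "hnorm H (U t v - v) \<le> hnorm H (U t v - U t u) + hnorm H (U t u - v)" using c v by (intro hnorm_triangle_diff)
      also have "hnorm H (U t u - v) \<le> hnorm H (U t u - u) + hnorm H (u - v)" using c v uc by (intro hnorm_triangle_diff)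
      finally have "hnorm H (U t v - v) < e" using 1 elim u(2) hnorm_minus_commute[OF v uc] by linarith
      then show ?case using c v by simp
    qed
  qed
qed

end

context fock_space begin

text \<open>The displacement operator, characterized by its action on exponential vectors.\<close>

definition W :: "'a \<Rightarrow> ('a list \<Rightarrow> complex) \<Rightarrow> 'a list \<Rightarrow> complex" where
  "W z = (SOME U. U \<in> bop (sym_fock H) \<and>
     (\<forall>h\<in>car H. U (ev h) = smul (sym_fock H) (exp (- (ip H z z / 2) - ip H z h)) (ev (h + z))) \<and>
     (\<forall>v\<in>fock_carrier H. \<forall>w\<in>fock_carrier H. ip (sym_fock H) (U v) (U w) = ip (sym_fock H) v w))"

lemma W_exists:
  assumes z: "z \<in> car H"
  shows "\<exists>U. U \<in> bop (sym_fock H) \<and>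
     (\<forall>h\<in>car H. U (ev h) = smul (sym_fock H) (exp (- (ip H z z / 2) - ip H z h)) (ev (h + z))) \<and>
     (\<forall>v\<in>fock_carrier H. \<forall>w\<in>fock_carrier H. ip (sym_fock H) (U v) (U w) = ip (sym_fock H) v w)"
proof -
  let ?y = "\<lambda>h. smul (sym_fock H) (exp (- (ip H z z / 2) - ip H z h)) (ev (h + z))"
  have "ip (sym_fock H) (?y h) (?y k) = ip (sym_fock H) (ev h) (ev k)" if hk: "h \<in> car H" "k \<in> car H" for h k
  proof -
    have c: "ev (h + z) \<in> fock_carrier H" "ev (k + z) \<in> fock_carrier H" using hk z ev_fock by auto
    have zz: "cnj (ip H z z) = ip H z z" using ip_cnj[OF z z] by simp
    have "ip (sym_fock H) (?y h) (?y k) =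
        cnj (exp (- (ip H z z / 2) - ip H z h)) * (exp (- (ip H z z / 2) - ip H z k) * exp (ip H (h + z) (k + z)))"
      using c hk z by (simp add: F.ip_scale F.ip_scale_left fock_scale ip_ev_ev)
    also have "\<dots> = exp (cnj (- (ip H z z / 2) - ip H z h) + (- (ip H z z / 2) - ip H z k) + ip H (h + z) (k + z))"
      by (simp add: exp_add exp_cnj)
    also have "cnj (- (ip H z z / 2) - ip H z h) + (- (ip H z z / 2) - ip H z k) + ip H (h + z) (k + z) = ip H h k"
      using hk z ip_cnj[OF z hk(1)] zz by (simp add: ip_simps)
    finally show ?thesis using hk by (simp add: ip_ev_ev)
  qed
  then have "\<exists>U\<in>bop (sym_fock H). (\<forall>h\<in>car H. U (ev h) = ?y h) \<and>
     (\<forall>v\<in>car (sym_fock H). \<forall>w\<in>car (sym_fock H). ip (sym_fock H) (U v) (U w) = ip (sym_fock H) v w)"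
    using z ev_fock ev_total by (intro F.isometry_extension) (auto simp: fock_scale)
  then show ?thesis by auto
qed

lemma W_bop: "z \<in> car H \<Longrightarrow> W z \<in> bop (sym_fock H)"
  and W_ev: "z \<in> car H \<Longrightarrow> h \<in> car H \<Longrightarrow> W z (ev h) = smul (sym_fock H) (exp (- (ip H z z / 2) - ip H z h)) (ev (h + z))"
  and W_ip: "z \<in> car H \<Longrightarrow> v \<in> fock_carrier H \<Longrightarrow> w \<in> fock_carrier H \<Longrightarrow> ip (sym_fock H) (W z v) (W z w) = ip (sym_fock H) v w"
  using someI_ex[OF W_exists[of z]] unfolding W_def by blast+

lemma W_eqI:
  assumes "A \<in> bop (sym_fock H)" "B \<in> bop (sym_fock H)" "\<And>h. h \<in> car H \<Longrightarrow> A (ev h) = B (ev h)"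
  shows "A = B"
  by (rule F.bop_eqI[OF assms(1,2), of "ev ` car H"]) (use assms(3) ev_fock ev_total in auto)

text \<open>Both sides map \<open>e(h)\<close> to a multiple of \<open>e(h + w + z)\<close>; the exponents are compared.\<close>

theorem weyl_relation:
  assumes z: "z \<in> car H" and w: "w \<in> car H"
  shows "W z \<circ> W w = (\<lambda>\<psi>. smul (sym_fock H) (exp ((ip H w z - ip H z w) / 2)) (W (z + w) \<psi>))"
proof (rule W_eqI)
  show "W z \<circ> W w \<in> bop (sym_fock H)" using z w W_bop by (intro F.bop_comp)
  show "(\<lambda>\<psi>. smul (sym_fock H) (exp ((ip H w z - ip H z w) / 2)) (W (z + w) \<psi>)) \<in> bop (sym_fock H)"
    using z w W_bop by (intro F.bop_smul) auto
  fix h assume h: "h \<in> car H"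
  have c: "ev (h + w) \<in> fock_carrier H" "ev (h + w + z) \<in> fock_carrier H" using h w z ev_fock by auto
  have "(W z \<circ> W w) (ev h) = smul (sym_fock H) (exp (- (ip H w w / 2) - ip H w h) * exp (- (ip H z z / 2) - ip H z (h + w))) (ev (h + w + z))"
    using h w z c by (simp add: W_ev F.bop_scale[OF W_bop[OF z]])
  also have "exp (- (ip H w w / 2) - ip H w h) * exp (- (ip H z z / 2) - ip H z (h + w))
      = exp ((ip H w z - ip H z w) / 2) * exp (- (ip H (z + w) (z + w) / 2) - ip H (z + w) h)"
    unfolding exp_add[symmetric] using h w z by (simp add: ip_simps field_simps)
  also have "h + w + z = h + (z + w)" by (simp add: add_ac)
  finally show "(W z \<circ> W w) (ev h) = smul (sym_fock H) (exp ((ip H w z - ip H z w) / 2)) (W (z + w) (ev h))"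
    using h w z by (simp add: W_ev)
qed

lemma W_zero: "W 0 = hid (sym_fock H)"
  by (rule W_eqI) (auto simp: W_bop F.bop_hid W_ev ev_fock)

lemma W_inverse: "z \<in> car H \<Longrightarrow> W z \<circ> W (- z) = hid (sym_fock H)"
  using weyl_relation[of z "- z"] by (simp add: W_zero ip_minus ip_minus_left)

lemma W_unitary: assumes z: "z \<in> car H" shows "unitary_op (sym_fock H) (W z)"
  unfolding unitary_op_def
proof (intro conjI W_bop z ballI)
  show "W z ` car (sym_fock H) = car (sym_fock H)"
  proof
    show "W z ` car (sym_fock H) \<subseteq> car (sym_fock H)" using W_bop[OF z] F.bop_car by blast
    show "car (sym_fock H) \<subseteq> W z ` car (sym_fock H)"
    proof
      fix v assume v: "v \<in> car (sym_fock H)"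
      have "W z (W (- z) v) = v" using fun_cong[OF W_inverse[OF z], of v] v by (simp del: sym_fock_sel)
      moreover have "W (- z) v \<in> car (sym_fock H)" by (rule F.bop_car[OF W_bop[OF uminus_car[OF z]] v])
      ultimately show "v \<in> W z ` car (sym_fock H)" by (metis imageI)
    qed
  qed
  show "ip (sym_fock H) (W z v) (W z w) = ip (sym_fock H) v w" if "v \<in> car (sym_fock H)" "w \<in> car (sym_fock H)" for v w
    using W_ip[OF z] that by simp
qed

lemma W_adjoint: assumes z: "z \<in> car H" shows "hadj (sym_fock H) (W z) = W (- z)"
proof (rule F.hadj_eqI)
  show "W (- z) \<in> bop (sym_fock H)" using z W_bop by auto
  fix v w assume vw: "v \<in> car (sym_fock H)" "w \<in> car (sym_fock H)"
  have c: "W (- z) v \<in> fock_carrier H" using F.bop_car[OF W_bop[OF uminus_car[OF z]] vw(1)] by simp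
  have "W z (W (- z) v) = v" using fun_cong[OF W_inverse[OF z], of v] vw by (simp del: sym_fock_sel)
  then show "ip (sym_fock H) (W (- z) v) w = ip (sym_fock H) v (W z w)"
    using W_ip[OF z c, of w] vw by simp
qed

text \<open>The unitary group \<open>t \<mapsto> W(t i g)\<close>, to be identified with \<open>t \<mapsto> exp (t i (a\<^sup>*(g) + a(g)))\<close>.\<close>

definition flow :: "'a \<Rightarrow> real \<Rightarrow> ('a list \<Rightarrow> complex) \<Rightarrow> 'a list \<Rightarrow> complex" where
  "flow g t = W (smul H (complex_of_real t * \<i>) g)"

lemma flow_ev: "g \<in> car H \<Longrightarrow> h \<in> car H \<Longrightarrow>
  flow g t (ev h) = smul (sym_fock H) (exp (- (complex_of_real (t\<^sup>2) * ip H g g / 2) + complex_of_real t * \<i> * ip H g h))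
    (ev (h + smul H (complex_of_real t * \<i>) g))"
  unfolding flow_def by (simp add: W_ev ip_scale ip_scale_left power2_eq_square mult_ac)

lemma flow_unitary_group:
  assumes g: "g \<in> car H" shows "unitary_group (sym_fock H) (flow g)"
  unfolding unitary_group_def
proof (intro conjI allI ballI)
  show "unitary_op (sym_fock H) (flow g t)" for t unfolding flow_def using g by (intro W_unitary) auto
  show "flow g 0 = hid (sym_fock H)" by (simp add: flow_def W_zero)
  show "flow g (s + t) = flow g s \<circ> flow g t" for s t
    unfolding flow_def using g weyl_relation[of "smul H (complex_of_real s * \<i>) g" "smul H (complex_of_real t * \<i>) g"]
    by (simp add: ip_scale ip_scale_left vs.scale_left_distrib[symmetric] distrib_right)
  fix v assume v: "v \<in> car (sym_fock H)"
  show "((\<lambda>t. hnorm (sym_fock H) (flow g t v - v)) \<longlongrightarrow> 0) (at 0)"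
  proof (rule F.strongly_continuous_at_0I[OF _ _ _ _ _ v])
    show b: "flow g t \<in> bop (sym_fock H)" for t unfolding flow_def using g W_bop by auto
    show nf: "hnorm (sym_fock H) (flow g t u) = hnorm (sym_fock H) u" if "u \<in> car (sym_fock H)" for t u
      unfolding hnorm_def flow_def using W_ip[of "smul H (complex_of_real t * \<i>) g" u u] g that by simp
    show "ev ` car H \<subseteq> car (sym_fock H)" using ev_fock by auto
    show "hclosure (sym_fock H) (F.vs.span (ev ` car H)) = car (sym_fock H)" using ev_total by simp
    fix s assume "s \<in> ev ` car H"
    then obtain h where h: "h \<in> car H" "s = ev h" by auto
    define f where "f t = exp (- (complex_of_real (t\<^sup>2) * ip H g g / 2) + complex_of_real t * \<i> * ip H g h) *
        exp (ip H h h + complex_of_real t * \<i> * ip H h g)" for t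
    have f: "ip (sym_fock H) (ev h) (flow g t (ev h)) = f t" for t
      using g h ev_fock by (simp add: flow_ev F.ip_scale ip_ev_ev ip_add ip_scale f_def)
    have "(f \<longlongrightarrow> f 0) (at 0)" unfolding f_def by (intro tendsto_intros) auto
    then have "((\<lambda>t. sqrt (2 * (hnorm (sym_fock H) (ev h))\<^sup>2 - 2 * Re (f t))) \<longlongrightarrow>
        sqrt (2 * (hnorm (sym_fock H) (ev h))\<^sup>2 - 2 * Re (f 0))) (at 0)"
      by (intro tendsto_real_sqrt tendsto_diff tendsto_mult tendsto_const tendsto_Re)
    moreover have "Re (f 0) = (hnorm (sym_fock H) (ev h))\<^sup>2"
      using h ev_fock by (simp add: F.hnorm_sq ip_ev_ev f_def)
    moreover have "hnorm (sym_fock H) (flow g t s - s) = sqrt (2 * (hnorm (sym_fock H) (ev h))\<^sup>2 - 2 * Re (f t))" for t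
    proof -
      have c: "ev h \<in> car (sym_fock H)" "flow g t (ev h) \<in> car (sym_fock H)" using h ev_fock F.bop_car'[OF b] by auto
      have "Re (ip (sym_fock H) (flow g t (ev h)) (ev h)) = Re (f t)"
        using F.ip_cnj[OF c] f by simp
      then have "(hnorm (sym_fock H) (flow g t (ev h) - ev h))\<^sup>2 = 2 * (hnorm (sym_fock H) (ev h))\<^sup>2 - 2 * Re (f t)"
        using F.hnorm_sq_diff[OF c(2,1)] nf[OF c(1)] by simp
      then show ?thesis using F.hnorm_nonneg[OF F.diff_car[OF c(2,1)]] h(2) by (metis real_sqrt_unique)
    qed
    ultimately show "((\<lambda>t. hnorm (sym_fock H) (flow g t s - s)) \<longlongrightarrow> 0) (at 0)" by simp
  qed
qed

section \<open>Weyl operators as exponentials of field operators\<close>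

lemma form_diag_derivative:
  assumes \<psi>: "form H \<psi>" and k: "k \<in> car H" and g: "g \<in> car H"
  shows "((\<lambda>t. \<psi> (replicate n (k + smul H (complex_of_real t * c) g))) has_vector_derivative
     of_nat n * cnj c * \<psi> (g # replicate (n - 1) (k + smul H (complex_of_real t * c) g))) (at t)"
proof -
  define K where "K = k + smul H (complex_of_real t * c) g"
  have K: "K \<in> car H" using k g by (auto simp: K_def)
  define b where "b j = of_nat (n choose j) * (cnj c ^ j * \<psi> (replicate j g @ replicate (n - j) K))" for j
  have eq: "\<psi> (replicate n (k + smul H (complex_of_real s * c) g)) = (\<Sum>j\<le>n. b j * complex_of_real ((s - t) ^ j))" for s
  proof -
    have "k + smul H (complex_of_real s * c) g = K + smul H (complex_of_real (s - t) * c) g"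
      unfolding K_def add.assoc vs.scale_left_distrib[symmetric] by (simp add: left_diff_distrib)
    then show ?thesis
      using form_binomial[OF \<psi> K g, of "[]" n "complex_of_real (s - t) * c"]
      by (simp add: b_def power_mult_distrib mult_ac)
  qed
  have "((\<lambda>s. \<Sum>j\<le>n. b j * complex_of_real ((s - t) ^ j)) has_vector_derivative
      (\<Sum>j\<le>n. b j * complex_of_real (of_nat j * (t - t) ^ (j - 1)))) (at t)"
    by (intro has_vector_derivative_sum has_vector_derivative_mult_right has_vector_derivative_of_real)
      (auto intro!: derivative_eq_intros)
  also have "(\<Sum>j\<le>n. b j * complex_of_real (of_nat j * (t - t) ^ (j - 1))) = (\<Sum>j\<le>n. if j = 1 then b 1 else 0)"
    by (intro sum.cong refl) (auto simp: power_0_left)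
  also have "\<dots> = of_nat n * cnj c * \<psi> (g # replicate (n - 1) K)"
    by (cases n) (auto simp: b_def)
  finally show ?thesis unfolding eq K_def .
qed

text \<open>For \<open>f = f\<^sup>*\<close>, \<open>\<pi>(f)\<close> is this operator with \<open>g = P\<^sub>1 f\<close>.\<close>

definition field :: "'a \<Rightarrow> ('a list \<Rightarrow> complex) \<Rightarrow> 'a list \<Rightarrow> complex" where
  "field g \<psi> = creation H g \<psi> + annihilation g \<psi>"

lemma field_add: "field g (\<psi> + \<phi>) = field g \<psi> + field g \<phi>"
  by (auto simp: fun_eq_iff field_def creation_def annihilation_def sum.distrib distrib_left add_divide_distrib)

lemma field_scale: "field g (smul (sym_fock H) c \<psi>) = smul (sym_fock H) c (field g \<psi>)"
  by (auto simp: fun_eq_iff field_def creation_def annihilation_def fock_smul sum_distrib_left distrib_left mult_ac)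

lemma field_zero: "field g 0 = 0"
  using field_scale[of g 0 0] by simp

lemma creation_sym_tensor_smul: "creation H g (sym_tensor H gs) =
    smul (sym_fock H) (complex_of_real (sqrt (real (Suc (length gs))))) (sym_tensor H (g # gs))"
  unfolding creation_sym_tensor by (simp add: fun_eq_iff fock_smul)

lemma creation_sym_tensor_fock: "g \<in> car H \<Longrightarrow> gs \<in> lists (car H) \<Longrightarrow> creation H g (sym_tensor H gs) \<in> fock_carrier H"
  unfolding creation_sym_tensor_smul by (intro fock_scale sym_tensor_fock) simp

lemma annihilation_sym_tensor_fock: "g \<in> car H \<Longrightarrow> gs \<in> lists (car H) \<Longrightarrow> annihilation g (sym_tensor H gs) \<in> fock_carrier H"
  using F.sum_car[of "{..<length gs}"] sym_tensor_fock[OF lists_append_drop]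
  by (subst annihilation_sym_tensor) (auto simp: fock_scale)

lemma field_sym_tensor_fock: "g \<in> car H \<Longrightarrow> gs \<in> lists (car H) \<Longrightarrow> field g (sym_tensor H gs) \<in> fock_carrier H"
  unfolding field_def by (intro fock_add creation_sym_tensor_fock annihilation_sym_tensor_fock)

definition field_graph :: "'a \<Rightarrow> (('a list \<Rightarrow> complex) \<times> ('a list \<Rightarrow> complex)) set" where
  "field_graph g = {(\<psi>, smul (sym_fock H) \<i> (field g \<psi>)) |\<psi>. \<psi> \<in> algebraic_tensors H}"

lemma algebraic_tensors_eq: "algebraic_tensors H = F.vs.span (sym_tensor H ` lists (car H))"
  by (simp add: algebraic_tensors_def)

lemma linear_field_graph: "F.linear_graph (field_graph g)"
  unfolding F.linear_graph_def
proof (intro conjI allI impI)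
  show "(0, 0) \<in> field_graph g"
    unfolding field_graph_def algebraic_tensors_eq using F.vs.span_zero field_zero by force
next
  fix a b c d assume "(a, b) \<in> field_graph g" "(c, d) \<in> field_graph g"
  then show "(a + c, b + d) \<in> field_graph g"
    unfolding field_graph_def algebraic_tensors_eq using F.vs.span_add
    by (auto simp: field_add F.vs.scale_right_distrib)
next
  fix z a b assume "(a, b) \<in> field_graph g"
  then show "(smul (sym_fock H) z a, smul (sym_fock H) z b) \<in> field_graph g"
    unfolding field_graph_def algebraic_tensors_eq using F.vs.span_scale
    by (auto simp: field_scale mult.commute)
qed

lemma ip_ev_homogeneous:
  assumes k: "k \<in> car H" and \<psi>: "\<psi> \<in> fock_carrier H" and hom: "\<And>xs. length xs \<noteq> m \<Longrightarrow> \<psi> xs = 0"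
  shows "ip (sym_fock H) (ev k) \<psi> = \<psi> (replicate m k) / complex_of_real (sqrt (fact m))"
proof -
  have "(\<lambda>n. \<psi> (replicate n k) / complex_of_real (sqrt (fact n))) =
      (\<lambda>n. if n = m then \<psi> (replicate n k) / complex_of_real (sqrt (fact n)) else 0)"
    using hom by (auto simp: fun_eq_iff)
  then show ?thesis using ip_ev_sums[OF k \<psi>] sums_single[of m "\<lambda>n. \<psi> (replicate n k) / complex_of_real (sqrt (fact n))"]
    sums_unique2 by metis
qed

lemma replicate_remove: "j < n \<Longrightarrow> take j (replicate n k) @ drop (Suc j) (replicate n k) = replicate (n - 1) k"
  by (simp add: take_replicate drop_replicate min_def flip: replicate_add)

text \<open>
  The field operator shifts the degree by one, and \<open>e(k)\<close> picks the diagonal value in the new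
  degree. The first summand comes from creation and the second from annihilation.
\<close>

lemma ip_ev_field:
  assumes k: "k \<in> car H" and g: "g \<in> car H" and gs: "gs \<in> lists (car H)"
  shows "ip (sym_fock H) (ev k) (field g (sym_tensor H gs)) =
    (ip H k g * sym_tensor H gs (replicate (length gs) k)
      + of_nat (length gs) * sym_tensor H gs (g # replicate (length gs - 1) k)) / complex_of_real (sqrt (fact (length gs)))"
proof -
  let ?n = "length gs" and ?a = "sym_tensor H gs"
  define r where "r = complex_of_real (sqrt (fact ?n))"
  have r0: "r \<noteq> 0" by (simp add: r_def)
  have c: "creation H g ?a \<in> fock_carrier H" "annihilation g ?a \<in> fock_carrier H"
    using creation_sym_tensor_fock annihilation_sym_tensor_fock g gs by auto
  have "ip (sym_fock H) (ev k) (creation H g ?a) = ip H k g * ?a (replicate ?n k) / r"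
  proof -
    define q where "q = complex_of_real (sqrt (real (Suc ?n)))"
    have q: "q \<noteq> 0" "q * q = of_nat (Suc ?n)" unfolding q_def of_real_mult[symmetric] by simp_all
    have sq: "complex_of_real (sqrt (fact (Suc ?n))) = q * r"
      unfolding q_def r_def of_real_mult[symmetric] real_sqrt_mult[symmetric] by simp
    have "creation H g ?a (replicate (Suc ?n) k) = (\<Sum>j<Suc ?n. ip H k g * ?a (replicate ?n k)) / q"
    proof -
      have "take j (replicate (Suc ?n) k) @ drop (Suc j) (replicate (Suc ?n) k) = replicate ?n k" if "j < Suc ?n" for j
        using replicate_remove[OF that] by simp
      then have "(\<Sum>j<length (replicate (Suc ?n) k). ip H (replicate (Suc ?n) k ! j) g *
          ?a (take j (replicate (Suc ?n) k) @ drop (Suc j) (replicate (Suc ?n) k))) = (\<Sum>j<Suc ?n. ip H k g * ?a (replicate ?n k))"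
        by (intro sum.cong) (auto simp del: replicate_Suc)
      then show ?thesis using replicate_car[OF k, of "Suc ?n"] unfolding creation_def q_def by (simp del: sum.lessThan_Suc)
    qed
    also have "\<dots> = q * (ip H k g * ?a (replicate ?n k))"
      using q(1) by (simp add: q(2)[symmetric] del: of_nat_Suc)
    finally have e: "creation H g ?a (replicate (Suc ?n) k) = q * (ip H k g * ?a (replicate ?n k))" .
    have "ip (sym_fock H) (ev k) (creation H g ?a) = creation H g ?a (replicate (Suc ?n) k) / complex_of_real (sqrt (fact (Suc ?n)))"
    proof (rule ip_ev_homogeneous[OF k c(1)])
      show "creation H g ?a xs = 0" if "length xs \<noteq> Suc ?n" for xs
        unfolding creation_sym_tensor using that by (simp add: sym_tensor_def)
    qed
    then show ?thesis unfolding e sq using q(1) by simp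
  qed
  moreover have "ip (sym_fock H) (ev k) (annihilation g ?a) = of_nat ?n * ?a (g # replicate (?n - 1) k) / r"
  proof (cases ?n)
    case 0
    then have "annihilation g ?a = 0" using annihilation_sym_tensor_Nil by simp
    then show ?thesis using 0 ev_fock[OF k] by simp
  next
    case (Suc m)
    define q where "q = complex_of_real (sqrt (real ?n))"
    have q: "q \<noteq> 0" "q * q = of_nat ?n" using Suc unfolding q_def of_real_mult[symmetric] by simp_all
    have sq: "r = q * complex_of_real (sqrt (fact m))"
      unfolding q_def r_def of_real_mult[symmetric] real_sqrt_mult[symmetric] Suc by simp
    have "ip (sym_fock H) (ev k) (annihilation g ?a) = annihilation g ?a (replicate m k) / complex_of_real (sqrt (fact m))"
      by (rule ip_ev_homogeneous[OF k c(2)]) (use Suc in \<open>simp add: annihilation_def sym_tensor_def\<close>)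
    also have "annihilation g ?a (replicate m k) = q * ?a (g # replicate (?n - 1) k)"
      using Suc by (simp add: annihilation_def q_def)
    also have "\<dots> / complex_of_real (sqrt (fact m)) = (q * q) * ?a (g # replicate (?n - 1) k) / r"
      unfolding sq using q(1) by simp
    finally show ?thesis unfolding q(2) .
  qed
  ultimately show ?thesis
    unfolding field_def r_def[symmetric] using F.ip_add[of "ev k"] ev_fock[OF k] c by (simp add: add_divide_distrib)
qed

lemma has_vector_derivative_exp:
  fixes f :: "real \<Rightarrow> complex"
  assumes "(f has_vector_derivative f') (at t)" shows "((\<lambda>t. exp (f t)) has_vector_derivative exp (f t) * f') (at t)"
  using field_vector_diff_chain_at[OF assms DERIV_exp] by (simp add: comp_def mult.commute)

text \<open>
  The derivative is computed weakly against exponential vectors: \<open>\<langle>e(k), flow g s \<psi>\<rangle>\<close> is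
  \<open>E(s) \<langle>e(k - i s g), \<psi>\<rangle>\<close> with a scalar factor \<open>E(s)\<close>, and for a tensor \<open>\<psi>\<close> this is \<open>E(s)\<close> times
  a diagonal value. Differentiating \<open>E\<close> gives the creation part of \<open>ip_ev_field\<close>, differentiating
  the diagonal value gives the annihilation part.
\<close>

lemma field_graph_generator:
  assumes g: "g \<in> car H" shows "field_graph g \<subseteq> generator (sym_fock H) (flow g)"
proof -
  interpret U: unitary_flow "sym_fock H" "flow g"
    by unfold_locales (rule flow_unitary_group[OF g])
  have base: "(sym_tensor H gs, smul (sym_fock H) \<i> (field g (sym_tensor H gs))) \<in> generator (sym_fock H) (flow g)"
    if gs: "gs \<in> lists (car H)" for gs
  proof (rule U.generatorI_weak[of "ev ` car H"])
    let ?a = "sym_tensor H gs" and ?n = "length gs"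
    show "ev ` car H \<subseteq> car (sym_fock H)" using ev_fock by auto
    show "hclosure (sym_fock H) (F.vs.span (ev ` car H)) = car (sym_fock H)" using ev_total by simp
    show a: "?a \<in> car (sym_fock H)" using sym_tensor_fock[OF gs] by simp
    have fa: "field g ?a \<in> fock_carrier H" by (rule field_sym_tensor_fock[OF g gs])
    then show b: "smul (sym_fock H) \<i> (field g ?a) \<in> car (sym_fock H)" by (simp add: fock_scale)
    fix x t assume "x \<in> ev ` car H"
    then obtain k where k: "k \<in> car H" "x = ev k" by auto
    define r where "r = complex_of_real (sqrt (fact ?n))"
    define E where "E s = exp (- (complex_of_real (s\<^sup>2) * ip H g g / 2) + complex_of_real s * \<i> * ip H k g)" for s
    define K where "K s = k + smul H (complex_of_real s * - \<i>) g" for s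
    have K: "K s \<in> car H" for s using k g by (auto simp: K_def)
    have shift: "ip (sym_fock H) (ev k) (flow g s v) = E s * ip (sym_fock H) (ev (K s)) v" if v: "v \<in> car (sym_fock H)" for s v
    proof -
      have "ip (sym_fock H) (ev k) (flow g s v) = ip (sym_fock H) (flow g (- s) (ev k)) v"
        using U.U_ip_shift[of "ev k" v "- s"] ev_fock[OF k(1)] v by simp
      also have "\<dots> = cnj (exp (- (complex_of_real ((- s)\<^sup>2) * ip H g g / 2) + complex_of_real (- s) * \<i> * ip H g k)) *
          ip (sym_fock H) (ev (K s)) v"
        unfolding flow_ev[OF g k(1)] using v ev_fock[OF K] by (simp add: F.ip_scale_left K_def)
      also have "cnj (exp (- (complex_of_real ((- s)\<^sup>2) * ip H g g / 2) + complex_of_real (- s) * \<i> * ip H g k)) = E s"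
      proof -
        have "cnj (ip H g g) = ip H g g" "cnj (ip H g k) = ip H k g" using ip_cnj[OF g k(1)] ip_cnj[OF g g] by simp_all
        then show ?thesis by (simp add: E_def exp_cnj)
      qed
      finally show ?thesis .
    qed
    have "(E has_vector_derivative E t * (- (complex_of_real t * ip H g g) + \<i> * ip H k g)) (at t)"
    proof -
      have "((\<lambda>s. - (complex_of_real (s\<^sup>2) * ip H g g / 2) + complex_of_real s * \<i> * ip H k g)
          has_vector_derivative - (complex_of_real (2 * t) * ip H g g / 2) + complex_of_real 1 * \<i> * ip H k g) (at t)"
        unfolding times_divide_eq_right[symmetric]
        by (intro has_vector_derivative_add has_vector_derivative_minus has_vector_derivative_mult_left has_vector_derivative_of_real)
          (auto intro!: derivative_eq_intros)
      from has_vector_derivative_exp[OF this] show ?thesis unfolding E_def by simp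
    qed
    moreover have "((\<lambda>s. ?a (replicate ?n (K s)) / r) has_vector_derivative
        of_nat ?n * \<i> * ?a (g # replicate (?n - 1) (K t)) / r) (at t)"
      unfolding K_def using form_diag_derivative[OF form_sym_tensor[OF gs] k(1) g, of ?n "- \<i>" t]
      by (intro has_vector_derivative_divide) simp
    ultimately have "((\<lambda>s. E s * (?a (replicate ?n (K s)) / r)) has_vector_derivative
        E t * (of_nat ?n * \<i> * ?a (g # replicate (?n - 1) (K t)) / r)
        + E t * (- (complex_of_real t * ip H g g) + \<i> * ip H k g) * (?a (replicate ?n (K t)) / r)) (at t)"
      by (rule has_vector_derivative_mult)
    moreover have "(\<lambda>s. E s * (?a (replicate ?n (K s)) / r)) = (\<lambda>s. ip (sym_fock H) x (flow g s ?a))"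
    proof
      fix s
      have "ip (sym_fock H) (ev (K s)) ?a = ?a (replicate ?n (K s)) / r"
        unfolding r_def using a by (intro ip_ev_homogeneous K) (auto simp: sym_tensor_def)
      then show "E s * (?a (replicate ?n (K s)) / r) = ip (sym_fock H) x (flow g s ?a)"
        using shift[OF a] k(2) by simp
    qed
    moreover have "E t * (of_nat ?n * \<i> * ?a (g # replicate (?n - 1) (K t)) / r)
        + E t * (- (complex_of_real t * ip H g g) + \<i> * ip H k g) * (?a (replicate ?n (K t)) / r)
        = ip (sym_fock H) x (flow g t (smul (sym_fock H) \<i> (field g ?a)))"
    proof -
      have "ip H (K t) g = ip H k g + complex_of_real t * \<i> * ip H g g"
        unfolding K_def using k g by (simp add: ip_simps)
      then have "- (complex_of_real t * ip H g g) + \<i> * ip H k g = \<i> * ip H (K t) g" by (simp add: algebra_simps)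
      moreover have "ip (sym_fock H) x (flow g t (smul (sym_fock H) \<i> (field g ?a))) =
          E t * (\<i> * ((ip H (K t) g * ?a (replicate ?n (K t)) + of_nat ?n * ?a (g # replicate (?n - 1) (K t))) / r))"
        unfolding k(2) shift[OF b] r_def ip_ev_field[OF K g gs, symmetric] using fa ev_fock[OF K] by (simp add: F.ip_scale)
      ultimately show ?thesis by (simp add: add_divide_distrib distrib_left mult_ac)
    qed
    ultimately show "((\<lambda>t. ip (sym_fock H) x (flow g t ?a)) has_vector_derivative
        ip (sym_fock H) x (flow g t (smul (sym_fock H) \<i> (field g ?a)))) (at t)" by simp
  qed
  have lin: "F.linear_graph (generator (sym_fock H) (flow g))" by (rule U.linear_graph_generator)
  have "(\<psi>, smul (sym_fock H) \<i> (field g \<psi>)) \<in> generator (sym_fock H) (flow g)"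
    if "\<psi> \<in> F.vs.span (sym_tensor H ` lists (car H))" for \<psi>
    using that
  proof (induction rule: F.vs.span_induct_alt)
    case base show ?case
      unfolding field_zero F.vs.scale_zero_right using lin unfolding F.linear_graph_def by (rule conjunct1)
  next
    case (step c x y)
    then obtain gs where gs: "gs \<in> lists (car H)" "x = sym_tensor H gs" by auto
    have "(smul (sym_fock H) c x, smul (sym_fock H) c (smul (sym_fock H) \<i> (field g x))) \<in> generator (sym_fock H) (flow g)"
      using lin base[OF gs(1)] gs(2) unfolding F.linear_graph_def by blast
    then have "(smul (sym_fock H) c x + y, smul (sym_fock H) c (smul (sym_fock H) \<i> (field g x)) + smul (sym_fock H) \<i> (field g y)) \<in> generator (sym_fock H) (flow g)"
      using lin step.IH unfolding F.linear_graph_def by blast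
    then show ?case by (simp only: field_add field_scale F.vs.scale_right_distrib F.vs.scale_scale mult.commute)
  qed
  then show ?thesis unfolding field_graph_def algebraic_tensors_eq by blast
qed

lemma norm_annihilation_replicate:
  assumes g: "g \<in> car H" and h: "h \<in> car H"
  shows "hnorm (sym_fock H) (annihilation g (sym_tensor H (replicate n h))) \<le> sqrt (real (Suc n)) * (hnorm H g * hnorm H h ^ n)"
proof (cases n)
  case 0
  then show ?thesis using g by (simp add: annihilation_sym_tensor_Nil)
next
  case (Suc m)
  let ?T = "sym_tensor H (replicate m h)" and ?c = "ip H g h / complex_of_real (sqrt (real n))"
  have T: "?T \<in> car (sym_fock H)" using sym_tensor_fock[OF replicate_car[OF h]] by simp
  have "annihilation g (sym_tensor H (replicate n h)) = (\<Sum>j<n. smul (sym_fock H) ?c ?T)"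
    unfolding annihilation_sym_tensor[OF replicate_car[OF h] g] length_replicate
  proof (rule sum.cong[OF refl])
    fix j assume "j \<in> {..<n}"
    then have "take j (replicate n h) @ drop (Suc j) (replicate n h) = replicate m h" "replicate n h ! j = h"
      using replicate_remove[of j n h] Suc by (simp_all del: replicate_Suc)
    then show "smul (sym_fock H) (ip H g (replicate n h ! j) / complex_of_real (sqrt (real n)))
        (sym_tensor H (take j (replicate n h) @ drop (Suc j) (replicate n h))) = smul (sym_fock H) ?c ?T" by simp
  qed
  moreover have "hnorm (sym_fock H) (\<Sum>j<n. smul (sym_fock H) ?c ?T) \<le> (\<Sum>j<n. hnorm (sym_fock H) (smul (sym_fock H) ?c ?T))"
    using T by (intro F.hnorm_sum F.scale_car)
  ultimately have "hnorm (sym_fock H) (annihilation g (sym_tensor H (replicate n h))) \<le> (\<Sum>j<n. hnorm (sym_fock H) (smul (sym_fock H) ?c ?T))"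
    by (simp only:)
  also have "\<dots> = real n / sqrt (real n) * (cmod (ip H g h) * hnorm (sym_fock H) ?T)"
    using T by (simp add: F.hnorm_scale norm_divide)
  also have "\<dots> = sqrt (real n) * (cmod (ip H g h) * hnorm (sym_fock H) ?T)"
    using real_div_sqrt[of "real n"] by simp
  also have "\<dots> \<le> sqrt (real (Suc n)) * ((hnorm H g * hnorm H h) * hnorm H h ^ m)"
    using norm_sym_tensor[OF replicate_car[OF h], of m] norm_replicate[of m h] F.hnorm_nonneg[OF T] g h
    by (intro mult_mono cauchy_schwarz) auto
  finally show ?thesis using Suc by (simp add: mult.assoc)
qed

text \<open>
  The partial sums of \<open>e(h)\<close> are algebraic tensors. The field operator enlarges the bound
  \<open>\<parallel>h\<parallel>\<^sup>n / \<surd>n!\<close> of the term of degree \<open>n\<close> by a factor of order \<open>\<surd>n\<close> only, so its values on the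
  partial sums converge too.
\<close>

lemma ev_in_field_closure:
  assumes g: "g \<in> car H" and h: "h \<in> car H"
  shows "\<exists>b. (ev h, b) \<in> graph_closure (sym_fock H) (field_graph g)"
proof -
  have fc: "field g (ev_term h n) \<in> fock_carrier H" for n
    unfolding ev_term_def field_scale by (intro fock_scale field_sym_tensor_fock g replicate_car h)
  have bd: "hnorm (sym_fock H) (field g (ev_term h n)) \<le> 2 * hnorm H g * (sqrt (real (Suc n)) * hnorm H h ^ n / sqrt (fact n))" for n
  proof -
    let ?r = "replicate n h"
    have c: "creation H g (sym_tensor H ?r) \<in> car (sym_fock H)" "annihilation g (sym_tensor H ?r) \<in> car (sym_fock H)"
      using creation_sym_tensor_fock[OF g replicate_car[OF h]] annihilation_sym_tensor_fock[OF g replicate_car[OF h]] by auto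
    have gr: "g # ?r \<in> lists (car H)" using g replicate_car[OF h] by auto
    have "hnorm (sym_fock H) (creation H g (sym_tensor H ?r)) = sqrt (real (Suc n)) * hnorm (sym_fock H) (sym_tensor H (g # ?r))"
      unfolding creation_sym_tensor_smul using sym_tensor_fock[OF gr] by (subst F.hnorm_scale) auto
    also have "\<dots> \<le> sqrt (real (Suc n)) * (hnorm H g * hnorm H h ^ n)"
      using norm_sym_tensor[OF gr] norm_replicate[of n h] by (intro mult_left_mono) auto
    finally have 1: "hnorm (sym_fock H) (creation H g (sym_tensor H ?r)) \<le> sqrt (real (Suc n)) * (hnorm H g * hnorm H h ^ n)" .
    have "hnorm (sym_fock H) (field g (sym_tensor H ?r)) \<le> 2 * (sqrt (real (Suc n)) * (hnorm H g * hnorm H h ^ n))"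
      unfolding field_def using F.hnorm_triangle[OF c] 1 norm_annihilation_replicate[OF g h, of n] by linarith
    then have "1 / sqrt (fact n) * hnorm (sym_fock H) (field g (sym_tensor H ?r)) \<le>
        1 / sqrt (fact n) * (2 * (sqrt (real (Suc n)) * (hnorm H g * hnorm H h ^ n)))"
      by (rule mult_left_mono) simp
    moreover have "hnorm (sym_fock H) (field g (ev_term h n)) = 1 / sqrt (fact n) * hnorm (sym_fock H) (field g (sym_tensor H ?r))"
      unfolding ev_term_def field_scale using field_sym_tensor_fock[OF g replicate_car[OF h]]
      by (subst F.hnorm_scale) (auto simp: norm_divide)
    ultimately show ?thesis by (simp add: mult_ac)
  qed
  have sm: "summable (\<lambda>n. 2 * hnorm H g * (sqrt (real (Suc n)) * hnorm H h ^ n / sqrt (fact n)))"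
    using summable_Suc_power_root_fact[OF hnorm_nonneg[OF h]] by (rule summable_mult)
  obtain d where d: "F.lim_to (\<lambda>N. \<Sum>n<N. field g (ev_term h n)) d"
    using F.summable_lim_to[of "\<lambda>n. field g (ev_term h n)", OF _ bd sm] fc by auto
  have span: "(\<Sum>n<N. ev_term h n) \<in> algebraic_tensors H" for N
    unfolding algebraic_tensors_eq ev_term_def using replicate_car[OF h]
    by (intro F.vs.span_sum F.vs.span_scale F.vs.span_base) auto
  have "field g (\<Sum>n<N. ev_term h n) = (\<Sum>n<N. field g (ev_term h n))" for N
    by (induction N) (simp_all only: lessThan_0 sum.empty sum.lessThan_Suc field_zero field_add)
  then have mem: "(\<Sum>n<N. ev_term h n, smul (sym_fock H) \<i> (\<Sum>n<N. field g (ev_term h n))) \<in> field_graph g" for N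
    using span[of N] unfolding field_graph_def by force
  have sub: "field_graph g \<subseteq> car (sym_fock H) \<times> car (sym_fock H)"
    using field_graph_generator[OF g] unfolding generator_def by auto
  have "(ev h, smul (sym_fock H) \<i> d) \<in> graph_closure (sym_fock H) (field_graph g)"
    unfolding F.graph_closure_iff[OF sub]
    by (intro exI conjI allI) (rule mem, rule ev_lim[OF h], rule F.lim_to_scale[OF d])
  then show ?thesis by (rule exI[of _ "smul (sym_fock H) \<i> d"])
qed

text \<open>
  Exponential vectors are total, lie in the domain of the closure and are permuted up to scalars
  by the group; so the closure of the field operator is the full generator.
\<close>

theorem exp_field:
  assumes g: "g \<in> car H"
  shows "exp_op (sym_fock H) (graph_closure (sym_fock H) (field_graph g)) = W (smul H \<i> g)"
proof -
  interpret U: unitary_flow "sym_fock H" "flow g"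
    by unfold_locales (rule flow_unitary_group[OF g])
  have E: "ev ` car H \<subseteq> car (sym_fock H)" "hclosure (sym_fock H) (F.vs.span (ev ` car H)) = car (sym_fock H)"
    using ev_fock ev_total by auto
  have dom: "\<exists>b. (e, b) \<in> graph_closure (sym_fock H) (field_graph g)" if "e \<in> ev ` car H" for e
    using that ev_in_field_closure[OF g] by blast
  have inv: "\<exists>c. \<exists>e'\<in>ev ` car H. flow g t e = smul (sym_fock H) c e'" if e: "e \<in> ev ` car H" for e t
  proof -
    obtain h where h: "h \<in> car H" "e = ev h" using e by blast
    have "h + smul H (complex_of_real t * \<i>) g \<in> car H" using h g by auto
    then show ?thesis unfolding h(2) flow_ev[OF g h(1)] by blast
  qed
  have "graph_closure (sym_fock H) (field_graph g) = generator (sym_fock H) (flow g)"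
    by (rule U.graph_closure_eq_generator[OF linear_field_graph field_graph_generator[OF g] E inv dom])
  then have "exp_op (sym_fock H) (graph_closure (sym_fock H) (field_graph g)) = flow g 1"
    using dom by (intro F.exp_op_eqI[OF U.unitary_group _ E]) auto
  then show ?thesis by (simp add: flow_def)
qed

end

section \<open>Weyl algebras\<close>

locale ccr =
  fixes X :: "('k::ab_group_add) ccr_space" and P :: "'k \<Rightarrow> 'k"
  assumes ccr: "is_ccr_space X" and bproj: "basis_projection X P" and khilb: "hilbert_space (Khilb X P)"
begin

abbreviation K where "K \<equiv> Khilb X P"
abbreviation K1 where "K1 \<equiv> K1hilb X P"
abbreviation \<F> where "\<F> \<equiv> Fock X P"

sublocale K: hilbert K
  using khilb by (simp add: hilbert_space_iff)

lemma K_sel [simp]: "car K = UNIV" "smul K = scal X" "ip K = (\<lambda>f g. kap X f (Cop P g))"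
  by (simp_all add: Khilb_def)

lemma P_add: "P (f + g) = P f + P g" and P_scale: "P (scal X c f) = scal X c (P f)"
  using bproj Vector_Spaces.linear.axioms(1) unfolding basis_projection_def Vector_Spaces.linear_def module_hom_def module_hom_axioms_def
  by blast+

lemma P_zero: "P 0 = 0"
  using P_add[of 0 0] by simp
lemma P_minus: "P (- f) = - P f"
  using P_add[of f "- f"] P_zero by (simp add: eq_neg_iff_add_eq_0 add.commute)
lemma P_diff: "P (f - g) = P f - P g"
  using P_add[of f "- g"] P_minus[of g] by simp

lemma P_idem: "P (P f) = P f"
  using bproj unfolding basis_projection_def by (metis comp_apply)
lemma kap_P: "kap X f (P g) = kap X (P f) g"
  using bproj by (simp add: basis_projection_def)

lemma kap_add: "kap X f (g + h) = kap X f g + kap X f h" and kap_scale: "kap X f (scal X c g) = c * kap X f g"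
  and kap_cnj: "kap X g f = cnj (kap X f g)" and kap_nondeg: "(\<And>g. kap X f g = 0) \<Longrightarrow> f = 0"
  and star_add: "star X (f + g) = star X f + star X g" and star_scale: "star X (scal X c f) = scal X (cnj c) (star X f)"
  and star_star: "star X (star X f) = f"
proof -
  note c2 = ccr[unfolded is_ccr_space_def, THEN conjunct2]
  note c3 = c2[THEN conjunct2]
  note c4 = c3[THEN conjunct2]
  note c5 = c4[THEN conjunct2]
  note c6 = c5[THEN conjunct2]
  note c7 = c6[THEN conjunct2]
  note c8 = c7[THEN conjunct2]
  note c9 = c8[THEN conjunct2]
  show "kap X f (g + h) = kap X f g + kap X f h" by (rule c3[THEN conjunct1, rule_format])
  show "kap X f (scal X c g) = c * kap X f g" by (rule c4[THEN conjunct1, rule_format])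
  show "kap X g f = cnj (kap X f g)" by (rule c5[THEN conjunct1, rule_format])
  show "f = 0" if "\<And>g. kap X f g = 0" by (rule c6[THEN conjunct1, rule_format]) (rule that)
  show "star X (f + g) = star X f + star X g" by (rule c7[THEN conjunct1, rule_format])
  show "star X (scal X c f) = scal X (cnj c) (star X f)" by (rule c8[THEN conjunct1, rule_format])
  show "star X (star X f) = f" by (rule c9[THEN conjunct1, rule_format])
qed

lemma scal_zero [simp]: "scal X c 0 = 0" and scal_minus [simp]: "scal X c (- f) = - scal X c f"
  and scal_add: "scal X c (f + g) = scal X c f + scal X c g"
  using K.vs.scale_zero_right[of c] K.vs.scale_minus_right[of c f] K.vs.scale_right_distrib[of c f g] by (simp_all only: K_sel)

lemma range_P: "f \<in> range P \<longleftrightarrow> P f = f"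
  by (metis P_idem imageE rangeI)

lemma Cop_Cop: "Cop P (Cop P f) = f"
  by (simp add: Cop_def P_diff P_idem)
lemma Cop_P: "Cop P (P f) = P f"
  by (simp add: Cop_def P_idem)
lemma P_Cop: "P (Cop P f) = P f"
  by (simp add: Cop_def P_diff P_idem)

lemma ip_P: "ip K f (P g) = ip K (P f) g"
  using kap_P[of f "Cop P g"] by (simp add: Cop_P P_Cop)

lemma kap_eq_ip: "kap X f g = ip K f (Cop P g)"
  by (simp add: Cop_Cop)

declare K_sel(3) [simp del]

lemma P_bop: "P \<in> bop K"
proof -
  have "hnorm K (P f) \<le> 1 * hnorm K f" for f
  proof -
    have "(hnorm K (P f))\<^sup>2 = cmod (ip K (P f) (P f))" by (simp add: K.ip_self norm_power)
    also have "\<dots> = cmod (ip K f (P f))" using ip_P[of f "P f"] by (simp add: P_idem)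
    also have "\<dots> \<le> hnorm K f * hnorm K (P f)" by (rule K.cauchy_schwarz) auto
    finally have "hnorm K (P f) * hnorm K (P f) \<le> hnorm K f * hnorm K (P f)" by (simp add: power2_eq_square)
    moreover have "hnorm K (P f) \<ge> 0" "hnorm K f \<ge> 0" by (auto intro: K.hnorm_nonneg)
    ultimately show ?thesis by (cases "hnorm K (P f) = 0") (auto simp: mult_le_cancel_right)
  qed
  then show ?thesis unfolding bop_def by (auto simp: P_add P_scale intro!: exI[of _ 1])
qed

lemma closed_range_P: "K.closed_sub (range P)"
  unfolding K.closed_sub_def
proof (intro conjI subsetI)
  show "K.vs.subspace (range P)"
  proof (rule K.vs.subspaceI)
    show "0 \<in> range P" using P_zero by (metis rangeI)
    show "x + y \<in> range P" if "x \<in> range P" "y \<in> range P" for x y using that by (simp add: range_P P_add)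
    show "smul K c x \<in> range P" if "x \<in> range P" for c x using that by (simp add: range_P P_scale)
  qed
  fix v assume "v \<in> hclosure K (range P)"
  then obtain s where s: "\<And>n. s n \<in> range P" "K.lim_to s v" by (rule K.hclosureE[rotated]) auto
  have "K.lim_to (\<lambda>n. P (s n)) (P v)" by (rule K.lim_to_bop[OF P_bop s(2)])
  moreover have "(\<lambda>n. P (s n)) = s" using s(1) range_P by blast
  ultimately have "P v = v" using s(2) K.lim_to_unique by metis
  then show "v \<in> range P" by (simp add: range_P)
qed simp

sublocale H: fock_space K1
  unfolding fock_space_def K1hilb_def by (rule K.hilbert_closed_sub[OF closed_range_P])

lemma K1_sel [simp]: "car K1 = range P" "smul K1 = scal X" "ip K1 = ip K"
  by (simp_all add: K1hilb_def)

lemma star_zero: "star X 0 = 0"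
  using star_add[of 0 0] by simp
lemma star_minus: "star X (- f) = - star X f"
  using star_add[of f "- f"] star_zero by (simp add: eq_neg_iff_add_eq_0 add.commute)
lemma star_diff: "star X (f - g) = star X f - star X g"
  using star_add[of f "- g"] star_minus[of g] by simp

text \<open>The one-particle vector of \<open>w(f)\<close>: for \<open>f = f\<^sup>*\<close>, \<open>w(f) = W(z f)\<close>.\<close>

abbreviation z :: "'k \<Rightarrow> 'k" where "z f \<equiv> scal X \<i> (P f)"

lemma z_car: "z f \<in> range P"
  using H.scale_car[of "P f" \<i>] by simp

lemma z_add: "z (f + g) = z f + z g"
  by (simp add: P_add scal_add)

lemma weyl_eq: assumes "star X f = f" shows "weyl X P f = H.W (z f)"
proof -
  have "{(\<psi>, smul \<F> \<i> (field_op X P f \<psi>)) |\<psi>. \<psi> \<in> algebraic_tensors K1} = H.field_graph (P f)"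
    unfolding H.field_graph_def H.field_def field_op_def assms ..
  then show ?thesis unfolding weyl_def using H.exp_field[of "P f"] by simp
qed

definition real_weyl :: "'k set \<Rightarrow> (('k list \<Rightarrow> complex) \<Rightarrow> 'k list \<Rightarrow> complex) set" where
  "real_weyl M = {weyl X P f |f. f \<in> M \<and> star X f = f}"

lemma real_weylI: "f \<in> M \<Longrightarrow> star X f = f \<Longrightarrow> weyl X P f \<in> real_weyl M"
  by (auto simp: real_weyl_def)

lemma weyl_bop: "star X f = f \<Longrightarrow> weyl X P f \<in> bop \<F>"
  using H.W_bop[of "z f"] z_car by (simp add: weyl_eq)

lemma weyl_zero: "weyl X P 0 = hid \<F>"
  using H.W_zero by (simp add: weyl_eq star_zero P_zero)

lemma weyl_hadj: assumes "star X f = f" shows "hadj \<F> (weyl X P f) = weyl X P (- f)"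
  using H.W_adjoint[of "z f"] z_car assms by (simp add: weyl_eq star_minus P_minus)

text \<open>The scalar is the phase of the Weyl relation, which linear spans absorb.\<close>

lemma weyl_comp: assumes f: "star X f = f" and g: "star X g = g"
  shows "\<exists>c. weyl X P f \<circ> weyl X P g = (\<lambda>\<psi>. smul \<F> c (weyl X P (f + g) \<psi>))"
  using H.weyl_relation[of "z f" "z g"] z_car z_add assms star_add[of f g] by (auto simp: weyl_eq)

context
  fixes M assumes M: "K.vs.subspace M"
begin

lemma real_weyl_bop: "real_weyl M \<subseteq> bop \<F>"
  using weyl_bop by (auto simp: real_weyl_def)

lemma real_weyl_comp: "A \<in> real_weyl M \<Longrightarrow> B \<in> real_weyl M \<Longrightarrow> A \<circ> B \<in> op_span \<F> (real_weyl M)"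
proof -
  assume "A \<in> real_weyl M" "B \<in> real_weyl M"
  then obtain f g where fg: "A = weyl X P f" "B = weyl X P g" "f \<in> M" "g \<in> M" "star X f = f" "star X g = g"
    by (auto simp: real_weyl_def)
  then have "f + g \<in> M" "star X (f + g) = f + g" using K.vs.subspace_add[OF M] star_add by auto
  then have "weyl X P (f + g) \<in> real_weyl M" by (rule real_weylI)
  moreover obtain c where "A \<circ> B = (\<lambda>\<psi>. smul \<F> c (weyl X P (f + g) \<psi>))" using weyl_comp fg by blast
  ultimately show ?thesis using H.F.op_span_scale[OF H.F.op_span_base] by simp
qed

lemma real_weyl_hadj: "A \<in> real_weyl M \<Longrightarrow> hadj \<F> A \<in> op_span \<F> (real_weyl M)"
proof -
  assume "A \<in> real_weyl M"
  then obtain f where f: "A = weyl X P f" "f \<in> M" "star X f = f" by (auto simp: real_weyl_def)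
  then have "weyl X P (- f) \<in> real_weyl M"
    using K.vs.subspace_neg[OF M] star_minus by (intro real_weylI) auto
  then show ?thesis using f weyl_hadj H.F.op_span_base by simp
qed

text \<open>The Weyl relation keeps products of Weyl operators in their linear span.\<close>

lemma weyl_algebra_eq: "weyl_algebra X P M = op_closure \<F> (op_span \<F> (real_weyl M))"
  unfolding weyl_algebra_def real_weyl_def[symmetric]
  by (rule H.F.cstar_generated_eq[OF real_weyl_bop real_weyl_comp real_weyl_hadj])

lemma weyl_algebra_cstar: "cstar_algebra_on \<F> (weyl_algebra X P M)"
  unfolding weyl_algebra_eq by (rule H.F.cstar_op_closure[OF real_weyl_bop real_weyl_comp real_weyl_hadj])

lemma weyl_algebra_bop: "A \<in> weyl_algebra X P M \<Longrightarrow> A \<in> bop \<F>"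
  using weyl_algebra_cstar unfolding cstar_algebra_on_def by blast
lemma weyl_algebra_comp: "A \<in> weyl_algebra X P M \<Longrightarrow> B \<in> weyl_algebra X P M \<Longrightarrow> A \<circ> B \<in> weyl_algebra X P M"
  using weyl_algebra_cstar unfolding cstar_algebra_on_def by blast
lemma weyl_algebra_hadj: "A \<in> weyl_algebra X P M \<Longrightarrow> hadj \<F> A \<in> weyl_algebra X P M"
  using weyl_algebra_cstar unfolding cstar_algebra_on_def by blast
lemma weyl_algebra_smul: "A \<in> weyl_algebra X P M \<Longrightarrow> (\<lambda>v. smul \<F> c (A v)) \<in> weyl_algebra X P M"
  using weyl_algebra_cstar unfolding cstar_algebra_on_def by blast
lemma weyl_algebra_add: "A \<in> weyl_algebra X P M \<Longrightarrow> B \<in> weyl_algebra X P M \<Longrightarrow> (\<lambda>v. A v + B v) \<in> weyl_algebra X P M"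
  by (rule cstar_algebra_add[OF weyl_algebra_cstar])

lemma op_span_weyl_algebra: "A \<in> op_span \<F> (real_weyl M) \<Longrightarrow> A \<in> weyl_algebra X P M"
  unfolding weyl_algebra_eq op_closure_def using H.F.op_span_bop[OF real_weyl_bop]
  by (auto intro!: bexI[of _ A])

lemma weyl_in_algebra: "f \<in> M \<Longrightarrow> star X f = f \<Longrightarrow> weyl X P f \<in> weyl_algebra X P M"
  by (intro op_span_weyl_algebra H.F.op_span_base real_weylI)

lemma hid_in_algebra: "hid \<F> \<in> weyl_algebra X P M"
  using weyl_in_algebra[of 0] K.vs.subspace_0[OF M] star_zero weyl_zero by simp

lemma weyl_algebra_approx:
  assumes "A \<in> weyl_algebra X P M" "e > 0"
  obtains B where "B \<in> op_span \<F> (real_weyl M)" "\<And>v. v \<in> car \<F> \<Longrightarrow> hnorm \<F> (A v - B v) \<le> e * hnorm \<F> v"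
  using assms unfolding weyl_algebra_eq by (rule H.F.op_closureE) (rule that)

end

lemma subspace_UNIV: "K.vs.subspace UNIV"
  by (rule K.vs.subspace_UNIV)

lemma vacuum_sym_tensor: "vacuum = sym_tensor K1 []"
  by (rule ext) (auto simp: vacuum_def sym_tensor_def)

lemma vacuum_car: "vacuum \<in> car \<F>"
  unfolding vacuum_sym_tensor using H.sym_tensor_fock[of "[]"] by simp

end

section \<open>Norms of symmetrised tensors of orthonormal vectors\<close>

lemma prod_fact_count: "finite A \<Longrightarrow> set \<beta> \<subseteq> A \<Longrightarrow>
    (\<Prod>j\<in>set \<beta>. fact (count_list \<beta> j)) = (\<Prod>j\<in>A. fact (count_list \<beta> j) :: 'a::{comm_semiring_1,semiring_char_0})"
  by (rule prod.mono_neutral_left) (auto simp: count_notin)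

lemma prod_fact_count_Cons:
  "(\<Prod>j\<in>set (b # \<beta>). fact (count_list (b # \<beta>) j)) =
    of_nat (count_list (b # \<beta>) b) * (\<Prod>j\<in>set \<beta>. fact (count_list \<beta> j) :: 'a::{comm_semiring_1,semiring_char_0})"
proof -
  let ?A = "set (b # \<beta>)"
  have "(\<Prod>j\<in>?A. fact (count_list (b # \<beta>) j)) = fact (count_list (b # \<beta>) b) * (\<Prod>j\<in>?A - {b}. fact (count_list (b # \<beta>) j) :: 'a)"
    by (rule prod.remove) auto
  also have "(\<Prod>j\<in>?A - {b}. fact (count_list (b # \<beta>) j) :: 'a) = (\<Prod>j\<in>?A - {b}. fact (count_list \<beta> j))"
    by (intro prod.cong) auto
  also have "fact (count_list (b # \<beta>) b) = (of_nat (count_list (b # \<beta>) b) * fact (count_list \<beta> b) :: 'a)" by simp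
  also have "of_nat (count_list (b # \<beta>) b) * fact (count_list \<beta> b) * (\<Prod>j\<in>?A - {b}. fact (count_list \<beta> j))
      = of_nat (count_list (b # \<beta>) b) * (\<Prod>j\<in>?A. fact (count_list \<beta> j) :: 'a)"
    by (subst prod.remove[of ?A b]) (auto simp: mult.assoc)
  also have "(\<Prod>j\<in>?A. fact (count_list \<beta> j) :: 'a) = (\<Prod>j\<in>set \<beta>. fact (count_list \<beta> j))"
    by (rule prod_fact_count[symmetric]) auto
  finally show ?thesis .
qed

lemma sum_indicator_count_list: "(\<Sum>j<length \<alpha>. if \<alpha> ! j = b then c else 0) = of_nat (count_list \<alpha> b) * (c::complex)"
proof (induction \<alpha>)
  case (Cons a \<alpha>)
  then show ?case by (simp add: sum.lessThan_Suc_shift distrib_right del: sum.lessThan_Suc)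
qed simp

text \<open>
  Only the permutations matching equal indices contribute, and there are \<open>\<Prod>\<^sub>j m\<^sub>j!\<close> of them if the
  index \<open>j\<close> occurs \<open>m\<^sub>j\<close> times. In the induction, the expansion of the permanent leaves as many
  equal terms as there are occurrences of \<open>b\<close>. This number is the square of the norm that the
  coefficients \<open>c\<^sub>\<alpha>\<close> normalize.
\<close>

lemma per_orthonormal:
  assumes on: "\<And>i j. i \<in> I \<Longrightarrow> j \<in> I \<Longrightarrow> ip H (f i) (f j) = (if i = j then 1 else 0)"
  shows "\<alpha> \<in> lists I \<Longrightarrow> \<beta> \<in> lists I \<Longrightarrow>
    per H (map f \<beta>) (map f \<alpha>) = (if mset \<alpha> = mset \<beta> then (\<Prod>j\<in>set \<beta>. fact (count_list \<beta> j)) else 0)"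
proof (induction \<beta> arbitrary: \<alpha>)
  case Nil
  then show ?case by (cases \<alpha>) (auto simp: per_def)
next
  case (Cons b \<beta>)
  show ?case
  proof (cases "length \<alpha> = Suc (length \<beta>)")
    case False
    then have "mset \<alpha> \<noteq> mset (b # \<beta>)" using mset_eq_length by fastforce
    then show ?thesis using False by (simp add: per_length)
  next
    case True
    let ?p = "\<Prod>j\<in>set \<beta>. fact (count_list \<beta> j) :: complex"
    have "per H (map f (b # \<beta>)) (map f \<alpha>) = (\<Sum>j<length \<alpha>. ip H (map f \<alpha> ! j) (f b) * per H (map f \<beta>) (take j (map f \<alpha>) @ drop (Suc j) (map f \<alpha>)))"
      using True per_Cons[of "map f \<alpha>" "map f \<beta>" H "f b"] by simp
    also have "\<dots> = (\<Sum>j<length \<alpha>. if \<alpha> ! j = b then (if mset \<alpha> = mset (b # \<beta>) then ?p else 0) else 0)"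
    proof (rule sum.cong[OF refl])
      fix j assume "j \<in> {..<length \<alpha>}"
      then have j: "j < length \<alpha>" by simp
      then have aj: "\<alpha> ! j \<in> I" using Cons.prems(1) by (auto simp: in_lists_conv_set)
      have "ip H (f (\<alpha> ! j)) (f b) = (if \<alpha> ! j = b then 1 else 0)" using on[OF aj, of b] Cons.prems(2) by auto
      moreover have "per H (map f \<beta>) (map f (take j \<alpha> @ drop (Suc j) \<alpha>)) = (if mset (take j \<alpha> @ drop (Suc j) \<alpha>) = mset \<beta> then ?p else 0)"
        using Cons.prems lists_append_drop[OF Cons.prems(1)] by (intro Cons.IH) auto
      moreover have "mset \<alpha> = add_mset (\<alpha> ! j) (mset (take j \<alpha> @ drop (Suc j) \<alpha>))"
        using id_take_nth_drop[OF j] by (metis mset.simps(2) mset_append union_mset_add_mset_right)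
      ultimately show "ip H (map f \<alpha> ! j) (f b) * per H (map f \<beta>) (take j (map f \<alpha>) @ drop (Suc j) (map f \<alpha>))
          = (if \<alpha> ! j = b then (if mset \<alpha> = mset (b # \<beta>) then ?p else 0) else 0)"
        using j by (auto simp: take_map drop_map)
    qed
    also have "\<dots> = of_nat (count_list \<alpha> b) * (if mset \<alpha> = mset (b # \<beta>) then ?p else 0)"
      by (rule sum_indicator_count_list)
    also have "\<dots> = (if mset \<alpha> = mset (b # \<beta>) then (\<Prod>j\<in>set (b # \<beta>). fact (count_list (b # \<beta>) j)) else 0)"
    proof (cases "mset \<alpha> = mset (b # \<beta>)")
      case True
      then have "count_list \<alpha> b = count_list (b # \<beta>) b" by (metis count_mset)
      then show ?thesis using True unfolding prod_fact_count_Cons by (simp del: count_list.simps)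
    qed simp
    finally show ?thesis .
  qed
qed

section \<open>Weyl operators of the range of a Bogoliubov operator\<close>

locale ccr_bogoliubov = ccr +
  fixes V assumes V: "V \<in> bogoliubov X P"
begin

lemma V_bop: "V \<in> bop K" and V_dagger: "kdagger X P V (V g) = g"
  using V by (auto simp: bogoliubov_def fun_eq_iff)

lemma V_add: "V (f + g) = V f + V g" and V_scale: "V (scal X c f) = scal X c (V f)"
  using K.bop_add[OF V_bop, of f g] K.bop_scale[OF V_bop, of f c] by simp_all

lemma V_star: "V (star X g) = star X (V g)"
proof -
  have "bar X V g = V g" using V by (simp add: bogoliubov_def)
  then show ?thesis unfolding bar_def by (metis star_star)
qed

lemma V_zero: "V 0 = 0"
  using V_add[of 0 0] by simp

lemma V_star_iff: "star X (V g) = V g \<longleftrightarrow> star X g = g"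
proof
  assume "star X (V g) = V g"
  then have "kdagger X P V (V (star X g)) = kdagger X P V (V g)" by (simp only: V_star)
  then show "star X g = g" by (simp only: V_dagger)
qed (simp flip: V_star)

lemma subspace_range_V: "K.vs.subspace (range V)"
proof (rule K.vs.subspaceI)
  show "0 \<in> range V" using rangeI[of V 0] by (simp add: V_zero)
  show "x + y \<in> range V" if "x \<in> range V" "y \<in> range V" for x y using that by (auto simp flip: V_add)
  show "smul K c x \<in> range V" if "x \<in> range V" for c x using that by (auto simp flip: V_scale)
qed

lemma kap_V: "kap X (V g) u = kap X g (kdagger X P V u)"
proof -
  have "kap X (V g) u = ip K (V g) (Cop P u)" by (rule kap_eq_ip)
  also have "\<dots> = cnj (ip K (Cop P u) (V g))" by (rule K.ip_cnj) auto
  also have "\<dots> = cnj (ip K (hadj K V (Cop P u)) g)" using K.ip_hadj[OF V_bop] by simp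
  also have "\<dots> = ip K g (hadj K V (Cop P u))" by (rule K.ip_cnj[symmetric]) auto
  also have "\<dots> = kap X g (kdagger X P V u)" by (simp add: kdagger_def K_sel(3))
  finally show ?thesis .
qed

definition N where "N = range P \<inter> {f. kdagger X P V f = 0}"

text \<open>
  By \<open>kap_V\<close>, the kernel of \<open>V\<^sup>\<dagger>\<close> is the \<open>\<kappa>\<close>-orthogonal complement of \<open>ran V\<close>. On \<open>\<K>\<^sub>1\<close> the form \<open>\<kappa>\<close>
  agrees with the inner product, which makes \<open>N\<close> orthogonal to \<open>P\<^sub>1 V g\<close>.
\<close>

lemma N_iff: "u \<in> N \<longleftrightarrow> P u = u \<and> (\<forall>g. kap X (V g) u = 0)"
proof -
  have "kdagger X P V u = 0 \<longleftrightarrow> (\<forall>g. kap X (V g) u = 0)"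
  proof
    assume "kdagger X P V u = 0"
    then show "\<forall>g. kap X (V g) u = 0" using kap_scale[of _ 0 0] by (simp add: kap_V)
  next
    assume a: "\<forall>g. kap X (V g) u = 0"
    show "kdagger X P V u = 0"
    proof (rule kap_nondeg)
      fix g show "kap X (kdagger X P V u) g = 0"
        using a kap_cnj[of g "kdagger X P V u"] by (simp add: kap_V)
    qed
  qed
  then show ?thesis by (auto simp: N_def range_P)
qed

lemma N_range: "N \<subseteq> range P"
  by (auto simp: N_def)

lemma N_subspace: "K.vs.subspace N"
proof (rule K.vs.subspaceI)
  show "0 \<in> N" using kap_scale[of _ 0 0] by (simp add: N_iff P_zero)
  show "x + y \<in> N" if "x \<in> N" "y \<in> N" for x y using that by (simp add: N_iff P_add kap_add)
  show "smul K c x \<in> N" if "x \<in> N" for c x using that by (simp add: N_iff P_scale kap_scale)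
qed

lemma ip_PV_N: "u \<in> N \<Longrightarrow> ip K (P (V g)) u = 0"
  using ip_P[of "V g" u] Cop_P[of u] by (simp add: N_iff K_sel(3))

lemma ip_z_N: "u \<in> N \<Longrightarrow> ip K1 (z (V g)) u = 0"
  using H.ip_scale_left[of "P (V g)" u \<i>] ip_PV_N N_range by auto
lemma ip_N_z: "u \<in> N \<Longrightarrow> ip K1 u (z (V g)) = 0"
  using ip_z_N[of u g] H.ip_cnj[of "z (V g)" u] N_range z_car by auto

text \<open>The vacuum expectation value of \<open>w(V g)\<close>, for \<open>g = g\<^sup>*\<close>.\<close>

definition s where "s g = exp (- (ip K1 (z (V g)) (z (V g)) / 2))"

lemma cnj_s: "cnj (s g) = s g"
  using H.ip_cnj[of "z (V g)" "z (V g)"] z_car by (simp add: s_def exp_cnj)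

text \<open>The term \<open>\<langle>i P\<^sub>1 V g, u\<rangle>\<close> in the exponent vanishes, so the factor does not depend on \<open>u\<close>.\<close>

lemma weyl_V_ev:
  assumes g: "star X g = g" and u: "u \<in> N"
  shows "weyl X P (V g) (H.ev u) = smul \<F> (s g) (H.ev (u + z (V g)))"
  using H.W_ev[of "z (V g)" u] u N_range z_car ip_z_N[OF u, of g] g V_star_iff by (auto simp: weyl_eq s_def)

text \<open>The Fock space over \<open>N\<close>, as a subspace of the Fock space over \<open>\<K>\<^sub>1\<close>.\<close>

definition T where "T = hclosure \<F> (H.F.vs.span (H.ev ` N))"

lemma ev_N_car: "H.ev ` N \<subseteq> car \<F>"
  using H.ev_fock N_range by auto

lemma ev_N_T: "H.ev ` N \<subseteq> T"
  unfolding T_def using H.F.hclosure_superset[OF H.F.span_car[OF ev_N_car]] H.F.vs.span_superset by blast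

lemma T_closed: "H.F.closed_sub T"
  unfolding T_def by (rule H.F.closed_sub_hclosure[OF H.F.vs.subspace_span H.F.span_car[OF ev_N_car]])

lemma T_car: "T \<subseteq> car \<F>"
  using T_closed by (simp add: H.F.closed_sub_def)

lemma T_orth: "v \<in> car \<F> \<Longrightarrow> (\<And>u. u \<in> N \<Longrightarrow> ip \<F> (H.ev u) v = 0) \<Longrightarrow> \<psi> \<in> T \<Longrightarrow> ip \<F> \<psi> v = 0"
proof -
  assume v: "v \<in> car \<F>" "\<And>u. u \<in> N \<Longrightarrow> ip \<F> (H.ev u) v = 0" and "\<psi> \<in> T"
  then show ?thesis
    unfolding T_def using H.F.orth_hclosure[OF H.F.span_car[OF ev_N_car] v(1), of \<psi>] H.F.orth_span[OF ev_N_car v(1)] by blast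
qed

lemma orth_ev_N_imp_zero:
  assumes "\<psi> \<in> car \<F>" "\<And>u. u \<in> N \<Longrightarrow> ip \<F> (H.ev u) \<psi> = 0" "xs \<in> lists N"
  shows "\<psi> xs = 0"
proof (rule H.orth_ev_imp_zero[of \<psi> N])
  show "h + smul K1 (complex_of_real t) k \<in> N" if "h \<in> N" "k \<in> N" for h k t
    using that K.vs.subspace_add[OF N_subspace] K.vs.subspace_scale[OF N_subspace] by simp
  show "xs \<in> lists (hclosure K1 (H.vs.span N))"
  proof -
    have "N \<subseteq> hclosure K1 (H.vs.span N)"
      using H.hclosure_superset[OF H.span_car[of N]] H.vs.span_superset[of N] N_range by auto
    then show ?thesis using assms(3) lists_mono by blast
  qed
qed (use assms N_range K.vs.subspace_0[OF N_subspace] in auto)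

text \<open>
  The difference between the tensor and its projection to \<open>T\<close> is orthogonal to all \<open>e(u)\<close>,
  \<open>u \<in> N\<close>, hence vanishes on lists over \<open>N\<close> by polarization. So it is orthogonal to the tensor
  itself.
\<close>

lemma sym_tensor_T:
  assumes us: "us \<in> lists N" shows "sym_tensor K1 us \<in> T"
proof -
  let ?t = "sym_tensor K1 us"
  have usc: "us \<in> lists (car K1)" using us lists_mono[OF N_range] by auto
  have t: "?t \<in> car \<F>" using H.sym_tensor_fock[OF usc] by simp
  obtain m where m: "m \<in> T" "\<And>u. u \<in> T \<Longrightarrow> ip \<F> u (?t - m) = 0" using H.F.projection[OF T_closed t] by blast
  have m1: "m \<in> car \<F>" using m(1) T_car by blast
  then have mc: "m \<in> car \<F>" "?t - m \<in> car \<F>" using H.F.diff_car[OF t m1] by blast+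
  have "(?t - m) us = 0"
    by (rule orth_ev_N_imp_zero[OF mc(2) _ us]) (use m(2) ev_N_T in auto)
  then have "ip \<F> ?t (?t - m) = 0" using H.sym_tensor_reproducing[OF usc, of "?t - m"] mc by simp
  then have "ip \<F> (?t - m) (?t - m) = 0" using m t mc by (simp add: H.F.ip_diff_left)
  then have "?t - m = 0" using H.F.ip_pos[OF mc(2)] by force
  then show ?thesis using m(1) by simp
qed

text \<open>
  For exponential vectors \<open>\<langle>e(u), e(u' + i P\<^sub>1 V g)\<rangle> = \<langle>e(u), e(u')\<rangle>\<close>, because \<open>u \<in> N\<close> is
  orthogonal to \<open>P\<^sub>1 V g\<close>. The identity is extended to the closed span in one variable after the
  other.
\<close>

lemma weyl_T:
  assumes g: "star X g = g" and \<psi>: "\<psi> \<in> T" and \<phi>: "\<phi> \<in> T"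
  shows "ip \<F> \<psi> (weyl X P (V g) \<phi>) = s g * ip \<F> \<psi> \<phi>"
proof -
  let ?A = "weyl X P (V g)"
  have Vg: "star X (V g) = V g" using g V_star_iff by simp
  have A: "?A \<in> bop \<F>" by (rule weyl_bop[OF Vg])
  have c: "\<psi> \<in> car \<F>" "\<phi> \<in> car \<F>" using \<psi> \<phi> T_car by auto
  have Ac: "?A v \<in> car \<F>" for v by (rule H.F.bop_car'[OF A])
  have hc: "hadj \<F> ?A v \<in> car \<F>" for v by (rule H.F.bop_car'[OF H.F.hadj_bop[OF A]])
  have base: "ip \<F> (H.ev u) (?A (H.ev u')) = s g * ip \<F> (H.ev u) (H.ev u')" if uu: "u \<in> N" "u' \<in> N" for u u'
  proof -
    have k: "u \<in> car K1" "u' \<in> car K1" "u' + z (V g) \<in> car K1" using uu N_range z_car H.add_car[of u' "z (V g)"] by auto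
    have "ip \<F> (H.ev u) (?A (H.ev u')) = s g * exp (ip K1 u (u' + z (V g)))"
      using k H.ev_fock by (simp add: weyl_V_ev[OF g uu(2)] H.F.ip_scale H.ip_ev_ev del: K1_sel)
    also have "ip K1 u (u' + z (V g)) = ip K1 u u'"
      using H.ip_add[of u u' "z (V g)"] k z_car ip_N_z[OF uu(1)] by simp
    finally show ?thesis using H.ip_ev_ev k by simp
  qed
  have step: "ip \<F> (H.ev u) (?A \<phi>) = s g * ip \<F> (H.ev u) \<phi>" if u: "u \<in> N" for u
  proof -
    have e: "H.ev u \<in> car \<F>" using u ev_N_car by auto
    \<comment> \<open>The identity says that \<open>w(V g)\<^sup>* - s g\<close> maps \<open>e(u)\<close> into the orthogonal complement of
      \<open>T\<close>.\<close>
    let ?v = "hadj \<F> ?A (H.ev u) - smul \<F> (s g) (H.ev u)"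
    have v: "?v \<in> car \<F>" using e hc by (intro H.F.diff_car H.F.scale_car)
    have "ip \<F> \<phi> ?v = 0"
    proof (rule T_orth[OF v _ \<phi>])
      fix u' assume u': "u' \<in> N"
      have e': "H.ev u' \<in> car \<F>" using u' ev_N_car by auto
      have "ip \<F> ?v (H.ev u') = 0"
        using e e' hc base[OF u u'] by (simp add: H.F.ip_diff_left H.F.ip_scale_left H.F.ip_hadj[OF A] cnj_s del: sym_fock_sel)
      then show "ip \<F> (H.ev u') ?v = 0" using H.F.ip_cnj[OF v e'] by simp
    qed
    then have "ip \<F> ?v \<phi> = 0" using H.F.ip_cnj[OF c(2) v] by simp
    then show ?thesis
      using e hc c by (simp add: H.F.ip_diff_left H.F.ip_scale_left H.F.ip_hadj[OF A] cnj_s del: sym_fock_sel)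
  qed
  let ?w = "?A \<phi> - smul \<F> (s g) \<phi>"
  have w: "?w \<in> car \<F>" using c Ac by (intro H.F.diff_car H.F.scale_car)
  have "ip \<F> \<psi> ?w = 0"
  proof (rule T_orth[OF w _ \<psi>])
    fix u assume u: "u \<in> N"
    have e: "H.ev u \<in> car \<F>" using u ev_N_car by auto
    then show "ip \<F> (H.ev u) ?w = 0"
      using c Ac step[OF u] by (simp add: H.F.ip_diff H.F.ip_scale del: sym_fock_sel)
  qed
  then show ?thesis using c Ac by (simp add: H.F.ip_diff H.F.ip_scale del: sym_fock_sel)
qed

end

section \<open>The decomposition into cyclic representations\<close>

locale ccr_representation = ccr_bogoliubov +
  fixes f :: "nat \<Rightarrow> 'a" and d :: enat and \<rho>
  assumes inj: "inj_on f (indices d)" and basis: "is_onb (K1kernel X P V) (f ` indices d)"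
    and induced: "induced_endomorphism X P V \<rho>"
begin

lemma K1kernel_sel [simp]: "car (K1kernel X P V) = N" "smul (K1kernel X P V) = scal X" "ip (K1kernel X P V) = ip K"
  by (simp_all add: K1kernel_def N_def)

lemma f_N: "i \<in> indices d \<Longrightarrow> f i \<in> N"
  using basis by (auto simp: is_onb_def)
lemma f_orthonormal: "i \<in> indices d \<Longrightarrow> j \<in> indices d \<Longrightarrow> ip K1 (f i) (f j) = (if i = j then 1 else 0)"
  using basis inj by (auto simp: is_onb_def inj_on_eq_iff)

lemma N_hclosure: "N \<subseteq> hclosure K1 (H.vs.span (f ` indices d))"
proof
  fix u assume u: "u \<in> N"
  have "hnorm (K1kernel X P V) = hnorm K1" by (simp add: hnorm_def fun_eq_iff)
  moreover have "u \<in> hclosure (K1kernel X P V) (module.span (smul (K1kernel X P V)) (f ` indices d))"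
    using basis u by (simp add: is_onb_def)
  ultimately show "u \<in> hclosure K1 (H.vs.span (f ` indices d))" using u N_range by (auto simp: hclosure_def)
qed

lemma map_f_lists: "\<alpha> \<in> lists (indices d) \<Longrightarrow> map f \<alpha> \<in> lists N"
  using f_N by auto

lemma lists_N_car: "us \<in> lists N \<Longrightarrow> us \<in> lists (car K1)"
  using lists_mono[OF N_range] by auto

text \<open>
  Each creation operator contributes the square root of the new degree, which accumulates to
  \<open>\<surd>n!\<close>.
\<close>

lemma phi_eq: "phi X P f \<alpha> = smul \<F> (complex_of_real (c_coeff \<alpha> * sqrt (fact (length \<alpha>)))) (sym_tensor K1 (map f \<alpha>))"
proof -
  have "foldr (\<lambda>j. creation K1 (f j)) \<alpha> vacuum = smul \<F> (complex_of_real (sqrt (fact (length \<alpha>)))) (sym_tensor K1 (map f \<alpha>))"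
  proof (induction \<alpha>)
    case Nil
    then show ?case by (simp add: vacuum_sym_tensor H.F.vs.scale_one)
  next
    case (Cons a \<alpha>)
    have "creation K1 (f a) (smul \<F> c \<psi>) = smul \<F> c (creation K1 (f a) \<psi>)" for c \<psi>
      by (rule ext) (simp add: creation_def H.fock_smul sum_distrib_left mult_ac)
    then show ?case
      by (simp add: Cons.IH H.creation_sym_tensor_smul real_sqrt_mult mult.commute del: sym_fock_sel of_nat_Suc)
  qed
  then show ?thesis by (simp add: phi_def)
qed

lemma c_coeff_pos: "c_coeff \<alpha> > 0"
  by (simp add: c_coeff_def prod_pos)

lemma phi_car: "\<alpha> \<in> lists (indices d) \<Longrightarrow> phi X P f \<alpha> \<in> car \<F>"
  unfolding phi_eq using H.sym_tensor_fock[OF lists_N_car[OF map_f_lists]] by (simp add: H.fock_scale)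

lemma phi_T: "\<alpha> \<in> lists (indices d) \<Longrightarrow> phi X P f \<alpha> \<in> T"
  unfolding phi_eq using sym_tensor_T[OF map_f_lists] T_closed H.F.vs.subspace_scale unfolding H.F.closed_sub_def by blast

lemma ip_phi:
  assumes "\<alpha> \<in> lists (indices d)" "\<psi> \<in> car \<F>"
  shows "ip \<F> (phi X P f \<alpha>) \<psi> = complex_of_real (c_coeff \<alpha> * sqrt (fact (length \<alpha>))) * \<psi> (map f \<alpha>)"
proof -
  have l: "map f \<alpha> \<in> lists (car K1)" by (rule lists_N_car[OF map_f_lists[OF assms(1)]])
  show ?thesis
    unfolding phi_eq using H.sym_tensor_fock[OF l] H.sym_tensor_reproducing[OF l] assms(2)
    by (subst H.F.ip_scale_left) auto
qed

lemma phi_orthonormal: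
  assumes \<alpha>: "\<alpha> \<in> lists (indices d)" "sorted \<alpha>" and \<beta>: "\<beta> \<in> lists (indices d)" "sorted \<beta>"
  shows "ip \<F> (phi X P f \<alpha>) (phi X P f \<beta>) = (if \<alpha> = \<beta> then 1 else 0)"
proof -
  have l: "map f \<alpha> \<in> lists (car K1)" by (rule lists_N_car[OF map_f_lists[OF \<alpha>(1)]])
  have m: "mset \<alpha> = mset \<beta> \<longleftrightarrow> \<alpha> = \<beta>"
    using \<alpha>(2) \<beta>(2) by (metis properties_for_sort sort_key_id_if_sorted sorted_sort_id)
  let ?k = "c_coeff \<beta> * sqrt (fact (length \<beta>))"
  let ?p = "(\<Prod>j\<in>set \<beta>. fact (count_list \<beta> j)) :: real"
  have p: "(\<Prod>j\<in>set \<beta>. fact (count_list \<beta> j)) = complex_of_real ?p" by simp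
  have "phi X P f \<beta> (map f \<alpha>) = complex_of_real ?k * (if \<alpha> = \<beta> then complex_of_real ?p / fact (length \<beta>) else 0)"
    unfolding phi_eq H.fock_smul using l per_orthonormal[OF f_orthonormal \<alpha>(1) \<beta>(1)]
    by (simp add: sym_tensor_eq_per m)
  also have "\<dots> = (if \<alpha> = \<beta> then complex_of_real (?k * (?p / fact (length \<beta>))) else 0)"
    by (cases "\<alpha> = \<beta>") (simp_all only: of_real_mult of_real_divide of_real_fact mult_zero_right if_True if_False refl)
  finally have "phi X P f \<beta> (map f \<alpha>) = (if \<alpha> = \<beta> then complex_of_real (?k * (?p / fact (length \<beta>))) else 0)" .
  then have "ip \<F> (phi X P f \<alpha>) (phi X P f \<beta>) = (if \<alpha> = \<beta> then complex_of_real (?k * (?k * (?p / fact (length \<beta>)))) else 0)"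
    unfolding ip_phi[OF \<alpha>(1) phi_car[OF \<beta>(1)]] 
    by (cases "\<alpha> = \<beta>") (simp_all only: of_real_mult mult_zero_right if_True if_False refl)
  moreover have "?k * (?k * (?p / fact (length \<beta>))) = 1"
  proof -
    have "?p > 0" by (simp add: prod_pos)
    then have "(c_coeff \<beta>)\<^sup>2 * ?p = 1" by (simp add: c_coeff_def power_divide)
    moreover have "?k * (?k * (?p / fact (length \<beta>))) = (c_coeff \<beta>)\<^sup>2 * ?p * ((sqrt (fact (length \<beta>)))\<^sup>2 / fact (length \<beta>))"
      by (simp only: power2_eq_square times_divide_eq_right mult_ac)
    ultimately show ?thesis by simp
  qed
  ultimately show ?thesis by (simp only: of_real_1)
qed

lemma multi_indicesD: "\<alpha> \<in> multi_indices d \<Longrightarrow> \<alpha> \<in> lists (indices d) \<and> sorted \<alpha>"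
  by (simp add: multi_indices_def)

lemma phi_ip: "\<alpha> \<in> multi_indices d \<Longrightarrow> \<beta> \<in> multi_indices d \<Longrightarrow>
    ip \<F> (phi X P f \<alpha>) (phi X P f \<beta>) = (if \<alpha> = \<beta> then 1 else 0)"
  using phi_orthonormal multi_indicesD by blast

lemma phi_norm: "\<alpha> \<in> multi_indices d \<Longrightarrow> hnorm \<F> (phi X P f \<alpha>) = 1"
  using phi_ip[of \<alpha> \<alpha>] by (simp add: hnorm_def del: sym_fock_sel)

lemma vacuum_phi: "vacuum = phi X P f []"
  by (simp add: phi_def c_coeff_def H.F.vs.scale_one)

lemma Nil_multi: "[] \<in> multi_indices d"
  by (simp add: multi_indices_def)

abbreviation \<WW> where "\<WW> \<equiv> weyl_algebra X P UNIV"
abbreviation \<WW>\<^sub>V where "\<WW>\<^sub>V \<equiv> weyl_algebra X P (range V)"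

lemma real_weyl_range: "real_weyl (range V) = {weyl X P (V g) |g. star X g = g}"
  unfolding real_weyl_def using V_star_iff by blast

text \<open>
  The operators for which the formula holds form a norm closed subspace, and for Weyl operators it
  is \<open>weyl_T\<close> with \<open>\<langle>\<phi>\<^sub>\<alpha>, \<phi>\<^sub>\<beta>\<rangle> = \<delta>\<^sub>\<alpha>\<^sub>\<beta>\<close>.
\<close>

lemma matrix_element:
  assumes A: "A \<in> \<WW>\<^sub>V" and \<alpha>: "\<alpha> \<in> multi_indices d" and \<beta>: "\<beta> \<in> multi_indices d"
  shows "ip \<F> (phi X P f \<alpha>) (A (phi X P f \<beta>)) = (if \<alpha> = \<beta> then ip \<F> vacuum (A vacuum) else 0)"
proof -
  let ?a = "phi X P f \<alpha>" and ?b = "phi X P f \<beta>"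
  let ?D = "\<lambda>A. ip \<F> ?a (A ?b) - (if \<alpha> = \<beta> then ip \<F> vacuum (A vacuum) else 0)"
  have c: "?a \<in> car \<F>" "?b \<in> car \<F>" "vacuum \<in> car \<F>"
    using phi_car multi_indicesD \<alpha> \<beta> vacuum_car by blast+
  have base: "?D A = 0" if A: "A \<in> real_weyl (range V)" for A
  proof -
    obtain g where g: "A = weyl X P (V g)" "star X g = g" using A unfolding real_weyl_range by blast
    have t: "?a \<in> T" "?b \<in> T" "vacuum \<in> T" using phi_T multi_indicesD \<alpha> \<beta> Nil_multi vacuum_phi by metis+
    have "ip \<F> vacuum vacuum = 1" using phi_ip[OF Nil_multi Nil_multi] vacuum_phi by simp
    then show ?thesis
      unfolding g(1) using weyl_T[OF g(2) t(1,2)] weyl_T[OF g(2) t(3,3)] phi_ip[OF \<alpha> \<beta>] by (simp del: sym_fock_sel)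
  qed
  have span: "?D A = 0" if A: "A \<in> op_span \<F> (real_weyl (range V))" for A
    using A
  proof (induction rule: op_span.induct)
    case zero
    then show ?case using c by (simp del: sym_fock_sel flip: zero_fun_def)
  next
    case (step A B z)
    have "A \<in> bop \<F>" "B \<in> bop \<F>"
      using step real_weyl_bop[OF subspace_range_V] H.F.op_span_bop[OF real_weyl_bop[OF subspace_range_V]] by auto
    then have cc: "A v \<in> car \<F>" "B v \<in> car \<F>" for v using H.F.bop_car' by auto
    have "?D (\<lambda>v. smul \<F> z (A v) + B v) = z * ?D A + ?D B"
      using c cc by (simp add: H.F.ip_add H.F.ip_scale algebra_simps del: sym_fock_sel)
    then show ?case using base[OF step(1)] step.IH by (simp only: mult_zero_right add_0_right)
  qed
  have "cmod (?D A) \<le> 2 * e" if e: "e > 0" for e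
  proof -
    obtain B where B: "B \<in> op_span \<F> (real_weyl (range V))" "\<And>v. v \<in> car \<F> \<Longrightarrow> hnorm \<F> (A v - B v) \<le> e * hnorm \<F> v"
      using weyl_algebra_approx[OF subspace_range_V A e] by metis
    have cc: "A v \<in> car \<F>" "B v \<in> car \<F>" for v
      using weyl_algebra_bop[OF subspace_range_V A] H.F.op_span_bop[OF real_weyl_bop[OF subspace_range_V] B(1)] H.F.bop_car' by auto
    have n: "hnorm \<F> ?a = 1" "hnorm \<F> ?b = 1" "hnorm \<F> vacuum = 1"
      using phi_norm \<alpha> \<beta> Nil_multi vacuum_phi by metis+
    have "cmod (ip \<F> ?a (A ?b - B ?b)) \<le> hnorm \<F> ?a * hnorm \<F> (A ?b - B ?b)"
      using c cc by (intro H.F.cauchy_schwarz) (blast intro: H.F.diff_car)+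
    then have 1: "cmod (ip \<F> ?a (A ?b) - ip \<F> ?a (B ?b)) \<le> e"
      using B(2)[OF c(2)] n c cc by (simp add: H.F.ip_diff del: sym_fock_sel)
    have "cmod (ip \<F> vacuum (A vacuum - B vacuum)) \<le> hnorm \<F> vacuum * hnorm \<F> (A vacuum - B vacuum)"
      using c cc by (intro H.F.cauchy_schwarz) (blast intro: H.F.diff_car)+
    then have 2: "cmod (ip \<F> vacuum (A vacuum) - ip \<F> vacuum (B vacuum)) \<le> e"
      using B(2)[OF c(3)] n c cc by (simp add: H.F.ip_diff del: sym_fock_sel)
    have eq: "?D A = (ip \<F> ?a (A ?b) - ip \<F> ?a (B ?b)) - (if \<alpha> = \<beta> then ip \<F> vacuum (A vacuum) - ip \<F> vacuum (B vacuum) else 0)"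
      using span[OF B(1)] by (simp add: algebra_simps del: sym_fock_sel split: if_splits)
    have "cmod (?D A) \<le> cmod (ip \<F> ?a (A ?b) - ip \<F> ?a (B ?b)) +
        cmod (if \<alpha> = \<beta> then ip \<F> vacuum (A vacuum) - ip \<F> vacuum (B vacuum) else 0)"
      unfolding eq by (rule norm_triangle_ineq4)
    also have "\<dots> \<le> e + e" using 1 2 e by (intro add_mono) auto
    finally show ?thesis by simp
  qed
  then have "cmod (?D A) \<le> 0"
    using field_le_epsilon[of "cmod (?D A)" 0] by (metis add_0 field_sum_of_halves half_gt_zero mult_2)
  then show ?thesis by simp
qed

lemma \<rho>_hom: "star_hom \<F> \<WW> \<F> \<rho>" and \<rho>_weyl: "star X g = g \<Longrightarrow> \<rho> (weyl X P g) = weyl X P (V g)"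
  using induced by (auto simp: induced_endomorphism_def star_endomorphism_def)

lemma \<rho>_hid: "\<rho> (hid \<F>) = hid \<F>"
  using \<rho>_weyl[of 0] by (simp add: weyl_zero star_zero V_zero)

lemma \<rho>_bop: "A \<in> \<WW> \<Longrightarrow> \<rho> A \<in> bop \<F>"
  using \<rho>_hom by (simp add: star_hom_def)
lemma \<rho>_add: "A \<in> \<WW> \<Longrightarrow> B \<in> \<WW> \<Longrightarrow> \<rho> (\<lambda>v. A v + B v) = (\<lambda>v. \<rho> A v + \<rho> B v)"
  by (rule star_hom_add[OF \<rho>_hom])
lemma \<rho>_comp: "A \<in> \<WW> \<Longrightarrow> B \<in> \<WW> \<Longrightarrow> \<rho> (A \<circ> B) = \<rho> A \<circ> \<rho> B"
  using \<rho>_hom unfolding star_hom_def by blast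
lemma \<rho>_smul: "A \<in> \<WW> \<Longrightarrow> \<rho> (\<lambda>v. smul \<F> c (A v)) = (\<lambda>v. smul \<F> c (\<rho> A v))"
  using \<rho>_hom unfolding star_hom_def by blast
lemma \<rho>_hadj: "A \<in> \<WW> \<Longrightarrow> \<rho> (hadj \<F> A) = hadj \<F> (\<rho> A)"
  using \<rho>_hom unfolding star_hom_def by blast

lemma \<rho>_contractive:
  assumes "A \<in> \<WW>" "M \<ge> 0" "\<And>v. v \<in> car \<F> \<Longrightarrow> hnorm \<F> (A v) \<le> M * hnorm \<F> v" "w \<in> car \<F>"
  shows "hnorm \<F> (\<rho> A w) \<le> M * hnorm \<F> w"
  by (rule star_hom_contractive[OF H.hilbert_fock H.hilbert_fock weyl_algebra_cstar[OF subspace_UNIV]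
    hid_in_algebra[OF subspace_UNIV] \<rho>_hom \<rho>_hid assms])

lemma \<rho>_op_span:
  assumes "A \<in> op_span \<F> (real_weyl UNIV)" shows "\<rho> A \<in> op_span \<F> (real_weyl (range V))"
  using assms
proof (induction rule: op_span.induct)
  case zero
  have "(\<lambda>v. smul \<F> 0 (hid \<F> v)) = (\<lambda>_. 0)" by (simp only: H.F.vs.scale_zero_left)
  then have "\<rho> (\<lambda>_. 0) = (\<lambda>_. 0)"
    using \<rho>_smul[OF hid_in_algebra[OF subspace_UNIV], of 0] by (simp only: H.F.vs.scale_zero_left)
  then show ?case by (simp only: op_span.zero)
next
  case (step A B c)
  obtain g where g: "A = weyl X P g" "star X g = g" using step(1) by (auto simp: real_weyl_def)
  have A: "A \<in> \<WW>" unfolding g(1) by (rule weyl_in_algebra[OF subspace_UNIV UNIV_I g(2)])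
  have B: "B \<in> \<WW>" by (rule op_span_weyl_algebra[OF subspace_UNIV step(2)])
  have "\<rho> A \<in> real_weyl (range V)" unfolding g(1) \<rho>_weyl[OF g(2)] real_weyl_range using g(2) by blast
  then have "(\<lambda>v. smul \<F> c (\<rho> A v) + \<rho> B v) \<in> op_span \<F> (real_weyl (range V))" using step.IH by (rule op_span.step)
  moreover have "\<rho> (\<lambda>v. smul \<F> c (A v) + B v) = (\<lambda>v. smul \<F> c (\<rho> A v) + \<rho> B v)"
    using \<rho>_add[OF weyl_algebra_smul[OF subspace_UNIV A] B] \<rho>_smul[OF A] by (simp only:)
  ultimately show ?case by (simp only:)
qed

text \<open>
  With \<open>\<rho>_range\<close>, the image of \<open>\<rho>\<close> lies between the linear span of the \<open>w(V g)\<close> and its norm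
  closure, the Weyl algebra of \<open>ran V\<close>.
\<close>

lemma op_span_range:
  assumes "B \<in> op_span \<F> (real_weyl (range V))" shows "\<exists>A\<in>\<WW>. \<rho> A = B"
  using assms
proof (induction rule: op_span.induct)
  case zero
  have "(\<lambda>v. smul \<F> 0 (hid \<F> v)) = (\<lambda>_. 0)" by (simp only: H.F.vs.scale_zero_left)
  then have "\<rho> (\<lambda>_. 0) = (\<lambda>_. 0)"
    using \<rho>_smul[OF hid_in_algebra[OF subspace_UNIV], of 0] by (simp only: H.F.vs.scale_zero_left)
  moreover have "(\<lambda>_. 0) \<in> \<WW>" by (rule op_span_weyl_algebra[OF subspace_UNIV op_span.zero])
  ultimately show ?case by blast
next
  case (step A B c)
  obtain g where g: "A = weyl X P (V g)" "star X g = g" using step(1) unfolding real_weyl_range by blast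
  obtain B' where B': "B' \<in> \<WW>" "\<rho> B' = B" using step.IH by blast
  have A': "weyl X P g \<in> \<WW>" by (rule weyl_in_algebra[OF subspace_UNIV UNIV_I g(2)])
  have "\<rho> (\<lambda>v. smul \<F> c (weyl X P g v) + B' v) = (\<lambda>v. smul \<F> c (A v) + B v)"
    using \<rho>_add[OF weyl_algebra_smul[OF subspace_UNIV A'] B'(1)] \<rho>_smul[OF A'] \<rho>_weyl[OF g(2)] g(1) B'(2) by (simp only:)
  moreover have "(\<lambda>v. smul \<F> c (weyl X P g v) + B' v) \<in> \<WW>"
    by (rule weyl_algebra_add[OF subspace_UNIV weyl_algebra_smul[OF subspace_UNIV A'] B'(1)])
  ultimately show ?case by blast
qed

text \<open>
  Contractivity carries approximations by linear combinations of Weyl operators over to the image.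
\<close>

lemma \<rho>_range:
  assumes A: "A \<in> \<WW>" shows "\<rho> A \<in> \<WW>\<^sub>V"
  unfolding weyl_algebra_eq[OF subspace_range_V] op_closure_def
proof (intro CollectI conjI allI impI)
  show "\<rho> A \<in> bop \<F>" by (rule \<rho>_bop[OF A])
  fix e :: real assume e: "e > 0"
  obtain B where B: "B \<in> op_span \<F> (real_weyl UNIV)" "\<And>v. v \<in> car \<F> \<Longrightarrow> hnorm \<F> (A v - B v) \<le> e * hnorm \<F> v"
    using weyl_algebra_approx[OF subspace_UNIV A e] by metis
  have BW: "B \<in> \<WW>" by (rule op_span_weyl_algebra[OF subspace_UNIV B(1)])
  have nB: "(\<lambda>v. smul \<F> (-1) (B v)) \<in> \<WW>" by (rule weyl_algebra_smul[OF subspace_UNIV BW])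
  have "hnorm \<F> (\<rho> A v - \<rho> B v) \<le> e * hnorm \<F> v" if v: "v \<in> car \<F>" for v
  proof -
    have "hnorm \<F> (\<rho> (\<lambda>v. A v + smul \<F> (-1) (B v)) v) \<le> e * hnorm \<F> v"
      by (rule \<rho>_contractive[OF weyl_algebra_add[OF subspace_UNIV A nB] _ _ v]) (use e B(2) in \<open>auto simp del: sym_fock_sel\<close>)
    then show ?thesis using \<rho>_add[OF A nB] \<rho>_smul[OF BW, of "-1"] by (simp del: sym_fock_sel)
  qed
  then show "\<exists>B\<in>op_span \<F> (real_weyl (range V)). \<forall>v\<in>car \<F>. hnorm \<F> (\<rho> A v - B v) \<le> e * hnorm \<F> v"
    using \<rho>_op_span[OF B(1)] by blast
qed

definition M where "M \<alpha> = hclosure \<F> {A (phi X P f \<alpha>) |A. A \<in> \<WW>\<^sub>V}"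

lemma F_sub_eq: "F_sub X P V f \<alpha> = \<F>\<lparr>car := M \<alpha>\<rparr>"
  by (simp add: F_sub_def M_def)

lemma orbit_car: "{A (phi X P f \<alpha>) |A. A \<in> \<WW>\<^sub>V} \<subseteq> car \<F>"
  using weyl_algebra_bop[OF subspace_range_V] H.F.bop_car' by blast

lemma M_closed: "H.F.closed_sub (M \<alpha>)"
  unfolding M_def
proof (rule H.F.closed_sub_hclosure[OF _ orbit_car], rule H.F.vs.subspaceI)
  let ?S = "{A (phi X P f \<alpha>) |A. A \<in> \<WW>\<^sub>V}"
  have "(\<lambda>_. 0) \<in> \<WW>\<^sub>V" by (rule op_span_weyl_algebra[OF subspace_range_V op_span.zero])
  then show "0 \<in> ?S" by (intro CollectI exI[of _ "\<lambda>_. 0"]) simp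
  fix x assume "x \<in> ?S"
  then obtain A where A: "A \<in> \<WW>\<^sub>V" "x = A (phi X P f \<alpha>)" by blast
  show "smul \<F> c x \<in> ?S" for c
    using weyl_algebra_smul[OF subspace_range_V A(1), of c] A(2)
    by (intro CollectI exI[of _ "\<lambda>v. smul \<F> c (A v)"]) (simp only: simp_thms)
  fix y assume "y \<in> ?S"
  then obtain B where B: "B \<in> \<WW>\<^sub>V" "y = B (phi X P f \<alpha>)" by blast
  show "x + y \<in> ?S" using weyl_algebra_add[OF subspace_range_V A(1) B(1)] A(2) B(2)
    by (intro CollectI exI[of _ "\<lambda>v. A v + B v"]) (simp only: simp_thms)
qed

lemma M_car: "M \<alpha> \<subseteq> car \<F>"
  unfolding M_def by (rule H.F.hclosure_car)

lemma orbit_M: "A \<in> \<WW>\<^sub>V \<Longrightarrow> A (phi X P f \<alpha>) \<in> M \<alpha>"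
  unfolding M_def using H.F.hclosure_superset[OF orbit_car] by blast

lemma M_invariant: assumes B: "B \<in> \<WW>\<^sub>V" and v: "v \<in> M \<alpha>" shows "B v \<in> M \<alpha>"
proof -
  obtain s where s: "\<And>n. s n \<in> {A (phi X P f \<alpha>) |A. A \<in> \<WW>\<^sub>V}" "H.F.lim_to s v"
    by (rule H.F.hclosureE[OF orbit_car v[unfolded M_def]]) (rule that)
  have lim: "H.F.lim_to (\<lambda>n. B (s n)) (B v)"
    by (rule H.F.lim_to_bop[OF weyl_algebra_bop[OF subspace_range_V B] s(2)])
  have mem: "B (s n) \<in> {A (phi X P f \<alpha>) |A. A \<in> \<WW>\<^sub>V}" for n
  proof -
    obtain A where A: "A \<in> \<WW>\<^sub>V" "s n = A (phi X P f \<alpha>)" using s(1)[of n] by blast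
    have "B (s n) = (B \<circ> A) (phi X P f \<alpha>)" using A(2) by simp
    then show ?thesis using weyl_algebra_comp[OF subspace_range_V B A(1)] by blast
  qed
  show ?thesis unfolding M_def by (rule H.F.hclosureI[OF orbit_car mem lim])
qed

text \<open>\<open>\<langle>A \<phi>\<^sub>\<alpha>, B \<phi>\<^sub>\<beta>\<rangle> = \<langle>\<phi>\<^sub>\<alpha>, A\<^sup>* B \<phi>\<^sub>\<beta>\<rangle>\<close> is an off-diagonal matrix element.\<close>

lemma M_orthogonal:
  assumes \<alpha>: "\<alpha> \<in> multi_indices d" and \<beta>: "\<beta> \<in> multi_indices d" and ne: "\<alpha> \<noteq> \<beta>" and u: "u \<in> M \<alpha>" and v: "v \<in> M \<beta>"
  shows "ip \<F> u v = 0"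
proof -
  have vc: "v \<in> car \<F>" using v M_car by blast
  have "ip \<F> (A (phi X P f \<alpha>)) v = 0" if A: "A \<in> \<WW>\<^sub>V" for A
  proof -
    have Ab: "A \<in> bop \<F>" by (rule weyl_algebra_bop[OF subspace_range_V A])
    have ac: "A (phi X P f \<alpha>) \<in> car \<F>" by (rule H.F.bop_car'[OF Ab])
    have pc: "phi X P f \<alpha> \<in> car \<F>" using phi_car multi_indicesD \<alpha> by blast
    have "ip \<F> v (A (phi X P f \<alpha>)) = 0"
    proof (rule H.F.orth_hclosure[OF orbit_car ac _ v[unfolded M_def]])
      fix y assume "y \<in> {A (phi X P f \<beta>) |A. A \<in> \<WW>\<^sub>V}"
      then obtain B where B: "B \<in> \<WW>\<^sub>V" "y = B (phi X P f \<beta>)" by blast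
      have Bb: "B \<in> bop \<F>" by (rule weyl_algebra_bop[OF subspace_range_V B(1)])
      have qc: "phi X P f \<beta> \<in> car \<F>" using phi_car multi_indicesD \<beta> by blast
      have "ip \<F> (hadj \<F> A y) (phi X P f \<alpha>) = ip \<F> y (A (phi X P f \<alpha>))"
        unfolding B(2) by (rule H.F.ip_hadj[OF Ab H.F.bop_car'[OF Bb] pc])
      moreover have "ip \<F> (phi X P f \<alpha>) (hadj \<F> A y) = 0"
      proof -
        have "hadj \<F> A \<circ> B \<in> \<WW>\<^sub>V" by (rule weyl_algebra_comp[OF subspace_range_V weyl_algebra_hadj[OF subspace_range_V A] B(1)])
        from matrix_element[OF this \<alpha> \<beta>] show ?thesis using ne B(2) by (simp del: sym_fock_sel)
      qed
      moreover have "ip \<F> (hadj \<F> A y) (phi X P f \<alpha>) = cnj (ip \<F> (phi X P f \<alpha>) (hadj \<F> A y))"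
        by (rule H.F.ip_cnj[OF pc H.F.bop_car'[OF H.F.hadj_bop[OF Ab]]])
      ultimately show "ip \<F> y (A (phi X P f \<alpha>)) = 0" by (simp del: sym_fock_sel)
    qed
    then show ?thesis using H.F.ip_cnj[OF vc ac] by (simp del: sym_fock_sel)
  qed
  then show ?thesis
    by (intro H.F.orth_hclosure[OF orbit_car vc _ u[unfolded M_def]]) blast
qed

text \<open>
  A vector orthogonal to all cyclic subspaces is orthogonal to \<open>e(h)\<close> for all \<open>h\<close> in the real
  subspace \<open>R = N + i P\<^sub>1 V(Re \<K>)\<close>, and \<open>R\<close> spans a dense subspace of \<open>\<K>\<^sub>1\<close>.
\<close>

lemma M_total: "hclosure \<F> (H.F.vs.span (\<Union>\<alpha>\<in>multi_indices d. M \<alpha>)) = car \<F>"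
proof (rule H.F.total_if_orth)
  show "(\<Union>\<alpha>\<in>multi_indices d. M \<alpha>) \<subseteq> car \<F>" using M_car by blast
  fix v assume v: "v \<in> car \<F>" and orth: "\<And>u. u \<in> (\<Union>\<alpha>\<in>multi_indices d. M \<alpha>) \<Longrightarrow> ip \<F> u v = 0"
  have ev0: "ip \<F> (H.ev (u + z (V g))) v = 0" if g: "star X g = g" and u: "u \<in> N" for g u
  proof -
    let ?A = "weyl X P (V g)"
    have Vg: "star X (V g) = V g" using g V_star_iff by simp
    have AW: "?A \<in> \<WW>\<^sub>V" by (rule weyl_in_algebra[OF subspace_range_V rangeI Vg])
    have Ab: "?A \<in> bop \<F>" by (rule weyl_bop[OF Vg])
    \<comment> \<open>Orthogonality to \<open>w(V g) \<phi>\<^sub>\<alpha>\<close> for all \<open>\<alpha>\<close> says that \<open>w(V g)\<^sup>* v\<close> vanishes on lists of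
      the basis of \<open>N\<close>, hence on all lists over \<open>N\<close>.\<close>
    let ?w = "hadj \<F> ?A v"
    have w: "?w \<in> car \<F>" by (rule H.F.bop_car'[OF H.F.hadj_bop[OF Ab]])
    have adj: "ip \<F> x ?w = ip \<F> (?A x) v" if x: "x \<in> car \<F>" for x
      using H.F.ip_hadj[OF Ab v x] H.F.ip_cnj[OF w x] H.F.ip_cnj[OF H.F.bop_car'[OF Ab] v] by (metis complex_cnj_cnj H.F.bop_car' Ab H.F.ip_cnj v)
    have zero: "?w (map f js) = 0" if js: "js \<in> lists (indices d)" for js
    proof -
      have so: "sort js \<in> multi_indices d" using js by (auto simp: multi_indices_def in_lists_conv_set)
      then have "ip \<F> (phi X P f (sort js)) ?w = 0"
        using adj[of "phi X P f (sort js)"] phi_car multi_indicesD orth orbit_M[OF AW] by (metis UN_I)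
      then have "?w (map f (sort js)) = 0"
        using ip_phi[of "sort js" ?w] multi_indicesD[OF so] w c_coeff_pos[of "sort js"] by (simp del: sym_fock_sel)
      moreover have "?w (map f (sort js)) = ?w (map f js)"
        using w by (intro form_sym[OF H.fock_form]) auto
      ultimately show ?thesis by simp
    qed
    have zeroS: "?w xs = 0" if "xs \<in> lists (f ` indices d)" for xs
    proof -
      have "\<exists>js\<in>lists (indices d). xs = map f js"
        using that by (auto simp: lists_image)
      then show ?thesis using zero by blast
    qed
    have wf: "?w \<in> fock_carrier K1" using w by simp
    have zeroN: "?w xs = 0" if "xs \<in> lists N" for xs
      by (rule H.form_zero_closed_span[OF H.fock_form[OF wf] _ zeroS])
        (use f_N N_range lists_mono[OF N_hclosure] that in auto)
    have uc: "u \<in> car K1" using u N_range by auto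
    have "?w (replicate n u) = 0" for n using u by (intro zeroN) (auto simp: in_lists_conv_set)
    then have "ip \<F> (H.ev u) ?w = 0"
      using H.ip_ev_sums[OF uc wf] sums_unique2[OF sums_zero] by simp
    then have "ip \<F> (?A (H.ev u)) v = 0" using adj[of "H.ev u"] u ev_N_car by auto
    then have "cnj (s g) * ip \<F> (H.ev (u + z (V g))) v = 0"
      using weyl_V_ev[OF g u] H.F.ip_scale_left[of "H.ev (u + z (V g))" v "s g"] H.ev_fock[of "u + z (V g)"] uc z_car v
        H.add_car[of u "z (V g)"] by (auto simp del: sym_fock_sel simp: sym_fock_sel(1))
    moreover have "s g \<noteq> 0" unfolding s_def by (rule exp_not_eq_zero)
    ultimately show ?thesis unfolding cnj_s mult_eq_0_iff by blast
  qed
  define R where "R = {u + z (V g) |u g. u \<in> N \<and> star X g = g}"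
  have Rc: "R \<subseteq> car K1"
  proof
    fix r assume "r \<in> R"
    then obtain u g where "r = u + z (V g)" "u \<in> N" unfolding R_def by blast
    then show "r \<in> car K1" using H.add_car[of u "z (V g)"] N_range z_car by auto
  qed
  have total: "hclosure K1 (H.vs.span R) = car K1"
  proof (rule H.total_if_orth[OF Rc])
    fix k assume k: "k \<in> car K1" and ork: "\<And>r. r \<in> R \<Longrightarrow> ip K1 r k = 0"
    have real: "kap X (V g) k = 0" if g: "star X g = g" for g
    proof -
      have "z (V g) \<in> R" unfolding R_def using g K.vs.subspace_0[OF N_subspace] by force
      then have "ip K1 (z (V g)) k = 0" using ork by blast
      then have "ip K (P (V g)) k = 0" using H.ip_scale_left[of "P (V g)" k \<i>] k by simp
      then show ?thesis using ip_P[of "V g" k] k Cop_P[of k] range_P by (simp add: K_sel(3))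
    qed
    have "kap X (V g) k = 0" for g
    proof -
      \<comment> \<open>The two vectors are twice the real part and, up to a factor, twice the imaginary
        part of \<open>g\<close>; their images are \<open>\<kappa>\<close>-orthogonal to \<open>k\<close>, and \<open>V\<close> is complex linear.\<close>
      have r1: "star X (g + star X g) = g + star X g" by (simp add: star_add star_star add.commute)
      have r2: "star X (scal X \<i> (g - star X g)) = scal X \<i> (g - star X g)"
        using scal_minus[of \<i> "g - star X g"] K.vs.scale_minus_left[of \<i> "star X g - g"]
        by (simp add: star_scale star_diff star_star)
      have "kap X k (V (g + star X g)) = 0" using real[OF r1] kap_cnj[of "V (g + star X g)" k] by simp
      moreover have "kap X k (V (scal X \<i> (g - star X g))) = 0" using real[OF r2] kap_cnj by (metis complex_cnj_zero)
      ultimately have 1: "kap X k (V g) + kap X k (V (star X g)) = 0" and 2: "kap X k (V (g - star X g)) = 0"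
        by (simp_all add: V_add kap_add V_scale kap_scale)
      have "V (g - star X g) + V (star X g) = V g" by (simp flip: V_add)
      then have "kap X k (V g) = kap X k (V (g - star X g)) + kap X k (V (star X g))" by (metis kap_add)
      then have "kap X k (V g) = 0" using 1 2 by simp
      then show ?thesis using kap_cnj[of k "V g"] by (metis complex_cnj_zero kap_cnj)
    qed
    then have "k \<in> N" using k by (simp add: N_iff range_P)
    then have "k \<in> R" unfolding R_def using star_zero V_zero P_zero by force
    then have "ip K1 k k = 0" using ork by blast
    then show "k = 0" using H.ip_pos[OF k] by force
  qed
  show "v = 0"
  proof (rule H.fock_eqI)
    show vf: "v \<in> fock_carrier K1" using v by simp
    show "0 \<in> fock_carrier K1" by (rule H.fock_0)
    fix xs assume xs: "xs \<in> lists (car K1)"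
    have "v xs = 0"
    proof (rule H.orth_ev_imp_zero[OF vf Rc])
      show "0 \<in> R" unfolding R_def using K.vs.subspace_0[OF N_subspace] star_zero V_zero P_zero by force
      show "ip \<F> (H.ev h) v = 0" if "h \<in> R" for h using that ev0 by (auto simp: R_def)
      show "xs \<in> lists (hclosure K1 (H.vs.span R))" using xs total by simp
      fix h k t assume "h \<in> R" "k \<in> R"
      then obtain u g u' g' where hk: "h = u + z (V g)" "k = u' + z (V g')" "u \<in> N" "u' \<in> N" "star X g = g" "star X g' = g'"
        by (auto simp: R_def)
      let ?t = "complex_of_real t"
      have "u + scal X ?t u' \<in> N" using hk K.vs.subspace_add[OF N_subspace] K.vs.subspace_scale[OF N_subspace] by simp
      moreover have "star X (g + scal X ?t g') = g + scal X ?t g'" using hk by (simp add: star_add star_scale)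
      moreover have "h + smul K1 ?t k = (u + scal X ?t u') + z (V (g + scal X ?t g'))"
        using K.vs.scale_scale[of ?t \<i> "P (V g')"] K.vs.scale_scale[of \<i> ?t "P (V g')"]
        by (simp add: hk V_add V_scale P_add P_scale scal_add mult.commute algebra_simps)
      ultimately show "h + smul K1 ?t k \<in> R" unfolding R_def by blast
    qed
    then show "v xs = 0 xs" by simp
  qed
qed

abbreviation \<H> where "\<H> \<equiv> F_sub X P V f"
abbreviation \<pi> where "\<pi> \<equiv> pi_sub X P V \<rho> f"

lemma F_sub_sel [simp]: "car (\<H> \<alpha>) = M \<alpha>" "smul (\<H> \<alpha>) = smul \<F>" "ip (\<H> \<alpha>) = ip \<F>" "hnorm (\<H> \<alpha>) = hnorm \<F>"
  by (simp_all add: F_sub_eq hnorm_def fun_eq_iff)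

lemma hilbert_F_sub: "hilbert (\<H> \<alpha>)"
  unfolding F_sub_eq by (rule H.F.hilbert_closed_sub[OF M_closed])

lemma pi_sub_eq: "\<pi> \<alpha> A v = (if v \<in> M \<alpha> then \<rho> A v else 0)"
  by (simp add: pi_sub_def)

lemma M_add: "u \<in> M \<alpha> \<Longrightarrow> v \<in> M \<alpha> \<Longrightarrow> u + v \<in> M \<alpha>"
  and M_scale: "u \<in> M \<alpha> \<Longrightarrow> smul \<F> c u \<in> M \<alpha>"
  using M_closed H.F.vs.subspace_add H.F.vs.subspace_scale unfolding H.F.closed_sub_def by blast+

lemma pi_sub_bop: assumes A: "A \<in> \<WW>" shows "\<pi> \<alpha> A \<in> bop (\<H> \<alpha>)"
proof -
  have b: "\<rho> A \<in> bop \<F>" by (rule \<rho>_bop[OF A])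
  have inv: "\<rho> A v \<in> M \<alpha>" if "v \<in> M \<alpha>" for v by (rule M_invariant[OF \<rho>_range[OF A] that])
  obtain C where C: "\<And>v. v \<in> car \<F> \<Longrightarrow> hnorm \<F> (\<rho> A v) \<le> C * hnorm \<F> v" using b unfolding bop_def by blast
  show ?thesis
    unfolding bop_def F_sub_sel
  proof (intro CollectI conjI ballI allI impI)
    show "\<exists>C. \<forall>v\<in>M \<alpha>. hnorm \<F> (\<pi> \<alpha> A v) \<le> C * hnorm \<F> v"
      by (intro exI[of _ C] ballI) (simp only: pi_sub_eq if_True C subsetD[OF M_car])
    fix v assume v: "v \<in> M \<alpha>"
    then have vc: "v \<in> car \<F>" using M_car by blast
    show "\<pi> \<alpha> A v \<in> M \<alpha>" using v inv by (simp only: pi_sub_eq if_True)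
    show "\<pi> \<alpha> A (smul \<F> c v) = smul \<F> c (\<pi> \<alpha> A v)" for c
      using v M_scale[OF v] H.F.bop_scale[OF b vc] by (simp only: pi_sub_eq if_True)
    fix w assume w: "w \<in> M \<alpha>"
    then have wc: "w \<in> car \<F>" using M_car by blast
    show "\<pi> \<alpha> A (v + w) = \<pi> \<alpha> A v + \<pi> \<alpha> A w"
      using v w M_add[OF v w] H.F.bop_add[OF b vc wc] by (simp only: pi_sub_eq if_True)
  qed (simp only: pi_sub_eq if_False)
qed

lemma pi_sub_hom: "star_hom \<F> \<WW> (\<H> \<alpha>) (\<pi> \<alpha>)"
  unfolding star_hom_def
proof (intro conjI ballI allI)
  fix A assume A: "A \<in> \<WW>"
  show "\<pi> \<alpha> A \<in> bop (\<H> \<alpha>)" by (rule pi_sub_bop[OF A])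
  show "\<pi> \<alpha> (\<lambda>v. smul \<F> c (A v)) = (\<lambda>v. smul (\<H> \<alpha>) c (\<pi> \<alpha> A v))" for c
    by (rule ext) (auto simp only: pi_sub_eq \<rho>_smul[OF A] F_sub_sel H.F.vs.scale_zero_right split: if_split)
  interpret Ha: hilbert "\<H> \<alpha>" by (rule hilbert_F_sub)
  have Aadj: "hadj \<F> A \<in> \<WW>" by (rule weyl_algebra_hadj[OF subspace_UNIV A])
  have "hadj (\<H> \<alpha>) (\<pi> \<alpha> A) = \<pi> \<alpha> (hadj \<F> A)"
  proof (rule Ha.hadj_eqI[OF pi_sub_bop[OF Aadj]])
    fix v w assume "v \<in> car (\<H> \<alpha>)" "w \<in> car (\<H> \<alpha>)"
    then have m: "v \<in> M \<alpha>" "w \<in> M \<alpha>" by (simp_all only: F_sub_sel)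
    then have c: "v \<in> car \<F>" "w \<in> car \<F>" using M_car by blast+
    show "ip (\<H> \<alpha>) (\<pi> \<alpha> (hadj \<F> A) v) w = ip (\<H> \<alpha>) v (\<pi> \<alpha> A w)"
      using H.F.ip_hadj[OF \<rho>_bop[OF A] c] m by (simp only: F_sub_sel pi_sub_eq \<rho>_hadj[OF A] if_True)
  qed
  then show "\<pi> \<alpha> (hadj \<F> A) = hadj (\<H> \<alpha>) (\<pi> \<alpha> A)" ..
  fix B assume B: "B \<in> \<WW>"
  show "\<pi> \<alpha> (\<lambda>v. A v + B v) = (\<lambda>v. \<pi> \<alpha> A v + \<pi> \<alpha> B v)"
    by (rule ext) (auto simp only: pi_sub_eq \<rho>_add[OF A B] add_0_right split: if_split)
  have z: "\<rho> A 0 = 0" using H.F.bop_zero[OF \<rho>_bop[OF A]] .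
  show "\<pi> \<alpha> (A \<circ> B) = \<pi> \<alpha> A \<circ> \<pi> \<alpha> B"
  proof
    fix v show "\<pi> \<alpha> (A \<circ> B) v = (\<pi> \<alpha> A \<circ> \<pi> \<alpha> B) v"
    proof (cases "v \<in> M \<alpha>")
      case True
      then have "\<rho> B v \<in> M \<alpha>" by (rule M_invariant[OF \<rho>_range[OF B]])
      then show ?thesis using True by (simp only: pi_sub_eq \<rho>_comp[OF A B] comp_apply if_True)
    next
      case False
      then show ?thesis by (simp only: pi_sub_eq comp_apply if_False z if_cancel)
    qed
  qed
qed

lemma pi_sub_representation: "representation \<F> \<WW> (\<H> \<alpha>) (\<pi> \<alpha>)"
  unfolding representation_def
proof (intro conjI)
  show "hilbert_space (\<H> \<alpha>)" using hilbert_F_sub by (simp add: hilbert_space_iff)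
  show "\<pi> \<alpha> (hid \<F>) = hid (\<H> \<alpha>)"
    using M_car by (auto simp only: fun_eq_iff pi_sub_eq \<rho>_hid hid_def F_sub_sel split: if_split)
qed (rule pi_sub_hom)

lemma \<rho>_representation: "representation \<F> \<WW> \<F> \<rho>"
  unfolding representation_def hilbert_space_iff using H.hilbert_fock \<rho>_hom \<rho>_hid by blast

theorem rep_direct_sum_pi_sub: "rep_direct_sum \<F> \<WW> \<F> \<rho> (multi_indices d) \<H> \<pi>"
  unfolding rep_direct_sum_def F_sub_sel
proof (intro conjI ballI impI)
  show "representation \<F> \<WW> \<F> \<rho>" by (rule \<rho>_representation)
  show "hclosure \<F> (module.span (smul \<F>) (\<Union>\<alpha>\<in>multi_indices d. M \<alpha>)) = car \<F>" by (rule M_total)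
  show "representation \<F> \<WW> (\<H> \<alpha>) (\<pi> \<alpha>)" "M \<alpha> \<subseteq> car \<F>" for \<alpha>
    by (rule pi_sub_representation, rule M_car)
  show "\<rho> A v = \<pi> \<alpha> A v" if "v \<in> M \<alpha>" for \<alpha> A v using that by (simp only: pi_sub_eq if_True)
qed (use M_orthogonal in blast | rule refl)+

lemma pullback_state: "state_on \<F> \<WW> (vacuum_state X P \<circ> \<rho>)"
  unfolding state_on_def vacuum_state_def comp_def[of "vacuum_state X P" \<rho>]
proof (intro conjI ballI allI)
  fix A assume A: "A \<in> \<WW>"
  have Ac: "\<rho> A vacuum \<in> car \<F>" by (rule H.F.bop_car'[OF \<rho>_bop[OF A]])
  show "ip \<F> vacuum (\<rho> (\<lambda>v. smul \<F> c (A v)) vacuum) = c * ip \<F> vacuum (\<rho> A vacuum)" for c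
    using H.F.ip_scale[OF vacuum_car Ac] by (simp only: \<rho>_smul[OF A])
  have "ip \<F> vacuum (\<rho> (hadj \<F> A \<circ> A) vacuum) = ip \<F> vacuum (hadj \<F> (\<rho> A) (\<rho> A vacuum))"
    by (simp only: \<rho>_comp[OF weyl_algebra_hadj[OF subspace_UNIV A] A] \<rho>_hadj[OF A] comp_apply)
  also have "\<dots> = cnj (ip \<F> (hadj \<F> (\<rho> A) (\<rho> A vacuum)) vacuum)"
    by (rule H.F.ip_cnj[OF H.F.bop_car'[OF H.F.hadj_bop[OF \<rho>_bop[OF A]]] vacuum_car])
  also have "\<dots> = cnj (ip \<F> (\<rho> A vacuum) (\<rho> A vacuum))"
    by (simp only: H.F.ip_hadj[OF \<rho>_bop[OF A] Ac vacuum_car])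
  also have "\<dots> = complex_of_real ((hnorm \<F> (\<rho> A vacuum))\<^sup>2)"
    by (simp only: H.F.ip_self[OF Ac] complex_cnj_complex_of_real complex_cnj_power of_real_power)
  finally show "\<exists>r\<ge>0. ip \<F> vacuum (\<rho> (hadj \<F> A \<circ> A) vacuum) = complex_of_real r"
    by (intro exI[of _ "(hnorm \<F> (\<rho> A vacuum))\<^sup>2"] conjI) (simp only: zero_le_power2)
  fix B assume B: "B \<in> \<WW>"
  have Bc: "\<rho> B vacuum \<in> car \<F>" by (rule H.F.bop_car'[OF \<rho>_bop[OF B]])
  show "ip \<F> vacuum (\<rho> (\<lambda>v. A v + B v) vacuum) = ip \<F> vacuum (\<rho> A vacuum) + ip \<F> vacuum (\<rho> B vacuum)"
    using H.F.ip_add[OF vacuum_car Ac Bc] by (simp only: \<rho>_add[OF A B])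
next
  show "ip \<F> vacuum (\<rho> (hid \<F>) vacuum) = 1"
    using phi_ip[OF Nil_multi Nil_multi] vacuum_car by (simp only: \<rho>_hid hid_def if_True vacuum_phi simp_thms)
qed

lemma phi_M: assumes \<alpha>: "\<alpha> \<in> multi_indices d" shows "phi X P f \<alpha> \<in> M \<alpha>"
  using orbit_M[OF hid_in_algebra[OF subspace_range_V], of \<alpha>] phi_car multi_indicesD[OF \<alpha>] by (simp add: hid_def del: sym_fock_sel)

text \<open>
  Elements of the Weyl algebra of \<open>ran V\<close> are approximated by linear combinations of \<open>w(V g)\<close>,
  which lie in the image of \<open>\<rho>\<close>.
\<close>

lemma phi_cyclic:
  assumes \<alpha>: "\<alpha> \<in> multi_indices d"
  shows "hclosure (\<H> \<alpha>) {\<pi> \<alpha> A (phi X P f \<alpha>) |A. A \<in> \<WW>} = M \<alpha>"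
proof
  show "hclosure (\<H> \<alpha>) {\<pi> \<alpha> A (phi X P f \<alpha>) |A. A \<in> \<WW>} \<subseteq> M \<alpha>" by (auto simp only: hclosure_def F_sub_sel)
  show "M \<alpha> \<subseteq> hclosure (\<H> \<alpha>) {\<pi> \<alpha> A (phi X P f \<alpha>) |A. A \<in> \<WW>}"
  proof
    fix v assume v: "v \<in> M \<alpha>"
    have pc: "phi X P f \<alpha> \<in> car \<F>" using M_car phi_M[OF \<alpha>] by blast
    have "\<exists>s\<in>{\<pi> \<alpha> A (phi X P f \<alpha>) |A. A \<in> \<WW>}. hnorm \<F> (v - s) < e" if e: "e > 0" for e
    proof -
      obtain A where A: "A \<in> \<WW>\<^sub>V" "hnorm \<F> (v - A (phi X P f \<alpha>)) < e / 2"
        using v half_gt_zero[OF e] unfolding M_def hclosure_def by blast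
      obtain B where B: "B \<in> op_span \<F> (real_weyl (range V))" "\<And>v. v \<in> car \<F> \<Longrightarrow> hnorm \<F> (A v - B v) \<le> e / 2 * hnorm \<F> v"
        by (rule weyl_algebra_approx[OF subspace_range_V A(1) half_gt_zero[OF e]]) (rule that)
      obtain B' where B': "B' \<in> \<WW>" "\<rho> B' = B" using op_span_range[OF B(1)] by blast
      have c: "v \<in> car \<F>" "A (phi X P f \<alpha>) \<in> car \<F>" "B (phi X P f \<alpha>) \<in> car \<F>"
        using v M_car H.F.bop_car'[OF weyl_algebra_bop[OF subspace_range_V A(1)]] H.F.bop_car'[OF \<rho>_bop[OF B'(1)]] B'(2) by blast+
      have "hnorm \<F> ((v - A (phi X P f \<alpha>)) + (A (phi X P f \<alpha>) - B (phi X P f \<alpha>)))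
          \<le> hnorm \<F> (v - A (phi X P f \<alpha>)) + hnorm \<F> (A (phi X P f \<alpha>) - B (phi X P f \<alpha>))"
        by (intro H.F.hnorm_triangle H.F.diff_car c)
      also have "\<dots> < e / 2 + e / 2" using A(2) B(2)[OF pc] phi_norm[OF \<alpha>] by (intro add_less_le_mono) simp_all
      finally have "hnorm \<F> (v - \<pi> \<alpha> B' (phi X P f \<alpha>)) < e"
        using phi_M[OF \<alpha>] B'(2) by (simp add: pi_sub_eq)
      then show ?thesis using B'(1) by blast
    qed
    then show "v \<in> hclosure (\<H> \<alpha>) {\<pi> \<alpha> A (phi X P f \<alpha>) |A. A \<in> \<WW>}"
      using v by (auto simp only: hclosure_def F_sub_sel)
  qed
qed

theorem gns_representation_pi_sub: assumes \<alpha>: "\<alpha> \<in> multi_indices d"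
  shows "gns_representation \<F> \<WW> (vacuum_state X P \<circ> \<rho>) (\<pi> \<alpha>) (\<H> \<alpha>) (phi X P f \<alpha>)"
  unfolding gns_representation_def F_sub_sel
proof (intro conjI ballI)
  fix A assume A: "A \<in> \<WW>"
  show "ip \<F> (phi X P f \<alpha>) (\<pi> \<alpha> A (phi X P f \<alpha>)) = (vacuum_state X P \<circ> \<rho>) A"
    using matrix_element[OF \<rho>_range[OF A] \<alpha> \<alpha>] phi_M[OF \<alpha>]
    by (simp only: pi_sub_eq if_True comp_apply vacuum_state_def simp_thms)
qed (rule pullback_state pi_sub_representation phi_M[OF \<alpha>] phi_cyclic[OF \<alpha>])+

end

theorem proposition3p2:
  fixes X :: "('k::ab_group_add) ccr_space"
    and P\<^sub>1 V :: "'k \<Rightarrow> 'k"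
    and \<rho> :: "(('k list \<Rightarrow> complex) \<Rightarrow> 'k list \<Rightarrow> complex) \<Rightarrow> ('k list \<Rightarrow> complex) \<Rightarrow> 'k list \<Rightarrow> complex"
    and f :: "nat \<Rightarrow> 'k" and d :: enat
  assumes "is_ccr_space X"
    and "basis_projection X P\<^sub>1"
    and "hilbert_space (Khilb X P\<^sub>1)"
    and "separable_hspace (Khilb X P\<^sub>1)"
    and "V \<in> bogoliubov X P\<^sub>1"
    and "induced_endomorphism X P\<^sub>1 V \<rho>"
    and "inj_on f (indices d)"
    and "is_onb (K1kernel X P\<^sub>1 V) (f ` indices d)"
  shows "rep_direct_sum (Fock X P\<^sub>1) (weyl_algebra X P\<^sub>1 UNIV) (Fock X P\<^sub>1) \<rho>
           (multi_indices d) (F_sub X P\<^sub>1 V f) (pi_sub X P\<^sub>1 V \<rho> f) \<and>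
         (\<forall>\<alpha>\<in>multi_indices d.
            gns_representation (Fock X P\<^sub>1) (weyl_algebra X P\<^sub>1 UNIV) (vacuum_state X P\<^sub>1 \<circ> \<rho>)
              (pi_sub X P\<^sub>1 V \<rho> f \<alpha>) (F_sub X P\<^sub>1 V f \<alpha>) (phi X P\<^sub>1 f \<alpha>))"
proof -
  interpret ccr_representation X P\<^sub>1 V f d \<rho>
    using assms by unfold_locales
  show ?thesis using rep_direct_sum_pi_sub gns_representation_pi_sub by blast
qed

end
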